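(* Let $(\mathcal X,d,\mu)$ be a non-homogeneous metric measure space (upper doubling and geometrically doubling) with dominating function $\lambda$. Let $K$ be a locally integrable function on $(\mathcal X\times\mathcal X)\setminus\{(x,x):x\in\mathcal X\}$ for which there exists a positive constant $C$ such that, for all $x,y\in\mathcal X$ with $x\neq y$, $$|K(x,y)|\le C\,\frac{d(x,y)}{\lambda(x,d(x,y))}$$ and, for all $y,y'\in\mathcal X$, $$\int_{d(x,y)\ge 2d(y,y')}\big[|K(x,y)-K(x,y')|+|K(y,x)-K(y',x)|\big]\frac{1}{d(x,y)}\,d\mu(x)\le C.$$ Let $\mathcal M$ be the Marcinkiewicz integral associated with $K$, that is, for $x\in\mathcal X$, $$\mathcal M(f)(x):=\left[\int_0^\infty\left|\int_{d(x,y)<t}K(x,y)f(y)\,d\mu(y)\right|^2\frac{dt}{t^3}\right]^{1/2}.$$ Suppose that $\mathcal M$ is bounded on $L^{p_0}(\mu)$ for some $p_0\in(1,\infty)$. Then: (i) $\mathcal M$ is bounded from $L^1(\mu)$ into $L^{1,\infty}(\mu)$; (ii) $\mathcal M$ is bounded from $H^1(\mu)$ into $L^1(\mu)$; (iii) for $f\in L^\infty(\mu)$, $\mathcal M(f)$ is either infinite everywhere or finite $\mu$-almost everywhere; more precisely, if $\mathcal M(f)$ is finite at some point $x_0\in\mathcal X$, then $\mathcal M(f)$ is finite $\mu$-almost everywhere and $$\|\mathcal M(f)\|_{\mathrm{RBLO}(\mu)}\le C\|f\|_{L^\infty(\mu)},$$ where the positive constant $C$ is independent of $f$; (iv) $\mathcal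 M$ is bounded on $L^p(\mu)$ for all $p\in(1,\infty)$.
   Context: Balls: $B(x,r):=\{y\in\mathcal X: d(x,y)<r\}$ with $x\in\mathcal X$, $r\in(0,\infty)$. A ball $B$ comes with its center $c_B$ and radius $r_B$; for $\rho\in(0,\infty)$, $\rho B:=B(c_B,\rho r_B)$. $L^1_{\rm loc}(\mu)$ is the space of locally $\mu$-integrable functions. Non-homogeneous metric measure space: a metric space $(\mathcal X,d)$ with a Borel measure $\mu$ such that: (a) Upper doubling: there exist a dominating function $\lambda:\mathcal X\times(0,\infty)\to(0,\infty)$ and a positive constant $C_\lambda$ such that, for each $x\in\mathcal X$, $r\mapsto\lambda(x,r)$ is non-decreasing and, for all $x\in\mathcal X$ and $r\in(0,\infty)$, $\mu(B(x,r))\le\lambda(x,r)\le C_\lambda\lambda(x,r/2)$. It is always assumed in addition that, for all $x,y\in\mathcal X$ with $d(x,y)\le r$, $\lambda(x,r)\le C_\lambda\lambda(y,r)$. (b) Geometrically doubling: there exists $N_0\in\mathbb N=\{1,2,\dots\}$ such that every ball $B(x,r)\subset\mathcal X$ can be covered by at most $N_0$ balls $B(x_i,r/2)$. Coefficient $\delta$: for balls $B\subset S$, $\delta(B,S):=\int_{(2S)\setminus B}\frac{d\mu(x)}{\lambda(c_B,d(x,c_B))}$. Doubling balls: for $\alpha,\beta\in(1,\infty)$, a ball $B$ is $(\alpha,\beta)$-doubling if $\mu(\alpha B)\le\beta\mu(B)$. Let $n:=\log_2N_0$, $\nu:=\log_2C_\lambda$ and $\beta_\alpha:=\alpha^{3\max\{n,\nu\}}+30^n+30^\nu$.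 For a ball $B$, $\widetilde B^\alpha$ denotes the smallest $(\alpha,\beta_\alpha)$-doubling ball of the form $\alpha^jB$ with $j\in\mathbb N$. Atomic blocks: let $\rho\in(1,\infty)$ and $p\in(1,\infty]$. A function $b\in L^1_{\rm loc}(\mu)$ is a $(p,1)_\lambda$-atomic block if (1) there is a ball $B$ with $\operatorname{supp}(b)\subset B$; (2) $\int_{\mathcal X}b\,d\mu=0$; (3) for $j\in\{1,2\}$ there exist a function $a_j$ supported on a ball $B_j\subset B$ and $\kappa_j\in\mathbb C$ such that $b=\kappa_1a_1+\kappa_2a_2$ and $\|a_j\|_{L^p(\mu)}\le[\mu(\rho B_j)]^{1/p-1}[1+\delta(B_j,B)]^{-1}$. Set $|b|_{H^{1,p}_{\rm atb}(\mu)}:=|\kappa_1|+|\kappa_2|$. When $\mu(\mathcal X)<\infty$, the constant function $[\mu(\mathcal X)]^{-1}$ is also regarded as a $(p,1)_\lambda$-atomic block (of size $1$, so that $\|[\mu(\mathcal X)]^{-1}\|_{H^1(\mu)}\le1$). Atomic Hardy space: $f\in L^1(\mu)$ belongs to $H^{1,p}_{\rm atb}(\mu)$ if there exist $(p,1)_\lambda$-atomic blocks $\{b_j\}_{j\in\mathbb N}$ with $f=\sum_{j=1}^\infty b_j$ and $\sum_{j}|b_j|_{H^{1,p}_{\rm atb}(\mu)}<\infty$; the norm is the infimum of $\sum_j|b_j|_{H^{1,p}_{\rm atb}(\mu)}$ over all such decompositions. It is known that this space does not depend on $\rho\in(1,\infty)$ nor on $p\in(1,\infty]$ (with equivalent norms);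 it is denoted by $H^1(\mu)$. $\mathrm{RBLO}(\mu)$: let $\eta,\rho\in(1,\infty)$. A real-valued $f\in L^1_{\rm loc}(\mu)$ is in $\mathrm{RBLO}(\mu)$ if there exists a non-negative constant $C$ such that, for all balls $B$, $\frac1{\mu(\eta B)}\int_B\big[f(y)-\operatorname{ess\,inf}_{\widetilde B^\rho}f\big]\,d\mu(y)\le C$ and, for all $(\rho,\beta_\rho)$-doubling balls $B\subset S$, $\operatorname{ess\,inf}_Bf-\operatorname{ess\,inf}_Sf\le C[1+\delta(B,S)]$. $\|f\|_{\mathrm{RBLO}(\mu)}$ is the minimal such $C$. The space is known to be independent of $\eta,\rho\in(1,\infty)$. *)

theory Defs
  imports "HOL-Probability.Essential_Supremum"
begin

section \<open>Non-homogeneous metric measure spaces\<close>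

text \<open>
  A ball is always given by its centre \<open>c\<close> and its radius \<open>r > 0\<close>, which the underlying set
  need not determine; an inclusion of balls is an inclusion of sets.  The dominating function
  \<open>lam\<close> is constrained (and used) at positive radii only.
\<close>

locale nonhomogeneous_space =
  fixes \<mu> :: "'a::metric_space measure"
    and lam :: "'a \<Rightarrow> real \<Rightarrow> real" and Clam :: real and N0 :: nat
  assumes sets_borel: "sets \<mu> = sets borel"
    and Clam_pos: "0 < Clam"
    and lam_pos: "0 < r \<Longrightarrow> 0 < lam x r"
    and lam_mono: "0 < r \<Longrightarrow> r \<le> s \<Longrightarrow> lam x r \<le> lam x s"
    and upper_doubling: "0 < r \<Longrightarrow> emeasure \<mu> (ball x r) \<le> ennreal (lam x r)"
    and lam_doubling: "0 < r \<Longrightarrow> lam x r \<le> Clam * lam x (r / 2)"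
    and lam_shift: "0 < r \<Longrightarrow> dist x y \<le> r \<Longrightarrow> lam x r \<le> Clam * lam y r"
    and N0_pos: "1 \<le> N0"
    and geometrically_doubling:
      "0 < r \<Longrightarrow> \<exists>F. finite F \<and> card F \<le> N0 \<and> ball x r \<subseteq> (\<Union>y\<in>F. ball y (r / 2))"

definition ball_delta :: "'a::metric_space measure \<Rightarrow> ('a \<Rightarrow> real \<Rightarrow> real) \<Rightarrow>
    'a \<Rightarrow> real \<Rightarrow> 'a \<Rightarrow> real \<Rightarrow> real" where
  "ball_delta \<mu> lam c r c' r' =
     (LINT x:(ball c' (2 * r') - ball c r)|\<mu>. 1 / lam c (dist x c))"

definition doubling_ball :: "'a::metric_space measure \<Rightarrow> real \<Rightarrow> real \<Rightarrow> 'a \<Rightarrow> real \<Rightarrow> bool" where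
  "doubling_ball \<mu> \<alpha> \<beta> c r \<longleftrightarrow>
     emeasure \<mu> (ball c (\<alpha> * r)) \<le> ennreal \<beta> * emeasure \<mu> (ball c r)"

definition doubling_beta :: "real \<Rightarrow> nat \<Rightarrow> real \<Rightarrow> real" where
  "doubling_beta Clam N0 \<alpha> =
     (let n = log 2 (real N0); \<nu> = log 2 Clam
      in \<alpha> powr (3 * max n \<nu>) + 30 powr n + 30 powr \<nu>)"

text \<open>The radius of the smallest doubling ball \<open>\<alpha>\<^sup>jB\<close>; here \<open>j \<ge> 1\<close>.\<close>

definition doubling_radius ::
    "'a::metric_space measure \<Rightarrow> real \<Rightarrow> nat \<Rightarrow> real \<Rightarrow> 'a \<Rightarrow> real \<Rightarrow> real" where
  "doubling_radius \<mu> Clam N0 \<alpha> c r =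
     \<alpha> ^ (LEAST j. 1 \<le> j \<and> doubling_ball \<mu> \<alpha> (doubling_beta Clam N0 \<alpha>) c (\<alpha> ^ j * r)) * r"


section \<open>Function spaces\<close>

text \<open>Intended for exponents \<open>a > 0\<close>.\<close>

definition ennreal_powr :: "ennreal \<Rightarrow> real \<Rightarrow> ennreal" where
  "ennreal_powr x a = (if x = \<infinity> then \<infinity> else ennreal (enn2real x powr a))"

text \<open>
  Norms are defined on functions with values in \<open>[0, \<infinity>]\<close>, since a Marcinkiewicz integral may be
  infinite at some points; for complex-valued \<open>f\<close> they are applied to \<open>|f|\<close>.
\<close>

definition Lp_norm :: "'a measure \<Rightarrow> ennreal \<Rightarrow> ('a \<Rightarrow> ennreal) \<Rightarrow> ennreal" where
  "Lp_norm \<mu> p g =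
     (if p = \<infinity> then esssup \<mu> g
      else ennreal_powr (\<integral>\<^sup>+x. ennreal_powr (g x) (enn2real p) \<partial>\<mu>) (1 / enn2real p))"

abbreviation Lp_cnorm :: "'a measure \<Rightarrow> ennreal \<Rightarrow> ('a \<Rightarrow> complex) \<Rightarrow> ennreal" where
  "Lp_cnorm \<mu> p f \<equiv> Lp_norm \<mu> p (\<lambda>x. ennreal (norm (f x)))"

definition Lp_space :: "'a measure \<Rightarrow> ennreal \<Rightarrow> ('a \<Rightarrow> complex) set" where
  "Lp_space \<mu> p = {f \<in> borel_measurable \<mu>. Lp_cnorm \<mu> p f < \<infinity>}"

definition weak_L1_norm :: "'a measure \<Rightarrow> ('a \<Rightarrow> ennreal) \<Rightarrow> ennreal" where
  "weak_L1_norm \<mu> g = (SUP t\<in>{0::real<..}. ennreal t * emeasure \<mu> {x \<in> space \<mu>. g x > ennreal t})"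

definition bounded_operator ::
    "'a measure \<Rightarrow> ('a \<Rightarrow> complex) set \<Rightarrow> (('a \<Rightarrow> complex) \<Rightarrow> ennreal) \<Rightarrow>
     (('a \<Rightarrow> ennreal) \<Rightarrow> ennreal) \<Rightarrow> (('a \<Rightarrow> complex) \<Rightarrow> 'a \<Rightarrow> ennreal) \<Rightarrow> bool" where
  "bounded_operator \<mu> X normX normY T \<longleftrightarrow>
     (\<exists>C::real. 0 < C \<and> (\<forall>f\<in>X. T f \<in> borel_measurable \<mu> \<and> normY (T f) \<le> ennreal C * normX f))"

text \<open>Local integrability on a set \<open>S\<close>, in the sense of neighbourhoods of the points of \<open>S\<close>.\<close>

definition locally_integrable_on ::
    "'b::topological_space measure \<Rightarrow> 'b set \<Rightarrow> ('b \<Rightarrow> complex) \<Rightarrow> bool" where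
  "locally_integrable_on M S f \<longleftrightarrow>
     (\<forall>z\<in>S. \<exists>U. open U \<and> z \<in> U \<and> set_integrable M (U \<inter> S) f)"

text \<open>The space \<open>L\<^sup>1\<^sub>l\<^sub>o\<^sub>c(\<mu>)\<close>: integrability over balls.\<close>

definition L1_loc ::
    "'a::metric_space measure \<Rightarrow> ('a \<Rightarrow> 'b::{banach, second_countable_topology}) \<Rightarrow> bool" where
  "L1_loc \<mu> f \<longleftrightarrow> (\<forall>c r. 0 < r \<longrightarrow> set_integrable \<mu> (ball c r) f)"


section \<open>The atomic Hardy space\<close>

text \<open>
  \<open>atom_in\<close> describes one summand \<open>a\<^sub>j\<close> of an atomic block on the ball \<open>(c, r)\<close>.  If
  \<open>\<mu>(\<rho>B\<^sub>j) = 0\<close>, then \<open>a\<^sub>j\<close> vanishes almost everywhere and the size condition holds trivially,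
  whatever the value of the negative power of \<open>0\<close>.
\<close>

definition atom_in :: "'a::metric_space measure \<Rightarrow> ('a \<Rightarrow> real \<Rightarrow> real) \<Rightarrow> real \<Rightarrow> ennreal \<Rightarrow>
    'a \<Rightarrow> real \<Rightarrow> ('a \<Rightarrow> complex) \<Rightarrow> bool" where
  "atom_in \<mu> lam \<rho> p c r a \<longleftrightarrow>
     (\<exists>c' r'. 0 < r' \<and> ball c' r' \<subseteq> ball c r \<and>
        a \<in> borel_measurable \<mu> \<and> (\<forall>x. x \<notin> ball c' r' \<longrightarrow> a x = 0) \<and>
        Lp_cnorm \<mu> p a \<le>
          ennreal (measure \<mu> (ball c' (\<rho> * r')) powr (enn2real (1 / p) - 1)
                   * inverse (1 + ball_delta \<mu> lam c' r' c r)))"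

text \<open>
  The quantity \<open>|\<kappa>\<^sub>1| + |\<kappa>\<^sub>2|\<close> depends on the chosen representation of \<open>b\<close>, so the size \<open>s\<close> is an
  argument of a relation.  On a space of finite measure the scalar multiples of the exceptional
  constant block are included, as linearity of the Hardy space requires.
\<close>

definition atomic_block :: "'a::metric_space measure \<Rightarrow> ('a \<Rightarrow> real \<Rightarrow> real) \<Rightarrow> real \<Rightarrow> ennreal \<Rightarrow>
    ('a \<Rightarrow> complex) \<Rightarrow> real \<Rightarrow> bool" where
  "atomic_block \<mu> lam \<rho> p b s \<longleftrightarrow>
     (L1_loc \<mu> b \<and>
      (\<exists>c r. 0 < r \<and> (\<forall>x. x \<notin> ball c r \<longrightarrow> b x = 0) \<and> (\<integral>x. b x \<partial>\<mu>) = 0 \<and>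
        (\<exists>a1 a2 \<kappa>1 \<kappa>2. atom_in \<mu> lam \<rho> p c r a1 \<and> atom_in \<mu> lam \<rho> p c r a2 \<and>
           b = (\<lambda>x. \<kappa>1 * a1 x + \<kappa>2 * a2 x) \<and> s = norm \<kappa>1 + norm \<kappa>2)))
     \<or> (emeasure \<mu> (space \<mu>) < \<infinity> \<and>
        (\<exists>\<kappa>. b = (\<lambda>x. \<kappa> * complex_of_real (inverse (measure \<mu> (space \<mu>)))) \<and> s = norm \<kappa>))"

text \<open>The series \<open>f = \<Sum>\<^sub>j b\<^sub>j\<close> is understood in \<open>L\<^sup>1(\<mu>)\<close>.\<close>

definition atomic_decomposition :: "'a::metric_space measure \<Rightarrow> ('a \<Rightarrow> real \<Rightarrow> real) \<Rightarrow>
    real \<Rightarrow> ennreal \<Rightarrow> ('a \<Rightarrow> complex) \<Rightarrow> (nat \<Rightarrow> 'a \<Rightarrow> complex) \<Rightarrow> (nat \<Rightarrow> real) \<Rightarrow> bool" where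
  "atomic_decomposition \<mu> lam \<rho> p f b s \<longleftrightarrow>
     (\<forall>j. atomic_block \<mu> lam \<rho> p (b j) (s j)) \<and> summable s \<and>
     (\<lambda>n. Lp_cnorm \<mu> 1 (\<lambda>x. f x - (\<Sum>j<n. b j x))) \<longlonglongrightarrow> 0"

definition H1_space :: "'a::metric_space measure \<Rightarrow> ('a \<Rightarrow> real \<Rightarrow> real) \<Rightarrow> real \<Rightarrow> ennreal \<Rightarrow>
    ('a \<Rightarrow> complex) set" where
  "H1_space \<mu> lam \<rho> p = {f \<in> Lp_space \<mu> 1. \<exists>b s. atomic_decomposition \<mu> lam \<rho> p f b s}"

definition H1_norm :: "'a::metric_space measure \<Rightarrow> ('a \<Rightarrow> real \<Rightarrow> real) \<Rightarrow> real \<Rightarrow> ennreal \<Rightarrow>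
    ('a \<Rightarrow> complex) \<Rightarrow> ennreal" where
  "H1_norm \<mu> lam \<rho> p f =
     Inf {ennreal (\<Sum>j. s j) | b s. atomic_decomposition \<mu> lam \<rho> p f b s}"


section \<open>The space RBLO\<close>

definition essinf_on :: "'a measure \<Rightarrow> 'a set \<Rightarrow> ('a \<Rightarrow> real) \<Rightarrow> ereal" where
  "essinf_on \<mu> A f = - esssup (restrict_space \<mu> A) (\<lambda>x. - ereal (f x))"

text \<open>
  In the first condition the integrand is non-negative almost everywhere on the ball, so that the
  truncation implicit in \<^const>\<open>e2ennreal\<close> is harmless; the quotient is \<open>0\<close> if \<open>\<mu>(\<eta>B) = 0\<close>.
  The essential infimum over a null set is \<open>\<infinity>\<close>; the second condition is therefore imposed on
  balls of positive measure only.
\<close>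

definition RBLO_bound :: "'a::metric_space measure \<Rightarrow> ('a \<Rightarrow> real \<Rightarrow> real) \<Rightarrow> real \<Rightarrow> nat \<Rightarrow>
    real \<Rightarrow> real \<Rightarrow> ('a \<Rightarrow> real) \<Rightarrow> real \<Rightarrow> bool" where
  "RBLO_bound \<mu> lam Clam N0 \<eta> \<rho> f C \<longleftrightarrow>
     0 \<le> C \<and>
     (\<forall>c r. 0 < r \<longrightarrow>
        (\<integral>\<^sup>+y\<in>ball c r.
            e2ennreal (ereal (f y) - essinf_on \<mu> (ball c (doubling_radius \<mu> Clam N0 \<rho> c r)) f) \<partial>\<mu>)
          / emeasure \<mu> (ball c (\<eta> * r)) \<le> ennreal C) \<and>
     (\<forall>c r c' r'. 0 < r \<and> 0 < r' \<and> ball c r \<subseteq> ball c' r' \<and>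
        doubling_ball \<mu> \<rho> (doubling_beta Clam N0 \<rho>) c r \<and>
        doubling_ball \<mu> \<rho> (doubling_beta Clam N0 \<rho>) c' r' \<and>
        0 < emeasure \<mu> (ball c r) \<longrightarrow>
        essinf_on \<mu> (ball c r) f - essinf_on \<mu> (ball c' r') f
          \<le> ereal (C * (1 + ball_delta \<mu> lam c r c' r')))"

definition RBLO_space :: "'a::metric_space measure \<Rightarrow> ('a \<Rightarrow> real \<Rightarrow> real) \<Rightarrow> real \<Rightarrow> nat \<Rightarrow>
    real \<Rightarrow> real \<Rightarrow> ('a \<Rightarrow> real) set" where
  "RBLO_space \<mu> lam Clam N0 \<eta> \<rho> =
     {f. L1_loc \<mu> f \<and> (\<exists>C. RBLO_bound \<mu> lam Clam N0 \<eta> \<rho> f C)}"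

definition RBLO_norm :: "'a::metric_space measure \<Rightarrow> ('a \<Rightarrow> real \<Rightarrow> real) \<Rightarrow> real \<Rightarrow> nat \<Rightarrow>
    real \<Rightarrow> real \<Rightarrow> ('a \<Rightarrow> real) \<Rightarrow> real" where
  "RBLO_norm \<mu> lam Clam N0 \<eta> \<rho> f = Inf {C. RBLO_bound \<mu> lam Clam N0 \<eta> \<rho> f C}"


section \<open>The Marcinkiewicz integral\<close>

text \<open>
  Kernels are defined off the diagonal, so the point \<open>y = x\<close> (which may be an atom of \<open>\<mu>\<close>) is left
  out of the inner integral; the values \<open>K x x\<close> are never used.  For \<open>y = y'\<close> the integrand of
  the regularity condition vanishes identically.
\<close>

definition marcinkiewicz ::
    "'a::metric_space measure \<Rightarrow> ('a \<Rightarrow> 'a \<Rightarrow> complex) \<Rightarrow> ('a \<Rightarrow> complex) \<Rightarrow> 'a \<Rightarrow> ennreal" where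
  "marcinkiewicz \<mu> K f x =
     ennreal_powr
       (\<integral>\<^sup>+t\<in>{0<..}. ennreal ((norm (LINT y:(ball x t - {x})|\<mu>. K x y * f y))\<^sup>2 / t ^ 3) \<partial>lborel)
       (1 / 2)"

definition marcinkiewicz_kernel ::
    "'a::metric_space measure \<Rightarrow> ('a \<Rightarrow> real \<Rightarrow> real) \<Rightarrow> ('a \<Rightarrow> 'a \<Rightarrow> complex) \<Rightarrow> bool" where
  "marcinkiewicz_kernel \<mu> lam K \<longleftrightarrow>
     locally_integrable_on (\<mu> \<Otimes>\<^sub>M \<mu>) {(x, y). x \<noteq> y} (\<lambda>(x, y). K x y) \<and>
     (\<exists>C::real. 0 < C \<and>
        (\<forall>x y. x \<noteq> y \<longrightarrow> norm (K x y) \<le> C * (dist x y / lam x (dist x y))) \<and>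
        (\<forall>y y'. (\<integral>\<^sup>+x\<in>{x. 2 * dist y y' \<le> dist x y}.
             ennreal ((norm (K x y - K x y') + norm (K y x - K y' x)) * (1 / dist x y)) \<partial>\<mu>)
           \<le> ennreal C))"

end

theory Submission
  imports Defs
begin

text \<open>
  The Marcinkiewicz integral is the \<open>L\<^sup>2(dt/t\<^sup>3)\<close>-norm of a linear operator whose kernel
  \<open>K(x,y) 1\<^bsub>d(x,y)<t\<^esub>\<close> takes values in that Hilbert space.  Restricting \<open>t\<close> to \<open>(\<epsilon>, L)\<close> makes everything
  absolutely convergent and yields a vector-valued Calderon--Zygmund kernel with constants
  independent of \<open>\<epsilon>\<close> and \<open>L\<close>; moreover the transposed kernel satisfies the same hypotheses.
  For the weak type (1,1) estimate the function is cut into finitely many pieces supported in balls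
  of radius \<open>\<epsilon>\<close>.  For the stopping-time argument each piece is a point mass, which is then spread
  over a doubling ball around it with controlled total density; the cost of this
  is the integral defining \<open>\<delta>\<close>, which stays bounded up to the first doubling ball.  Interpolation, applied to the operator and to its
  transpose, gives all exponents \<open>1 < p < \<infinity>\<close>, and Fatou's lemma removes the truncation.
  On \<open>L\<^sup>\<infinity>\<close> the values of \<open>M(f)\<close> at two points of balls \<open>B \<subseteq> S\<close> differ by \<open>M(f 1\<^bsub>\<eta>B\<^esub>)\<close> plus
  \<open>C (1 + \<delta>(B, S)) \<parallel>f\<parallel>\<close>, which gives the RBLO bound.  On \<open>H\<^sup>1\<close> each atomic block is estimated by
  boundedness near its atoms, by size between the atoms and twice the large ball, and by
  cancellation outside; the weak type bound permits summation of the series.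
\<close>

section \<open>Powers and norms of extended non-negative functions\<close>

text \<open>Cutting a function at a height would call for a differentiation theorem and for stopping
  balls of arbitrarily small radius. The truncation \<open>t > \<epsilon>\<close> avoids both: for
  \<open>dist x y < \<epsilon>\<close> it replaces the size bound \<open>1 / lam\<close> by
  \<open>(dist x y / \<epsilon>) / lam\<close>, so that a piece supported in a ball of radius
  \<open>\<epsilon>\<close> has an integrable image near that ball, uniformly in
  \<open>\<epsilon>\<close>, and stopping never goes below this radius. The number of pieces is
  finite but uncontrolled; hence every estimate is linear in their masses. Interpolating weak type
  (1,1) with \<open>p0\<close> reaches exponents below \<open>p0\<close> only. The larger ones need
  the transpose, which takes Hilbert space valued functions to scalar ones. So both sides carry an
  auxiliary measure, and kernels are measured in the Hilbert-Schmidt norm, which transposition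
  preserves. The cutoff \<open>dist x y < t\<close> is not smooth: moving \<open>y\<close> by
  \<open>R\<close> shifts its jump by at most \<open>R\<close>. In the norm of
  \<open>dt / t^3\<close> this costs a factor \<open>sqrt (R / dist x y)\<close> against the size
  bound, and the dyadic sum of these factors converges. The rest of the regularity is the hypothesis
  on \<open>K\<close>.\<close>

lemma ennreal_powr_top [simp]: "ennreal_powr \<infinity> a = \<infinity>" "ennreal_powr top a = \<infinity>"
  by (simp_all add: ennreal_powr_def)

lemma ennreal_powr_ennreal: "0 \<le> x \<Longrightarrow> ennreal_powr (ennreal x) a = ennreal (x powr a)"
  by (simp add: ennreal_powr_def)

lemma ennreal_powr_0 [simp]: "ennreal_powr 0 a = 0"
  by (simp add: ennreal_powr_def)

lemma ennreal_powr_1 [simp]: "ennreal_powr x 1 = x"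
  by (cases x) (auto simp: ennreal_powr_ennreal)

lemma ennreal_powr_2 [simp]: "ennreal_powr x 2 = x\<^sup>2"
  by (cases x) (auto simp: ennreal_powr_ennreal ennreal_power power_top_ennreal)

lemma ennreal_powr_mono: "0 \<le> a \<Longrightarrow> x \<le> y \<Longrightarrow> ennreal_powr x a \<le> ennreal_powr y a"
  by (cases x; cases y) (auto simp: ennreal_powr_ennreal top_unique powr_mono2)

lemma ennreal_powr_strict_mono: "0 < a \<Longrightarrow> x < y \<Longrightarrow> ennreal_powr x a < ennreal_powr y a"
  by (cases x; cases y) (auto simp: ennreal_powr_ennreal ennreal_less_iff intro!: powr_less_mono2)

lemma ennreal_powr_le_iff: "0 < a \<Longrightarrow> ennreal_powr x a \<le> ennreal_powr y a \<longleftrightarrow> x \<le> y"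
  by (meson ennreal_powr_mono ennreal_powr_strict_mono leD less_imp_le not_le)

lemma ennreal_powr_less_iff: "0 < a \<Longrightarrow> ennreal_powr x a < ennreal_powr y a \<longleftrightarrow> x < y"
  by (meson ennreal_powr_le_iff not_le)

lemma ennreal_powr_mult:
  assumes "0 < a" shows "ennreal_powr (x * y) a = ennreal_powr x a * ennreal_powr y a"
proof (cases "x = 0 \<or> y = 0")
  case False
  then show ?thesis using assms
    by (cases x; cases y)
       (auto simp: ennreal_powr_ennreal powr_mult ennreal_mult_top ennreal_top_mult
         simp flip: ennreal_mult split: if_splits)
qed auto

lemma ennreal_powr_add:
  assumes "0 < a" "0 < b" shows "ennreal_powr x (a + b) = ennreal_powr x a * ennreal_powr x b"
  using assms by (cases x) (auto simp: ennreal_powr_ennreal powr_add simp flip: ennreal_mult)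

lemma ennreal_powr_powr: "ennreal_powr (ennreal_powr x a) b = ennreal_powr x (a * b)"
  by (cases x) (auto simp: ennreal_powr_ennreal powr_powr)

lemma ennreal_powr_inverse [simp]:
  assumes "0 < a" shows "ennreal_powr (ennreal_powr x a) (1 / a) = x"
    "ennreal_powr (ennreal_powr x (1 / a)) a = x"
  using assms by (simp_all add: ennreal_powr_powr)

lemma ennreal_powr_eq_0_iff [simp]: "ennreal_powr x a = 0 \<longleftrightarrow> x = 0"
  by (cases x) (auto simp: ennreal_powr_ennreal)

lemma ennreal_powr_less_top_iff [simp]: "ennreal_powr x a < top \<longleftrightarrow> x < top"
  by (cases x) (auto simp: ennreal_powr_ennreal)

lemma ennreal_powr_eq_top_iff [simp]: "ennreal_powr x a = top \<longleftrightarrow> x = top"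
  by (cases x) (auto simp: ennreal_powr_ennreal)

lemma measurable_ennreal_powr [measurable]:
  assumes [measurable]: "f \<in> borel_measurable M"
  shows "(\<lambda>x. ennreal_powr (f x) a) \<in> borel_measurable M"
  unfolding ennreal_powr_def by measurable

text \<open>This half of the continuity of powers is what carries Fatou's lemma through an outer
  root or power.\<close>

lemma ennreal_powr_liminf:
  fixes f :: "nat \<Rightarrow> ennreal"
  assumes "0 < a"
  shows "ennreal_powr (liminf f) a \<le> liminf (\<lambda>n. ennreal_powr (f n) a)"
proof (subst le_Liminf_iff, safe)
  fix y assume "y < ennreal_powr (liminf f) a"
  then have "ennreal_powr y (1 / a) < liminf f"
    using assms ennreal_powr_less_iff[of a "ennreal_powr y (1/a)"] by simp
  then have "\<forall>\<^sub>F n in sequentially. ennreal_powr y (1 / a) < f n"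
    using le_Liminf_iff[of "liminf f" sequentially f] by blast
  then show "\<forall>\<^sub>F n in sequentially. y < ennreal_powr (f n) a"
    by eventually_elim (use assms ennreal_powr_less_iff[of a "ennreal_powr y (1/a)"] in simp)
qed

lemma Young_ennreal:
  fixes x y :: ennreal
  assumes p: "1 < p" "1 < q" "1 / p + 1 / q = (1::real)"
  shows "x * y \<le> ennreal (1 / p) * ennreal_powr x p + ennreal (1 / q) * ennreal_powr y q"
proof (cases "x = top \<or> y = top")
  case True
  have "ennreal (1 / p) \<noteq> 0" "ennreal (1 / q) \<noteq> 0" using p by auto
  with True show ?thesis by (auto simp: ennreal_mult_top)
next
  case False
  then obtain a b where ab: "x = ennreal a" "y = ennreal b" "0 \<le> a" "0 \<le> b"
    by (cases x; cases y) auto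
  have "a * b \<le> 1 / p * (a powr p) + 1 / q * (b powr q)"
    using Youngs_inequality[of p q a b] p ab by simp
  then show ?thesis using ab p
    by (simp add: ennreal_powr_ennreal flip: ennreal_mult ennreal_plus)
qed

lemma Holder_nn_integral:
  assumes p: "1 < p" "1 < q" "1 / p + 1 / q = (1::real)"
    and [measurable]: "f \<in> borel_measurable M" "g \<in> borel_measurable M"
  shows "(\<integral>\<^sup>+x. f x * g x \<partial>M) \<le>
     ennreal_powr (\<integral>\<^sup>+x. ennreal_powr (f x) p \<partial>M) (1 / p)
       * ennreal_powr (\<integral>\<^sup>+x. ennreal_powr (g x) q \<partial>M) (1 / q)"
    (is "_ \<le> ennreal_powr ?F _ * ennreal_powr ?G _")
proof -
  consider "?F = 0" | "?G = 0" | "?F \<noteq> 0" "?G \<noteq> 0" "?F = top \<or> ?G = top"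
    | "?F \<noteq> 0" "?G \<noteq> 0" "?F \<noteq> top" "?G \<noteq> top" by blast
  then show ?thesis
  proof cases
    case 1
    then have "AE x in M. ennreal_powr (f x) p = 0"
      by (subst (asm) nn_integral_0_iff_AE) auto
    then have "(\<integral>\<^sup>+x. f x * g x \<partial>M) = (\<integral>\<^sup>+x. 0 \<partial>M)"
      by (intro nn_integral_cong_AE) auto
    then show ?thesis by simp
  next
    case 2
    then have "AE x in M. ennreal_powr (g x) q = 0"
      by (subst (asm) nn_integral_0_iff_AE) auto
    then have "(\<integral>\<^sup>+x. f x * g x \<partial>M) = (\<integral>\<^sup>+x. 0 \<partial>M)"
      by (intro nn_integral_cong_AE) auto
    then show ?thesis by simp
  next
    case 3
    then have "ennreal_powr ?F (1 / p) * ennreal_powr ?G (1 / q) = top"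
      by (auto simp: ennreal_mult_top ennreal_top_mult)
    then show ?thesis by simp
  next
    case 4
    \<comment> \<open>Both norms are positive and finite here. After division by them, integrating
      Young's inequality pointwise gives \<open>1 / p + 1 / q = 1\<close>.\<close>
    define a where "a = enn2real (ennreal_powr ?F (1 / p))"
    define b where "b = enn2real (ennreal_powr ?G (1 / q))"
    have a: "ennreal a = ennreal_powr ?F (1 / p)" and b: "ennreal b = ennreal_powr ?G (1 / q)"
      unfolding a_def b_def using 4 by (simp_all add: less_top)
    have ab0: "0 < a" "0 < b"
      using a b 4 by (metis a_def b_def enn2real_nonneg ennreal_0 ennreal_powr_eq_0_iff
          order_le_less)+
    have ap: "ennreal_powr (ennreal (1 / a)) p * ?F = 1"
    proof -
      have "?F = ennreal_powr (ennreal a) p" using a p by simp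
      then show ?thesis using ab0
        by (simp add: ennreal_powr_ennreal powr_divide flip: ennreal_mult)
    qed
    have bq: "ennreal_powr (ennreal (1 / b)) q * ?G = 1"
    proof -
      have "?G = ennreal_powr (ennreal b) q" using b p by simp
      then show ?thesis using ab0
        by (simp add: ennreal_powr_ennreal powr_divide flip: ennreal_mult)
    qed
    have "ennreal (1 / a) * ennreal (1 / b) * (\<integral>\<^sup>+x. f x * g x \<partial>M)
        = (\<integral>\<^sup>+x. (ennreal (1 / a) * f x) * (ennreal (1 / b) * g x) \<partial>M)"
      by (subst nn_integral_cmult[symmetric]) (auto intro!: nn_integral_cong simp: ac_simps)
    also have "\<dots> \<le> (\<integral>\<^sup>+x. ennreal (1 / p) * ennreal_powr (ennreal (1 / a) * f x) p
          + ennreal (1 / q) * ennreal_powr (ennreal (1 / b) * g x) q \<partial>M)"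
      by (intro nn_integral_mono Young_ennreal p)
    also have "\<dots> = ennreal (1 / p) * (ennreal_powr (ennreal (1 / a)) p * ?F)
          + ennreal (1 / q) * (ennreal_powr (ennreal (1 / b)) q * ?G)"
      using p by (simp add: ennreal_powr_mult nn_integral_add nn_integral_cmult)
    also have "\<dots> = 1" using p by (simp add: ap bq flip: ennreal_plus)
    finally have *: "ennreal (1 / a) * ennreal (1 / b) * (\<integral>\<^sup>+x. f x * g x \<partial>M) \<le> 1" .
    have "(\<integral>\<^sup>+x. f x * g x \<partial>M)
        = (ennreal a * ennreal b) * (ennreal (1 / a) * ennreal (1 / b) * (\<integral>\<^sup>+x. f x * g x \<partial>M))"
      using ab0 by (simp add: mult.assoc[symmetric] flip: ennreal_mult)
    also have "\<dots> \<le> (ennreal a * ennreal b) * 1" by (intro mult_left_mono *) auto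
    finally show ?thesis by (simp add: a b)
  qed
qed

section \<open>The L2 norm of functions with values in [0, \<infinity>]\<close>

definition L2 :: "'a measure \<Rightarrow> ('a \<Rightarrow> ennreal) \<Rightarrow> ennreal" where
  "L2 M f = ennreal_powr (\<integral>\<^sup>+x. (f x)\<^sup>2 \<partial>M) (1 / 2)"

lemma ennreal_sqrt_square [simp]: "(ennreal_powr x (1 / 2))\<^sup>2 = x"
  using ennreal_powr_inverse(2)[of 2 x] by (simp del: ennreal_powr_inverse)

lemma ennreal_sqrt_le_iff: "ennreal_powr x (1 / 2) \<le> y \<longleftrightarrow> x \<le> y\<^sup>2"
  using ennreal_powr_le_iff[of 2 "ennreal_powr x (1/2)" y] by simp

lemma ennreal_power2_le_iff: "x\<^sup>2 \<le> y\<^sup>2 \<longleftrightarrow> x \<le> (y::ennreal)"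
  using ennreal_powr_le_iff[of 2 x y] by simp

lemma L2_square: "(L2 M f)\<^sup>2 = (\<integral>\<^sup>+x. (f x)\<^sup>2 \<partial>M)"
  by (simp add: L2_def)

lemma L2_le_iff: "L2 M f \<le> y \<longleftrightarrow> (\<integral>\<^sup>+x. (f x)\<^sup>2 \<partial>M) \<le> y\<^sup>2"
  by (simp add: L2_def ennreal_sqrt_le_iff)

lemma L2_mono_AE: "AE x in M. f x \<le> g x \<Longrightarrow> L2 M f \<le> L2 M g"
  unfolding L2_le_iff L2_square by (intro nn_integral_mono_AE, elim eventually_mono) (simp add: power_mono)

lemma L2_mono: "(\<And>x. x \<in> space M \<Longrightarrow> f x \<le> g x) \<Longrightarrow> L2 M f \<le> L2 M g"
  by (intro L2_mono_AE) auto

lemma L2_cong: "(\<And>x. x \<in> space M \<Longrightarrow> f x = g x) \<Longrightarrow> L2 M f = L2 M g"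
  by (intro antisym L2_mono) auto

lemma L2_0 [simp]: "L2 M (\<lambda>x. 0) = 0"
  by (simp add: L2_def)

lemma L2_cmult:
  assumes [measurable]: "f \<in> borel_measurable M"
  shows "L2 M (\<lambda>x. c * f x) = c * L2 M f"
proof -
  have "ennreal_powr (c\<^sup>2) (1 / 2) = c"
    using ennreal_powr_inverse(1)[of 2 c] by simp
  then show ?thesis by (simp add: L2_def power_mult_distrib nn_integral_cmult ennreal_powr_mult)
qed

lemma L2_multc:
  assumes [measurable]: "f \<in> borel_measurable M"
  shows "L2 M (\<lambda>x. f x * c) = L2 M f * c"
  using L2_cmult[OF assms, of c] by (simp add: mult.commute)

lemma L2_measurable [measurable]:
  assumes "sigma_finite_measure M"
    and [measurable]: "(\<lambda>(y, x). f y x) \<in> borel_measurable (N \<Otimes>\<^sub>M M)"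
  shows "(\<lambda>y. L2 M (f y)) \<in> borel_measurable N"
proof -
  interpret sigma_finite_measure M by fact
  show ?thesis unfolding L2_def by measurable
qed

lemma L2_Cauchy_Schwarz:
  assumes [measurable]: "f \<in> borel_measurable M" "g \<in> borel_measurable M"
  shows "(\<integral>\<^sup>+x. f x * g x \<partial>M) \<le> L2 M f * L2 M g"
  using Cauchy_Schwarz_nn_integral[OF assms]
  by (subst ennreal_power2_le_iff[symmetric]) (simp add: power_mult_distrib L2_square)

text \<open>Expand the square and apply Cauchy--Schwarz.\<close>

lemma L2_Minkowski:
  assumes "sigma_finite_measure M" "sigma_finite_measure N"
    and [measurable]: "(\<lambda>(x, y). k x y) \<in> borel_measurable (M \<Otimes>\<^sub>M N)"
  shows "L2 M (\<lambda>x. \<integral>\<^sup>+y. k x y \<partial>N) \<le> (\<integral>\<^sup>+y. L2 M (\<lambda>x. k x y) \<partial>N)"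
proof -
  interpret M: sigma_finite_measure M by fact
  interpret N: sigma_finite_measure N by fact
  interpret P: pair_sigma_finite M N ..
  interpret P': pair_sigma_finite N M ..
  interpret Q: pair_sigma_finite N N ..
  have [measurable]: "(\<lambda>y. L2 M (\<lambda>x. k x y)) \<in> borel_measurable N"
    by (rule L2_measurable[OF M.sigma_finite_measure_axioms]) measurable
  have "(\<integral>\<^sup>+x. (\<integral>\<^sup>+y. k x y \<partial>N)\<^sup>2 \<partial>M) = (\<integral>\<^sup>+x. (\<integral>\<^sup>+y. \<integral>\<^sup>+y'. k x y * k x y' \<partial>N \<partial>N) \<partial>M)"
    by (intro nn_integral_cong)
       (simp add: power2_eq_square nn_integral_cmult nn_integral_multc)
  also have "\<dots> = (\<integral>\<^sup>+y. \<integral>\<^sup>+x. \<integral>\<^sup>+y'. k x y * k x y' \<partial>N \<partial>M \<partial>N)"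
    by (rule P'.Fubini') measurable
  also have "\<dots> = (\<integral>\<^sup>+y. \<integral>\<^sup>+y'. \<integral>\<^sup>+x. k x y * k x y' \<partial>M \<partial>N \<partial>N)"
    by (intro nn_integral_cong P'.Fubini') measurable
  also have "\<dots> \<le> (\<integral>\<^sup>+y. \<integral>\<^sup>+y'. L2 M (\<lambda>x. k x y) * L2 M (\<lambda>x. k x y') \<partial>N \<partial>N)"
    by (intro nn_integral_mono L2_Cauchy_Schwarz) measurable
  also have "\<dots> = (\<integral>\<^sup>+y. L2 M (\<lambda>x. k x y) \<partial>N)\<^sup>2"
    by (simp add: power2_eq_square nn_integral_cmult nn_integral_multc)
  finally show ?thesis by (simp add: L2_le_iff)
qed

lemma L2_add:
  assumes [measurable]: "f \<in> borel_measurable M" "g \<in> borel_measurable M"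
  shows "L2 M (\<lambda>x. f x + g x) \<le> L2 M f + L2 M g"
proof -
  have "(\<integral>\<^sup>+x. (f x + g x)\<^sup>2 \<partial>M) = (\<integral>\<^sup>+x. (f x)\<^sup>2 + (g x)\<^sup>2 + 2 * (f x * g x) \<partial>M)"
    by (intro nn_integral_cong) (simp add: power2_sum mult.assoc)
  also have "\<dots> = (L2 M f)\<^sup>2 + (L2 M g)\<^sup>2 + 2 * (\<integral>\<^sup>+x. f x * g x \<partial>M)"
    by (simp add: nn_integral_add nn_integral_cmult L2_square)
  also have "\<dots> \<le> (L2 M f)\<^sup>2 + (L2 M g)\<^sup>2 + 2 * (L2 M f * L2 M g)"
    by (intro add_left_mono mult_left_mono L2_Cauchy_Schwarz) auto
  also have "\<dots> = (L2 M f + L2 M g)\<^sup>2" by (simp add: power2_sum mult.assoc)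
  finally show ?thesis by (simp add: L2_le_iff)
qed

section \<open>Geometry of the space\<close>

context nonhomogeneous_space
begin

lemma space_UNIV [simp]: "space \<mu> = UNIV"
  using sets_eq_imp_space_eq[OF sets_borel] by simp

lemma ball_sets [measurable, simp]: "ball x r \<in> sets \<mu>"
  by (simp add: sets_borel)

lemma singleton_sets [measurable, simp]: "{x} \<in> sets \<mu>"
  by (simp add: sets_borel)

lemma Clam_ge_1: "1 \<le> Clam"
proof -
  fix x :: 'a
  have "lam x 1 \<le> Clam * lam x (1 / 2)" using lam_doubling[of 1 x] by simp
  also have "\<dots> \<le> Clam * lam x 1"
    using Clam_pos lam_mono[of "1/2" 1 x] by (intro mult_left_mono) auto
  finally show ?thesis using lam_pos[of 1 x] by simp
qed

lemma emeasure_ball_finite [simp]: "emeasure \<mu> (ball x r) < top" "emeasure \<mu> (ball x r) \<noteq> top"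
proof -
  show "emeasure \<mu> (ball x r) < top"
  proof (cases "0 < r")
    case True
    then show ?thesis using upper_doubling[OF True, of x] ennreal_less_top le_less_trans by blast
  qed (simp add: ball_empty)
  then show "emeasure \<mu> (ball x r) \<noteq> top" by simp
qed

lemma fmeasurable_ball: "ball x r \<in> fmeasurable \<mu>"
  by (intro fmeasurableI) (auto simp: emeasure_ball_finite)

lemma emeasure_ball_eq: "emeasure \<mu> (ball x r) = ennreal (measure \<mu> (ball x r))"
  by (simp add: emeasure_eq_ennreal_measure)

lemma measure_ball_mono: "ball x r \<subseteq> ball y s \<Longrightarrow> measure \<mu> (ball x r) \<le> measure \<mu> (ball y s)"
  by (intro measure_mono_fmeasurable fmeasurable_ball) auto

lemma sigma_finite: "sigma_finite_measure \<mu>"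
proof
  fix o1 :: 'a
  show "\<exists>A. countable A \<and> A \<subseteq> sets \<mu> \<and> \<Union> A = space \<mu> \<and> (\<forall>a\<in>A. emeasure \<mu> a \<noteq> \<infinity>)"
  proof (intro exI[of _ "range (\<lambda>n::nat. ball o1 (real n))"] conjI)
    show "\<Union> (range (\<lambda>n::nat. ball o1 (real n))) = space \<mu>"
      by (auto simp: reals_Archimedean2)
  qed auto
qed

sublocale sigma_finite_measure \<mu>
  by (rule sigma_finite)

section \<open>Total boundedness, separability and measurability of the distance\<close>

lemma finite_cover:
  fixes x :: 'a
  assumes "0 < r" "0 < e"
  shows "\<exists>F. finite F \<and> ball x r \<subseteq> (\<Union>y\<in>F. ball y e)"
proof -
  have *: "\<exists>F. finite F \<and> ball x r \<subseteq> (\<Union>y\<in>F. ball y (r / 2 ^ k))" for k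
  proof (induction k)
    case 0
    then show ?case by (intro exI[of _ "{x}"]) auto
  next
    case (Suc k)
    then obtain F where F: "finite F" "ball x r \<subseteq> (\<Union>y\<in>F. ball y (r / 2 ^ k))" by blast
    have "\<forall>y::'a. \<exists>G. finite G \<and> ball y (r / 2 ^ k) \<subseteq> (\<Union>w\<in>G. ball w (r / 2 ^ k / 2))"
    proof
      fix y :: 'a
      have "0 < r / 2 ^ k" using assms by simp
      from geometrically_doubling[OF this, of y]
      show "\<exists>G. finite G \<and> ball y (r / 2 ^ k) \<subseteq> (\<Union>w\<in>G. ball w (r / 2 ^ k / 2))"
        by (elim ex_forward) simp
    qed
    from choice[OF this] obtain G where
      G: "\<forall>y::'a. finite (G y) \<and> ball y (r / 2 ^ k) \<subseteq> (\<Union>w\<in>G y. ball w (r / 2 ^ k / 2))"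
      by blast
    show ?case
    proof (intro exI[of _ "\<Union>y\<in>F. G y"] conjI)
      have "ball x r \<subseteq> (\<Union>y\<in>F. \<Union>w\<in>G y. ball w (r / 2 ^ k / 2))" using F(2) G by blast
      then show "ball x r \<subseteq> (\<Union>y\<in>\<Union>y\<in>F. G y. ball y (r / 2 ^ Suc k))"
        by (simp add: field_simps)
    qed (use F G in auto)
  qed
  obtain k where "r / e < 2 ^ k"
    using real_arch_pow[of 2 "r / e"] by auto
  then have "r / 2 ^ k \<le> e" using assms by (simp add: field_simps)
  with *[of k] show ?thesis by (meson SUP_mono order_trans subset_ball)
qed

text \<open>The centres of finite covers of growing balls at shrinking scales form a dense set. The
  type \<open>'a\<close> carries no countability axiom, so geometric doubling is the source of joint
  measurability on the product.\<close>

lemma separable: "\<exists>D::'a set. countable D \<and> (\<forall>x e. 0 < e \<longrightarrow> (\<exists>d\<in>D. dist x d < e))"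
proof -
  fix o1 :: 'a
  have "\<forall>n k::nat. \<exists>F. finite F \<and> ball o1 (real (Suc n)) \<subseteq> (\<Union>y\<in>F. ball y (1 / real (Suc k)))"
    by (intro allI finite_cover) auto
  then obtain F where F: "\<And>n k. finite (F n k)"
     "\<And>n k::nat. ball o1 (real (Suc n)) \<subseteq> (\<Union>y\<in>F n k. ball y (1 / real (Suc k)))" by metis
  show ?thesis
  proof (intro exI[of _ "\<Union>n k. F n k"] conjI allI impI)
    show "countable (\<Union>n k. F n k)" by (meson countable_UN countableI_type countable_finite F(1))
    fix x and e :: real assume "0 < e"
    then obtain k :: nat where k: "1 / real (Suc k) < e" using nat_approx_posE by blast
    obtain n :: nat where "dist o1 x < real n" using reals_Archimedean2 by blast
    then have "x \<in> ball o1 (real (Suc n))" by auto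
    then obtain y where "y \<in> F n k" "x \<in> ball y (1 / real (Suc k))" using F(2) by blast
    then show "\<exists>d\<in>\<Union>n k. F n k. dist x d < e" using k by (intro bexI[of _ y]) (auto simp: dist_commute)
  qed
qed

text \<open>Without separability, open sets of the product need not lie in the product of the Borel
  \<open>\<sigma>\<close>-algebras. A countable dense set and rational radii write
  \<open>dist < a\<close> as a countable union of rectangles of balls.\<close>

lemma measurable_dist [measurable (raw)]:
  assumes [measurable]: "f \<in> M \<rightarrow>\<^sub>M \<mu>" "g \<in> M \<rightarrow>\<^sub>M \<mu>"
  shows "(\<lambda>w. dist (f w) (g w)) \<in> borel_measurable M"
proof -
  obtain D :: "'a set" where D: "countable D" "\<And>x e. 0 < e \<Longrightarrow> \<exists>d\<in>D. dist x d < e"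
    using separable by blast
  have "{w \<in> space M. dist (f w) (g w) < a} \<in> sets M" for a
  proof -
    have eq: "{w \<in> space M. dist (f w) (g w) < a}
       = (\<Union>d\<in>D. \<Union>q\<in>\<rat>. (f -` ball d q \<inter> space M) \<inter> (g -` ball d (a - q) \<inter> space M))"
      (is "?L = ?R")
    proof (intro set_eqI iffI)
      fix w assume w: "w \<in> ?L"
      define e where "e = (a - dist (f w) (g w)) / 3"
      have "0 < e" using w by (simp add: e_def)
      then obtain d where d: "d \<in> D" "dist (f w) d < e" using D by blast
      obtain q where q: "q \<in> \<rat>" "dist (f w) d < q" "q < e"
        using Rats_dense_in_real d(2) by blast
      have "dist d (g w) \<le> dist (f w) d + dist (f w) (g w)"
        by (metis dist_commute dist_triangle)
      then have "dist d (g w) < a - q" using d q w unfolding e_def by auto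
      then show "w \<in> ?R" using w d q by (auto simp: dist_commute)
    next
      fix w assume "w \<in> ?R"
      then obtain d q where "w \<in> space M" "dist d (f w) < q" "dist d (g w) < a - q" by auto
      then show "w \<in> ?L" using dist_triangle3[of "f w" "g w" d] by simp
    qed
    show ?thesis unfolding eq
      by (intro sets.countable_UN'[OF D(1)] sets.countable_UN'[OF countable_rat] image_subsetI
          sets.Int measurable_sets[OF assms(1)] measurable_sets[OF assms(2)]) auto
  qed
  then show ?thesis by (simp add: borel_measurable_iff_less)
qed

text \<open>Monotonicity in the radius gives Borel measurability. The value \<open>lam c 0\<close>,
  about which nothing is assumed, is split off on the singleton \<open>{c}\<close>.\<close>

lemma measurable_lam [measurable]: "(\<lambda>y. lam c (dist c y)) \<in> borel_measurable \<mu>"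
proof -
  define g where "g t = (if 0 < t then lam c t else 0)" for t :: real
  have "mono g"
    using lam_mono lam_pos by (auto simp: mono_def g_def less_imp_le)
  then have [measurable]: "g \<in> borel_measurable borel" by (rule borel_measurable_mono)
  have [measurable]: "(\<lambda>y. dist c y) \<in> borel_measurable \<mu>" by measurable
  have "(\<lambda>y. lam c (dist c y)) = (\<lambda>y. if y \<in> {c} then lam c 0 else g (dist c y))"
    by (auto simp: g_def)
  also have "\<dots> \<in> borel_measurable \<mu>" by measurable
  finally show ?thesis .
qed

lemma nn_integral_union_le:
  assumes [measurable]: "g \<in> borel_measurable \<mu>" "A \<in> sets \<mu>" "B \<in> sets \<mu>" and "S \<subseteq> A \<union> B"
  shows "(\<integral>\<^sup>+y\<in>S. g y \<partial>\<mu>) \<le> (\<integral>\<^sup>+y\<in>A. g y \<partial>\<mu>) + (\<integral>\<^sup>+y\<in>B. g y \<partial>\<mu>)"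
proof -
  have "(\<integral>\<^sup>+y\<in>S. g y \<partial>\<mu>) \<le> (\<integral>\<^sup>+y. g y * indicator A y + g y * indicator B y \<partial>\<mu>)"
    using assms(4) by (intro nn_integral_mono) (auto simp: indicator_def)
  then show ?thesis by (simp add: nn_integral_add)
qed

section \<open>Growth of the dominating function and radial integrals\<close>

lemma lam_pow: "0 < r \<Longrightarrow> lam x (2 ^ k * r) \<le> Clam ^ k * lam x r"
proof (induction k)
  case (Suc k)
  have "lam x (2 ^ Suc k * r) \<le> Clam * lam x (2 ^ k * r)"
    using lam_doubling[of "2 ^ Suc k * r" x] Suc by simp
  also have "\<dots> \<le> Clam * (Clam ^ k * lam x r)" using Suc Clam_pos by (intro mult_left_mono) auto
  finally show ?case by (simp add: mult.assoc)
qed simp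

text \<open>Doubling is iterated \<open>k\<close> times with \<open>2 ^ k \<ge> a\<close>; the extra
  factor \<open>Clam\<close> pays for rounding \<open>log 2 a\<close> up to an integer.\<close>

lemma lam_growth:
  assumes "0 < r" "1 \<le> a"
  shows "lam x (a * r) \<le> Clam * a powr (log 2 Clam) * lam x r"
proof -
  define k where "k = nat \<lceil>log 2 a\<rceil>"
  have k: "log 2 a \<le> real k" "real k \<le> 1 + log 2 a"
    using assms by (auto simp: k_def) (use zero_le_log_cancel_iff[of 2 a] in linarith)
  have "a = 2 powr (log 2 a)" using assms by simp
  also have "\<dots> \<le> 2 powr (real k)" using k by (intro powr_mono) auto
  finally have "a \<le> 2 ^ k" by (simp add: powr_realpow)
  then have "lam x (a * r) \<le> lam x (2 ^ k * r)" using assms by (intro lam_mono) auto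
  also have "\<dots> \<le> Clam ^ k * lam x r" by (rule lam_pow) fact
  also have "Clam ^ k = Clam powr real k" using Clam_pos by (simp add: powr_realpow)
  also have "\<dots> \<le> Clam powr (1 + log 2 a)" using k Clam_ge_1 by (intro powr_mono) auto
  also have "Clam powr (1 + log 2 a) = Clam * a powr (log 2 Clam)"
  proof -
    have "Clam powr (log 2 a) = a powr (log 2 Clam)"
      using assms Clam_pos by (simp add: powr_def log_def)
    then show ?thesis using Clam_pos by (simp add: powr_add)
  qed
  finally show ?thesis using lam_pos[OF assms(1), of x] by (auto intro: mult_right_mono)
qed

text \<open>Summation over annuli: a bound on each piece whose product with the measure decays
  geometrically. It serves small radii, large radii, and the radii below the first doubling
  ball.\<close>

lemma nn_integral_pieces:
  fixes g :: "'a \<Rightarrow> ennreal"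
  assumes "\<And>x. g x \<noteq> 0 \<Longrightarrow> \<exists>k::nat. x \<in> A k \<and> g x \<le> c k" "\<And>k. A k \<in> sets \<mu>"
    and b: "\<And>k. c k * emeasure \<mu> (A k) \<le> ennreal (B * q ^ k)" and q: "0 \<le> B" "0 \<le> q" "q < 1"
  shows "(\<integral>\<^sup>+x. g x \<partial>\<mu>) \<le> ennreal (B / (1 - q))"
proof -
  have "(\<integral>\<^sup>+x. g x \<partial>\<mu>) \<le> (\<integral>\<^sup>+x. (\<Sum>k. c k * indicator (A k) x) \<partial>\<mu>)"
  proof (intro nn_integral_mono)
    fix x
    show "g x \<le> (\<Sum>k. c k * indicator (A k) x)"
    proof (cases "g x = 0")
      case False
      then obtain k where k: "x \<in> A k" "g x \<le> c k" using assms(1) by blast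
      then have "g x \<le> (\<Sum>k\<in>{k}. c k * indicator (A k) x)" by simp
      also have "\<dots> \<le> (\<Sum>k. c k * indicator (A k) x)" by (intro sum_le_suminf) auto
      finally show ?thesis .
    qed simp
  qed
  also have "\<dots> = (\<Sum>k. c k * emeasure \<mu> (A k))"
    using assms(2) by (simp add: nn_integral_suminf nn_integral_cmult)
  also have "\<dots> \<le> (\<Sum>k. ennreal (B * q ^ k))" by (intro suminf_le b) auto
  also have "\<dots> = ennreal (\<Sum>k. B * q ^ k)"
    using q by (intro suminf_ennreal2) (auto intro!: summable_mult summable_geometric)
  also have "(\<Sum>k. B * q ^ k) = B / (1 - q)"
    using q suminf_geometric[of q] suminf_mult[of "\<lambda>k. q ^ k" B] summable_geometric[of q] by simp
  finally show ?thesis .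
qed

text \<open>On the annulus of radius about \<open>s / 2 ^ k\<close> the measure is at most
  \<open>Clam\<close> times the value of \<open>lam\<close> in the denominator, so that the
  numerator \<open>s / 2 ^ k\<close> remains and is summed. That the bound is linear in
  \<open>s\<close> is essential: the truncated kernel divides it by a radius of the same
  order.\<close>

lemma near_integral:
  assumes "0 < s"
  shows "(\<integral>\<^sup>+y\<in>ball z s. ennreal (dist z y / lam z (dist z y)) \<partial>\<mu>) \<le> ennreal (2 * Clam * s)"
proof -
  have "(\<integral>\<^sup>+y\<in>ball z s. ennreal (dist z y / lam z (dist z y)) \<partial>\<mu>) \<le> ennreal ((Clam * s) / (1 - 1 / 2))"
  proof (rule nn_integral_pieces)
    fix y assume "ennreal (dist z y / lam z (dist z y)) * indicator (ball z s) y \<noteq> 0"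
    then have y: "0 < dist z y" "dist z y < s" by (auto simp: indicator_def split: if_splits)
    define k where "k = (LEAST k. s / 2 ^ Suc k \<le> dist z y)"
    obtain m where "s / dist z y < 2 ^ m" using real_arch_pow[of 2 "s / dist z y"] by auto
    then have "s < dist z y * 2 ^ m" using y by (simp add: field_simps)
    also have "\<dots> \<le> dist z y * 2 ^ Suc m" by simp
    finally have "s / 2 ^ Suc m \<le> dist z y" by (simp add: field_simps)
    then have k1: "s / 2 ^ Suc k \<le> dist z y" unfolding k_def by (rule LeastI)
    have k2: "dist z y < s / 2 ^ k"
    proof (cases k)
      case (Suc j)
      then have "\<not> s / 2 ^ Suc j \<le> dist z y" unfolding k_def using not_less_Least by (metis lessI)
      then show ?thesis using Suc by simp
    qed (use y in simp)
    have "dist z y / lam z (dist z y) \<le> (s / 2 ^ k) / lam z (s / 2 ^ Suc k)"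
      using k1 k2 assms y by (intro frac_le lam_mono lam_pos) auto
    then show "\<exists>k. y \<in> ball z (s / 2 ^ k) - ball z (s / 2 ^ Suc k) \<and>
        ennreal (dist z y / lam z (dist z y)) * indicator (ball z s) y
          \<le> ennreal ((s / 2 ^ k) / lam z (s / 2 ^ Suc k))"
      using k1 k2 y by (intro exI[of _ k]) (auto intro: ennreal_leI)
  next
    fix k :: nat
    let ?r = "s / 2 ^ k"
    have r: "0 < ?r" "s / 2 ^ Suc k = ?r / 2" "0 < ?r / 2" using assms by auto
    have "emeasure \<mu> (ball z ?r - ball z (s / 2 ^ Suc k)) \<le> emeasure \<mu> (ball z ?r)"
      by (intro emeasure_mono) auto
    also have "\<dots> \<le> ennreal (Clam * lam z (?r / 2))"
      using upper_doubling[OF r(1), of z] lam_doubling[OF r(1), of z] ennreal_leI order_trans by blast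
    finally have "ennreal (?r / lam z (s / 2 ^ Suc k)) * emeasure \<mu> (ball z ?r - ball z (s / 2 ^ Suc k))
       \<le> ennreal (?r / lam z (?r / 2)) * ennreal (Clam * lam z (?r / 2))"
      unfolding r(2) by (intro mult_left_mono) auto
    also have "\<dots> = ennreal (Clam * s * (1 / 2) ^ k)"
      using r lam_pos[OF r(3), of z] Clam_pos assms
      by (simp add: power_divide field_simps flip: ennreal_mult)
    finally show "ennreal (?r / lam z (s / 2 ^ Suc k)) * emeasure \<mu> (ball z ?r - ball z (s / 2 ^ Suc k))
       \<le> ennreal (Clam * s * (1 / 2) ^ k)" .
  qed (use assms Clam_pos in auto)
  also have "(Clam * s) / (1 - 1 / 2) = 2 * Clam * s" by simp
  finally show ?thesis .
qed

text \<open>Without the square root every dyadic annulus would contribute a constant. The factor is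
  what displacing the cutoff in \<open>t\<close> yields (see \<open>L2_theta_jump\<close>), and it
  produces the ratio \<open>1 / sqrt 2 \<le> 3 / 4\<close>; hence the 4.\<close>

lemma far_integral:
  assumes "0 < s"
  shows "(\<integral>\<^sup>+y\<in>- ball z s. ennreal (sqrt (s / dist z y) / lam z (dist z y)) \<partial>\<mu>) \<le> ennreal (4 * Clam)"
proof -
  let ?q = "1 / sqrt 2"
  have q: "?q \<le> 3 / 4"
  proof -
    have "4 / 3 \<le> sqrt 2" by (rule real_le_rsqrt) (simp add: power2_eq_square)
    then show ?thesis by (simp add: field_simps)
  qed
  have "(\<integral>\<^sup>+y\<in>- ball z s. ennreal (sqrt (s / dist z y) / lam z (dist z y)) \<partial>\<mu>) \<le> ennreal (Clam / (1 - ?q))"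
  proof (rule nn_integral_pieces)
    fix y assume "ennreal (sqrt (s / dist z y) / lam z (dist z y)) * indicator (- ball z s) y \<noteq> 0"
    then have y: "s \<le> dist z y" by (auto simp: indicator_def split: if_splits)
    define k where "k = (LEAST k. dist z y < 2 ^ Suc k * s)"
    obtain m where "dist z y / s < 2 ^ m" using real_arch_pow[of 2 "dist z y / s"] by auto
    then have "dist z y < 2 ^ m * s" using assms by (simp add: field_simps)
    also have "\<dots> \<le> 2 ^ Suc m * s" using assms by simp
    finally have k1: "dist z y < 2 ^ Suc k * s" unfolding k_def by (rule LeastI)
    have k2: "2 ^ k * s \<le> dist z y"
    proof (cases k)
      case (Suc j)
      then have "\<not> dist z y < 2 ^ Suc j * s" unfolding k_def using not_less_Least by (metis lessI)
      then show ?thesis using Suc by simp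
    qed (use y in simp)
    have "s / dist z y \<le> s / (2 ^ k * s)"
      using k2 assms y by (intro divide_left_mono mult_pos_pos) auto
    then have "sqrt (s / dist z y) \<le> sqrt (1 / 2 ^ k)" using assms by (simp add: field_simps)
    then have "sqrt (s / dist z y) \<le> ?q ^ k" by (simp add: real_sqrt_divide real_sqrt_power power_divide)
    then have "sqrt (s / dist z y) / lam z (dist z y) \<le> ?q ^ k / lam z (2 ^ k * s)"
      using k2 assms y by (intro frac_le lam_mono lam_pos) auto
    then show "\<exists>k. y \<in> ball z (2 ^ Suc k * s) - ball z (2 ^ k * s) \<and>
        ennreal (sqrt (s / dist z y) / lam z (dist z y)) * indicator (- ball z s) y
          \<le> ennreal (?q ^ k / lam z (2 ^ k * s))"
      using k1 k2 y by (intro exI[of _ k]) (auto intro: ennreal_leI)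
  next
    fix k :: nat
    have r: "0 < 2 ^ k * s" "0 < 2 ^ Suc k * s" "2 ^ Suc k * s / 2 = 2 ^ k * s" using assms by auto
    have "emeasure \<mu> (ball z (2 ^ Suc k * s) - ball z (2 ^ k * s)) \<le> emeasure \<mu> (ball z (2 ^ Suc k * s))"
      by (intro emeasure_mono) auto
    also have "\<dots> \<le> ennreal (Clam * lam z (2 ^ k * s))"
      using upper_doubling[OF r(2), of z] lam_doubling[OF r(2), of z] ennreal_leI order_trans
      unfolding r(3) by blast
    finally have "ennreal (?q ^ k / lam z (2 ^ k * s)) * emeasure \<mu> (ball z (2 ^ Suc k * s) - ball z (2 ^ k * s))
       \<le> ennreal (?q ^ k / lam z (2 ^ k * s)) * ennreal (Clam * lam z (2 ^ k * s))"
      by (intro mult_left_mono) auto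
    also have "\<dots> = ennreal (Clam * ?q ^ k)"
      using r lam_pos[OF r(1), of z] Clam_pos by (simp add: field_simps flip: ennreal_mult)
    finally show "ennreal (?q ^ k / lam z (2 ^ k * s)) * emeasure \<mu> (ball z (2 ^ Suc k * s) - ball z (2 ^ k * s))
       \<le> ennreal (Clam * ?q ^ k)" .
  qed (use q Clam_pos in auto)
  also have "\<dots> \<le> ennreal (4 * Clam)"
    using q Clam_pos by (intro ennreal_leI) (simp add: field_simps)
  finally show ?thesis .
qed

lemma annulus_integral:
  assumes "0 < s" "1 \<le> a"
  shows "(\<integral>\<^sup>+y\<in>ball z (a * s) - ball z s. ennreal (1 / lam z (dist z y)) \<partial>\<mu>)
     \<le> ennreal (Clam * a powr (log 2 Clam))"
proof -
  have "(\<integral>\<^sup>+y\<in>ball z (a * s) - ball z s. ennreal (1 / lam z (dist z y)) \<partial>\<mu>)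
      \<le> (\<integral>\<^sup>+y. ennreal (1 / lam z s) * indicator (ball z (a * s)) y \<partial>\<mu>)"
    using assms lam_pos[of s z] lam_mono[of s _ z]
    by (intro nn_integral_mono) (auto simp: indicator_def intro!: ennreal_leI divide_left_mono lam_pos mult_pos_pos)
  also have "\<dots> = ennreal (1 / lam z s) * emeasure \<mu> (ball z (a * s))"
    by (simp add: nn_integral_cmult)
  also have "\<dots> \<le> ennreal (1 / lam z s) * ennreal (Clam * a powr (log 2 Clam) * lam z s)"
    using upper_doubling[of "a * s" z] lam_growth[OF assms, of z] assms
    by (intro mult_left_mono) (auto elim!: order_trans intro!: ennreal_leI)
  also have "\<dots> = ennreal (Clam * a powr (log 2 Clam))"
    using lam_pos[OF assms(1), of z] Clam_pos by (simp flip: ennreal_mult)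
  finally show ?thesis .
qed

section \<open>Doubling balls\<close>

abbreviation "beta \<equiv> doubling_beta Clam N0"

lemma log_Clam_nonneg: "0 \<le> log 2 Clam"
  using Clam_ge_1 by simp

text \<open>Exceeding the growth rate \<open>\<rho> powr (log 2 Clam)\<close> of \<open>lam\<close>
  is what forces doubling balls to exist and gives a ratio below one in
  \<open>doubling_delta\<close>. The margin 1 comes from the summand
  \<open>30 powr n\<close>.\<close>

lemma beta_ge:
  assumes "1 < \<rho>" shows "\<rho> powr (log 2 Clam) + 1 \<le> beta \<rho>"
proof -
  have "\<rho> powr (log 2 Clam) \<le> \<rho> powr (3 * max (log 2 (real N0)) (log 2 Clam))"
    using assms log_Clam_nonneg by (intro powr_mono) auto
  moreover have "1 \<le> (30::real) powr (log 2 (real N0))"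
    using N0_pos by (intro ge_one_powr_ge_zero) auto
  moreover have "0 \<le> (30::real) powr (log 2 Clam)" by simp
  ultimately show ?thesis unfolding doubling_beta_def Let_def by linarith
qed

lemma beta_pos: "1 < \<rho> \<Longrightarrow> 0 < beta \<rho>"
  using beta_ge[of \<rho>] powr_ge_zero[of \<rho> "log 2 Clam"] by linarith

text \<open>If all dilates failed to be doubling, their measures would grow by the factor
  \<open>beta \<rho>\<close> at each step and overtake the dominating function.\<close>

lemma doubling_exists:
  assumes "1 < \<rho>" "0 < r"
  shows "\<exists>j. 1 \<le> j \<and> doubling_ball \<mu> \<rho> (beta \<rho>) c (\<rho> ^ j * r)"
proof (rule ccontr)
  assume *: "\<not> ?thesis"
  have nd: "beta \<rho> * measure \<mu> (ball c (\<rho> ^ j * r)) < measure \<mu> (ball c (\<rho> ^ Suc j * r))"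
    if "1 \<le> j" for j
  proof -
    have "\<not> doubling_ball \<mu> \<rho> (beta \<rho>) c (\<rho> ^ j * r)" using * that by blast
    then show ?thesis using beta_pos[OF assms(1)]
      by (simp add: doubling_ball_def not_le emeasure_ball_eq ennreal_less_iff mult.assoc
        flip: ennreal_mult)
  qed
  define m where "m = measure \<mu> (ball c (\<rho> ^ 2 * r))"
  define p where "p = \<rho> powr (log 2 Clam)"
  have p: "0 < p" using assms by (simp add: p_def)
  have b: "p + 1 \<le> beta \<rho>" using beta_ge[OF assms(1)] by (simp add: p_def)
  \<comment> \<open>Failure of doubling is a strict inequality, so the ball of radius
    \<open>\<rho> ^ 2 * r\<close> has positive measure, whereas smaller ones may be null. This is
    why the iteration starts at exponent 2.\<close>
  have "0 \<le> beta \<rho> * measure \<mu> (ball c (\<rho> ^ 1 * r))" using beta_pos[OF assms(1)] by simp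
  then have m: "0 < m" using nd[of 1] unfolding m_def numeral_2_eq_2 One_nat_def by linarith
  have 1: "beta \<rho> ^ i * m \<le> measure \<mu> (ball c (\<rho> ^ (2 + i) * r))" for i
  proof (induction i)
    case (Suc i)
    have "beta \<rho> ^ Suc i * m \<le> beta \<rho> * measure \<mu> (ball c (\<rho> ^ (2 + i) * r))"
      using Suc beta_pos[OF assms(1)] by simp
    also have "\<dots> \<le> measure \<mu> (ball c (\<rho> ^ (2 + Suc i) * r))"
      using nd[of "2 + i"] by simp
    finally show ?case .
  qed (simp add: m_def)
  have 2: "measure \<mu> (ball c (\<rho> ^ (2 + i) * r)) \<le> Clam * p ^ i * lam c (\<rho> ^ 2 * r)" for i
  proof -
    have "ennreal (measure \<mu> (ball c (\<rho> ^ (2 + i) * r))) \<le> ennreal (lam c (\<rho> ^ (2 + i) * r))"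
      using upper_doubling[of "\<rho> ^ (2 + i) * r" c] assms by (simp add: emeasure_ball_eq)
    moreover have "0 < lam c (\<rho> ^ (2 + i) * r)" using assms by (intro lam_pos) auto
    ultimately have "measure \<mu> (ball c (\<rho> ^ (2 + i) * r)) \<le> lam c (\<rho> ^ (2 + i) * r)"
      by simp
    also have "\<dots> = lam c (\<rho> ^ i * (\<rho> ^ 2 * r))" by (simp add: power2_eq_square ac_simps)
    also have "\<dots> \<le> Clam * (\<rho> ^ i) powr (log 2 Clam) * lam c (\<rho> ^ 2 * r)"
      using assms by (intro lam_growth) auto
    also have "(\<rho> ^ i) powr (log 2 Clam) = p ^ i"
      using assms by (simp add: p_def powr_powr powr_power mult.commute flip: powr_realpow)
    finally show ?thesis .
  qed
  \<comment> \<open>Per step the measure gains at least \<open>p + 1\<close> and the bound by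
    \<open>lam\<close> at most \<open>p\<close>; the quotient is unbounded in
    \<open>i\<close>.\<close>
  have 3: "((p + 1) / p) ^ i \<le> Clam * lam c (\<rho> ^ 2 * r) / m" for i
  proof -
    have "(p + 1) ^ i * m \<le> beta \<rho> ^ i * m"
      using b p m by (intro mult_right_mono power_mono) auto
    then have "(p + 1) ^ i * m \<le> Clam * p ^ i * lam c (\<rho> ^ 2 * r)" using 1[of i] 2[of i] by linarith
    then show ?thesis using p m by (simp add: power_divide field_simps)
  qed
  obtain i where "Clam * lam c (\<rho> ^ 2 * r) / m < ((p + 1) / p) ^ i"
    using real_arch_pow[of "(p + 1) / p"] p by auto
  with 3[of i] show False by simp
qed

lemma doubling_radius_props:
  assumes "1 < \<rho>" "0 < r"
  obtains J where "1 \<le> J" "doubling_radius \<mu> Clam N0 \<rho> c r = \<rho> ^ J * r"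
    "doubling_ball \<mu> \<rho> (beta \<rho>) c (\<rho> ^ J * r)"
    "\<And>j. 1 \<le> j \<Longrightarrow> j < J \<Longrightarrow> \<not> doubling_ball \<mu> \<rho> (beta \<rho>) c (\<rho> ^ j * r)"
proof -
  let ?P = "\<lambda>j. 1 \<le> j \<and> doubling_ball \<mu> \<rho> (beta \<rho>) c (\<rho> ^ j * r)"
  have "?P (LEAST j. ?P j)" using doubling_exists[OF assms, of c] by (rule LeastI_ex)
  then show ?thesis
    using that[of "LEAST j. ?P j"] not_less_Least[of _ ?P] by (auto simp: doubling_radius_def)
qed

text \<open>The first summand stands for the annuli up to the first doubling dilate, the second for
  the annulus between that dilate and its double.\<close>

definition doubling_delta_const :: "real \<Rightarrow> real" where
  "doubling_delta_const \<rho> = (let p = \<rho> powr (log 2 Clam) in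
     Clam * p / (1 - p / beta \<rho>) + Clam * 2 powr (log 2 Clam))"

lemma doubling_delta_const_nonneg: "1 < \<rho> \<Longrightarrow> 0 \<le> doubling_delta_const \<rho>"
proof -
  assume \<rho>: "1 < \<rho>"
  have "\<rho> powr log 2 Clam / beta \<rho> \<le> 1"
    using beta_ge[OF \<rho>] beta_pos[OF \<rho>] by simp
  then show ?thesis unfolding doubling_delta_const_def Let_def using Clam_pos
    by (intro add_nonneg_nonneg divide_nonneg_nonneg mult_nonneg_nonneg) auto
qed

text \<open>Below the first doubling radius each step inwards divides the measure by at least
  \<open>beta \<rho>\<close>, while \<open>lam\<close> decreases, up to one factor
  \<open>Clam\<close>, by at most \<open>p = \<rho> powr (log 2 Clam)\<close> per step. The annuli
  contribute a geometric series of ratio \<open>p / beta \<rho>\<close>, whatever their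
  number.\<close>

lemma doubling_delta:
  assumes "1 < \<rho>" "0 < r"
  shows "(\<integral>\<^sup>+y\<in>ball c (2 * doubling_radius \<mu> Clam N0 \<rho> c r) - ball c r.
            ennreal (1 / lam c (dist c y)) \<partial>\<mu>) \<le> ennreal (doubling_delta_const \<rho>)"
proof -
  obtain J where J: "1 \<le> J" "doubling_radius \<mu> Clam N0 \<rho> c r = \<rho> ^ J * r"
    "\<And>j. 1 \<le> j \<Longrightarrow> j < J \<Longrightarrow> \<not> doubling_ball \<mu> \<rho> (beta \<rho>) c (\<rho> ^ j * r)"
    using doubling_radius_props[OF assms] by metis
  define p where "p = \<rho> powr (log 2 Clam)"
  have p: "0 < p" using assms by (simp add: p_def)
  have b: "p + 1 \<le> beta \<rho>" using beta_ge[OF assms(1)] by (simp add: p_def)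
  let ?R = "\<lambda>j. \<rho> ^ j * r"
  let ?g = "\<lambda>y. ennreal (1 / lam c (dist c y))"
  have Rpos: "0 < ?R j" for j using assms by simp
  have nd: "measure \<mu> (ball c (?R j)) \<le> measure \<mu> (ball c (?R (Suc j))) / beta \<rho>"
    if "1 \<le> j" "j < J" for j
  proof -
    have "beta \<rho> * measure \<mu> (ball c (?R j)) < measure \<mu> (ball c (?R (Suc j)))"
      using J(3)[OF that] beta_pos[OF assms(1)]
      by (simp add: doubling_ball_def not_le emeasure_ball_eq ennreal_less_iff mult.assoc
        flip: ennreal_mult)
    then show ?thesis using beta_pos[OF assms(1)] by (simp add: field_simps)
  qed
  have chain: "measure \<mu> (ball c (?R (J - k))) \<le> measure \<mu> (ball c (?R J)) / beta \<rho> ^ k" if "k < J" for k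
    using that
  proof (induction k)
    case (Suc k)
    have "measure \<mu> (ball c (?R (J - Suc k))) \<le> measure \<mu> (ball c (?R (J - k))) / beta \<rho>"
      using nd[of "J - Suc k"] Suc by (simp add: Suc_diff_Suc)
    also have "\<dots> \<le> measure \<mu> (ball c (?R J)) / beta \<rho> ^ k / beta \<rho>"
      using Suc beta_pos[OF assms(1)] by (intro divide_right_mono) auto
    finally show ?case by (simp add: field_simps)
  qed simp
  \<comment> \<open>Pieces are counted inwards from the doubling ball: piece \<open>k\<close> lies
    between the radii with exponents \<open>J - Suc k\<close> and \<open>J - k\<close>, and is empty
    once \<open>k \<ge> J\<close>. The innermost one ends at the given ball, about whose own measure
    nothing is known; the estimate involves the outer radius of each annulus.\<close>
  have 1: "(\<integral>\<^sup>+y\<in>ball c (?R J) - ball c r. ?g y \<partial>\<mu>) \<le> ennreal ((Clam * p) / (1 - p / beta \<rho>))"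
  proof (rule nn_integral_pieces)
    fix y assume "?g y * indicator (ball c (?R J) - ball c r) y \<noteq> 0"
    then have y: "r \<le> dist c y" "dist c y < ?R J" by (auto simp: indicator_def split: if_splits)
    define i where "i = (LEAST i. dist c y < ?R (Suc i))"
    have J': "dist c y < ?R (Suc (J - 1))" using y J by simp
    then have i1: "dist c y < ?R (Suc i)" unfolding i_def by (rule LeastI)
    have iJ: "i \<le> J - 1" unfolding i_def using J' by (rule Least_le)
    have i2: "?R i \<le> dist c y"
    proof (cases i)
      case (Suc j)
      then have "\<not> dist c y < ?R (Suc j)" unfolding i_def using not_less_Least by (metis lessI)
      then show ?thesis using Suc by simp
    qed (use y in simp)
    have "1 / lam c (dist c y) \<le> 1 / lam c (?R i)"
      using i2 less_le_trans[OF Rpos[of i] i2] assms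
      by (intro divide_left_mono lam_mono mult_pos_pos lam_pos) auto
    moreover have "J - (J - 1 - i) = Suc i" "J - Suc (J - 1 - i) = i" "J - 1 - i < J"
      using iJ J by auto
    ultimately show "\<exists>k. y \<in> (if k < J then ball c (?R (J - k)) - ball c (?R (J - Suc k)) else {}) \<and>
        ?g y * indicator (ball c (?R J) - ball c r) y \<le> ennreal (1 / lam c (?R (J - Suc k)))"
      using i1 i2 by (intro exI[of _ "J - 1 - i"]) (auto simp: indicator_def intro: ennreal_leI)
  next
    fix k
    show "ennreal (1 / lam c (?R (J - Suc k))) * emeasure \<mu>
        (if k < J then ball c (?R (J - k)) - ball c (?R (J - Suc k)) else {}) \<le> ennreal (Clam * p * (p / beta \<rho>) ^ k)"
    proof (cases "k < J")
      case True
      let ?j = "J - Suc k"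
      have lpos: "0 < lam c (?R ?j)" "0 < lam c (?R J)" using Rpos lam_pos by blast+
      have "emeasure \<mu> (ball c (?R (J - k)) - ball c (?R ?j)) \<le> emeasure \<mu> (ball c (?R (J - k)))"
        by (intro emeasure_mono) auto
      also have "\<dots> = ennreal (measure \<mu> (ball c (?R (J - k))))" by (rule emeasure_ball_eq)
      also have "\<dots> \<le> ennreal (measure \<mu> (ball c (?R J)) / beta \<rho> ^ k)" using chain[OF True] by (rule ennreal_leI)
      also have "\<dots> \<le> ennreal (Clam * p ^ Suc k * lam c (?R ?j) / beta \<rho> ^ k)"
      proof (intro ennreal_leI divide_right_mono)
        have "measure \<mu> (ball c (?R J)) \<le> lam c (?R J)"
          using upper_doubling[OF Rpos[of J], of c] lpos by (simp add: emeasure_ball_eq)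
        also have "lam c (?R J) = lam c (\<rho> ^ Suc k * ?R ?j)" using True
          by (simp add: mult.assoc[symmetric] power_add[symmetric] del: power_Suc)
        also have "\<dots> \<le> Clam * (\<rho> ^ Suc k) powr (log 2 Clam) * lam c (?R ?j)"
          using assms Rpos[of ?j] one_le_power[of \<rho> "Suc k"] by (intro lam_growth) auto
        also have "(\<rho> ^ Suc k) powr (log 2 Clam) = p ^ Suc k"
          unfolding p_def using assms
          by (simp add: powr_powr powr_power mult.commute flip: powr_realpow del: power_Suc)
        finally show "measure \<mu> (ball c (?R J)) \<le> Clam * p ^ Suc k * lam c (?R ?j)" .
      qed (use beta_pos[OF assms(1)] in simp)
      finally have "ennreal (1 / lam c (?R ?j)) * emeasure \<mu> (ball c (?R (J - k)) - ball c (?R ?j))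
        \<le> ennreal (1 / lam c (?R ?j)) * ennreal (Clam * p ^ Suc k * lam c (?R ?j) / beta \<rho> ^ k)"
        by (rule mult_left_mono) simp
      also have "\<dots> = ennreal (Clam * p * (p / beta \<rho>) ^ k)"
        using lpos p Clam_pos beta_pos[OF assms(1)]
        by (simp add: power_divide field_simps flip: ennreal_mult)
      finally show ?thesis using True by simp
    qed simp
  qed (use p b Clam_pos beta_pos[OF assms(1)] in auto)
  have 2: "(\<integral>\<^sup>+y\<in>ball c (2 * ?R J) - ball c (?R J). ?g y \<partial>\<mu>) \<le> ennreal (Clam * 2 powr (log 2 Clam))"
    by (rule annulus_integral) (use Rpos in auto)
  have "(\<integral>\<^sup>+y\<in>ball c (2 * ?R J) - ball c r. ?g y \<partial>\<mu>)
      \<le> (\<integral>\<^sup>+y\<in>ball c (?R J) - ball c r. ?g y \<partial>\<mu>)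
        + (\<integral>\<^sup>+y\<in>ball c (2 * ?R J) - ball c (?R J). ?g y \<partial>\<mu>)"
    by (rule nn_integral_union_le) auto
  also have "\<dots> \<le> ennreal ((Clam * p) / (1 - p / beta \<rho>)) + ennreal (Clam * 2 powr (log 2 Clam))"
    by (intro add_mono 1 2)
  also have "\<dots> = ennreal (doubling_delta_const \<rho>)"
    using p b Clam_pos beta_pos[OF assms(1)]
    by (subst ennreal_plus[symmetric]) (auto simp: doubling_delta_const_def p_def Let_def)
  finally show ?thesis using J(2) by simp
qed

end

section \<open>A Calderon--Zygmund decomposition of finitely many point masses\<close>

text \<open>Greedy selection: a ball that meets one of maximal radius lies in the triple of the
  latter, and the induction goes on with the balls disjoint from it. The maximum exists by
  finiteness, which gives the factor 3.\<close>

lemma finite_Vitali: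
  fixes z :: "'i \<Rightarrow> 'a::metric_space"
  assumes "finite I" "\<And>i. i \<in> I \<Longrightarrow> 0 < r i"
  shows "\<exists>S\<subseteq>I. disjoint_family_on (\<lambda>i. ball (z i) (r i)) S \<and>
     (\<Union>i\<in>I. ball (z i) (r i)) \<subseteq> (\<Union>i\<in>S. ball (z i) (3 * r i))"
  using assms
proof (induction "card I" arbitrary: I rule: less_induct)
  case less
  show ?case
  proof (cases "I = {}")
    case False
    obtain i where i: "i \<in> I" "\<And>j. j \<in> I \<Longrightarrow> r j \<le> r i"
      using obtains_MAX[OF less.prems(1) False, of r] by (metis Max_ge finite_imageI image_eqI less.prems(1))
    define I' where "I' = {j\<in>I. ball (z j) (r j) \<inter> ball (z i) (r i) = {}}"
    have "i \<notin> I'" using less.prems(2)[OF i(1)] by (auto simp: I'_def)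
    then have "I' \<subset> I" using i(1) unfolding I'_def by blast
    then have "card I' < card I" using less.prems(1) by (intro psubset_card_mono)
    then obtain S where S: "S \<subseteq> I'" "disjoint_family_on (\<lambda>i. ball (z i) (r i)) S"
      "(\<Union>i\<in>I'. ball (z i) (r i)) \<subseteq> (\<Union>i\<in>S. ball (z i) (3 * r i))"
      using less.hyps[of I'] less.prems by (auto simp: I'_def)
    have "ball (z j) (r j) \<subseteq> ball (z i) (3 * r i)" if j: "j \<in> I - I'" for j
    proof
      fix y assume y: "y \<in> ball (z j) (r j)"
      obtain x where x: "dist (z j) x < r j" "dist (z i) x < r i" using j by (auto simp: I'_def)
      have "dist (z i) y \<le> dist (z i) x + dist (z j) x + dist (z j) y"
        using dist_triangle[of "z i" y "z j"] dist_triangle2[of "z i" "z j" x] by linarith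
      then show "y \<in> ball (z i) (3 * r i)" using x y i(2)[of j] j by simp
    qed
    then have "(\<Union>i\<in>I. ball (z i) (r i)) \<subseteq> (\<Union>i\<in>insert i S. ball (z i) (3 * r i))"
      using S(3) by blast
    moreover have "disjoint_family_on (\<lambda>i. ball (z i) (r i)) (insert i S)"
      using S(1,2) by (auto simp: disjoint_family_on_def I'_def)
    ultimately show ?thesis using S(1) i(1) by (intro exI[of _ "insert i S"]) (auto simp: I'_def)
  qed (auto simp: disjoint_family_on_def)
qed

context nonhomogeneous_space
begin

text \<open>
  Every mass \<open>a k\<close> at \<open>z k\<close> is spread out over a ball of radius \<open>R k\<close> as \<open>a k * w k\<close>, so that the
  total density stays below \<open>4 \<beta> t\<close>.  Beyond the last stopping radius \<open>r k\<close> the masses have density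
  at most \<open>t\<close>; spreading them in order of increasing \<open>R k\<close>, at least half of the ball is still
  available when \<open>k\<close> has its turn.
\<close>

lemma spread_masses:
  fixes z :: "'i \<Rightarrow> 'a" and a R :: "'i \<Rightarrow> real"
  assumes "finite I" "\<And>k. k \<in> I \<Longrightarrow> 0 \<le> a k" "0 < t" "0 < \<beta>" "\<And>k. k \<in> I \<Longrightarrow> 0 < R k"
    and pos: "\<And>k. k \<in> I \<Longrightarrow> 0 < measure \<mu> (ball (z k) (R k))"
    and dens: "\<And>k. k \<in> I \<Longrightarrow> sum a {i\<in>I. z i \<in> ball (z k) (3 * R k)} \<le> t * \<beta> * measure \<mu> (ball (z k) (R k))"
  obtains w :: "'i \<Rightarrow> 'a \<Rightarrow> real" where
    "\<And>k. k \<in> I \<Longrightarrow> w k \<in> borel_measurable \<mu>" "\<And>k y. k \<in> I \<Longrightarrow> 0 \<le> w k y"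
    "\<And>k y. k \<in> I \<Longrightarrow> y \<notin> ball (z k) (R k) \<Longrightarrow> w k y = 0"
    "\<And>k. k \<in> I \<Longrightarrow> (\<integral>\<^sup>+y. ennreal (w k y) \<partial>\<mu>) = 1"
    "\<And>k y. k \<in> I \<Longrightarrow> w k y \<le> 2 / measure \<mu> (ball (z k) (R k))"
    "\<And>y. (\<Sum>k\<in>I. a k * w k y) \<le> 4 * \<beta> * t"
proof -
  define P where "P k v \<longleftrightarrow> v \<in> borel_measurable \<mu> \<and> (\<forall>y. 0 \<le> v y) \<and>
      (\<forall>y. y \<notin> ball (z k) (R k) \<longrightarrow> v y = 0) \<and> (\<integral>\<^sup>+y. ennreal (v y) \<partial>\<mu>) = 1 \<and>
      (\<forall>y. v y \<le> 2 / measure \<mu> (ball (z k) (R k)))" for k and v :: "'a \<Rightarrow> real"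
  have "\<exists>w. (\<forall>k\<in>S. P k (w k)) \<and> (\<forall>y. (\<Sum>k\<in>S. a k * w k y) \<le> 4 * \<beta> * t)"
    if "finite S" "S \<subseteq> I" for S
    using that
  proof (induction S rule: finite_ranking_induct[where f=R])
    case empty
    then show ?case using assms by simp
  next
    case (insert x S)
    show ?case
    proof (cases "x \<in> S")
      case True
      then show ?thesis using insert by (simp add: insert_absorb)
    next
      case False
      obtain w where w: "\<And>k. k \<in> S \<Longrightarrow> P k (w k)" "\<And>y. (\<Sum>k\<in>S. a k * w k y) \<le> 4 * \<beta> * t"
        using insert by auto
      define h where "h y = (\<Sum>k\<in>S. a k * w k y)" for y
      have [measurable]: "h \<in> borel_measurable \<mu>"
        unfolding h_def using w(1)
        by (intro borel_measurable_sum borel_measurable_times borel_measurable_const) (simp add: P_def)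
      have h0: "0 \<le> h y" for y
        unfolding h_def using w(1) insert assms by (intro sum_nonneg mult_nonneg_nonneg) (auto simp: P_def)
      let ?B = "ball (z x) (R x)"
      define m where "m = measure \<mu> ?B"
      have m: "0 < m" using pos[of x] insert by (simp add: m_def)
      have x: "x \<in> I" "0 < R x" using insert assms by auto
      have dx: "sum a {i\<in>I. z i \<in> ball (z x) (3 * R x)} \<le> t * \<beta> * m" using dens[OF x(1)] by (simp add: m_def)
      have "(\<integral>\<^sup>+y\<in>?B. ennreal (h y) \<partial>\<mu>) = (\<integral>\<^sup>+y. (\<Sum>k\<in>S. ennreal (a k) * ennreal (w k y) * indicator ?B y) \<partial>\<mu>)"
      proof (intro nn_integral_cong)
        fix y
        have "ennreal (h y) = (\<Sum>k\<in>S. ennreal (a k) * ennreal (w k y))"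
          unfolding h_def using w(1) insert assms
          by (subst sum_ennreal[symmetric]) (auto simp: P_def ennreal_mult subset_iff)
        then show "ennreal (h y) * indicator ?B y = (\<Sum>k\<in>S. ennreal (a k) * ennreal (w k y) * indicator ?B y)"
          by (simp add: sum_distrib_right)
      qed
      also have "\<dots> = (\<Sum>k\<in>S. \<integral>\<^sup>+y. ennreal (a k) * ennreal (w k y) * indicator ?B y \<partial>\<mu>)"
      proof (rule nn_integral_sum)
        fix k assume "k \<in> S"
        then have [measurable]: "w k \<in> borel_measurable \<mu>" using w(1) by (simp add: P_def)
        show "(\<lambda>y. ennreal (a k) * ennreal (w k y) * indicator ?B y) \<in> borel_measurable \<mu>"
          by measurable
      qed
      \<comment> \<open>Every \<open>w k\<close> has integral one, so a mass is counted in full when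
        its centre is within \<open>3 * R x\<close> and contributes nothing to \<open>?B\<close>
        otherwise.\<close>
      also have "\<dots> \<le> (\<Sum>k\<in>S. ennreal (if z k \<in> ball (z x) (3 * R x) then a k else 0))"
      proof (intro sum_mono)
        fix k assume k: "k \<in> S"
        have Pk: "P k (w k)" and [measurable]: "w k \<in> borel_measurable \<mu>" using w(1) k by (auto simp: P_def)
        show "(\<integral>\<^sup>+y. ennreal (a k) * ennreal (w k y) * indicator ?B y \<partial>\<mu>)
            \<le> ennreal (if z k \<in> ball (z x) (3 * R x) then a k else 0)"
        proof (cases "z k \<in> ball (z x) (3 * R x)")
          case True
          have "(\<integral>\<^sup>+y. ennreal (a k) * ennreal (w k y) * indicator ?B y \<partial>\<mu>)
              \<le> (\<integral>\<^sup>+y. ennreal (a k) * ennreal (w k y) \<partial>\<mu>)"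
            by (intro nn_integral_mono) (auto simp: indicator_def)
          also have "\<dots> = ennreal (a k)" using Pk by (simp add: nn_integral_cmult P_def)
          finally show ?thesis using True by simp
        next
          case False
          have "w k y = 0" if "y \<in> ?B" for y
          proof (rule ccontr)
            assume "w k y \<noteq> 0"
            then have "y \<in> ball (z k) (R k)" using Pk by (auto simp: P_def)
            then have "dist (z x) (z k) < R x + R k"
              using that dist_triangle2[of "z x" "z k" y] by simp
            \<comment> \<open>This is where the order of treatment matters: the earlier radii
              \<open>R k\<close> are at most \<open>R x\<close>.\<close>
            also have "\<dots> \<le> 3 * R x" using insert.hyps(2)[OF k] x by linarith
            finally show False using False by simp
          qed
          then have "(\<integral>\<^sup>+y. ennreal (a k) * ennreal (w k y) * indicator ?B y \<partial>\<mu>) = (\<integral>\<^sup>+y. 0 \<partial>\<mu>)"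
            by (intro nn_integral_cong) (auto simp: indicator_def)
          then show ?thesis by simp
        qed
      qed
      also have "\<dots> = ennreal (\<Sum>k\<in>S. if z k \<in> ball (z x) (3 * R x) then a k else 0)"
        using assms insert by (intro sum_ennreal) auto
      also have "\<dots> \<le> ennreal (t * \<beta> * m)"
      proof (intro ennreal_leI order_trans[OF _ dx])
        have "(\<Sum>k\<in>S. if z k \<in> ball (z x) (3 * R x) then a k else 0) = sum a {k\<in>S. z k \<in> ball (z x) (3 * R x)}"
          using insert by (simp add: sum.If_cases Int_def)
        also have "\<dots> \<le> sum a {i\<in>I. z i \<in> ball (z x) (3 * R x)}"
          using insert assms by (intro sum_mono2) auto
        finally show "(\<Sum>k\<in>S. if z k \<in> ball (z x) (3 * R x) then a k else 0)
          \<le> sum a {i\<in>I. z i \<in> ball (z x) (3 * R x)}" .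
      qed
      finally have hB: "(\<integral>\<^sup>+y\<in>?B. ennreal (h y) \<partial>\<mu>) \<le> ennreal (t * \<beta> * m)" .
      \<comment> \<open>By Chebyshev, a mass of at most \<open>t * \<beta> * m\<close> spread over
        \<open>?B\<close> has density above \<open>2 * \<beta> * t\<close> on at most half of the
        ball; \<open>A\<close> is the rest.\<close>
      define A where "A = {y\<in>?B. h y \<le> 2 * \<beta> * t}"
      have [measurable]: "A \<in> sets \<mu>"
      proof -
        have "A = ?B \<inter> {y\<in>space \<mu>. h y \<le> 2 * \<beta> * t}" by (auto simp: A_def)
        also have "\<dots> \<in> sets \<mu>" by measurable
        finally show ?thesis .
      qed
      have fA: "emeasure \<mu> A \<noteq> top" "emeasure \<mu> (?B - A) \<noteq> top"
      proof -
        have "emeasure \<mu> A \<le> emeasure \<mu> ?B" "emeasure \<mu> (?B - A) \<le> emeasure \<mu> ?B"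
          by (rule emeasure_mono; auto simp: A_def)+
        then show "emeasure \<mu> A \<noteq> top" "emeasure \<mu> (?B - A) \<noteq> top"
          using emeasure_ball_finite(2)[of "z x" "R x"] by (auto simp: top_unique)
      qed
      have "ennreal (2 * \<beta> * t) * emeasure \<mu> (?B - A) = (\<integral>\<^sup>+y. ennreal (2 * \<beta> * t) * indicator (?B - A) y \<partial>\<mu>)"
        by (simp add: nn_integral_cmult)
      also have "\<dots> \<le> (\<integral>\<^sup>+y\<in>?B. ennreal (h y) \<partial>\<mu>)"
        by (intro nn_integral_mono) (auto simp: indicator_def A_def intro!: ennreal_leI)
      finally have "ennreal (2 * \<beta> * t) * emeasure \<mu> (?B - A) \<le> ennreal (t * \<beta> * m)"
        using hB by (rule order_trans)
      then have "2 * \<beta> * t * measure \<mu> (?B - A) \<le> t * \<beta> * m"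
        using fA assms m by (simp add: emeasure_eq_ennreal_measure flip: ennreal_mult)
      then have "measure \<mu> (?B - A) \<le> m / 2" using assms by (simp add: field_simps)
      moreover have "m = measure \<mu> A + measure \<mu> (?B - A)"
      proof -
        have "emeasure \<mu> ?B = emeasure \<mu> A + emeasure \<mu> (?B - A)"
        proof -
          have "A \<union> (?B - A) = ?B" by (auto simp: A_def)
          then show ?thesis using plus_emeasure[of A \<mu> "?B - A"] by simp
        qed
        then show ?thesis unfolding m_def using fA
          by (simp add: measure_def enn2real_plus less_top)
      qed
      ultimately have mA: "m / 2 \<le> measure \<mu> A" by linarith
      then have mA0: "0 < measure \<mu> A" using m by linarith
      define v where "v y = indicator A y / measure \<mu> A" for y :: 'a
      have [measurable]: "v \<in> borel_measurable \<mu>" unfolding v_def by measurable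
      have v: "P x v"
        unfolding P_def
      proof (intro conjI allI impI)
        have "(\<integral>\<^sup>+y. ennreal (v y) \<partial>\<mu>) = (\<integral>\<^sup>+y. ennreal (1 / measure \<mu> A) * indicator A y \<partial>\<mu>)"
          by (intro nn_integral_cong) (auto simp: v_def indicator_def)
        also have "\<dots> = 1"
          using mA0 fA by (simp add: nn_integral_cmult emeasure_eq_ennreal_measure flip: ennreal_mult)
        finally show "(\<integral>\<^sup>+y. ennreal (v y) \<partial>\<mu>) = 1" .
        fix y
        have "v y \<le> 1 / measure \<mu> A" by (auto simp: v_def indicator_def)
        also have "\<dots> \<le> 1 / (m / 2)" using mA m by (intro divide_left_mono) auto
        finally show "v y \<le> 2 / measure \<mu> (ball (z x) (R x))" by (simp add: m_def)
      next
        show "v \<in> borel_measurable \<mu>" by measurable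
      qed (auto simp: v_def A_def)
      have ax: "a x \<le> t * \<beta> * m"
      proof -
        have "sum a {x} \<le> sum a {i\<in>I. z i \<in> ball (z x) (3 * R x)}"
          using x assms by (intro sum_mono2) auto
        with dx show ?thesis by simp
      qed
      show ?thesis
      proof (intro exI[of _ "w(x := v)"] conjI ballI allI)
        fix k assume "k \<in> insert x S"
        then show "P k ((w(x := v)) k)" using v w(1) by auto
      next
        fix y
        have "(\<Sum>k\<in>insert x S. a k * (w(x := v)) k y) = a x * v y + h y"
          using False insert by (simp add: h_def) (intro sum.cong, auto)
        \<comment> \<open>On \<open>A\<close> the old density is at most
          \<open>2 * \<beta> * t\<close>, and the new term adds no more than that, because
          \<open>a x \<le> t * \<beta> * m\<close> and \<open>v \<le> 2 / m\<close>. Off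
          \<open>A\<close> nothing is added.\<close>
        also have "\<dots> \<le> 4 * \<beta> * t"
        proof (cases "y \<in> A")
          case True
          have "a x * v y \<le> (t * \<beta> * m) * (2 / m)"
            using ax v assms x m by (intro mult_mono) (auto simp: P_def m_def)
          then have "a x * v y \<le> 2 * \<beta> * t" using m by (simp add: ac_simps)
          then show ?thesis using True by (simp add: A_def)
        next
          case False
          then show ?thesis using w(2)[of y] by (simp add: v_def h_def)
        qed
        finally show "(\<Sum>k\<in>insert x S. a k * (w(x := v)) k y) \<le> 4 * \<beta> * t" .
      qed
    qed
  qed
  from this[OF assms(1) order_refl] obtain w where
    "\<And>k. k \<in> I \<Longrightarrow> P k (w k)" "\<And>y. (\<Sum>k\<in>I. a k * w k y) \<le> 4 * \<beta> * t" by blast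
  then show ?thesis by (intro that[of w]) (auto simp: P_def)
qed

text \<open>A scale \<open>s\<close> at \<open>x\<close> stops when the mass in
  \<open>ball x (3 * s)\<close> exceeds \<open>t\<close> times the measure of
  \<open>ball x (9 * s)\<close>. These radii fit the covering argument, in which disjoint balls of
  radius \<open>3 * s\<close> have triples of radius \<open>9 * s\<close>. The doubling ratio 9 then
  turns a doubling ball that does not stop into one whose mass within three radii is at most
  \<open>t * beta 9\<close> times its own measure. \<open>r k\<close> is the last stopping scale, or
  \<open>\<epsilon>\<close> if there is none, and \<open>R k\<close> is the first doubling radius
  beyond it.\<close>

lemma CZ_point_masses:
  fixes z :: "'i \<Rightarrow> 'a" and a :: "'i \<Rightarrow> real"
  assumes I: "finite I" and a: "\<And>k. k \<in> I \<Longrightarrow> 0 \<le> a k" and t: "0 < t" and e: "0 < \<epsilon>"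
    and pos: "\<And>k. k \<in> I \<Longrightarrow> 0 < emeasure \<mu> (ball (z k) \<epsilon>)"
    and small: "ennreal (sum a I) < ennreal t * emeasure \<mu> UNIV"
  obtains r R :: "'i \<Rightarrow> real" and w :: "'i \<Rightarrow> 'a \<Rightarrow> real" and E :: "'a set" where
    "E \<in> sets \<mu>" "ennreal t * emeasure \<mu> E \<le> ennreal (sum a I)"
    "\<And>k. k \<in> I \<Longrightarrow> \<epsilon> \<le> r k" "\<And>k. k \<in> I \<Longrightarrow> r k \<le> R k"
    "\<And>k. k \<in> I \<Longrightarrow> ball (z k) (r k) \<subseteq> E \<union> ball (z k) \<epsilon>"
    "\<And>k. k \<in> I \<Longrightarrow> (\<integral>\<^sup>+y\<in>ball (z k) (2 * R k) - ball (z k) (r k).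
        ennreal (1 / lam (z k) (dist (z k) y)) \<partial>\<mu>) \<le> ennreal (doubling_delta_const 9)"
    "\<And>k. k \<in> I \<Longrightarrow> w k \<in> borel_measurable \<mu>" "\<And>k y. k \<in> I \<Longrightarrow> 0 \<le> w k y"
    "\<And>k y. k \<in> I \<Longrightarrow> y \<notin> ball (z k) (R k) \<Longrightarrow> w k y = 0"
    "\<And>k. k \<in> I \<Longrightarrow> (\<integral>\<^sup>+y. ennreal (w k y) \<partial>\<mu>) = 1"
    "\<And>k y. k \<in> I \<Longrightarrow> w k y * measure \<mu> (ball (z k) (2 * R k)) \<le> 2 * beta 9"
    "\<And>y. (\<Sum>k\<in>I. a k * w k y) \<le> 4 * beta 9 * t"
proof -
  define nu where "nu S = sum a {i\<in>I. z i \<in> S}" for S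
  define stop where "stop x s \<longleftrightarrow> t * measure \<mu> (ball x (9 * s)) < nu (ball x (3 * s))" for x s
  have nu_le: "nu S \<le> sum a I" for S unfolding nu_def using I a by (intro sum_mono2) auto
  \<comment> \<open>By \<open>small\<close>, large balls have \<open>t\<close> times their measure
    above the total mass, so stopping comes to an end.\<close>
  have "\<exists>j0. \<forall>j\<ge>j0. \<not> stop (z k) (9 ^ j * \<epsilon>)" for k
  proof -
    have "(SUP j. emeasure \<mu> (ball (z k) (9 ^ j * \<epsilon>))) = emeasure \<mu> (\<Union>j. ball (z k) (9 ^ j * \<epsilon>))"
      by (intro SUP_emeasure_incseq incseq_SucI subset_ball) (use e in auto)
    also have "(\<Union>j. ball (z k) (9 ^ j * \<epsilon>)) = UNIV"
    proof (rule UNIV_eq_I[symmetric])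
      fix x
      obtain j where "dist (z k) x / \<epsilon> < 9 ^ j" using real_arch_pow[of 9 "dist (z k) x / \<epsilon>"] by auto
      then show "x \<in> (\<Union>j. ball (z k) (9 ^ j * \<epsilon>))" using e by (auto simp: field_simps)
    qed
    finally have "ennreal (sum a I) < (SUP j. ennreal t * emeasure \<mu> (ball (z k) (9 ^ j * \<epsilon>)))"
      using small by (simp flip: SUP_mult_left_ennreal)
    then obtain j0 where j0: "ennreal (sum a I) < ennreal t * emeasure \<mu> (ball (z k) (9 ^ j0 * \<epsilon>))"
      by (auto simp: less_SUP_iff)
    have "\<not> stop (z k) (9 ^ j * \<epsilon>)" if "j0 \<le> j" for j
    proof -
      have "sum a I \<le> t * measure \<mu> (ball (z k) (9 ^ j0 * \<epsilon>))"
        using j0 t a by (simp add: emeasure_ball_eq ennreal_less_iff sum_nonneg flip: ennreal_mult)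
      also have "\<dots> \<le> t * measure \<mu> (ball (z k) (9 * (9 ^ j * \<epsilon>)))"
      proof (intro mult_left_mono measure_ball_mono subset_ball)
        have "(9::real) ^ j0 \<le> 9 ^ Suc j" using that by (intro power_increasing) auto
        then show "9 ^ j0 * \<epsilon> \<le> 9 * (9 ^ j * \<epsilon>)" using e by simp
      qed (use t in auto)
      finally show ?thesis using nu_le[of "ball (z k) (3 * (9 ^ j * \<epsilon>))"] by (simp add: stop_def)
    qed
    then show ?thesis by blast
  qed
  \<comment> \<open>The largest stopping index, or 0 if no scale stops. No later scale stops, in
    particular not \<open>R k\<close>, which is \<open>r k\<close> times a positive power of
    9.\<close>
  then have "\<exists>j. (\<forall>i>j. \<not> stop (z k) (9 ^ i * \<epsilon>)) \<and> (j = 0 \<or> stop (z k) (9 ^ j * \<epsilon>))" for k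
  proof -
    obtain j0 where j0: "\<forall>j\<ge>j0. \<not> stop (z k) (9 ^ j * \<epsilon>)"
      using \<open>\<And>k. \<exists>j0. \<forall>j\<ge>j0. \<not> stop (z k) (9 ^ j * \<epsilon>)\<close> by blast
    define M where "M = insert 0 {j. stop (z k) (9 ^ j * \<epsilon>)}"
    have "M \<subseteq> insert 0 {..<j0}" using j0 by (auto simp: M_def) (meson leI)
    then have M: "finite M" "M \<noteq> {}" by (auto simp: M_def intro: finite_subset)
    show ?thesis
      using Max_in[OF M] Max_ge[OF M(1)] by (intro exI[of _ "Max M"]) (auto simp: M_def dest: leD)
  qed
  then obtain j where j: "\<And>k i. j k < i \<Longrightarrow> \<not> stop (z k) (9 ^ i * \<epsilon>)"
      "\<And>k. j k = 0 \<or> stop (z k) (9 ^ j k * \<epsilon>)" by metis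
  define r where "r k = 9 ^ j k * \<epsilon>" for k
  define R where "R k = doubling_radius \<mu> Clam N0 9 (z k) (r k)" for k
  have r: "\<epsilon> \<le> r k" "0 < r k" for k using e by (auto simp: r_def)
  have R: "r k \<le> R k" "doubling_ball \<mu> 9 (beta 9) (z k) (R k)" "\<not> stop (z k) (R k)" for k
  proof -
    obtain J where J: "1 \<le> J" "R k = 9 ^ J * r k" "doubling_ball \<mu> 9 (beta 9) (z k) (9 ^ J * r k)"
      unfolding R_def by (rule doubling_radius_props[of 9 "r k" "z k"]) (use r in auto)
    show "r k \<le> R k" using r[of k] by (simp add: J(2))
    show "doubling_ball \<mu> 9 (beta 9) (z k) (R k)" using J by simp
    have "R k = 9 ^ (J + j k) * \<epsilon>" by (simp add: J(2) r_def power_add)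
    then show "\<not> stop (z k) (R k)" using j(1)[of k "J + j k"] J(1) by simp
  qed
  have Rpos: "0 < R k" for k using R(1)[of k] r(2)[of k] by linarith
  have b0: "0 < beta 9" by (rule beta_pos) simp
  have doub: "measure \<mu> (ball (z k) (9 * R k)) \<le> beta 9 * measure \<mu> (ball (z k) (R k))" for k
    using R(2)[of k] b0 by (simp add: doubling_ball_def emeasure_ball_eq flip: ennreal_mult)
  have mpos: "0 < measure \<mu> (ball (z k) (R k))" if "k \<in> I" for k
  proof -
    have "ball (z k) \<epsilon> \<subseteq> ball (z k) (R k)" using r(1)[of k] R(1)[of k] by (intro subset_ball) linarith
    then have "0 < emeasure \<mu> (ball (z k) (R k))"
      using pos[OF that] emeasure_mono[of "ball (z k) \<epsilon>" "ball (z k) (R k)" \<mu>] by auto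
    then show ?thesis by (simp add: emeasure_ball_eq)
  qed
  have dens: "sum a {i\<in>I. z i \<in> ball (z k) (3 * R k)} \<le> t * beta 9 * measure \<mu> (ball (z k) (R k))" for k
  proof -
    have "nu (ball (z k) (3 * R k)) \<le> t * measure \<mu> (ball (z k) (9 * R k))"
      using R(3)[of k] by (simp add: stop_def)
    also have "\<dots> \<le> t * (beta 9 * measure \<mu> (ball (z k) (R k)))"
      using doub t by (intro mult_left_mono) auto
    finally show ?thesis by (simp add: nu_def mult.assoc)
  qed
  obtain w :: "'i \<Rightarrow> 'a \<Rightarrow> real" where w:
    "\<And>k. k \<in> I \<Longrightarrow> w k \<in> borel_measurable \<mu>" "\<And>k y. k \<in> I \<Longrightarrow> 0 \<le> w k y"
    "\<And>k y. k \<in> I \<Longrightarrow> y \<notin> ball (z k) (R k) \<Longrightarrow> w k y = 0"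
    "\<And>k. k \<in> I \<Longrightarrow> (\<integral>\<^sup>+y. ennreal (w k y) \<partial>\<mu>) = 1"
    "\<And>k y. k \<in> I \<Longrightarrow> w k y \<le> 2 / measure \<mu> (ball (z k) (R k))"
    "\<And>y. (\<Sum>k\<in>I. a k * w k y) \<le> 4 * beta 9 * t"
    by (rule spread_masses[OF I a t b0 Rpos mpos dens]) (assumption | blast)+
  define Is where "Is = {k\<in>I. stop (z k) (r k)}"
  define E where "E = (\<Union>k\<in>Is. ball (z k) (r k))"
  have fin: "finite Is" using I by (simp add: Is_def)
  have E: "E \<in> sets \<mu>" unfolding E_def using fin by (intro sets.finite_UN) auto
  \<comment> \<open>The selected balls of radius \<open>3 * r i\<close> are disjoint, so the masses
    in them sum to at most \<open>sum a I\<close>; their triples have the radius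
    \<open>9 * r i\<close> of the stopping condition and cover \<open>E\<close>.\<close>
  obtain S where S: "S \<subseteq> Is" "disjoint_family_on (\<lambda>i. ball (z i) (3 * r i)) S"
    "(\<Union>i\<in>Is. ball (z i) (3 * r i)) \<subseteq> (\<Union>i\<in>S. ball (z i) (3 * (3 * r i)))"
    using finite_Vitali[OF fin, of "\<lambda>i. 3 * r i" z] r by auto
  have fS: "finite S" using S fin by (auto intro: finite_subset)
  have "ball (z k) (r k) \<subseteq> ball (z k) (3 * r k)" for k
    using r(2)[of k] by (intro subset_ball) linarith
  then have "E \<subseteq> (\<Union>i\<in>Is. ball (z i) (3 * r i))" unfolding E_def by (rule UN_mono[OF order_refl])
  then have "E \<subseteq> (\<Union>i\<in>S. ball (z i) (9 * r i))" using S(3) by (simp add: mult.assoc)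
  then have "emeasure \<mu> E \<le> emeasure \<mu> (\<Union>i\<in>S. ball (z i) (9 * r i))"
    using fS by (intro emeasure_mono sets.finite_UN) auto
  also have "\<dots> \<le> (\<Sum>i\<in>S. emeasure \<mu> (ball (z i) (9 * r i)))"
    using fS by (intro emeasure_subadditive_finite) auto
  finally have "ennreal t * emeasure \<mu> E \<le> ennreal t * (\<Sum>i\<in>S. emeasure \<mu> (ball (z i) (9 * r i)))"
    by (rule mult_left_mono) simp
  also have "\<dots> = ennreal (\<Sum>i\<in>S. t * measure \<mu> (ball (z i) (9 * r i)))"
    using t by (simp add: emeasure_ball_eq sum_distrib_left ennreal_mult[symmetric] sum_nonneg)
  also have "\<dots> \<le> ennreal (\<Sum>i\<in>S. nu (ball (z i) (3 * r i)))"
    using S(1) by (intro ennreal_leI sum_mono) (auto simp: Is_def stop_def)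
  also have "(\<Sum>i\<in>S. nu (ball (z i) (3 * r i))) = sum a (\<Union>i\<in>S. {k\<in>I. z k \<in> ball (z i) (3 * r i)})"
    unfolding nu_def
  proof (rule sum.UNION_disjoint[symmetric])
    show "\<forall>i\<in>S. \<forall>j\<in>S. i \<noteq> j \<longrightarrow>
        {k\<in>I. z k \<in> ball (z i) (3 * r i)} \<inter> {k\<in>I. z k \<in> ball (z j) (3 * r j)} = {}"
      using S(2) unfolding disjoint_family_on_def by blast
  qed (use fS I in auto)
  also have "ennreal \<dots> \<le> ennreal (sum a I)"
    using I a by (intro ennreal_leI sum_mono2) auto
  finally have muE: "ennreal t * emeasure \<mu> E \<le> ennreal (sum a I)" .
  show ?thesis
  proof (rule that[OF E muE, of r R w])
    fix k assume k: "k \<in> I"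
    \<comment> \<open>If \<open>j k = 0\<close> the radius is \<open>\<epsilon>\<close>; otherwise
      the ball stops and is one of those forming \<open>E\<close>.\<close>
    show "ball (z k) (r k) \<subseteq> E \<union> ball (z k) \<epsilon>"
      using j(2)[of k] k by (auto simp: E_def Is_def r_def)
    show "(\<integral>\<^sup>+y\<in>ball (z k) (2 * R k) - ball (z k) (r k).
        ennreal (1 / lam (z k) (dist (z k) y)) \<partial>\<mu>) \<le> ennreal (doubling_delta_const 9)"
      unfolding R_def by (rule doubling_delta) (use r in auto)
    fix y
    have "measure \<mu> (ball (z k) (2 * R k)) \<le> measure \<mu> (ball (z k) (9 * R k))"
      using Rpos[of k] by (intro measure_ball_mono subset_ball) auto
    then have "w k y * measure \<mu> (ball (z k) (2 * R k))
      \<le> 2 / measure \<mu> (ball (z k) (R k)) * (beta 9 * measure \<mu> (ball (z k) (R k)))"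
      using w(2,5)[OF k, of y] doub[of k] mpos[OF k] by (intro mult_mono) auto
    then show "w k y * measure \<mu> (ball (z k) (2 * R k)) \<le> 2 * beta 9"
      using mpos[OF k] by simp
  qed (use r R w in auto)
qed

end

section \<open>Operators with vector-valued kernels\<close>

lemma norm_integral_le_nn_integral:
  fixes f :: "'a \<Rightarrow> 'b::{banach, second_countable_topology}"
  shows "ennreal (norm (\<integral>x. f x \<partial>M)) \<le> (\<integral>\<^sup>+x. ennreal (norm (f x)) \<partial>M)"
  by (cases "integrable M f") (auto simp: integral_norm_bound_ennreal not_integrable_integral_eq)

abbreviation fnorm :: "'c measure \<Rightarrow> ('a \<Rightarrow> 'c \<Rightarrow> complex) \<Rightarrow> 'a \<Rightarrow> ennreal" where
  "fnorm \<tau> F x \<equiv> L2 \<tau> (\<lambda>c. ennreal (norm (F x c)))"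

lemma fnorm_add_le:
  assumes "F x \<in> borel_measurable \<tau>" "G x \<in> borel_measurable \<tau>"
  shows "fnorm \<tau> (\<lambda>x c. F x c + G x c) x \<le> fnorm \<tau> F x + fnorm \<tau> G x"
proof -
  have [measurable]: "F x \<in> borel_measurable \<tau>" "G x \<in> borel_measurable \<tau>" by fact+
  have "fnorm \<tau> (\<lambda>x c. F x c + G x c) x \<le> L2 \<tau> (\<lambda>c. ennreal (norm (F x c)) + ennreal (norm (G x c)))"
    by (intro L2_mono) (simp add: norm_triangle_ineq flip: ennreal_plus)
  also have "\<dots> \<le> fnorm \<tau> F x + fnorm \<tau> G x" by (intro L2_add) auto
  finally show ?thesis .
qed

lemma fnorm_le_bound:
  assumes "finite_measure \<tau>" "\<And>c. norm (F x c) \<le> m"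
  shows "fnorm \<tau> F x \<le> ennreal (m * sqrt (measure \<tau> (space \<tau>)))"
proof -
  interpret finite_measure \<tau> by fact
  have m: "0 \<le> m" using order_trans[OF norm_ge_zero assms(2)] .
  have "(\<integral>\<^sup>+c. (ennreal (norm (F x c)))\<^sup>2 \<partial>\<tau>) \<le> (\<integral>\<^sup>+c. ennreal (m\<^sup>2) \<partial>\<tau>)"
    using assms(2) by (intro nn_integral_mono) (auto simp: ennreal_power intro!: ennreal_leI power_mono)
  also have "\<dots> = ennreal (m\<^sup>2 * measure \<tau> (space \<tau>))"
    by (simp add: emeasure_eq_measure ennreal_mult)
  also have "\<dots> = (ennreal (m * sqrt (measure \<tau> (space \<tau>))))\<^sup>2"
    using m by (simp add: ennreal_power power_mult_distrib)
  finally show ?thesis by (simp add: L2_le_iff)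
qed

context nonhomogeneous_space
begin

text \<open>
  Bounded measurable functions with bounded support are a class on which every integral below
  converges absolutely, and truncations of arbitrary functions belong to it.
\<close>

definition test_function :: "'c measure \<Rightarrow> ('a \<Rightarrow> 'c \<Rightarrow> complex) \<Rightarrow> bool" where
  "test_function \<tau> F \<longleftrightarrow> (\<lambda>v. F (fst v) (snd v)) \<in> borel_measurable (\<mu> \<Otimes>\<^sub>M \<tau>) \<and>
     (\<exists>m. \<forall>x c. norm (F x c) \<le> m) \<and> (\<exists>z r. \<forall>x. x \<notin> ball z r \<longrightarrow> (\<forall>c. F x c = 0))"

lemma test_functionI:
  assumes "(\<lambda>v. F (fst v) (snd v)) \<in> borel_measurable (\<mu> \<Otimes>\<^sub>M \<tau>)"
    "\<And>x c. norm (F x c) \<le> m" "\<And>x c. x \<notin> ball z r \<Longrightarrow> F x c = 0"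
  shows "test_function \<tau> F"
  using assms unfolding test_function_def by blast

lemma test_functionD_measurable:
  assumes "test_function \<tau> F" "f \<in> M \<rightarrow>\<^sub>M \<mu>" "g \<in> M \<rightarrow>\<^sub>M \<tau>"
  shows "(\<lambda>w. F (f w) (g w)) \<in> borel_measurable M"
proof -
  have "(\<lambda>v. F (fst v) (snd v)) \<in> borel_measurable (\<mu> \<Otimes>\<^sub>M \<tau>)" using assms(1) by (simp add: test_function_def)
  from measurable_compose[OF measurable_Pair[OF assms(2,3)] this] show ?thesis by simp
qed

lemma test_function_sect: "test_function \<tau> F \<Longrightarrow> F x \<in> borel_measurable \<tau>"
  using test_functionD_measurable[of \<tau> F "\<lambda>_. x" \<tau> "\<lambda>c. c"] by simp

lemma test_function_bound:
  assumes "test_function \<tau> F" obtains m where "0 \<le> m" "\<And>x c. norm (F x c) \<le> m"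
  using assms norm_ge_zero order_trans unfolding test_function_def by blast

lemma test_function_support:
  assumes "test_function \<tau> F" obtains z r where "0 < r" "\<And>x c. x \<notin> ball z r \<Longrightarrow> F x c = 0"
proof -
  obtain z r where zr: "\<And>x. x \<notin> ball z r \<Longrightarrow> \<forall>c. F x c = 0" using assms unfolding test_function_def by blast
  have "ball z r \<subseteq> ball z (max r 1)" by (intro subset_ball) auto
  with zr show ?thesis by (intro that[of "max r 1" z]) auto
qed

lemma fnorm_measurable:
  assumes "test_function \<tau> F" "finite_measure \<tau>"
  shows "fnorm \<tau> F \<in> borel_measurable \<mu>"
proof -
  interpret finite_measure \<tau> by fact
  have [measurable]: "(\<lambda>v. F (fst v) (snd v)) \<in> borel_measurable (\<mu> \<Otimes>\<^sub>M \<tau>)" using assms(1) by (simp add: test_function_def)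
  show ?thesis
    by (rule L2_measurable[OF sigma_finite_measure_axioms]) (simp add: split_beta)
qed

lemma test_function_mult:
  assumes F: "test_function \<tau> F" and g: "g \<in> borel_measurable \<mu>" "\<And>x. norm (g x) \<le> b"
  shows "test_function \<tau> (\<lambda>x c. g x * F x c)"
proof -
  obtain m where m: "0 \<le> m" "\<And>x c. norm (F x c) \<le> m" by (rule test_function_bound[OF F]) (rule that, auto)
  have [measurable]: "(\<lambda>v. F (fst v) (snd v)) \<in> borel_measurable (\<mu> \<Otimes>\<^sub>M \<tau>)" using F by (simp add: test_function_def)
  have [measurable]: "g \<in> borel_measurable \<mu>" by fact
  obtain z r where z: "0 < r" "\<And>x c. x \<notin> ball z r \<Longrightarrow> F x c = 0" by (rule test_function_support[OF F]) (rule that, auto)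
  have "norm (g x * F x c) \<le> b * m" for x c
    unfolding norm_mult using g(2)[of x] m(2)[of x c] order_trans[OF norm_ge_zero g(2)[of x]]
    by (intro mult_mono) auto
  then show ?thesis using z(2) by (intro test_functionI[where m="b * m" and z=z and r=r]) auto
qed

lemma test_function_add:
  assumes F: "test_function \<tau> F" and G: "test_function \<tau> G"
  shows "test_function \<tau> (\<lambda>x c. F x c + G x c)"
proof -
  obtain m where m: "0 \<le> m" "\<And>x c. norm (F x c) \<le> m" by (rule test_function_bound[OF F]) (rule that, auto)
  obtain m' where m': "0 \<le> m'" "\<And>x c. norm (G x c) \<le> m'" by (rule test_function_bound[OF G]) (rule that, auto)
  obtain z r where z: "0 < r" "\<And>x c. x \<notin> ball z r \<Longrightarrow> F x c = 0" by (rule test_function_support[OF F]) (rule that, auto)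
  obtain z' r' where z': "0 < r'" "\<And>x c. x \<notin> ball z' r' \<Longrightarrow> G x c = 0" by (rule test_function_support[OF G]) (rule that, auto)
  have [measurable]: "(\<lambda>v. F (fst v) (snd v)) \<in> borel_measurable (\<mu> \<Otimes>\<^sub>M \<tau>)"
    "(\<lambda>v. G (fst v) (snd v)) \<in> borel_measurable (\<mu> \<Otimes>\<^sub>M \<tau>)" using F G by (simp_all add: test_function_def)
  have "norm (F x c + G x c) \<le> m + m'" for x c
    using norm_triangle_ineq[of "F x c" "G x c"] m(2)[of x c] m'(2)[of x c] by linarith
  moreover have "F x c + G x c = 0" if "x \<notin> ball z (r + r' + dist z z')" for x c
  proof -
    have "x \<notin> ball z r" using that z'(1) zero_le_dist[of z z'] unfolding mem_ball by linarith
    moreover have "x \<notin> ball z' r'" using that z(1) dist_triangle[of z x z'] unfolding mem_ball by linarith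
    ultimately show ?thesis using z(2) z'(2) by simp
  qed
  ultimately show ?thesis
    by (intro test_functionI[where m="m + m'" and z=z and r="r + r' + dist z z'"]) auto
qed

lemma test_function_0: "test_function \<tau> (\<lambda>x c. 0)"
  by (intro test_functionI[where m=0]) auto

lemma test_function_sum:
  "finite I \<Longrightarrow> (\<And>i. i \<in> I \<Longrightarrow> test_function \<tau> (F i)) \<Longrightarrow> test_function \<tau> (\<lambda>x c. \<Sum>i\<in>I. F i x c)"
proof (induction I rule: finite_induct)
  case (insert i I)
  then show ?case using test_function_add[of \<tau> "F i" "\<lambda>x c. \<Sum>i\<in>I. F i x c"] by simp
qed (simp add: test_function_0)

lemma test_function_uminus: "test_function \<tau> F \<Longrightarrow> test_function \<tau> (\<lambda>x c. - F x c)"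
  using test_function_mult[of \<tau> F "\<lambda>_. - 1" 1] by simp

lemma test_function_diff: "test_function \<tau> F \<Longrightarrow> test_function \<tau> G \<Longrightarrow> test_function \<tau> (\<lambda>x c. F x c - G x c)"
  using test_function_add[OF _ test_function_uminus, of \<tau> F G] by simp

lemma test_function_indicator: "test_function \<tau> F \<Longrightarrow> S \<in> sets \<mu> \<Longrightarrow> test_function \<tau> (\<lambda>x c. indicator S x * F x c)"
  by (rule test_function_mult[where b=1]) (auto simp: indicator_def)

lemma test_function_tensor:
  assumes [measurable]: "\<alpha> \<in> borel_measurable \<tau>" "w \<in> borel_measurable \<mu>"
    and "\<And>c. norm (\<alpha> c) \<le> m" "\<And>x. norm (w x) \<le> b" "\<And>x. x \<notin> ball z r \<Longrightarrow> w x = (0::complex)"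
  shows "test_function \<tau> (\<lambda>x c. \<alpha> c * w x)"
proof -
  have "0 \<le> m" using order_trans[OF norm_ge_zero assms(3)] .
  then have "norm (\<alpha> c * w x) \<le> m * b" for x c
    unfolding norm_mult using assms(3)[of c] assms(4)[of x] by (intro mult_mono) auto
  then show ?thesis using assms(5) by (intro test_functionI[where m="m * b" and z=z and r=r]) auto
qed

lemma nn_integral_fnorm_finite:
  assumes F: "test_function \<tau> F" and "finite_measure \<tau>" and "0 < p"
  shows "(\<integral>\<^sup>+x. ennreal_powr (fnorm \<tau> F x) p \<partial>\<mu>) < top"
proof -
  obtain m where m: "0 \<le> m" "\<And>x c. norm (F x c) \<le> m" by (rule test_function_bound[OF F]) (rule that, auto)
  obtain z r where z: "\<And>x c. x \<notin> ball z r \<Longrightarrow> F x c = 0" by (rule test_function_support[OF F]) (rule that, auto)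
  let ?m = "ennreal (m * sqrt (measure \<tau> (space \<tau>)))"
  have "(\<integral>\<^sup>+x. ennreal_powr (fnorm \<tau> F x) p \<partial>\<mu>) \<le> (\<integral>\<^sup>+x. ennreal_powr ?m p * indicator (ball z r) x \<partial>\<mu>)"
  proof (intro nn_integral_mono)
    fix x
    show "ennreal_powr (fnorm \<tau> F x) p \<le> ennreal_powr ?m p * indicator (ball z r) x"
      using fnorm_le_bound[OF assms(2), of F x m] m z assms(3)
      by (cases "x \<in> ball z r") (auto intro!: ennreal_powr_mono)
  qed
  also have "\<dots> = ennreal_powr ?m p * emeasure \<mu> (ball z r)" by (simp add: nn_integral_cmult)
  also have "\<dots> < top" by (simp add: ennreal_mult_less_top)
  finally show ?thesis .
qed

text \<open>Cauchy-Schwarz in the variable of \<open>\<tau>\<close>, then Minkowski to take the norm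
  over \<open>\<theta>\<close> inside the integral over \<open>\<mu>\<close>. The kernel
  \<open>G\<close> is arbitrary so that the estimate also applies to the difference of two values of
  \<open>H\<close>.\<close>

lemma Minkowski_HS:
  assumes \<tau>: "finite_measure \<tau>" and \<theta>: "finite_measure \<theta>"
    and G: "(\<lambda>(d, v). G d (fst v) (snd v)) \<in> borel_measurable (\<theta> \<Otimes>\<^sub>M (\<mu> \<Otimes>\<^sub>M \<tau>))"
    and F: "(\<lambda>v. F (fst v) (snd v)) \<in> borel_measurable (\<mu> \<Otimes>\<^sub>M \<tau>)"
  shows "L2 \<theta> (\<lambda>d. ennreal (norm (\<integral>v. G d (fst v) (snd v) * F (fst v) (snd v) \<partial>(\<mu> \<Otimes>\<^sub>M \<tau>) :: complex)))
    \<le> (\<integral>\<^sup>+y. L2 \<theta> (\<lambda>d. fnorm \<tau> (G d) y) * fnorm \<tau> F y \<partial>\<mu>)"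
proof -
  interpret T: finite_measure \<tau> by fact
  interpret D: finite_measure \<theta> by fact
  interpret P: pair_sigma_finite \<mu> \<tau> ..
  note [measurable] = F
  have Gm': "(\<lambda>w. G (fst (fst w)) (snd (fst w)) (snd w)) \<in> borel_measurable ((\<theta> \<Otimes>\<^sub>M \<mu>) \<Otimes>\<^sub>M \<tau>)"
    by (rule measurable_compose[OF _ G, of "\<lambda>w. (fst (fst w), snd (fst w), snd w)", simplified]) measurable
  have 1[measurable]: "(\<lambda>(d, y). fnorm \<tau> (G d) y) \<in> borel_measurable (\<theta> \<Otimes>\<^sub>M \<mu>)"
    unfolding split_beta
    by (rule L2_measurable[OF T.sigma_finite_measure_axioms]) (use Gm' in \<open>simp add: split_beta\<close>)
  have 2[measurable]: "fnorm \<tau> F \<in> borel_measurable \<mu>"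
    by (rule L2_measurable[OF T.sigma_finite_measure_axioms]) (simp add: split_beta)
  have "L2 \<theta> (\<lambda>d. ennreal (norm (\<integral>v. G d (fst v) (snd v) * F (fst v) (snd v) \<partial>(\<mu> \<Otimes>\<^sub>M \<tau>))))
      \<le> L2 \<theta> (\<lambda>d. \<integral>\<^sup>+y. fnorm \<tau> (G d) y * fnorm \<tau> F y \<partial>\<mu>)"
  proof (rule L2_mono)
    fix d assume d: "d \<in> space \<theta>"
    have Gd[measurable]: "(\<lambda>v. G d (fst v) (snd v)) \<in> borel_measurable (\<mu> \<Otimes>\<^sub>M \<tau>)"
      by (rule measurable_compose[OF _ G, of "\<lambda>v. (d, v)", simplified]) (use d in measurable)
    have "ennreal (norm (\<integral>v. G d (fst v) (snd v) * F (fst v) (snd v) \<partial>(\<mu> \<Otimes>\<^sub>M \<tau>)))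
        \<le> (\<integral>\<^sup>+v. ennreal (norm (G d (fst v) (snd v) * F (fst v) (snd v))) \<partial>(\<mu> \<Otimes>\<^sub>M \<tau>))"
      by (rule norm_integral_le_nn_integral)
    also have "\<dots> = (\<integral>\<^sup>+y. \<integral>\<^sup>+c. ennreal (norm (G d y c)) * ennreal (norm (F y c)) \<partial>\<tau> \<partial>\<mu>)"
      by (subst T.nn_integral_fst[symmetric]) (auto simp: norm_mult ennreal_mult)
    also have "\<dots> \<le> (\<integral>\<^sup>+y. fnorm \<tau> (G d) y * fnorm \<tau> F y \<partial>\<mu>)"
    proof (intro nn_integral_mono L2_Cauchy_Schwarz)
      fix y assume y: "y \<in> space \<mu>"
      have [measurable]: "G d y \<in> borel_measurable \<tau>"
        using measurable_compose[OF measurable_Pair1'[OF y] Gd] by simp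
      have [measurable]: "F y \<in> borel_measurable \<tau>"
        using measurable_compose[OF measurable_Pair1'[OF y] F] by simp
      show "(\<lambda>c. ennreal (norm (G d y c))) \<in> borel_measurable \<tau>" by measurable
      show "(\<lambda>c. ennreal (norm (F y c))) \<in> borel_measurable \<tau>" by measurable
    qed
    finally show "ennreal (norm (\<integral>v. G d (fst v) (snd v) * F (fst v) (snd v) \<partial>(\<mu> \<Otimes>\<^sub>M \<tau>)))
        \<le> (\<integral>\<^sup>+y. fnorm \<tau> (G d) y * fnorm \<tau> F y \<partial>\<mu>)" .
  qed
  also have "\<dots> \<le> (\<integral>\<^sup>+y. L2 \<theta> (\<lambda>d. fnorm \<tau> (G d) y * fnorm \<tau> F y) \<partial>\<mu>)"
    by (rule L2_Minkowski[OF D.sigma_finite_measure_axioms sigma_finite]) measurable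
  also have "\<dots> = (\<integral>\<^sup>+y. L2 \<theta> (\<lambda>d. fnorm \<tau> (G d) y) * fnorm \<tau> F y \<partial>\<mu>)"
    by (intro nn_integral_cong L2_multc) measurable
  finally show ?thesis .
qed

end

text \<open>
  The operator maps functions with values in \<open>L\<^sup>2(\<tau>)\<close> to functions with values in \<open>L\<^sup>2(\<theta>)\<close>, so that its
  transpose is of the same form.  The bounds in the hypotheses are qualitative and never enter the
  constants.
\<close>

locale kernel_op = nonhomogeneous_space \<mu> lam Clam N0
  for \<mu> :: "'a::metric_space measure" and lam Clam N0 +
  fixes \<tau> :: "'c measure" and \<theta> :: "'d measure" and H :: "'a \<Rightarrow> 'd \<Rightarrow> 'a \<Rightarrow> 'c \<Rightarrow> complex"
  assumes fin_\<tau>: "finite_measure \<tau>" and fin_\<theta>: "finite_measure \<theta>"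
    and space_\<tau> [simp]: "space \<tau> = UNIV" and space_\<theta> [simp]: "space \<theta> = UNIV"
    and H_measurable: "(\<lambda>w. H (fst (fst w)) (snd (fst w)) (fst (snd w)) (snd (snd w)))
      \<in> borel_measurable ((\<mu> \<Otimes>\<^sub>M \<theta>) \<Otimes>\<^sub>M (\<mu> \<Otimes>\<^sub>M \<tau>))"
    and H_bounded: "\<exists>M. \<forall>x d. (\<integral>\<^sup>+v. ennreal (norm (H x d (fst v) (snd v))) \<partial>(\<mu> \<Otimes>\<^sub>M \<tau>)) \<le> ennreal M"
    and H_bounded': "\<exists>M. \<forall>y c. (\<integral>\<^sup>+w. ennreal (norm (H (fst w) (snd w) y c)) \<partial>(\<mu> \<Otimes>\<^sub>M \<theta>)) \<le> ennreal M"
    and H_fin: "\<And>x d z. (\<integral>\<^sup>+c. ennreal (norm (H x d z c)) \<partial>\<tau>) < top"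
    and H_fin': "\<And>x z c. (\<integral>\<^sup>+d. ennreal (norm (H x d z c)) \<partial>\<theta>) < top"
begin

sublocale T: finite_measure \<tau> by (rule fin_\<tau>)
sublocale D: finite_measure \<theta> by (rule fin_\<theta>)
sublocale MT: pair_sigma_finite \<mu> \<tau> ..
sublocale MD: pair_sigma_finite \<mu> \<theta> ..

lemma H_meas [measurable (raw)]:
  assumes "f \<in> M \<rightarrow>\<^sub>M \<mu>" "g \<in> M \<rightarrow>\<^sub>M \<theta>" "h \<in> M \<rightarrow>\<^sub>M \<mu>" "k \<in> M \<rightarrow>\<^sub>M \<tau>"
  shows "(\<lambda>w. H (f w) (g w) (h w) (k w)) \<in> borel_measurable M"
  using measurable_compose[OF measurable_Pair[OF measurable_Pair[OF assms(1,2)] measurable_Pair[OF assms(3,4)]]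
      H_measurable] by simp

text \<open>The Hilbert--Schmidt norm of the kernel at \<open>(x, y)\<close>; it does not change under transposition.\<close>

definition hs :: "'a \<Rightarrow> 'a \<Rightarrow> ennreal" where
  "hs x y = L2 \<theta> (\<lambda>d. L2 \<tau> (\<lambda>c. ennreal (norm (H x d y c))))"

definition appl :: "('a \<Rightarrow> 'c \<Rightarrow> complex) \<Rightarrow> 'a \<Rightarrow> 'd \<Rightarrow> complex" where
  "appl F x d = (\<integral>v. H x d (fst v) (snd v) * F (fst v) (snd v) \<partial>(\<mu> \<Otimes>\<^sub>M \<tau>))"

definition strong :: "real \<Rightarrow> real \<Rightarrow> bool" where
  "strong p B \<longleftrightarrow> (\<forall>F. test_function \<tau> F \<longrightarrow>
     (\<integral>\<^sup>+x. ennreal_powr (fnorm \<theta> (appl F) x) p \<partial>\<mu>) \<le> ennreal B * (\<integral>\<^sup>+x. ennreal_powr (fnorm \<tau> F x) p \<partial>\<mu>))"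

definition weak :: "real \<Rightarrow> bool" where
  "weak W \<longleftrightarrow> (\<forall>F s. test_function \<tau> F \<longrightarrow> 0 < s \<longrightarrow>
     ennreal s * emeasure \<mu> {x. ennreal s < fnorm \<theta> (appl F) x} \<le> ennreal W * (\<integral>\<^sup>+x. fnorm \<tau> F x \<partial>\<mu>))"

lemma nn_integral_appl_le:
  assumes "\<And>x c. norm (F x c) \<le> m" "0 \<le> m"
    and M: "(\<integral>\<^sup>+v. ennreal (norm (H x d (fst v) (snd v))) \<partial>(\<mu> \<Otimes>\<^sub>M \<tau>)) \<le> ennreal M"
  shows "(\<integral>\<^sup>+v. ennreal (norm (H x d (fst v) (snd v) * F (fst v) (snd v))) \<partial>(\<mu> \<Otimes>\<^sub>M \<tau>)) \<le> ennreal m * ennreal M"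
proof -
  have "(\<integral>\<^sup>+v. ennreal (norm (H x d (fst v) (snd v) * F (fst v) (snd v))) \<partial>(\<mu> \<Otimes>\<^sub>M \<tau>))
      \<le> (\<integral>\<^sup>+v. ennreal m * ennreal (norm (H x d (fst v) (snd v))) \<partial>(\<mu> \<Otimes>\<^sub>M \<tau>))"
    using assms(1,2) by (intro nn_integral_mono)
      (simp add: norm_mult mult.commute[of m] mult_left_mono flip: ennreal_mult)
  also have "\<dots> \<le> ennreal m * ennreal M"
    using M by (subst nn_integral_cmult) (auto intro!: mult_left_mono)
  finally show ?thesis .
qed

lemma integrable_appl:
  assumes "test_function \<tau> F"
  shows "integrable (\<mu> \<Otimes>\<^sub>M \<tau>) (\<lambda>v. H x d (fst v) (snd v) * F (fst v) (snd v))"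
proof (rule integrableI_bounded)
  have [measurable]: "(\<lambda>v. F (fst v) (snd v)) \<in> borel_measurable (\<mu> \<Otimes>\<^sub>M \<tau>)" using assms by (simp add: test_function_def)
  show "(\<lambda>v. H x d (fst v) (snd v) * F (fst v) (snd v)) \<in> borel_measurable (\<mu> \<Otimes>\<^sub>M \<tau>)" by measurable
  obtain m where m: "0 \<le> m" "\<And>x c. norm (F x c) \<le> m" by (rule test_function_bound[OF assms]) (rule that, auto)
  obtain M where M: "\<forall>x d. (\<integral>\<^sup>+v. ennreal (norm (H x d (fst v) (snd v))) \<partial>(\<mu> \<Otimes>\<^sub>M \<tau>)) \<le> ennreal M"
    using H_bounded by blast
  have "(\<integral>\<^sup>+v. ennreal (norm (H x d (fst v) (snd v) * F (fst v) (snd v))) \<partial>(\<mu> \<Otimes>\<^sub>M \<tau>)) \<le> ennreal m * ennreal M"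
    by (rule nn_integral_appl_le) (use m M in auto)
  also have "\<dots> < \<infinity>" by (simp add: ennreal_mult_less_top)
  finally show "(\<integral>\<^sup>+v. ennreal (norm (H x d (fst v) (snd v) * F (fst v) (snd v))) \<partial>(\<mu> \<Otimes>\<^sub>M \<tau>)) < \<infinity>" .
qed

lemma appl_bounded:
  assumes "test_function \<tau> F"
  shows "\<exists>m. \<forall>x d. norm (appl F x d) \<le> m"
proof -
  obtain m where m: "0 \<le> m" "\<And>x c. norm (F x c) \<le> m" by (rule test_function_bound[OF assms]) (rule that, auto)
  obtain M where M: "\<forall>x d. (\<integral>\<^sup>+v. ennreal (norm (H x d (fst v) (snd v))) \<partial>(\<mu> \<Otimes>\<^sub>M \<tau>)) \<le> ennreal M"
    using H_bounded by blast
  have "norm (appl F x d) \<le> m * max M 0" for x d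
  proof -
    have "ennreal (norm (appl F x d))
       \<le> (\<integral>\<^sup>+v. ennreal (norm (H x d (fst v) (snd v) * F (fst v) (snd v))) \<partial>(\<mu> \<Otimes>\<^sub>M \<tau>))"
      unfolding appl_def by (rule norm_integral_le_nn_integral)
    also have "\<dots> \<le> ennreal m * ennreal M"
      by (rule nn_integral_appl_le) (use m M in auto)
    also have "\<dots> \<le> ennreal (m * max M 0)"
      using m by (subst ennreal_mult) (auto intro!: mult_left_mono ennreal_leI)
    finally show ?thesis using m by (subst (asm) ennreal_le_iff) auto
  qed
  then show ?thesis by blast
qed

lemma appl_measurable:
  assumes "test_function \<tau> F"
  shows "(\<lambda>w. appl F (fst w) (snd w)) \<in> borel_measurable (\<mu> \<Otimes>\<^sub>M \<theta>)"
proof -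
  have [measurable]: "(\<lambda>v. F (fst v) (snd v)) \<in> borel_measurable (\<mu> \<Otimes>\<^sub>M \<tau>)" using assms by (simp add: test_function_def)
  show ?thesis unfolding appl_def
    by (rule sigma_finite_measure.borel_measurable_lebesgue_integral[OF MT.sigma_finite_measure_axioms])
      (simp add: split_beta, measurable)
qed

lemma appl_sect: "test_function \<tau> F \<Longrightarrow> appl F x \<in> borel_measurable \<theta>"
  using measurable_compose[OF measurable_Pair1'[of x \<mu> \<theta>] appl_measurable[of F]] by simp

lemma fnorm_appl_measurable:
  assumes "test_function \<tau> F" shows "fnorm \<theta> (appl F) \<in> borel_measurable \<mu>"
proof -
  note [measurable] = appl_measurable[OF assms]
  show ?thesis by (rule L2_measurable[OF D.sigma_finite_measure_axioms]) (simp add: split_beta)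
qed

lemma fnorm_appl_bounded:
  assumes "test_function \<tau> F" obtains m where "\<And>x. fnorm \<theta> (appl F) x \<le> ennreal m"
proof -
  obtain m where "\<forall>x d. norm (appl F x d) \<le> m" using appl_bounded[OF assms] by blast
  then show ?thesis by (intro that[of "m * sqrt (measure \<theta> (space \<theta>))"] fnorm_le_bound[OF fin_\<theta>]) auto
qed

lemma appl_add:
  "test_function \<tau> F \<Longrightarrow> test_function \<tau> G \<Longrightarrow> appl (\<lambda>x c. F x c + G x c) x d = appl F x d + appl G x d"
  unfolding appl_def using integrable_appl[of F x d] integrable_appl[of G x d]
  by (simp add: distrib_left)

lemma appl_uminus: "appl (\<lambda>x c. - F x c) x d = - appl F x d"
  unfolding appl_def by simp

lemma fnorm_appl_add:
  assumes "test_function \<tau> F" "test_function \<tau> G"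
  shows "fnorm \<theta> (appl (\<lambda>x c. F x c + G x c)) x \<le> fnorm \<theta> (appl F) x + fnorm \<theta> (appl G) x"
  using fnorm_add_le[of "appl F" x \<theta> "appl G"] appl_sect[OF assms(1)] appl_sect[OF assms(2)]
  by (simp add: appl_add[OF assms])

lemma fnorm_appl_diff:
  assumes "test_function \<tau> F" "test_function \<tau> G"
  shows "fnorm \<theta> (appl (\<lambda>x c. F x c - G x c)) x \<le> fnorm \<theta> (appl F) x + fnorm \<theta> (appl G) x"
  using fnorm_appl_add[OF assms(1) test_function_uminus[OF assms(2)], of x] by (simp add: appl_uminus)

lemma fnorm_appl_0 [simp]: "fnorm \<theta> (appl (\<lambda>x c. 0)) x = 0"
  by (simp add: appl_def)

lemma fnorm_appl_sum:
  assumes "finite I" "\<And>i. i \<in> I \<Longrightarrow> test_function \<tau> (F i)"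
  shows "fnorm \<theta> (appl (\<lambda>x c. \<Sum>i\<in>I. F i x c)) x \<le> (\<Sum>i\<in>I. fnorm \<theta> (appl (F i)) x)"
  using assms
proof (induction I rule: finite_induct)
  case (insert i I)
  have "fnorm \<theta> (appl (\<lambda>x c. F i x c + (\<Sum>i\<in>I. F i x c))) x
     \<le> fnorm \<theta> (appl (F i)) x + fnorm \<theta> (appl (\<lambda>x c. \<Sum>i\<in>I. F i x c)) x"
    using insert by (intro fnorm_appl_add test_function_sum) auto
  also have "\<dots> \<le> fnorm \<theta> (appl (F i)) x + (\<Sum>i\<in>I. fnorm \<theta> (appl (F i)) x)"
    using insert by (intro add_left_mono) auto
  finally show ?case using insert by simp
qed simp

lemma fnorm_appl_le:
  assumes "test_function \<tau> F"
  shows "fnorm \<theta> (appl F) x \<le> (\<integral>\<^sup>+y. hs x y * fnorm \<tau> F y \<partial>\<mu>)"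
  unfolding appl_def hs_def
  by (rule Minkowski_HS[OF fin_\<tau> fin_\<theta>]) (use assms in \<open>auto simp: test_function_def split_beta\<close>)

lemma hs_measurable [measurable (raw)]:
  assumes [measurable]: "f \<in> M \<rightarrow>\<^sub>M \<mu>" "g \<in> M \<rightarrow>\<^sub>M \<mu>"
  shows "(\<lambda>w. hs (f w) (g w)) \<in> borel_measurable M"
  unfolding hs_def
proof (rule L2_measurable[OF D.sigma_finite_measure_axioms])
  have "(\<lambda>u. L2 \<tau> (\<lambda>c. ennreal (norm (H (f (fst u)) (snd u) (g (fst u)) c)))) \<in> borel_measurable (M \<Otimes>\<^sub>M \<theta>)"
    by (rule L2_measurable[OF T.sigma_finite_measure_axioms]) (simp add: split_beta)
  then show "(\<lambda>(w, d). L2 \<tau> (\<lambda>c. ennreal (norm (H (f w) d (g w) c)))) \<in> borel_measurable (M \<Otimes>\<^sub>M \<theta>)"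
    by (simp add: split_beta)
qed

end

section \<open>The weak type (1,1) estimate\<close>

text \<open>
  The factor \<open>min 1 (dist x y / \<epsilon>)\<close> is what the restriction to \<open>t > \<epsilon>\<close> leaves near the diagonal: it
  makes the kernel integrable over balls of radius \<open>\<epsilon>\<close>, uniformly in \<open>\<epsilon>\<close>.
\<close>

locale cz_kernel = kernel_op \<mu> lam Clam N0 \<tau> \<theta> H
  for \<mu> :: "'a::metric_space measure" and lam Clam N0 and \<tau> :: "'c measure" and \<theta> :: "'d measure"
    and H :: "'a \<Rightarrow> 'd \<Rightarrow> 'a \<Rightarrow> 'c \<Rightarrow> complex" +
  fixes A \<epsilon> :: real
  assumes A_nonneg: "0 \<le> A" and eps_pos: "0 < \<epsilon>"
    and size: "\<And>x y. x \<noteq> y \<Longrightarrow> hs x y \<le> ennreal (A * min 1 (dist x y / \<epsilon>) / lam x (dist x y))"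
    and size_0: "\<And>x. hs x x = 0"
    and regular: "\<And>R y z. 0 < R \<Longrightarrow> dist z y < R \<Longrightarrow>
      (\<integral>\<^sup>+x\<in>- ball z (2 * R). L2 \<theta> (\<lambda>d. L2 \<tau> (\<lambda>c. ennreal (norm (H x d y c - H x d z c)))) \<partial>\<mu>) \<le> ennreal A"
    and regular': "\<And>R x z. 0 < R \<Longrightarrow> dist z x < R \<Longrightarrow>
      (\<integral>\<^sup>+y\<in>- ball z (2 * R). L2 \<tau> (\<lambda>c. L2 \<theta> (\<lambda>d. ennreal (norm (H x d y c - H z d y c)))) \<partial>\<mu>) \<le> ennreal A"
begin

text \<open>Within \<open>2 * \<epsilon>\<close> of \<open>z\<close> the extra factor
  \<open>dist x y / \<epsilon>\<close> of the truncated kernel turns \<open>near_integral\<close> on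
  a ball of radius \<open>3 * \<epsilon>\<close> into a constant, namely the 6. Farther out
  \<open>y\<close> may be replaced by \<open>z\<close>, and what remains is the integral behind
  \<open>\<delta>\<close>.\<close>

lemma hs_integral_near:
  assumes y: "dist z y < \<epsilon>" and S: "S \<subseteq> ball z (2 * \<epsilon>) \<union> (ball z s - ball z r)" and r: "0 < r"
    and dc: "(\<integral>\<^sup>+x\<in>ball z s - ball z r. ennreal (1 / lam z (dist z x)) \<partial>\<mu>) \<le> ennreal dc" and dc0: "0 \<le> dc"
  shows "(\<integral>\<^sup>+x\<in>S. hs x y \<partial>\<mu>) \<le> ennreal (A * Clam\<^sup>2 * (6 + dc))"
proof -
  let ?g1 = "\<lambda>x. ennreal (dist y x / lam y (dist y x)) * indicator (ball y (3 * \<epsilon>)) x"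
  let ?g2 = "\<lambda>x. ennreal (1 / lam z (dist z x)) * indicator (ball z s - ball z r) x"
  have [measurable]: "(\<lambda>x. dist y x) \<in> borel_measurable \<mu>" by measurable
  have "hs x y * indicator S x \<le> ennreal (A * Clam / \<epsilon>) * ?g1 x + ennreal (A * Clam\<^sup>2) * ?g2 x" for x
  proof (cases "x = y \<or> x \<notin> S")
    case True
    then show ?thesis using size_0 by (auto simp: indicator_def)
  next
    case False
    then have xy: "x \<noteq> y" "0 < dist x y" "x \<in> S" by auto
    have dyx: "dist y x = dist x y" by (rule dist_commute)
    show ?thesis
    proof (cases "dist z x < 2 * \<epsilon>")
      case True
      have "dist y x < 3 * \<epsilon>" using dist_triangle3[of y x z] y True by simp
      have "A * min 1 (dist x y / \<epsilon>) / lam x (dist x y) \<le> A * (dist x y / \<epsilon>) / (lam y (dist x y) / Clam)"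
      proof (rule frac_le)
        show "A * min 1 (dist x y / \<epsilon>) \<le> A * (dist x y / \<epsilon>)"
          using A_nonneg by (intro mult_left_mono) auto
        show "lam y (dist x y) / Clam \<le> lam x (dist x y)"
          using lam_shift[of "dist x y" y x] xy Clam_pos by (simp add: dyx field_simps)
      qed (use xy lam_pos A_nonneg Clam_pos eps_pos in auto)
      also have "\<dots> = A * Clam / \<epsilon> * (dist y x / lam y (dist y x))"
        by (simp add: dyx)
      finally have "hs x y \<le> ennreal (A * Clam / \<epsilon> * (dist y x / lam y (dist y x)))"
        using size[OF xy(1)] by (elim order_trans) (rule ennreal_leI)
      also have "\<dots> = ennreal (A * Clam / \<epsilon>) * ennreal (dist y x / lam y (dist y x))"
        using A_nonneg Clam_pos eps_pos by (subst ennreal_mult') auto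
      also have "\<dots> = ennreal (A * Clam / \<epsilon>) * ?g1 x" using \<open>dist y x < 3 * \<epsilon>\<close> by simp
      finally show ?thesis using xy(3) by (simp add: add_increasing2)
    next
      case False
      then have x: "x \<in> ball z s - ball z r" "2 * \<epsilon> \<le> dist z x" using S xy(3) by auto
      have zx: "0 < dist z x" using x(2) eps_pos by linarith
      \<comment> \<open>Because \<open>dist z y < \<epsilon> \<le> dist z x / 2\<close>. Moving the
        centre of \<open>lam\<close> from \<open>x\<close> to \<open>z\<close> and halving the
        radius cost one factor \<open>Clam\<close> each.\<close>
      have "dist z x / 2 \<le> dist x y" using dist_triangle[of z x y] y x(2) by (simp add: dist_commute)
      have "lam z (dist z x) \<le> Clam * lam x (dist z x)"
        using lam_shift[of "dist z x" z x] zx by simp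
      also have "\<dots> \<le> Clam * (Clam * lam x (dist z x / 2))"
        using lam_doubling[of "dist z x" x] zx Clam_pos by (intro mult_left_mono) auto
      also have "\<dots> \<le> Clam * (Clam * lam x (dist x y))"
        using \<open>dist z x / 2 \<le> dist x y\<close> zx Clam_pos by (intro mult_left_mono lam_mono) auto
      finally have l: "lam z (dist z x) / Clam\<^sup>2 \<le> lam x (dist x y)"
        using Clam_pos by (simp add: power2_eq_square field_simps)
      have "A * min 1 (dist x y / \<epsilon>) / lam x (dist x y) \<le> A * 1 / (lam z (dist z x) / Clam\<^sup>2)"
      proof (rule frac_le)
        show "A * min 1 (dist x y / \<epsilon>) \<le> A * 1"
          using A_nonneg by (intro mult_left_mono) auto
      qed (use l zx lam_pos A_nonneg Clam_pos eps_pos in auto)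
      also have "\<dots> = A * Clam\<^sup>2 * (1 / lam z (dist z x))" by simp
      finally have "hs x y \<le> ennreal (A * Clam\<^sup>2 * (1 / lam z (dist z x)))"
        using size[OF xy(1)] by (elim order_trans) (rule ennreal_leI)
      also have "\<dots> = ennreal (A * Clam\<^sup>2) * ennreal (1 / lam z (dist z x))"
        using A_nonneg Clam_pos by (subst ennreal_mult') auto
      also have "\<dots> = ennreal (A * Clam\<^sup>2) * ?g2 x" using x(1) by simp
      finally show ?thesis using xy(3) by (simp add: add_increasing)
    qed
  qed
  then have "(\<integral>\<^sup>+x\<in>S. hs x y \<partial>\<mu>) \<le> (\<integral>\<^sup>+x. ennreal (A * Clam / \<epsilon>) * ?g1 x + ennreal (A * Clam\<^sup>2) * ?g2 x \<partial>\<mu>)"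
    by (intro nn_integral_mono) auto
  also have "\<dots> = ennreal (A * Clam / \<epsilon>) * (\<integral>\<^sup>+x. ?g1 x \<partial>\<mu>) + ennreal (A * Clam\<^sup>2) * (\<integral>\<^sup>+x. ?g2 x \<partial>\<mu>)"
    by (simp add: nn_integral_add nn_integral_cmult)
  also have "\<dots> \<le> ennreal (A * Clam / \<epsilon>) * ennreal (2 * Clam * (3 * \<epsilon>)) + ennreal (A * Clam\<^sup>2) * ennreal dc"
    using eps_pos by (intro add_mono mult_left_mono near_integral dc) auto
  also have "\<dots> = ennreal (A * Clam\<^sup>2 * (6 + dc))"
    using A_nonneg Clam_pos eps_pos dc0
    by (simp add: power2_eq_square algebra_simps flip: ennreal_mult ennreal_plus)
  finally show ?thesis .
qed

text \<open>The summands belong to the piece itself inside the double ball, to its spread-out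
  replacement there, and to their difference outside.\<close>

definition piece_const :: "real \<Rightarrow> real \<Rightarrow> real" where
  "piece_const p B = A * Clam\<^sup>2 * (6 + doubling_delta_const 9)
     + B powr (1 / p) * (2 * beta 9) powr (1 - 1 / p) + 2 * A"

lemma piece_const_nonneg: "0 \<le> piece_const p B"
  unfolding piece_const_def using A_nonneg doubling_delta_const_nonneg[of 9]
  by (intro add_nonneg_nonneg mult_nonneg_nonneg) auto

text \<open>The piece \<open>F\<close> is replaced by \<open>\<Phi>\<close>, its vector-valued
  integral \<open>\<alpha>\<close> spread with the weight \<open>w\<close>, so that
  \<open>F - \<Phi>\<close> has mean zero. Inside \<open>ball z (2 * R)\<close> but off
  \<open>E\<close> the size of the kernel handles \<open>F\<close>, and the strong type bound with
  Hoelder handles \<open>\<Phi>\<close>; outside, mean zero and the regularity of the kernel handle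
  the difference. All bounds are linear in the mass \<open>a\<close>.\<close>

lemma CZ_piece:
  assumes F: "test_function \<tau> F" and FQ: "\<And>x c. x \<notin> ball z \<epsilon> \<Longrightarrow> F x c = 0"
    and st: "strong p B" and p: "1 < p" and B: "0 \<le> B"
    and a: "(\<integral>\<^sup>+x. fnorm \<tau> F x \<partial>\<mu>) = ennreal a" "0 \<le> a"
    and E[measurable]: "E \<in> sets \<mu>"
    and r: "\<epsilon> \<le> r" "r \<le> R" and rE: "ball z r \<subseteq> E \<union> ball z \<epsilon>"
    and dc: "(\<integral>\<^sup>+x\<in>ball z (2 * R) - ball z r. ennreal (1 / lam z (dist z x)) \<partial>\<mu>) \<le> ennreal (doubling_delta_const 9)"
    and w[measurable]: "w \<in> borel_measurable \<mu>" and w0: "\<And>y. 0 \<le> w y" and wR: "\<And>y. y \<notin> ball z R \<Longrightarrow> w y = 0"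
    and w1: "(\<integral>\<^sup>+y. ennreal (w y) \<partial>\<mu>) = 1" and wb: "\<And>y. w y * measure \<mu> (ball z (2 * R)) \<le> 2 * beta 9"
    and m0: "0 < measure \<mu> (ball z (2 * R))"
    and \<alpha>_def: "\<alpha> = (\<lambda>c. \<integral>y. F y c \<partial>\<mu>)" and \<Phi>_def: "\<Phi> = (\<lambda>y c. \<alpha> c * complex_of_real (w y))"
  shows "test_function \<tau> \<Phi>" "\<And>y. fnorm \<tau> \<Phi> y \<le> ennreal (a * w y)"
    "(\<integral>\<^sup>+x\<in>- E. fnorm \<theta> (appl (\<lambda>y c. F y c - \<Phi> y c)) x \<partial>\<mu>) \<le> ennreal (piece_const p B * a)"
proof -
  have r0: "0 < r" "0 < R" using r eps_pos by auto
  define M where "M = measure \<mu> (ball z (2 * R))"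
  have M: "0 < M" using m0 by (simp add: M_def)
  obtain m where m: "0 \<le> m" "\<And>x c. norm (F x c) \<le> m" by (rule test_function_bound[OF F]) (rule that, auto)
  note [measurable] = test_functionD_measurable[OF F]
  have Fint: "integrable \<mu> (\<lambda>y. F y c)" "(\<integral>\<^sup>+y. ennreal (norm (F y c)) \<partial>\<mu>) \<le> ennreal (m * measure \<mu> (ball z \<epsilon>))" for c
  proof -
    have "(\<integral>\<^sup>+y. ennreal (norm (F y c)) \<partial>\<mu>) \<le> (\<integral>\<^sup>+y. ennreal m * indicator (ball z \<epsilon>) y \<partial>\<mu>)"
      using m FQ by (intro nn_integral_mono) (auto simp: indicator_def intro!: ennreal_leI)
    also have "\<dots> = ennreal (m * measure \<mu> (ball z \<epsilon>))"
      using m by (simp add: nn_integral_cmult emeasure_ball_eq ennreal_mult)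
    finally show *: "(\<integral>\<^sup>+y. ennreal (norm (F y c)) \<partial>\<mu>) \<le> ennreal (m * measure \<mu> (ball z \<epsilon>))" .
    show "integrable \<mu> (\<lambda>y. F y c)"
      by (rule integrableI_bounded) (measurable, use le_less_trans[OF * ennreal_less_top] in simp)
  qed
  have \<alpha>m[measurable]: "\<alpha> \<in> borel_measurable \<tau>"
    unfolding \<alpha>_def by (rule borel_measurable_lebesgue_integral) measurable
  have \<alpha>b: "norm (\<alpha> c) \<le> m * measure \<mu> (ball z \<epsilon>)" for c
  proof -
    have "ennreal (norm (\<alpha> c)) \<le> (\<integral>\<^sup>+y. ennreal (norm (F y c)) \<partial>\<mu>)"
      unfolding \<alpha>_def by (rule norm_integral_le_nn_integral)
    also have "\<dots> \<le> ennreal (m * measure \<mu> (ball z \<epsilon>))" by (rule Fint(2))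
    finally show ?thesis using m by simp
  qed
  have wb': "w y \<le> 2 * beta 9 / M" for y using wb[of y] M by (simp add: M_def field_simps)
  show \<Phi>: "test_function \<tau> \<Phi>"
    unfolding \<Phi>_def
    by (rule test_function_tensor[where m="m * measure \<mu> (ball z \<epsilon>)" and b="2 * beta 9 / M" and z=z and r=R])
      (use \<alpha>b wb' w0 wR in auto)
  have \<alpha>L: "L2 \<tau> (\<lambda>c. ennreal (norm (\<alpha> c))) \<le> ennreal a"
  proof -
    have "L2 \<tau> (\<lambda>c. ennreal (norm (\<alpha> c))) \<le> L2 \<tau> (\<lambda>c. \<integral>\<^sup>+y. ennreal (norm (F y c)) \<partial>\<mu>)"
      unfolding \<alpha>_def by (intro L2_mono norm_integral_le_nn_integral)
    also have "\<dots> \<le> (\<integral>\<^sup>+y. L2 \<tau> (\<lambda>c. ennreal (norm (F y c))) \<partial>\<mu>)"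
      by (rule L2_Minkowski[OF T.sigma_finite_measure_axioms sigma_finite]) measurable
    finally show ?thesis by (simp add: a)
  qed
  show \<Phi>n: "fnorm \<tau> \<Phi> y \<le> ennreal (a * w y)" for y
  proof -
    have "fnorm \<tau> \<Phi> y = L2 \<tau> (\<lambda>c. ennreal (norm (\<alpha> c)) * ennreal (w y))"
      by (intro L2_cong) (simp add: \<Phi>_def norm_mult ennreal_mult w0)
    also have "\<dots> = L2 \<tau> (\<lambda>c. ennreal (norm (\<alpha> c))) * ennreal (w y)" by (intro L2_multc) measurable
    also have "\<dots> \<le> ennreal a * ennreal (w y)" by (intro mult_right_mono \<alpha>L) simp
    finally show ?thesis using a w0 by (simp add: ennreal_mult)
  qed
  let ?B = "\<lambda>y c. F y c - \<Phi> y c"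
  have Bn: "test_function \<tau> ?B" by (rule test_function_diff[OF F \<Phi>])
  note [measurable] = fnorm_appl_measurable[OF F] fnorm_appl_measurable[OF \<Phi>] fnorm_appl_measurable[OF Bn]
    fnorm_measurable[OF F fin_\<tau>] fnorm_measurable[OF \<Phi> fin_\<tau>] fnorm_measurable[OF Bn fin_\<tau>]
    test_functionD_measurable[OF \<Phi>]
  have 1: "(\<integral>\<^sup>+x\<in>ball z (2 * R) - E. fnorm \<theta> (appl F) x \<partial>\<mu>)
      \<le> ennreal (A * Clam\<^sup>2 * (6 + doubling_delta_const 9) * a)"
  proof -
    let ?S = "ball z (2 * R) - E"
    have S: "?S \<subseteq> ball z (2 * \<epsilon>) \<union> (ball z (2 * R) - ball z r)"
    proof
      fix x assume x: "x \<in> ?S"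
      have "ball z \<epsilon> \<subseteq> ball z (2 * \<epsilon>)" using eps_pos by (intro subset_ball) auto
      then show "x \<in> ball z (2 * \<epsilon>) \<union> (ball z (2 * R) - ball z r)" using x rE by blast
    qed
    have "(\<integral>\<^sup>+x\<in>?S. fnorm \<theta> (appl F) x \<partial>\<mu>) \<le> (\<integral>\<^sup>+x\<in>?S. (\<integral>\<^sup>+y. hs x y * fnorm \<tau> F y \<partial>\<mu>) \<partial>\<mu>)"
      by (intro nn_integral_mono mult_right_mono fnorm_appl_le F) auto
    also have "\<dots> = (\<integral>\<^sup>+x. (\<integral>\<^sup>+y. hs x y * fnorm \<tau> F y * indicator ?S x \<partial>\<mu>) \<partial>\<mu>)"
      by (intro nn_integral_cong) (simp add: nn_integral_multc)
    also have "\<dots> = (\<integral>\<^sup>+y. (\<integral>\<^sup>+x. hs x y * fnorm \<tau> F y * indicator ?S x \<partial>\<mu>) \<partial>\<mu>)"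
      by (rule pair_sigma_finite.Fubini') (auto simp: pair_sigma_finite_def sigma_finite)
    also have "\<dots> \<le> (\<integral>\<^sup>+y. ennreal (A * Clam\<^sup>2 * (6 + doubling_delta_const 9)) * fnorm \<tau> F y \<partial>\<mu>)"
    proof (intro nn_integral_mono)
      fix y
      show "(\<integral>\<^sup>+x. hs x y * fnorm \<tau> F y * indicator ?S x \<partial>\<mu>)
        \<le> ennreal (A * Clam\<^sup>2 * (6 + doubling_delta_const 9)) * fnorm \<tau> F y"
      proof (cases "dist z y < \<epsilon>")
        case True
        have "(\<integral>\<^sup>+x. hs x y * fnorm \<tau> F y * indicator ?S x \<partial>\<mu>)
            = (\<integral>\<^sup>+x\<in>?S. hs x y \<partial>\<mu>) * fnorm \<tau> F y"
          by (subst nn_integral_multc[symmetric]) (auto intro!: nn_integral_cong simp: ac_simps)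
        also have "\<dots> \<le> ennreal (A * Clam\<^sup>2 * (6 + doubling_delta_const 9)) * fnorm \<tau> F y"
          by (intro mult_right_mono hs_integral_near[OF True S r0(1) dc] doubling_delta_const_nonneg) auto
        finally show ?thesis .
      next
        case False
        then have "fnorm \<tau> F y = 0" using FQ[of y] by simp
        then show ?thesis by simp
      qed
    qed
    also have "\<dots> = ennreal (A * Clam\<^sup>2 * (6 + doubling_delta_const 9) * a)"
      using a(2) A_nonneg doubling_delta_const_nonneg[of 9] by (simp add: nn_integral_cmult a(1) ennreal_mult)
    finally show ?thesis .
  qed
  have 2: "(\<integral>\<^sup>+x\<in>ball z (2 * R). fnorm \<theta> (appl \<Phi>) x \<partial>\<mu>)
      \<le> ennreal (B powr (1 / p) * (2 * beta 9) powr (1 - 1 / p) * a)"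
  proof -
    define q where "q = p / (p - 1)"
    have q: "1 < q" "1 / p + 1 / q = 1" "1 / q = 1 - 1 / p" using p by (auto simp: q_def field_simps)
    have b9: "0 < beta 9" by (rule beta_pos) simp
    have "(\<integral>\<^sup>+x\<in>ball z (2 * R). fnorm \<theta> (appl \<Phi>) x \<partial>\<mu>)
       \<le> ennreal_powr (\<integral>\<^sup>+x. ennreal_powr (fnorm \<theta> (appl \<Phi>) x) p \<partial>\<mu>) (1 / p)
         * ennreal_powr (\<integral>\<^sup>+x. ennreal_powr (indicator (ball z (2 * R)) x) q \<partial>\<mu>) (1 / q)"
      by (rule Holder_nn_integral[OF p q(1,2)]) measurable
    also have "(\<integral>\<^sup>+x. ennreal_powr (indicator (ball z (2 * R)) x) q \<partial>\<mu>) = (\<integral>\<^sup>+x. indicator (ball z (2 * R)) x \<partial>\<mu>)"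
      by (intro nn_integral_cong) (auto simp: indicator_def ennreal_powr_def)
    also have "\<dots> = ennreal M" by (simp add: emeasure_ball_eq M_def)
    also have "ennreal_powr (ennreal M) (1 / q) = ennreal (M powr (1 - 1 / p))"
      using M by (simp add: ennreal_powr_ennreal q(3))
    also have "(\<integral>\<^sup>+x. ennreal_powr (fnorm \<theta> (appl \<Phi>) x) p \<partial>\<mu>)
        \<le> ennreal B * (\<integral>\<^sup>+x. ennreal_powr (fnorm \<tau> \<Phi> x) p \<partial>\<mu>)"
      using st \<Phi> by (simp add: strong_def)
    \<comment> \<open>One factor \<open>w x\<close> is kept for its integral one, and the other
      \<open>p - 1\<close> are bounded by \<open>2 * beta 9 / M\<close>. After the root this leaves
      \<open>M\<close> to the power \<open>-(1 - 1 / p)\<close>, which cancels the power from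
      Hoelder's inequality.\<close>
    also have "(\<integral>\<^sup>+x. ennreal_powr (fnorm \<tau> \<Phi> x) p \<partial>\<mu>)
        \<le> (\<integral>\<^sup>+x. ennreal (a powr p * (2 * beta 9 / M) powr (p - 1)) * ennreal (w x) \<partial>\<mu>)"
    proof (intro nn_integral_mono)
      fix x
      have "ennreal_powr (fnorm \<tau> \<Phi> x) p \<le> ennreal_powr (ennreal (a * w x)) p"
        using p \<Phi>n by (intro ennreal_powr_mono) auto
      also have "\<dots> = ennreal (a powr p * w x powr p)"
        using a w0 by (simp add: ennreal_powr_ennreal powr_mult)
      also have "w x powr p = w x powr (p - 1) * w x"
        using w0[of x] by (cases "w x = 0") (auto simp: powr_diff)
      also have "ennreal (a powr p * (w x powr (p - 1) * w x))
          \<le> ennreal (a powr p * ((2 * beta 9 / M) powr (p - 1) * w x))"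
        using wb'[of x] w0[of x] p by (intro ennreal_leI mult_left_mono mult_right_mono powr_mono2) auto
      also have "\<dots> = ennreal (a powr p * (2 * beta 9 / M) powr (p - 1)) * ennreal (w x)"
        using w0 by (simp add: mult.assoc flip: ennreal_mult)
      finally show "ennreal_powr (fnorm \<tau> \<Phi> x) p
          \<le> ennreal (a powr p * (2 * beta 9 / M) powr (p - 1)) * ennreal (w x)" .
    qed
    also have "\<dots> = ennreal (a powr p * (2 * beta 9 / M) powr (p - 1))"
      using w1 by (simp add: nn_integral_cmult)
    also have "ennreal_powr (ennreal B * ennreal (a powr p * (2 * beta 9 / M) powr (p - 1))) (1 / p)
        = ennreal (B powr (1 / p) * (a * (2 * beta 9 / M) powr (1 - 1 / p)))"
    proof -
      have "(a powr p * (2 * beta 9 / M) powr (p - 1)) powr (1 / p) = a * (2 * beta 9 / M) powr (1 - 1 / p)"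
        using a(2) b9 M p by (simp add: powr_mult powr_powr diff_divide_distrib)
      then show ?thesis
        using B by (simp add: ennreal_powr_ennreal powr_mult flip: ennreal_mult)
    qed
    finally have "(\<integral>\<^sup>+x\<in>ball z (2 * R). fnorm \<theta> (appl \<Phi>) x \<partial>\<mu>)
      \<le> ennreal (B powr (1 / p) * (a * (2 * beta 9 / M) powr (1 - 1 / p))) * ennreal (M powr (1 - 1 / p))"
      using p by (simp add: ennreal_powr_mono mult_right_mono mult_left_mono)
    also have "\<dots> = ennreal (B powr (1 / p) * (2 * beta 9) powr (1 - 1 / p) * a)"
      using a M b9 by (simp add: powr_divide flip: ennreal_mult)
    finally show ?thesis .
  qed
  have 3: "(\<integral>\<^sup>+x\<in>- ball z (2 * R). fnorm \<theta> (appl ?B) x \<partial>\<mu>) \<le> ennreal (2 * A * a)"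
  proof -
    let ?D = "\<lambda>x y. L2 \<theta> (\<lambda>d. L2 \<tau> (\<lambda>c. ennreal (norm (H x d y c - H x d z c))))"
    \<comment> \<open>Freezing \<open>y = z\<close> in the kernel leaves a factor constant in
      \<open>y\<close>, and for each \<open>c\<close> the integral of \<open>?B y c\<close> over
      \<open>y\<close> is \<open>\<alpha> c - \<alpha> c = 0\<close>. Absolute convergence comes
      from \<open>H_fin\<close> and the bounded support of \<open>?B\<close>.\<close>
    have mz: "(\<integral>v. H x d z (snd v) * ?B (fst v) (snd v) \<partial>(\<mu> \<Otimes>\<^sub>M \<tau>)) = 0"
       "integrable (\<mu> \<Otimes>\<^sub>M \<tau>) (\<lambda>v. H x d z (snd v) * ?B (fst v) (snd v))" for x d
    proof -
      obtain k where k: "0 \<le> k" "\<And>y c. norm (?B y c) \<le> k" by (rule test_function_bound[OF Bn]) (rule that, auto)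
      have B0: "?B y c = 0" if "y \<notin> ball z R" for y c
      proof -
        have "y \<notin> ball z \<epsilon>" using that r unfolding mem_ball by linarith
        then show ?thesis using that FQ[of y c] wR[of y] by (simp add: \<Phi>_def)
      qed
      have "(\<integral>\<^sup>+v. ennreal (norm (H x d z (snd v) * ?B (fst v) (snd v))) \<partial>(\<mu> \<Otimes>\<^sub>M \<tau>))
         \<le> (\<integral>\<^sup>+v. (ennreal k * indicator (ball z R) (fst v)) * ennreal (norm (H x d z (snd v))) \<partial>(\<mu> \<Otimes>\<^sub>M \<tau>))"
      proof (intro nn_integral_mono)
        fix v
        show "ennreal (norm (H x d z (snd v) * ?B (fst v) (snd v)))
          \<le> (ennreal k * indicator (ball z R) (fst v)) * ennreal (norm (H x d z (snd v)))"
        proof (cases "fst v \<in> ball z R")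
          case True
          then show ?thesis using k
            by (simp add: norm_mult mult.commute[of k] mult_left_mono flip: ennreal_mult)
        qed (use B0[of "fst v" "snd v"] in simp)
      qed
      also have "\<dots> = (\<integral>\<^sup>+y. \<integral>\<^sup>+c. (ennreal k * indicator (ball z R) y) * ennreal (norm (H x d z c)) \<partial>\<tau> \<partial>\<mu>)"
        by (subst T.nn_integral_fst[symmetric]) auto
      also have "\<dots> = (ennreal k * emeasure \<mu> (ball z R)) * (\<integral>\<^sup>+c. ennreal (norm (H x d z c)) \<partial>\<tau>)"
        by (simp add: nn_integral_cmult nn_integral_multc)
      also have "\<dots> < \<infinity>" using H_fin[of x d z] by (simp add: ennreal_mult_less_top)
      finally show int: "integrable (\<mu> \<Otimes>\<^sub>M \<tau>) (\<lambda>v. H x d z (snd v) * ?B (fst v) (snd v))"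
        by (intro integrableI_bounded) measurable
      have wint: "integrable \<mu> (\<lambda>y. complex_of_real (w y))" "(\<integral>y. complex_of_real (w y) \<partial>\<mu>) = 1"
      proof -
        have "integrable \<mu> w" using w1 w0 by (intro integrableI_bounded) auto
        then show "integrable \<mu> (\<lambda>y. complex_of_real (w y))" by simp
        have "(\<integral>y. w y \<partial>\<mu>) = 1" using w1 w0 by (subst integral_eq_nn_integral) auto
        then show "(\<integral>y. complex_of_real (w y) \<partial>\<mu>) = 1" by simp
      qed
      have "(\<integral>v. H x d z (snd v) * ?B (fst v) (snd v) \<partial>(\<mu> \<Otimes>\<^sub>M \<tau>))
          = (\<integral>c. \<integral>y. H x d z c * ?B y c \<partial>\<mu> \<partial>\<tau>)"
        using MT.integral_snd[of "\<lambda>y c. H x d z c * ?B y c", unfolded split_beta, OF int] by (rule sym)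
      also have "\<dots> = (\<integral>c. 0 \<partial>\<tau>)"
        using Fint(1) wint by (intro Bochner_Integration.integral_cong refl) (simp add: \<Phi>_def \<alpha>_def)
      finally show "(\<integral>v. H x d z (snd v) * ?B (fst v) (snd v) \<partial>(\<mu> \<Otimes>\<^sub>M \<tau>)) = 0" by simp
    qed
    have appl_eq: "appl ?B x d = (\<integral>v. (H x d (fst v) (snd v) - H x d z (snd v)) * ?B (fst v) (snd v) \<partial>(\<mu> \<Otimes>\<^sub>M \<tau>))" for x d
      using integrable_appl[OF Bn, of x d] mz[of x d]
      by (simp add: appl_def left_diff_distrib Bochner_Integration.integral_diff del: right_diff_distrib)
    have D[measurable]: "(\<lambda>(x, y). ?D x y) \<in> borel_measurable (\<mu> \<Otimes>\<^sub>M \<mu>)"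
    proof -
      have "(\<lambda>u. L2 \<tau> (\<lambda>c. ennreal (norm (H (fst (fst u)) (snd u) (snd (fst u)) c - H (fst (fst u)) (snd u) z c))))
         \<in> borel_measurable ((\<mu> \<Otimes>\<^sub>M \<mu>) \<Otimes>\<^sub>M \<theta>)"
        by (rule L2_measurable[OF T.sigma_finite_measure_axioms]) (simp add: split_beta)
      then show ?thesis unfolding split_beta
        by (intro L2_measurable[OF D.sigma_finite_measure_axioms]) (simp add: split_beta)
    qed
    have "fnorm \<theta> (appl ?B) x \<le> (\<integral>\<^sup>+y. ?D x y * fnorm \<tau> ?B y \<partial>\<mu>)" for x
      unfolding appl_eq by (rule Minkowski_HS[OF fin_\<tau> fin_\<theta>]) (auto simp: split_beta)
    then have "(\<integral>\<^sup>+x\<in>- ball z (2 * R). fnorm \<theta> (appl ?B) x \<partial>\<mu>)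
        \<le> (\<integral>\<^sup>+x\<in>- ball z (2 * R). (\<integral>\<^sup>+y. ?D x y * fnorm \<tau> ?B y \<partial>\<mu>) \<partial>\<mu>)"
      by (intro nn_integral_mono mult_right_mono) auto
    also have "\<dots> = (\<integral>\<^sup>+x. (\<integral>\<^sup>+y. ?D x y * fnorm \<tau> ?B y * indicator (- ball z (2 * R)) x \<partial>\<mu>) \<partial>\<mu>)"
      by (intro nn_integral_cong) (simp add: nn_integral_multc)
    also have "\<dots> = (\<integral>\<^sup>+y. (\<integral>\<^sup>+x. ?D x y * fnorm \<tau> ?B y * indicator (- ball z (2 * R)) x \<partial>\<mu>) \<partial>\<mu>)"
      by (rule pair_sigma_finite.Fubini') (auto simp: pair_sigma_finite_def sigma_finite)
    also have "\<dots> \<le> (\<integral>\<^sup>+y. ennreal A * (fnorm \<tau> F y + ennreal (a * w y)) \<partial>\<mu>)"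
    proof (intro nn_integral_mono)
      fix y
      show "(\<integral>\<^sup>+x. ?D x y * fnorm \<tau> ?B y * indicator (- ball z (2 * R)) x \<partial>\<mu>)
        \<le> ennreal A * (fnorm \<tau> F y + ennreal (a * w y))"
      proof (cases "dist z y < R")
        case True
        have "(\<integral>\<^sup>+x. ?D x y * fnorm \<tau> ?B y * indicator (- ball z (2 * R)) x \<partial>\<mu>)
            = (\<integral>\<^sup>+x\<in>- ball z (2 * R). ?D x y \<partial>\<mu>) * fnorm \<tau> ?B y"
          by (subst nn_integral_multc[symmetric]) (auto intro!: nn_integral_cong simp: ac_simps)
        also have "\<dots> \<le> ennreal A * (fnorm \<tau> F y + ennreal (a * w y))"
        proof (intro mult_mono regular r0 True)
          have "fnorm \<tau> ?B y \<le> fnorm \<tau> F y + fnorm \<tau> (\<lambda>y c. - \<Phi> y c) y"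
            using fnorm_add_le[of F y \<tau> "\<lambda>y c. - \<Phi> y c"] test_function_sect[OF F] test_function_sect[OF \<Phi>, of y] by simp
          also have "\<dots> \<le> fnorm \<tau> F y + ennreal (a * w y)" using \<Phi>n[of y] by (simp add: add_left_mono)
          finally show "fnorm \<tau> ?B y \<le> fnorm \<tau> F y + ennreal (a * w y)" .
        qed auto
        finally show ?thesis .
      next
        case False
        have "y \<notin> ball z \<epsilon>" using False r unfolding mem_ball by linarith
        then have "fnorm \<tau> ?B y = 0" using False FQ[of y] wR[of y] by (simp add: \<Phi>_def)
        then show ?thesis by simp
      qed
    qed
    also have "\<dots> = ennreal A * (ennreal a + ennreal a * 1)"
      using a w1 w0 by (simp add: nn_integral_cmult nn_integral_add ennreal_mult)
    also have "\<dots> = ennreal (2 * A * a)"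
      using a A_nonneg by (simp add: algebra_simps flip: ennreal_plus ennreal_mult)
    finally show ?thesis .
  qed
  \<comment> \<open>The piece and its replacement are separated inside the double ball only;
    outside, their difference must stay together to keep the cancellation.\<close>
  have "(\<integral>\<^sup>+x\<in>- E. fnorm \<theta> (appl ?B) x \<partial>\<mu>)
    \<le> (\<integral>\<^sup>+x. fnorm \<theta> (appl F) x * indicator (ball z (2 * R) - E) x
        + fnorm \<theta> (appl \<Phi>) x * indicator (ball z (2 * R)) x
        + fnorm \<theta> (appl ?B) x * indicator (- ball z (2 * R)) x \<partial>\<mu>)"
    using fnorm_appl_diff[OF F \<Phi>]
    by (intro nn_integral_mono) (auto simp: indicator_def)
  also have "\<dots> \<le> ennreal (A * Clam\<^sup>2 * (6 + doubling_delta_const 9) * a)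
      + ennreal (B powr (1 / p) * (2 * beta 9) powr (1 - 1 / p) * a) + ennreal (2 * A * a)"
    using 1 2 3 by (simp add: nn_integral_add add_mono)
  also have "\<dots> = ennreal (piece_const p B * a)"
    using a A_nonneg doubling_delta_const_nonneg[of 9]
    by (simp add: piece_const_def algebra_simps flip: ennreal_plus)
  finally show "(\<integral>\<^sup>+x\<in>- E. fnorm \<theta> (appl ?B) x \<partial>\<mu>) \<le> ennreal (piece_const p B * a)" .
qed

end

context nonhomogeneous_space
begin

lemma Markov:
  assumes [measurable]: "g \<in> borel_measurable \<mu>" "S \<in> sets \<mu>"
  shows "c * emeasure \<mu> {x\<in>S. c \<le> g x} \<le> (\<integral>\<^sup>+x\<in>S. g x \<partial>\<mu>)"
proof -
  have [measurable]: "{x\<in>S. c \<le> g x} \<in> sets \<mu>"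
  proof -
    have "{x\<in>S. c \<le> g x} = S \<inter> {x\<in>space \<mu>. c \<le> g x}" by auto
    also have "\<dots> \<in> sets \<mu>" by measurable
    finally show ?thesis .
  qed
  have "c * emeasure \<mu> {x\<in>S. c \<le> g x} = (\<integral>\<^sup>+x. c * indicator {x\<in>S. c \<le> g x} x \<partial>\<mu>)"
    by (simp add: nn_integral_cmult)
  also have "\<dots> \<le> (\<integral>\<^sup>+x\<in>S. g x \<partial>\<mu>)"
    by (intro nn_integral_mono) (auto simp: indicator_def)
  finally show ?thesis .
qed

lemma fnorm_sum_le:
  assumes "finite I" "\<And>i. i \<in> I \<Longrightarrow> test_function \<tau> (F i)"
  shows "fnorm \<tau> (\<lambda>x c. \<Sum>i\<in>I. F i x c) x \<le> (\<Sum>i\<in>I. fnorm \<tau> (F i) x)"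
  using assms
proof (induction I rule: finite_induct)
  case (insert i I)
  have "fnorm \<tau> (\<lambda>x c. F i x c + (\<Sum>i\<in>I. F i x c)) x
     \<le> fnorm \<tau> (F i) x + fnorm \<tau> (\<lambda>x c. \<Sum>i\<in>I. F i x c) x"
    using insert by (intro fnorm_add_le test_function_sect test_function_sum) auto
  also have "\<dots> \<le> fnorm \<tau> (F i) x + (\<Sum>i\<in>I. fnorm \<tau> (F i) x)"
    using insert by (intro add_left_mono) auto
  finally show ?case using insert by simp
qed simp

lemma fnorm_indicator:
  "fnorm \<tau> (\<lambda>x c. indicator S x * F x c) x = indicator S x * fnorm \<tau> F x"
  by (cases "x \<in> S") auto

end

context cz_kernel
begin

text \<open>The summands come from the exceptional set, from the spread-out part at height
  \<open>s / 2\<close>, and from the differences at height \<open>s / 2\<close>.\<close>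

definition weak_const :: "real \<Rightarrow> real \<Rightarrow> real" where
  "weak_const p B = 1 + 2 powr p * B * (4 * beta 9) powr (p - 1) + 2 * piece_const p B"

text \<open>Each piece of \<open>F\<close> enters the stopping-time argument as a number
  \<open>a k\<close>, its \<open>L\<^sup>1\<close> norm, placed at the centre \<open>f k\<close> of
  a ball of radius \<open>\<epsilon>\<close> containing the support. The sum \<open>\<Phi>s\<close>
  of the spread pieces is bounded pointwise by \<open>4 * beta 9 * s\<close>, so the strong type
  bound and Chebyshev apply to it. The differences are integrable off \<open>E\<close>, with a bound
  proportional to the total mass, however many there are.\<close>

lemma weak_type:
  assumes st: "strong p B" and p: "1 < p" and B: "0 \<le> B"
  shows "weak (weak_const p B)"
  unfolding weak_def
proof (intro allI impI)
  fix F :: "'a \<Rightarrow> 'c \<Rightarrow> complex" and s :: real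
  assume F: "test_function \<tau> F" and s: "0 < s"
  define I1 where "I1 = (\<integral>\<^sup>+x. fnorm \<tau> F x \<partial>\<mu>)"
  have I1: "I1 < top" using nn_integral_fnorm_finite[OF F fin_\<tau>, of 1] by (simp add: I1_def)
  have b9: "0 < beta 9" by (rule beta_pos) simp
  have wc: "1 \<le> weak_const p B" using B piece_const_nonneg[of p B] by (simp add: weak_const_def)
  let ?L = "{x. ennreal s < fnorm \<theta> (appl F) x}"
  note [measurable] = fnorm_measurable[OF F fin_\<tau>] fnorm_appl_measurable[OF F]
  have Lm: "?L \<in> sets \<mu>"
  proof -
    have "{x\<in>space \<mu>. ennreal s < fnorm \<theta> (appl F) x} \<in> sets \<mu>" by measurable
    then show ?thesis by simp
  qed
  show "ennreal s * emeasure \<mu> ?L \<le> ennreal (weak_const p B) * (\<integral>\<^sup>+x. fnorm \<tau> F x \<partial>\<mu>)"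
  \<comment> \<open>In a space of such small measure the estimate is trivial. Otherwise the total
    mass satisfies the hypothesis under which the stopping scales are bounded.\<close>
  proof (cases "ennreal s * emeasure \<mu> UNIV \<le> I1")
    case True
    have "ennreal s * emeasure \<mu> ?L \<le> ennreal s * emeasure \<mu> UNIV"
      using emeasure_space[of \<mu> ?L] by (intro mult_left_mono) auto
    also have "\<dots> \<le> 1 * I1" using True by simp
    also have "\<dots> \<le> ennreal (weak_const p B) * I1" using wc by (intro mult_right_mono) auto
    finally show ?thesis by (simp add: I1_def)
  next
    case False
    obtain z0 r0 where z0: "0 < r0" "\<And>x c. x \<notin> ball z0 r0 \<Longrightarrow> F x c = 0"
      by (rule test_function_support[OF F]) (rule that, auto)
    obtain G where G: "finite G" "ball z0 r0 \<subseteq> (\<Union>y\<in>G. ball y \<epsilon>)"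
      using finite_cover[OF z0(1) eps_pos] by blast
    define n where "n = card G"
    obtain f where f: "bij_betw f {0..<n} G" using ex_bij_betw_nat_finite[OF G(1)] unfolding n_def by blast
    define C where "C k = (if k < n then ball (f k) \<epsilon> else {})" for k
    define Q where "Q k = disjointed C k" for k
    have Cm: "C k \<in> sets \<mu>" for k by (simp add: C_def)
    have Qm[measurable]: "Q k \<in> sets \<mu>" for k
      unfolding Q_def using sets.range_disjointed_sets[of C \<mu>] Cm by blast
    have QC: "Q k \<subseteq> C k" for k unfolding Q_def by (rule disjointed_subset)
    have Qd: "disjoint_family_on Q J" for J
      using disjoint_family_disjointed[of C] by (auto simp: Q_def disjoint_family_on_def)
    have Qn: "Q k = {}" if "n \<le> k" for k using QC[of k] that by (simp add: C_def)
    have QU: "ball z0 r0 \<subseteq> (\<Union>k<n. Q k)"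
    proof
      fix x assume "x \<in> ball z0 r0"
      then obtain y where "y \<in> G" "x \<in> ball y \<epsilon>" using G by blast
      then obtain k where "k < n" "x \<in> C k" using f unfolding C_def bij_betw_def by force
      then have "x \<in> (\<Union>k. Q k)" unfolding Q_def UN_disjointed_eq by blast
      then obtain j where "x \<in> Q j" by blast
      then show "x \<in> (\<Union>k<n. Q k)" using Qn[of j] by (cases "j < n") auto
    qed
    define Fk where "Fk k x c = indicator (Q k) x * F x c" for k x c
    have Fkn: "test_function \<tau> (Fk k)" for k unfolding Fk_def by (rule test_function_indicator[OF F]) measurable
    have Fknorm: "fnorm \<tau> (Fk k) x = indicator (Q k) x * fnorm \<tau> F x" for k x
      unfolding Fk_def by (rule fnorm_indicator)
    have Fsum: "F x c = (\<Sum>k<n. Fk k x c)" for x c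
    proof -
      have "(\<Sum>k<n. Fk k x c) = indicator (\<Union>k<n. Q k) x * F x c"
        unfolding Fk_def by (subst indicator_UN_disjoint) (auto simp: Qd sum_distrib_right)
      also have "\<dots> = F x c"
      proof (cases "x \<in> ball z0 r0")
        case True
        then have "x \<in> (\<Union>k<n. Q k)" using QU by blast
        then show ?thesis by simp
      qed (use z0(2)[of x c] in simp)
      finally show ?thesis by simp
    qed
    \<comment> \<open>Balls of measure zero are set aside, since spreading divides by measures of
      balls. The pieces in them vanish almost everywhere and have image zero.\<close>
    define I where "I = {k\<in>{..<n}. 0 < emeasure \<mu> (ball (f k) \<epsilon>)}"
    have I: "finite I" "I \<subseteq> {..<n}" by (auto simp: I_def)
    define a where "a k = enn2real (\<integral>\<^sup>+x. fnorm \<tau> (Fk k) x \<partial>\<mu>)" for k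
    have a: "(\<integral>\<^sup>+x. fnorm \<tau> (Fk k) x \<partial>\<mu>) = ennreal (a k)" "0 \<le> a k" for k
      using nn_integral_fnorm_finite[OF Fkn fin_\<tau>, of 1] by (simp_all add: a_def)
    have aI: "ennreal (sum a I) \<le> I1"
    proof -
      have "ennreal (sum a I) = (\<Sum>k\<in>I. \<integral>\<^sup>+x. fnorm \<tau> (Fk k) x \<partial>\<mu>)"
        using a by (simp add: sum_ennreal)
      also have "\<dots> = (\<integral>\<^sup>+x. (\<Sum>k\<in>I. indicator (Q k) x) * fnorm \<tau> F x \<partial>\<mu>)"
        unfolding Fknorm by (subst nn_integral_sum[symmetric]) (auto simp: sum_distrib_right)
      also have "\<dots> \<le> I1"
        unfolding I1_def
      proof (intro nn_integral_mono)
        fix x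
        have "(\<Sum>k\<in>I. indicator (Q k) x) = (indicator (\<Union>k\<in>I. Q k) x :: ennreal)"
          by (rule indicator_UN_disjoint[symmetric]) (use I Qd in auto)
        also have "\<dots> \<le> 1" by (simp add: indicator_def)
        finally show "(\<Sum>k\<in>I. indicator (Q k) x) * fnorm \<tau> F x \<le> fnorm \<tau> F x"
          using mult_right_mono[of _ 1 "fnorm \<tau> F x"] by fastforce
      qed
      finally show ?thesis .
    qed
    have null: "fnorm \<theta> (appl (Fk k)) x = 0" if "k \<in> {..<n} - I" for k x
    proof -
      have "ball (f k) \<epsilon> \<in> null_sets \<mu>" using that by (intro null_setsI) (auto simp: I_def)
      then have "AE y in \<mu>. y \<notin> ball (f k) \<epsilon>" by (rule AE_not_in)
      then have "AE y in \<mu>. y \<notin> Q k"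
        using QC[of k] that by (elim eventually_mono) (auto simp: C_def)
      then have "(\<integral>\<^sup>+y. hs x y * fnorm \<tau> (Fk k) y \<partial>\<mu>) = (\<integral>\<^sup>+y. 0 \<partial>\<mu>)"
        by (intro nn_integral_cong_AE) (auto simp: Fknorm)
      then show ?thesis using fnorm_appl_le[OF Fkn, of k x] by simp
    qed
    have small: "ennreal (sum a I) < ennreal s * emeasure \<mu> UNIV" using aI False by simp
    have posI: "0 < emeasure \<mu> (ball (f k) \<epsilon>)" if "k \<in> I" for k using that by (simp add: I_def)
    obtain r R :: "nat \<Rightarrow> real" and w :: "nat \<Rightarrow> 'a \<Rightarrow> real" and E :: "'a set" where
      E: "E \<in> sets \<mu>" "ennreal s * emeasure \<mu> E \<le> ennreal (sum a I)"
      and rR: "\<And>k. k \<in> I \<Longrightarrow> \<epsilon> \<le> r k" "\<And>k. k \<in> I \<Longrightarrow> r k \<le> R k"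
      and rE: "\<And>k. k \<in> I \<Longrightarrow> ball (f k) (r k) \<subseteq> E \<union> ball (f k) \<epsilon>"
      and dc: "\<And>k. k \<in> I \<Longrightarrow> (\<integral>\<^sup>+y\<in>ball (f k) (2 * R k) - ball (f k) (r k).
          ennreal (1 / lam (f k) (dist (f k) y)) \<partial>\<mu>) \<le> ennreal (doubling_delta_const 9)"
      and w: "\<And>k. k \<in> I \<Longrightarrow> w k \<in> borel_measurable \<mu>" "\<And>k y. k \<in> I \<Longrightarrow> 0 \<le> w k y"
        "\<And>k y. k \<in> I \<Longrightarrow> y \<notin> ball (f k) (R k) \<Longrightarrow> w k y = 0"
        "\<And>k. k \<in> I \<Longrightarrow> (\<integral>\<^sup>+y. ennreal (w k y) \<partial>\<mu>) = 1"
        "\<And>k y. k \<in> I \<Longrightarrow> w k y * measure \<mu> (ball (f k) (2 * R k)) \<le> 2 * beta 9"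
        "\<And>y. (\<Sum>k\<in>I. a k * w k y) \<le> 4 * beta 9 * s"
      by (rule CZ_point_masses[OF I(1) a(2) s eps_pos posI small]) (assumption | blast)+
    define \<Phi> where "\<Phi> k y c = (\<integral>y. Fk k y c \<partial>\<mu>) * complex_of_real (w k y)" for k y c
    have \<Phi>: "test_function \<tau> (\<Phi> k)" "\<And>y. fnorm \<tau> (\<Phi> k) y \<le> ennreal (a k * w k y)"
      "(\<integral>\<^sup>+x\<in>- E. fnorm \<theta> (appl (\<lambda>y c. Fk k y c - \<Phi> k y c)) x \<partial>\<mu>) \<le> ennreal (piece_const p B * a k)"
      if k: "k \<in> I" for k
    proof -
      have supp: "Fk k x c = 0" if "x \<notin> ball (f k) \<epsilon>" for x c
      proof -
        have "k < n" using k I by auto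
        then have "x \<notin> Q k" using that QC[of k] by (auto simp: C_def)
        then show ?thesis by (simp add: Fk_def)
      qed
      have "ball (f k) \<epsilon> \<subseteq> ball (f k) (2 * R k)" using rR[OF k] eps_pos by (intro subset_ball) auto
      then have "0 < emeasure \<mu> (ball (f k) (2 * R k))"
        using k emeasure_mono[of "ball (f k) \<epsilon>" "ball (f k) (2 * R k)" \<mu>] by (auto simp: I_def)
      then have m0: "0 < measure \<mu> (ball (f k) (2 * R k))" by (simp add: emeasure_ball_eq)
      note * = CZ_piece[OF Fkn supp st p B a E(1) rR(1)[OF k] rR(2)[OF k] rE[OF k] dc[OF k] w(1)[OF k]
          w(2)[OF k] w(3)[OF k] w(4)[OF k] w(5)[OF k] m0 refl refl]
      show "test_function \<tau> (\<Phi> k)" "\<And>y. fnorm \<tau> (\<Phi> k) y \<le> ennreal (a k * w k y)"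
        "(\<integral>\<^sup>+x\<in>- E. fnorm \<theta> (appl (\<lambda>y c. Fk k y c - \<Phi> k y c)) x \<partial>\<mu>) \<le> ennreal (piece_const p B * a k)"
        using * by (simp_all add: \<Phi>_def[abs_def])
    qed
    define \<Phi>s where "\<Phi>s y c = (\<Sum>k\<in>I. \<Phi> k y c)" for y c
    have \<Phi>s: "test_function \<tau> \<Phi>s" unfolding \<Phi>s_def using I \<Phi> by (intro test_function_sum) auto
    let ?Bk = "\<lambda>k y c. Fk k y c - \<Phi> k y c"
    have Bkn: "test_function \<tau> (?Bk k)" if "k \<in> I" for k using \<Phi>(1)[OF that] Fkn by (intro test_function_diff)
    define g1 where "g1 x = fnorm \<theta> (appl \<Phi>s) x" for x
    define g2 where "g2 x = (\<Sum>k\<in>I. fnorm \<theta> (appl (?Bk k)) x)" for x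
    have g12: "fnorm \<theta> (appl F) x \<le> g1 x + g2 x" for x
    proof -
      have eq: "F = (\<lambda>y c. (\<Phi>s y c + (\<Sum>k\<in>I. ?Bk k y c)) + (\<Sum>k\<in>{..<n} - I. Fk k y c))"
      proof (intro ext)
        fix y c
        have "F y c = (\<Sum>k\<in>I. Fk k y c) + (\<Sum>k\<in>{..<n} - I. Fk k y c)"
          unfolding Fsum using I by (simp add: sum.subset_diff[of I "{..<n}"])
        then show "F y c = (\<Phi>s y c + (\<Sum>k\<in>I. ?Bk k y c)) + (\<Sum>k\<in>{..<n} - I. Fk k y c)"
          by (simp add: \<Phi>s_def sum_subtractf)
      qed
      have "fnorm \<theta> (appl F) x \<le> fnorm \<theta> (appl (\<lambda>y c. \<Phi>s y c + (\<Sum>k\<in>I. ?Bk k y c))) x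
          + fnorm \<theta> (appl (\<lambda>y c. \<Sum>k\<in>{..<n} - I. Fk k y c)) x"
        by (subst eq, rule fnorm_appl_add) (use \<Phi>s Bkn Fkn I in \<open>auto intro!: test_function_add test_function_sum\<close>)
      also have "\<dots> \<le> (fnorm \<theta> (appl \<Phi>s) x + fnorm \<theta> (appl (\<lambda>y c. \<Sum>k\<in>I. ?Bk k y c)) x)
          + (\<Sum>k\<in>{..<n} - I. fnorm \<theta> (appl (Fk k)) x)"
        by (intro add_mono fnorm_appl_add fnorm_appl_sum) (use \<Phi>s Bkn Fkn I in \<open>auto intro!: test_function_sum\<close>)
      also have "\<dots> \<le> (g1 x + g2 x) + 0"
        unfolding g1_def g2_def using null I Bkn by (intro add_mono fnorm_appl_sum) auto
      finally show ?thesis by simp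
    qed
    have [measurable]: "g1 \<in> borel_measurable \<mu>" "g2 \<in> borel_measurable \<mu>"
      unfolding g1_def g2_def using fnorm_appl_measurable[OF \<Phi>s] fnorm_appl_measurable[OF Bkn]
      by (auto intro!: borel_measurable_sum)
    note [measurable] = E(1)
    \<comment> \<open>In the \<open>L\<^sup>p\<close> norm of the good part one factor of the
      density is integrated, which gives the mass, and the others are bounded by
      \<open>4 * beta 9 * s\<close>. The powers of \<open>s\<close> then cancel those of the
      Chebyshev inequality except for one.\<close>
    have M1: "ennreal s * emeasure \<mu> {x\<in>space \<mu>. ennreal (s / 2) \<le> g1 x}
        \<le> ennreal (2 powr p * B * (4 * beta 9) powr (p - 1)) * I1"
    proof -
      have set_eq: "{x\<in>space \<mu>. ennreal (s / 2) \<le> g1 x}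
          = {x\<in>UNIV. ennreal_powr (ennreal (s / 2)) p \<le> ennreal_powr (g1 x) p}"
        using p by (simp add: ennreal_powr_le_iff)
      have "ennreal_powr (ennreal (s / 2)) p * emeasure \<mu> {x\<in>space \<mu>. ennreal (s / 2) \<le> g1 x}
          \<le> (\<integral>\<^sup>+x\<in>UNIV. ennreal_powr (g1 x) p \<partial>\<mu>)"
        unfolding set_eq by (rule Markov) (auto simp: sets_borel)
      also have "\<dots> = (\<integral>\<^sup>+x. ennreal_powr (fnorm \<theta> (appl \<Phi>s) x) p \<partial>\<mu>)" by (simp add: g1_def)
      also have "\<dots> \<le> ennreal B * (\<integral>\<^sup>+x. ennreal_powr (fnorm \<tau> \<Phi>s x) p \<partial>\<mu>)"
        using st \<Phi>s by (simp add: strong_def)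
      also have "(\<integral>\<^sup>+x. ennreal_powr (fnorm \<tau> \<Phi>s x) p \<partial>\<mu>)
          \<le> (\<integral>\<^sup>+x. ennreal ((4 * beta 9 * s) powr (p - 1)) * (\<Sum>k\<in>I. ennreal (a k) * ennreal (w k x)) \<partial>\<mu>)"
      proof (intro nn_integral_mono)
        fix x
        define v where "v = (\<Sum>k\<in>I. a k * w k x)"
        have v0: "0 \<le> v" unfolding v_def using a w by (intro sum_nonneg) auto
        have "fnorm \<tau> \<Phi>s x \<le> (\<Sum>k\<in>I. fnorm \<tau> (\<Phi> k) x)"
          unfolding \<Phi>s_def using I \<Phi> by (intro fnorm_sum_le) auto
        also have "\<dots> \<le> (\<Sum>k\<in>I. ennreal (a k * w k x))" using \<Phi> by (intro sum_mono) auto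
        also have "\<dots> = ennreal v" unfolding v_def using a w by (intro sum_ennreal) auto
        finally have "ennreal_powr (fnorm \<tau> \<Phi>s x) p \<le> ennreal_powr (ennreal v) p"
          using p by (intro ennreal_powr_mono) auto
        also have "\<dots> = ennreal (v powr (p - 1) * v)"
          using v0 by (cases "v = 0") (auto simp: ennreal_powr_ennreal powr_diff)
        also have "\<dots> \<le> ennreal ((4 * beta 9 * s) powr (p - 1) * v)"
          using v0 w(6)[of x] p by (intro ennreal_leI mult_right_mono powr_mono2) (auto simp: v_def)
        also have "\<dots> = ennreal ((4 * beta 9 * s) powr (p - 1)) * (\<Sum>k\<in>I. ennreal (a k) * ennreal (w k x))"
          using v0 a w by (simp add: ennreal_mult' v_def sum_ennreal[symmetric] ennreal_mult)
        finally show "ennreal_powr (fnorm \<tau> \<Phi>s x) p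
            \<le> ennreal ((4 * beta 9 * s) powr (p - 1)) * (\<Sum>k\<in>I. ennreal (a k) * ennreal (w k x))" .
      qed
      also have "\<dots> = ennreal ((4 * beta 9 * s) powr (p - 1)) * (\<Sum>k\<in>I. \<integral>\<^sup>+x. ennreal (a k) * ennreal (w k x) \<partial>\<mu>)"
      proof -
        have [measurable]: "(\<lambda>x. ennreal (a k) * ennreal (w k x)) \<in> borel_measurable \<mu>" if "k \<in> I" for k
        proof -
          note [measurable] = w(1)[OF that]
          show ?thesis by measurable
        qed
        show ?thesis by (simp add: nn_integral_cmult nn_integral_sum)
      qed
      also have "(\<Sum>k\<in>I. \<integral>\<^sup>+x. ennreal (a k) * ennreal (w k x) \<partial>\<mu>) = ennreal (sum a I)"
        using a w by (simp add: nn_integral_cmult sum_ennreal)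
      also have "\<dots> \<le> I1" by (rule aI)
      finally have *: "ennreal_powr (ennreal (s / 2)) p * emeasure \<mu> {x\<in>space \<mu>. ennreal (s / 2) \<le> g1 x}
          \<le> ennreal B * (ennreal ((4 * beta 9 * s) powr (p - 1)) * I1)"
        by (simp add: mult_left_mono)
      have "ennreal s = ennreal (s * (2 / s) powr p) * ennreal_powr (ennreal (s / 2)) p"
        using s by (simp add: ennreal_powr_ennreal powr_divide flip: ennreal_mult)
      then have "ennreal s * emeasure \<mu> {x\<in>space \<mu>. ennreal (s / 2) \<le> g1 x}
         = ennreal (s * (2 / s) powr p) * (ennreal_powr (ennreal (s / 2)) p * emeasure \<mu> {x\<in>space \<mu>. ennreal (s / 2) \<le> g1 x})"
        by (simp add: mult.assoc)
      also have "\<dots> \<le> ennreal (s * (2 / s) powr p) * (ennreal B * (ennreal ((4 * beta 9 * s) powr (p - 1)) * I1))"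
        by (intro mult_left_mono *) simp
      also have "\<dots> = ennreal (2 powr p * B * (4 * beta 9) powr (p - 1)) * I1"
      proof -
        have eq: "s * (2 / s) powr p * (B * (4 * beta 9 * s) powr (p - 1)) = 2 powr p * B * (4 * beta 9) powr (p - 1)"
          using s b9 by (simp add: powr_divide powr_mult powr_diff field_simps)
        have "ennreal (s * (2 / s) powr p) * (ennreal B * (ennreal ((4 * beta 9 * s) powr (p - 1)) * I1))
            = ennreal (s * (2 / s) powr p * (B * (4 * beta 9 * s) powr (p - 1))) * I1"
          using B s by (simp add: ennreal_mult mult.assoc)
        then show ?thesis by (simp only: eq)
      qed
      finally show ?thesis .
    qed
    have M2: "ennreal s * emeasure \<mu> {x\<in>- E. ennreal (s / 2) \<le> g2 x} \<le> ennreal (2 * piece_const p B) * I1"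
    proof -
      have "ennreal (s / 2) * emeasure \<mu> {x\<in>- E. ennreal (s / 2) \<le> g2 x} \<le> (\<integral>\<^sup>+x\<in>- E. g2 x \<partial>\<mu>)"
        using E(1) by (intro Markov) (auto simp: Compl_eq_Diff_UNIV sets_borel)
      also have "\<dots> = (\<Sum>k\<in>I. \<integral>\<^sup>+x\<in>- E. fnorm \<theta> (appl (?Bk k)) x \<partial>\<mu>)"
      proof -
        have "(\<lambda>x. fnorm \<theta> (appl (?Bk k)) x * indicator (- E) x) \<in> borel_measurable \<mu>" if "k \<in> I" for k
        proof -
          note [measurable] = fnorm_appl_measurable[OF Bkn[OF that]]
          have "- E = space \<mu> - E" by auto
          then show ?thesis by simp
        qed
        then show ?thesis by (simp add: g2_def sum_distrib_right nn_integral_sum)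
      qed
      also have "\<dots> \<le> (\<Sum>k\<in>I. ennreal (piece_const p B * a k))" using \<Phi>(3) by (intro sum_mono) auto
      also have "\<dots> = ennreal (piece_const p B) * ennreal (sum a I)"
        using a piece_const_nonneg[of p B]
        by (simp add: sum_ennreal sum_distrib_left[symmetric] ennreal_mult sum_nonneg)
      also have "\<dots> \<le> ennreal (piece_const p B) * I1" by (intro mult_left_mono aI) simp
      finally have "2 * (ennreal (s / 2) * emeasure \<mu> {x\<in>- E. ennreal (s / 2) \<le> g2 x})
          \<le> 2 * (ennreal (piece_const p B) * I1)" by (rule mult_left_mono) simp
      moreover have "2 * ennreal (s / 2) = ennreal s" "2 * ennreal (piece_const p B) = ennreal (2 * piece_const p B)"
        using s piece_const_nonneg[of p B] by (simp_all flip: ennreal_numeral ennreal_mult)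
      ultimately show ?thesis by (simp add: mult.assoc[symmetric])
    qed
    have "?L \<subseteq> E \<union> {x\<in>space \<mu>. ennreal (s / 2) \<le> g1 x} \<union> {x\<in>- E. ennreal (s / 2) \<le> g2 x}"
    proof (rule subsetI, rule ccontr)
      fix x assume x: "x \<in> ?L" "x \<notin> E \<union> {x\<in>space \<mu>. ennreal (s / 2) \<le> g1 x} \<union> {x\<in>- E. ennreal (s / 2) \<le> g2 x}"
      then have "g1 x \<le> ennreal (s / 2)" "g2 x \<le> ennreal (s / 2)" by auto
      then have "g1 x + g2 x \<le> ennreal (s / 2) + ennreal (s / 2)" by (rule add_mono)
      also have "\<dots> = ennreal s" using s by (simp flip: ennreal_plus)
      finally show False using x(1) g12[of x] by auto
    qed
    moreover have S2: "{x\<in>- E. ennreal (s / 2) \<le> g2 x} \<in> sets \<mu>"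
    proof -
      have "{x\<in>- E. ennreal (s / 2) \<le> g2 x} = {x\<in>space \<mu>. ennreal (s / 2) \<le> g2 x} - E" by auto
      also have "\<dots> \<in> sets \<mu>" by measurable
      finally show ?thesis .
    qed
    moreover have S1: "{x\<in>space \<mu>. ennreal (s / 2) \<le> g1 x} \<in> sets \<mu>" by measurable
    ultimately have "emeasure \<mu> ?L \<le> emeasure \<mu> (E \<union> {x\<in>space \<mu>. ennreal (s / 2) \<le> g1 x}
        \<union> {x\<in>- E. ennreal (s / 2) \<le> g2 x})"
      using E(1) by (intro emeasure_mono sets.Un)
    also have "\<dots> \<le> emeasure \<mu> (E \<union> {x\<in>space \<mu>. ennreal (s / 2) \<le> g1 x})
        + emeasure \<mu> {x\<in>- E. ennreal (s / 2) \<le> g2 x}"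
      by (intro emeasure_subadditive sets.Un E(1) S1 S2)
    also have "\<dots> \<le> emeasure \<mu> E + emeasure \<mu> {x\<in>space \<mu>. ennreal (s / 2) \<le> g1 x}
        + emeasure \<mu> {x\<in>- E. ennreal (s / 2) \<le> g2 x}"
      by (intro add_right_mono emeasure_subadditive E(1) S1)
    finally have "ennreal s * emeasure \<mu> ?L \<le> ennreal s * (emeasure \<mu> E
        + emeasure \<mu> {x\<in>space \<mu>. ennreal (s / 2) \<le> g1 x}
        + emeasure \<mu> {x\<in>- E. ennreal (s / 2) \<le> g2 x})"
      by (rule mult_left_mono) simp
    also have "\<dots> = ennreal s * emeasure \<mu> E
        + ennreal s * emeasure \<mu> {x\<in>space \<mu>. ennreal (s / 2) \<le> g1 x}
        + ennreal s * emeasure \<mu> {x\<in>- E. ennreal (s / 2) \<le> g2 x}"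
      by (simp only: distrib_left)
    also have "\<dots> \<le> 1 * I1 + ennreal (2 powr p * B * (4 * beta 9) powr (p - 1)) * I1
        + ennreal (2 * piece_const p B) * I1"
      using order_trans[OF E(2) aI] by (intro add_mono M1 M2) simp
    also have "\<dots> = ennreal (weak_const p B) * I1"
    proof -
      have "ennreal (weak_const p B) = 1 + ennreal (2 powr p * B * (4 * beta 9) powr (p - 1)) + ennreal (2 * piece_const p B)"
        using B piece_const_nonneg[of p B] by (simp add: weak_const_def)
      then show ?thesis by (simp only: distrib_right)
    qed
    finally show ?thesis by (simp add: I1_def)
  qed
qed

end

section \<open>Interpolation and duality\<close>

lemma nn_integral_powr_from_0:
  assumes "0 < q" "0 \<le> (v::real)"
  shows "(\<integral>\<^sup>+s. ennreal (if 0 < s \<and> s < v then s powr (q - 1) else 0) \<partial>lborel) = ennreal (v powr q / q)"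
proof -
  have "((\<lambda>s. s powr (q - 1)) has_integral (v powr q / q)) {0..v}"
    using has_integral_powr_from_0[of "q - 1" v] assms by simp
  then have "(\<integral>\<^sup>+s. ennreal (indicator {0..v} s * s powr (q - 1)) \<partial>lborel) = ennreal (v powr q / q)"
    by (intro nn_integral_has_integral_lebesgue) auto
  moreover have "(\<integral>\<^sup>+s. ennreal (if 0 < s \<and> s < v then s powr (q - 1) else 0) \<partial>lborel)
      = (\<integral>\<^sup>+s. ennreal (indicator {0..v} s * s powr (q - 1)) \<partial>lborel)"
    using AE_lborel_singleton[of v] AE_lborel_singleton[of 0]
    by (intro nn_integral_cong_AE) (auto simp: indicator_def)
  ultimately show ?thesis by simp
qed

lemma nn_integral_powr_to_inf:
  assumes "0 < q" "0 < (u::real)"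
  shows "(\<integral>\<^sup>+s. ennreal (if u \<le> s then s powr (- q - 1) else 0) \<partial>lborel) = ennreal (u powr (- q) / q)"
proof -
  have "((\<lambda>s. s powr (- q - 1)) has_integral (u powr (- q) / q)) {u..}"
    using has_integral_powr_to_inf[of "- q - 1" u] assms by simp
  then have "(\<integral>\<^sup>+s. ennreal (indicator {u..} s * s powr (- q - 1)) \<partial>lborel) = ennreal (u powr (- q) / q)"
    by (intro nn_integral_has_integral_lebesgue) auto
  moreover have "(\<integral>\<^sup>+s. ennreal (if u \<le> s then s powr (- q - 1) else 0) \<partial>lborel)
      = (\<integral>\<^sup>+s. ennreal (indicator {u..} s * s powr (- q - 1)) \<partial>lborel)"
    by (intro nn_integral_cong) (auto simp: indicator_def)
  ultimately show ?thesis by simp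
qed

context kernel_op
begin

text \<open>At each height \<open>s\<close> the function is cut where its norm \<open>u\<close>
  exceeds \<open>s\<close>: the large part is estimated by weak type, the small part by strong type.
  Integration over \<open>s\<close> produces the integral of \<open>s powr (q - 2)\<close> up to
  \<open>u\<close> and that of \<open>s powr (q - p - 1)\<close> from \<open>u\<close> on, hence the
  denominators \<open>q - 1\<close> and \<open>p - q\<close>.\<close>

lemma interpolate:
  assumes W: "weak W" "0 \<le> W" and st: "strong p B" "0 \<le> B" and q: "1 < q" "q < p"
  shows "strong q (q * (2 * W / (q - 1) + 2 powr p * B / (p - q)))"
  unfolding strong_def
proof (intro allI impI)
  fix F :: "'a \<Rightarrow> 'c \<Rightarrow> complex" assume F: "test_function \<tau> F"
  define u where "u x = enn2real (fnorm \<tau> F x)" for x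
  define v where "v x = enn2real (fnorm \<theta> (appl F) x)" for x
  obtain m0 where m0: "0 \<le> m0" "\<And>x c. norm (F x c) \<le> m0" by (rule test_function_bound[OF F]) (rule that, auto)
  have m: "fnorm \<tau> F x \<le> ennreal (m0 * sqrt (measure \<tau> (space \<tau>)))" for x
    by (rule fnorm_le_bound[OF fin_\<tau>]) (rule m0(2))
  obtain m' where m': "\<And>x. fnorm \<theta> (appl F) x \<le> ennreal m'" by (rule fnorm_appl_bounded[OF F]) (rule that, auto)
  have u: "fnorm \<tau> F x = ennreal (u x)" "0 \<le> u x" for x
    unfolding u_def using le_less_trans[OF m ennreal_less_top, of x] by simp_all
  have v: "fnorm \<theta> (appl F) x = ennreal (v x)" "0 \<le> v x" for x
    unfolding v_def using le_less_trans[OF m' ennreal_less_top, of x] by simp_all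
  note [measurable] = fnorm_measurable[OF F fin_\<tau>] fnorm_appl_measurable[OF F]
  have [measurable]: "u \<in> borel_measurable \<mu>" "v \<in> borel_measurable \<mu>"
    unfolding u_def v_def by measurable
  interpret P: pair_sigma_finite \<mu> lborel ..
  \<comment> \<open>Layer-cake formula, by Tonelli.\<close>
  have lay: "(\<integral>\<^sup>+x. ennreal (v x powr q) \<partial>\<mu>)
      = (\<integral>\<^sup>+s. ennreal (if 0 < s then q * s powr (q - 1) else 0) * emeasure \<mu> {x. s < v x} \<partial>lborel)"
  proof -
    have "(\<integral>\<^sup>+x. ennreal (v x powr q) \<partial>\<mu>)
        = (\<integral>\<^sup>+x. (\<integral>\<^sup>+s. ennreal q * ennreal (if 0 < s \<and> s < v x then s powr (q - 1) else 0) \<partial>lborel) \<partial>\<mu>)"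
    proof (intro nn_integral_cong)
      fix x
      have "(\<integral>\<^sup>+s. ennreal q * ennreal (if 0 < s \<and> s < v x then s powr (q - 1) else 0) \<partial>lborel)
         = ennreal q * ennreal (v x powr q / q)"
        using q v(2)[of x] by (subst nn_integral_cmult) (auto simp: nn_integral_powr_from_0)
      then show "ennreal (v x powr q) = (\<integral>\<^sup>+s. ennreal q * ennreal (if 0 < s \<and> s < v x then s powr (q - 1) else 0) \<partial>lborel)"
        using q by (simp flip: ennreal_mult)
    qed
    also have "\<dots> = (\<integral>\<^sup>+s. (\<integral>\<^sup>+x. ennreal q * ennreal (if 0 < s \<and> s < v x then s powr (q - 1) else 0) \<partial>\<mu>) \<partial>lborel)"
      by (rule P.Fubini'[symmetric]) measurable
    also have "\<dots> = (\<integral>\<^sup>+s. ennreal (if 0 < s then q * s powr (q - 1) else 0) * emeasure \<mu> {x. s < v x} \<partial>lborel)"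
    proof (intro nn_integral_cong)
      fix s :: real
      have [measurable]: "{x. s < v x} \<in> sets \<mu>"
      proof -
        have "{x\<in>space \<mu>. s < v x} \<in> sets \<mu>" by measurable
        then show ?thesis by simp
      qed
      have "(\<integral>\<^sup>+x. ennreal q * ennreal (if 0 < s \<and> s < v x then s powr (q - 1) else 0) \<partial>\<mu>)
        = (\<integral>\<^sup>+x. ennreal (if 0 < s then q * s powr (q - 1) else 0) * indicator {x. s < v x} x \<partial>\<mu>)"
        using q by (intro nn_integral_cong) (auto simp: indicator_def ennreal_mult)
      then show "(\<integral>\<^sup>+x. ennreal q * ennreal (if 0 < s \<and> s < v x then s powr (q - 1) else 0) \<partial>\<mu>)
        = ennreal (if 0 < s then q * s powr (q - 1) else 0) * emeasure \<mu> {x. s < v x}"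
        by (simp add: nn_integral_cmult)
    qed
    finally show ?thesis .
  qed
  let ?I1 = "\<lambda>s. \<integral>\<^sup>+x. ennreal (if s < u x then u x else 0) \<partial>\<mu>"
  let ?I2 = "\<lambda>s. \<integral>\<^sup>+x. ennreal (if u x \<le> s then u x powr p else 0) \<partial>\<mu>"
  have key: "emeasure \<mu> {x. s < v x} \<le> ennreal (2 * W / s) * ?I1 s + ennreal ((2 / s) powr p * B) * ?I2 s"
    if s: "0 < s" for s
  proof -
    define S where "S = {x. s < u x}"
    have S[measurable]: "S \<in> sets \<mu>" "- S \<in> sets \<mu>"
    proof -
      have "{x\<in>space \<mu>. s < u x} \<in> sets \<mu>" "{x\<in>space \<mu>. \<not> s < u x} \<in> sets \<mu>" by measurable
      moreover have "- S = {x. \<not> s < u x}" by (auto simp: S_def)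
      ultimately show "S \<in> sets \<mu>" "- S \<in> sets \<mu>" by (simp_all add: S_def)
    qed
    define F1 where "F1 x c = indicator S x * F x c" for x c
    define F2 where "F2 x c = indicator (- S) x * F x c" for x c
    have nF: "test_function \<tau> F1" "test_function \<tau> F2" unfolding F1_def F2_def by (intro test_function_indicator F S)+
    have eq: "F = (\<lambda>x c. F1 x c + F2 x c)" by (intro ext) (simp add: F1_def F2_def indicator_def)
    \<comment> \<open>This abbreviation denotes a superlevel set; it is unrelated to the number
      \<open>reg_const\<close> of the regularity estimates.\<close>
    let ?reg_const = "{x. ennreal (s / 2) < fnorm \<theta> (appl F1) x}"
    let ?A2 = "{x\<in>UNIV. ennreal_powr (ennreal (s / 2)) p \<le> ennreal_powr (fnorm \<theta> (appl F2) x) p}"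
    note [measurable] = fnorm_appl_measurable[OF nF(1)] fnorm_appl_measurable[OF nF(2)]
    have sub: "{x. s < v x} \<subseteq> ?reg_const \<union> ?A2"
    proof (rule subsetI, rule ccontr)
      fix x assume x: "x \<in> {x. s < v x}" "x \<notin> ?reg_const \<union> ?A2"
      have "fnorm \<theta> (appl F1) x \<le> ennreal (s / 2)" "fnorm \<theta> (appl F2) x \<le> ennreal (s / 2)"
        using x q by (auto simp: ennreal_powr_le_iff)
      then have "fnorm \<theta> (appl F1) x + fnorm \<theta> (appl F2) x \<le> ennreal (s / 2) + ennreal (s / 2)" by (rule add_mono)
      also have "\<dots> = ennreal s" using s by (simp flip: ennreal_plus)
      finally have "fnorm \<theta> (appl (\<lambda>x c. F1 x c + F2 x c)) x \<le> ennreal s"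
        by (rule order_trans[OF fnorm_appl_add[OF nF]])
      then have "fnorm \<theta> (appl F) x \<le> ennreal s" by (simp only: eq[symmetric])
      then show False using x(1) v[of x] s by (simp add: ennreal_le_iff)
    qed
    have Am: "?reg_const \<in> sets \<mu>" "?A2 \<in> sets \<mu>"
    proof -
      have "{x\<in>space \<mu>. ennreal (s / 2) < fnorm \<theta> (appl F1) x} \<in> sets \<mu>"
        "{x\<in>space \<mu>. ennreal_powr (ennreal (s / 2)) p \<le> ennreal_powr (fnorm \<theta> (appl F2) x) p} \<in> sets \<mu>"
        by measurable
      then show "?reg_const \<in> sets \<mu>" "?A2 \<in> sets \<mu>" by simp_all
    qed
    have "emeasure \<mu> {x. s < v x} \<le> emeasure \<mu> (?reg_const \<union> ?A2)"
      using sub Am by (intro emeasure_mono) auto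
    also have "\<dots> \<le> emeasure \<mu> ?reg_const + emeasure \<mu> ?A2" by (intro emeasure_subadditive Am)
    also have "\<dots> \<le> ennreal (2 * W / s) * ?I1 s + ennreal ((2 / s) powr p * B) * ?I2 s"
    proof (rule add_mono)
      have "ennreal (s / 2) * emeasure \<mu> ?reg_const \<le> ennreal W * (\<integral>\<^sup>+x. fnorm \<tau> F1 x \<partial>\<mu>)"
        using W(1) nF(1) s by (simp add: weak_def)
      also have "(\<integral>\<^sup>+x. fnorm \<tau> F1 x \<partial>\<mu>) = ?I1 s"
        unfolding F1_def fnorm_indicator by (intro nn_integral_cong) (auto simp: S_def u indicator_def)
      finally have "ennreal (2 / s) * (ennreal (s / 2) * emeasure \<mu> ?reg_const) \<le> ennreal (2 / s) * (ennreal W * ?I1 s)"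
        by (rule mult_left_mono) simp
      moreover have "ennreal (2 / s) * (ennreal (s / 2) * emeasure \<mu> ?reg_const) = emeasure \<mu> ?reg_const"
        using s by (simp add: mult.assoc[symmetric] flip: ennreal_mult)
      moreover have "ennreal (2 / s) * (ennreal W * ?I1 s) = ennreal (2 * W / s) * ?I1 s"
        using s W(2) by (simp add: mult.assoc[symmetric] flip: ennreal_mult)
      ultimately show "emeasure \<mu> ?reg_const \<le> ennreal (2 * W / s) * ?I1 s" by simp
    next
      have "ennreal_powr (ennreal (s / 2)) p * emeasure \<mu> ?A2
          \<le> (\<integral>\<^sup>+x\<in>UNIV. ennreal_powr (fnorm \<theta> (appl F2) x) p \<partial>\<mu>)"
        by (rule Markov) (auto simp: sets_borel)
      also have "\<dots> \<le> ennreal B * (\<integral>\<^sup>+x. ennreal_powr (fnorm \<tau> F2 x) p \<partial>\<mu>)"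
        using st(1) nF(2) by (simp add: strong_def)
      also have "(\<integral>\<^sup>+x. ennreal_powr (fnorm \<tau> F2 x) p \<partial>\<mu>) = ?I2 s"
        unfolding F2_def fnorm_indicator
        by (intro nn_integral_cong) (auto simp: S_def u indicator_def ennreal_powr_ennreal)
      finally have "ennreal ((2 / s) powr p) * (ennreal_powr (ennreal (s / 2)) p * emeasure \<mu> ?A2)
          \<le> ennreal ((2 / s) powr p) * (ennreal B * ?I2 s)"
        by (rule mult_left_mono) simp
      moreover have "ennreal ((2 / s) powr p) * ennreal_powr (ennreal (s / 2)) p = 1"
        using s by (simp add: ennreal_powr_ennreal powr_divide flip: ennreal_mult)
      then have "ennreal ((2 / s) powr p) * (ennreal_powr (ennreal (s / 2)) p * emeasure \<mu> ?A2) = emeasure \<mu> ?A2"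
        by (simp add: mult.assoc[symmetric])
      moreover have "ennreal ((2 / s) powr p) * (ennreal B * ?I2 s) = ennreal ((2 / s) powr p * B) * ?I2 s"
        using st(2) by (simp add: ennreal_mult mult.assoc)
      ultimately show "emeasure \<mu> ?A2 \<le> ennreal ((2 / s) powr p * B) * ?I2 s" by simp
    qed
    finally show ?thesis .
  qed
  define k1 where "k1 = 2 * W * q"
  define k2 where "k2 = 2 powr p * B * q"
  have k: "0 \<le> k1" "0 \<le> k2" using W(2) st(2) q by (auto simp: k1_def k2_def)
  have "(\<integral>\<^sup>+x. ennreal_powr (fnorm \<theta> (appl F) x) q \<partial>\<mu>) = (\<integral>\<^sup>+x. ennreal (v x powr q) \<partial>\<mu>)"
    by (intro nn_integral_cong) (simp add: v ennreal_powr_ennreal)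
  also have "\<dots> = (\<integral>\<^sup>+s. ennreal (if 0 < s then q * s powr (q - 1) else 0) * emeasure \<mu> {x. s < v x} \<partial>lborel)"
    by (rule lay)
  also have "\<dots> \<le> (\<integral>\<^sup>+s. (\<integral>\<^sup>+x. ennreal (k1 * u x) * ennreal (if 0 < s \<and> s < u x then s powr ((q - 1) - 1) else 0)
       + ennreal (k2 * u x powr p) * ennreal (if 0 < s \<and> u x \<le> s then s powr (- (p - q) - 1) else 0) \<partial>\<mu>) \<partial>lborel)"
  proof (intro nn_integral_mono)
    fix s :: real
    show "ennreal (if 0 < s then q * s powr (q - 1) else 0) * emeasure \<mu> {x. s < v x}
      \<le> (\<integral>\<^sup>+x. ennreal (k1 * u x) * ennreal (if 0 < s \<and> s < u x then s powr ((q - 1) - 1) else 0)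
       + ennreal (k2 * u x powr p) * ennreal (if 0 < s \<and> u x \<le> s then s powr (- (p - q) - 1) else 0) \<partial>\<mu>)"
    proof (cases "0 < s")
      case True
      have e1: "q * s powr (q - 1) * (2 * W / s) = k1 * s powr ((q - 1) - 1)"
        using True by (simp add: k1_def powr_diff power2_eq_square)
      have e2: "q * s powr (q - 1) * ((2 / s) powr p * B) = k2 * s powr (- (p - q) - 1)"
        using True by (simp add: k2_def powr_diff powr_minus powr_divide powr_add field_simps)
      have "ennreal (q * s powr (q - 1)) * emeasure \<mu> {x. s < v x}
          \<le> ennreal (q * s powr (q - 1)) * (ennreal (2 * W / s) * ?I1 s + ennreal ((2 / s) powr p * B) * ?I2 s)"
        by (intro mult_left_mono key True) simp
      also have "\<dots> = ennreal (q * s powr (q - 1) * (2 * W / s)) * ?I1 s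
          + ennreal (q * s powr (q - 1) * ((2 / s) powr p * B)) * ?I2 s"
      proof -
        have "ennreal (q * s powr (q - 1) * (2 * W / s)) = ennreal (q * s powr (q - 1)) * ennreal (2 * W / s)"
          "ennreal (q * s powr (q - 1) * ((2 / s) powr p * B)) = ennreal (q * s powr (q - 1)) * ennreal ((2 / s) powr p * B)"
          by (rule ennreal_mult; use q W(2) st(2) True in simp)+
        then show ?thesis by (simp only: distrib_left mult.assoc)
      qed
      also have "\<dots> = (\<integral>\<^sup>+x. ennreal (k1 * s powr ((q - 1) - 1)) * ennreal (if s < u x then u x else 0)
          + ennreal (k2 * s powr (- (p - q) - 1)) * ennreal (if u x \<le> s then u x powr p else 0) \<partial>\<mu>)"
        unfolding e1 e2 by (simp add: nn_integral_add nn_integral_cmult)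
      also have "\<dots> = (\<integral>\<^sup>+x. ennreal (k1 * u x) * ennreal (if 0 < s \<and> s < u x then s powr ((q - 1) - 1) else 0)
       + ennreal (k2 * u x powr p) * ennreal (if 0 < s \<and> u x \<le> s then s powr (- (p - q) - 1) else 0) \<partial>\<mu>)"
        using True k u(2) by (intro nn_integral_cong) (auto simp: ac_simps simp flip: ennreal_mult)
      finally show ?thesis using True by simp
    qed simp
  qed
  also have "\<dots> = (\<integral>\<^sup>+x. (\<integral>\<^sup>+s. ennreal (k1 * u x) * ennreal (if 0 < s \<and> s < u x then s powr ((q - 1) - 1) else 0)
       + ennreal (k2 * u x powr p) * ennreal (if 0 < s \<and> u x \<le> s then s powr (- (p - q) - 1) else 0) \<partial>lborel) \<partial>\<mu>)"
    by (rule P.Fubini') measurable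
  also have "\<dots> \<le> (\<integral>\<^sup>+x. ennreal (k1 / (q - 1) + k2 / (p - q)) * ennreal (u x powr q) \<partial>\<mu>)"
  proof (intro nn_integral_mono)
    fix x
    show "(\<integral>\<^sup>+s. ennreal (k1 * u x) * ennreal (if 0 < s \<and> s < u x then s powr ((q - 1) - 1) else 0)
       + ennreal (k2 * u x powr p) * ennreal (if 0 < s \<and> u x \<le> s then s powr (- (p - q) - 1) else 0) \<partial>lborel)
       \<le> ennreal (k1 / (q - 1) + k2 / (p - q)) * ennreal (u x powr q)"
    proof (cases "u x = 0")
      case False
      then have ux: "0 < u x" using u(2)[of x] by simp
      have "(\<integral>\<^sup>+s. ennreal (k1 * u x) * ennreal (if 0 < s \<and> s < u x then s powr ((q - 1) - 1) else 0)
       + ennreal (k2 * u x powr p) * ennreal (if 0 < s \<and> u x \<le> s then s powr (- (p - q) - 1) else 0) \<partial>lborel)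
       = ennreal (k1 * u x) * (\<integral>\<^sup>+s. ennreal (if 0 < s \<and> s < u x then s powr ((q - 1) - 1) else 0) \<partial>lborel)
       + ennreal (k2 * u x powr p) * (\<integral>\<^sup>+s. ennreal (if 0 < s \<and> u x \<le> s then s powr (- (p - q) - 1) else 0) \<partial>lborel)"
        by (simp add: nn_integral_add nn_integral_cmult)
      also have "\<dots> = ennreal (k1 * u x) * ennreal (u x powr (q - 1) / (q - 1))
        + ennreal (k2 * u x powr p) * ennreal (u x powr (- (p - q)) / (p - q))"
      proof -
        have "(\<lambda>s. ennreal (if 0 < s \<and> u x \<le> s then s powr (- (p - q) - 1) else 0))
           = (\<lambda>s. ennreal (if u x \<le> s then s powr (- (p - q) - 1) else 0))"
          using ux by auto
        then show ?thesis
          using q ux nn_integral_powr_from_0[of "q - 1" "u x"] nn_integral_powr_to_inf[of "p - q" "u x"] by simp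
      qed
      also have "\<dots> = ennreal ((k1 / (q - 1) + k2 / (p - q)) * u x powr q)"
      proof -
        have 1: "u x * u x powr (q - 1) = u x powr q" using ux by (simp add: powr_diff)
        have 2: "u x powr p * u x powr (- (p - q)) = u x powr q" using ux by (simp flip: powr_add)
        have "k1 * u x * (u x powr (q - 1) / (q - 1)) + k2 * u x powr p * (u x powr (- (p - q)) / (p - q))
          = k1 / (q - 1) * (u x * u x powr (q - 1)) + k2 / (p - q) * (u x powr p * u x powr (- (p - q)))"
          by simp
        also have "\<dots> = (k1 / (q - 1) + k2 / (p - q)) * u x powr q"
          unfolding 1 2 by (simp only: distrib_right)
        finally have "k1 * u x * (u x powr (q - 1) / (q - 1)) + k2 * u x powr p * (u x powr (- (p - q)) / (p - q))
          = (k1 / (q - 1) + k2 / (p - q)) * u x powr q" .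
        then show ?thesis using k q ux by (simp flip: ennreal_mult ennreal_plus)
      qed
      finally show ?thesis using k q by (simp add: ennreal_mult)
    qed (use q in simp)
  qed
  also have "\<dots> = ennreal (k1 / (q - 1) + k2 / (p - q)) * (\<integral>\<^sup>+x. ennreal_powr (fnorm \<tau> F x) q \<partial>\<mu>)"
    by (subst nn_integral_cmult) (auto simp: u ennreal_powr_ennreal)
  also have "k1 / (q - 1) + k2 / (p - q) = q * (2 * W / (q - 1) + 2 powr p * B / (p - q))"
    by (simp add: k1_def k2_def algebra_simps)
  finally show "(\<integral>\<^sup>+x. ennreal_powr (fnorm \<theta> (appl F) x) q \<partial>\<mu>)
    \<le> ennreal (q * (2 * W / (q - 1) + 2 powr p * B / (p - q))) * (\<integral>\<^sup>+x. ennreal_powr (fnorm \<tau> F x) q \<partial>\<mu>)" .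
qed

section \<open>Transposition and duality\<close>

lemma transpose: "kernel_op \<mu> lam Clam N0 \<theta> \<tau> (\<lambda>y c x d. H x d y c)"
proof (intro kernel_op.intro nonhomogeneous_space_axioms kernel_op_axioms.intro fin_\<tau> fin_\<theta> space_\<tau> space_\<theta>
    H_bounded H_bounded' H_fin H_fin')
  show "(\<lambda>w. H (fst (snd w)) (snd (snd w)) (fst (fst w)) (snd (fst w)))
     \<in> borel_measurable ((\<mu> \<Otimes>\<^sub>M \<tau>) \<Otimes>\<^sub>M (\<mu> \<Otimes>\<^sub>M \<theta>))"
    by measurable
qed

text \<open>Fubini for the bilinear pairing, without conjugation. Absolute convergence follows from
  the bounded support of \<open>G\<close>, the finiteness of \<open>\<theta>\<close> and the bound
  \<open>H_bounded\<close>.\<close>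

lemma duality_pairing:
  assumes F: "test_function \<tau> F" and G: "test_function \<theta> G"
  shows "(\<integral>w. G (fst w) (snd w) * appl F (fst w) (snd w) \<partial>(\<mu> \<Otimes>\<^sub>M \<theta>))
    = (\<integral>v. kernel_op.appl \<mu> \<theta> (\<lambda>y c x d. H x d y c) G (fst v) (snd v) * F (fst v) (snd v) \<partial>(\<mu> \<Otimes>\<^sub>M \<tau>))"
proof -
  interpret T': kernel_op \<mu> lam Clam N0 \<theta> \<tau> "\<lambda>y c x d. H x d y c" by (rule transpose)
  interpret P: pair_sigma_finite "\<mu> \<Otimes>\<^sub>M \<theta>" "\<mu> \<Otimes>\<^sub>M \<tau>" ..
  note [measurable] = test_functionD_measurable[OF F] test_functionD_measurable[OF G]
  obtain m where m: "0 \<le> m" "\<And>x c. norm (F x c) \<le> m" by (rule test_function_bound[OF F]) (rule that, auto)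
  obtain k where k: "0 \<le> k" "\<And>x c. norm (G x c) \<le> k" by (rule test_function_bound[OF G]) (rule that, auto)
  obtain z r where z: "\<And>x c. x \<notin> ball z r \<Longrightarrow> G x c = 0" by (rule test_function_support[OF G]) (rule that, auto)
  obtain M where M: "\<forall>x d. (\<integral>\<^sup>+v. ennreal (norm (H x d (fst v) (snd v))) \<partial>(\<mu> \<Otimes>\<^sub>M \<tau>)) \<le> ennreal M"
    using H_bounded by blast
  let ?f = "\<lambda>w v. G (fst w) (snd w) * (H (fst w) (snd w) (fst v) (snd v) * F (fst v) (snd v))"
  have int: "integrable ((\<mu> \<Otimes>\<^sub>M \<theta>) \<Otimes>\<^sub>M (\<mu> \<Otimes>\<^sub>M \<tau>)) (\<lambda>(w, v). ?f w v)"
  proof (rule integrableI_bounded)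
    have "(\<integral>\<^sup>+x. ennreal (norm (case x of (w, v) \<Rightarrow> ?f w v)) \<partial>((\<mu> \<Otimes>\<^sub>M \<theta>) \<Otimes>\<^sub>M (\<mu> \<Otimes>\<^sub>M \<tau>)))
        = (\<integral>\<^sup>+w. \<integral>\<^sup>+v. ennreal (norm (G (fst w) (snd w))) * ennreal (norm (H (fst w) (snd w) (fst v) (snd v) * F (fst v) (snd v))) \<partial>(\<mu> \<Otimes>\<^sub>M \<tau>) \<partial>(\<mu> \<Otimes>\<^sub>M \<theta>))"
      by (subst MT.nn_integral_fst[symmetric]) (auto simp: split_beta norm_mult ennreal_mult)
    also have "\<dots> \<le> (\<integral>\<^sup>+w. (ennreal k * (ennreal m * ennreal M)) * indicator (ball z r) (fst w) \<partial>(\<mu> \<Otimes>\<^sub>M \<theta>))"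
    proof (intro nn_integral_mono)
      fix w
      have "(\<integral>\<^sup>+v. ennreal (norm (G (fst w) (snd w))) * ennreal (norm (H (fst w) (snd w) (fst v) (snd v) * F (fst v) (snd v))) \<partial>(\<mu> \<Otimes>\<^sub>M \<tau>))
          = ennreal (norm (G (fst w) (snd w))) * (\<integral>\<^sup>+v. ennreal (norm (H (fst w) (snd w) (fst v) (snd v) * F (fst v) (snd v))) \<partial>(\<mu> \<Otimes>\<^sub>M \<tau>))"
        by (rule nn_integral_cmult) measurable
      also have "\<dots> \<le> (ennreal k * indicator (ball z r) (fst w)) * (ennreal m * ennreal M)"
      proof (rule mult_mono)
        show "ennreal (norm (G (fst w) (snd w))) \<le> ennreal k * indicator (ball z r) (fst w)"
          using k z[of "fst w" "snd w"] by (cases "fst w \<in> ball z r") (auto intro: ennreal_leI)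
        show "(\<integral>\<^sup>+v. ennreal (norm (H (fst w) (snd w) (fst v) (snd v) * F (fst v) (snd v))) \<partial>(\<mu> \<Otimes>\<^sub>M \<tau>)) \<le> ennreal m * ennreal M"
          by (rule nn_integral_appl_le) (use m M in auto)
      qed auto
      finally show "(\<integral>\<^sup>+v. ennreal (norm (G (fst w) (snd w))) * ennreal (norm (H (fst w) (snd w) (fst v) (snd v) * F (fst v) (snd v))) \<partial>(\<mu> \<Otimes>\<^sub>M \<tau>))
        \<le> (ennreal k * (ennreal m * ennreal M)) * indicator (ball z r) (fst w)" by (simp add: ac_simps)
    qed
    also have "\<dots> = (\<integral>\<^sup>+x. \<integral>\<^sup>+d. (ennreal k * (ennreal m * ennreal M)) * indicator (ball z r) x \<partial>\<theta> \<partial>\<mu>)"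
      by (subst D.nn_integral_fst[symmetric]) auto
    also have "\<dots> = (ennreal k * (ennreal m * ennreal M)) * emeasure \<theta> UNIV * emeasure \<mu> (ball z r)"
      by (simp add: nn_integral_cmult nn_integral_multc ac_simps)
    also have "\<dots> < \<infinity>"
    proof -
      have "emeasure \<theta> UNIV < top" using D.emeasure_finite[of UNIV] by (simp add: less_top[symmetric])
      then show ?thesis by (simp add: ennreal_mult_less_top)
    qed
    finally show "(\<integral>\<^sup>+x. ennreal (norm (case x of (w, v) \<Rightarrow> ?f w v)) \<partial>((\<mu> \<Otimes>\<^sub>M \<theta>) \<Otimes>\<^sub>M (\<mu> \<Otimes>\<^sub>M \<tau>))) < \<infinity>" .
  qed (unfold split_beta, measurable)
  have "(\<integral>w. G (fst w) (snd w) * appl F (fst w) (snd w) \<partial>(\<mu> \<Otimes>\<^sub>M \<theta>)) = (\<integral>w. \<integral>v. ?f w v \<partial>(\<mu> \<Otimes>\<^sub>M \<tau>) \<partial>(\<mu> \<Otimes>\<^sub>M \<theta>))"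
    using integrable_appl[OF F] by (intro Bochner_Integration.integral_cong refl) (simp add: appl_def)
  also have "\<dots> = (\<integral>v. \<integral>w. ?f w v \<partial>(\<mu> \<Otimes>\<^sub>M \<theta>) \<partial>(\<mu> \<Otimes>\<^sub>M \<tau>))"
    by (rule P.Fubini_integral[symmetric, OF int])
  also have "\<dots> = (\<integral>v. T'.appl G (fst v) (snd v) * F (fst v) (snd v) \<partial>(\<mu> \<Otimes>\<^sub>M \<tau>))"
    using T'.integrable_appl[OF G]
    by (intro Bochner_Integration.integral_cong refl) (simp add: T'.appl_def ac_simps flip: integral_mult_left_zero)
  finally show ?thesis .
qed

lemma pairing_bound:
  assumes F: "test_function \<tau> F" and G: "test_function \<theta> G" and st: "strong p B" and pq: "1 < p" "1 < q" "1 / p + 1 / q = 1"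
  shows "ennreal (norm (\<integral>w. G (fst w) (snd w) * appl F (fst w) (snd w) \<partial>(\<mu> \<Otimes>\<^sub>M \<theta>)))
    \<le> ennreal_powr (\<integral>\<^sup>+x. ennreal_powr (fnorm \<theta> G x) q \<partial>\<mu>) (1 / q)
      * ennreal_powr (ennreal B * (\<integral>\<^sup>+x. ennreal_powr (fnorm \<tau> F x) p \<partial>\<mu>)) (1 / p)"
proof -
  note [measurable] = test_functionD_measurable[OF F] test_functionD_measurable[OF G] appl_measurable[OF F]
     fnorm_appl_measurable[OF F] fnorm_measurable[OF G fin_\<theta>] appl_sect[OF F] test_function_sect[OF G]
  have "ennreal (norm (\<integral>w. G (fst w) (snd w) * appl F (fst w) (snd w) \<partial>(\<mu> \<Otimes>\<^sub>M \<theta>)))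
      \<le> (\<integral>\<^sup>+w. ennreal (norm (G (fst w) (snd w) * appl F (fst w) (snd w))) \<partial>(\<mu> \<Otimes>\<^sub>M \<theta>))"
    by (rule norm_integral_le_nn_integral)
  also have "\<dots> = (\<integral>\<^sup>+x. \<integral>\<^sup>+d. ennreal (norm (G x d)) * ennreal (norm (appl F x d)) \<partial>\<theta> \<partial>\<mu>)"
    by (subst D.nn_integral_fst[symmetric]) (auto simp: norm_mult ennreal_mult)
  also have "\<dots> \<le> (\<integral>\<^sup>+x. fnorm \<theta> G x * fnorm \<theta> (appl F) x \<partial>\<mu>)"
    by (intro nn_integral_mono L2_Cauchy_Schwarz) auto
  also have "\<dots> \<le> ennreal_powr (\<integral>\<^sup>+x. ennreal_powr (fnorm \<theta> G x) q \<partial>\<mu>) (1 / q)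
      * ennreal_powr (\<integral>\<^sup>+x. ennreal_powr (fnorm \<theta> (appl F) x) p \<partial>\<mu>) (1 / p)"
    using pq by (intro Holder_nn_integral) auto
  also have "\<dots> \<le> ennreal_powr (\<integral>\<^sup>+x. ennreal_powr (fnorm \<theta> G x) q \<partial>\<mu>) (1 / q)
      * ennreal_powr (ennreal B * (\<integral>\<^sup>+x. ennreal_powr (fnorm \<tau> F x) p \<partial>\<mu>)) (1 / p)"
    using st F pq unfolding strong_def by (intro mult_left_mono ennreal_powr_mono) auto
  finally show ?thesis .
qed

text \<open>The transposed image \<open>g\<close> of \<open>G\<close> is tested against its own
  extremal function, so that no description of the dual of a vector-valued \<open>L\<^sup>p\<close>
  space is involved. Both operators have norm at most \<open>B powr (1 / p)\<close>; its
  \<open>q\<close>-th power is the constant.\<close>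

lemma duality:
  assumes st: "strong p B" "0 \<le> B" and pq: "1 < p" "1 < q" "1 / p + 1 / q = 1"
  shows "kernel_op.strong \<mu> \<theta> \<tau> (\<lambda>y c x d. H x d y c) q (B powr (q / p))"
proof -
  interpret T': kernel_op \<mu> lam Clam N0 \<theta> \<tau> "\<lambda>y c x d. H x d y c" by (rule transpose)
  show ?thesis
    unfolding T'.strong_def
  proof (intro allI impI)
    fix G :: "'a \<Rightarrow> 'd \<Rightarrow> complex" assume G: "test_function \<theta> G"
    define g where "g = T'.appl G"
    define v where "v y = enn2real (fnorm \<tau> g y)" for y
    obtain V where "\<forall>y. fnorm \<tau> (T'.appl G) y \<le> ennreal V"
      by (rule T'.fnorm_appl_bounded[OF G]) auto
    then have V: "fnorm \<tau> g y \<le> ennreal V" for y by (simp add: g_def)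
    have v: "fnorm \<tau> g y = ennreal (v y)" "0 \<le> v y" for y
      unfolding v_def using le_less_trans[OF V ennreal_less_top, of y] by simp_all
    obtain m where m: "\<And>y c. norm (g y c) \<le> m" using T'.appl_bounded[OF G] unfolding g_def by blast
    have m0: "0 \<le> m" using order_trans[OF norm_ge_zero m] .
    have [measurable]: "v \<in> borel_measurable \<mu>" unfolding v_def g_def using T'.fnorm_appl_measurable[OF G] by measurable
    have [measurable]: "(\<lambda>w. g (fst w) (snd w)) \<in> borel_measurable (\<mu> \<Otimes>\<^sub>M \<tau>)"
      unfolding g_def by (rule T'.appl_measurable[OF G])
    have [measurable]: "g y \<in> borel_measurable \<tau>" for y unfolding g_def by (rule T'.appl_sect[OF G])
    fix o1 :: 'a
    \<comment> \<open>The ball gives the extremal function bounded support. The lower bound on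
      \<open>v\<close> keeps \<open>v powr (q - 2)\<close> bounded when \<open>q < 2\<close>; an
      upper bound on \<open>v\<close> is already available.\<close>
    define Y where "Y n = {y. dist o1 y < real n \<and> 1 / real n < v y}" for n :: nat
    have [measurable]: "(\<lambda>y. dist o1 y) \<in> borel_measurable \<mu>" by measurable
    have Y[measurable]: "Y n \<in> sets \<mu>" for n
    proof -
      have "{y\<in>space \<mu>. dist o1 y < real n \<and> 1 / real n < v y} \<in> sets \<mu>" by measurable
      then show ?thesis by (simp add: Y_def)
    qed
    let ?N = "\<integral>\<^sup>+x. ennreal_powr (fnorm \<theta> G x) q \<partial>\<mu>"
    have step: "(\<integral>\<^sup>+y\<in>Y n. ennreal (v y powr q) \<partial>\<mu>) \<le> ennreal (B powr (q / p)) * ?N" for n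
    proof -
      define J where "J = (\<integral>\<^sup>+y\<in>Y n. ennreal (v y powr q) \<partial>\<mu>)"
      \<comment> \<open>\<open>F\<close> is \<open>cnj g\<close> times the power
        \<open>q - 2\<close> of the norm \<open>v\<close> of \<open>g\<close>. Hence
        \<open>g * F\<close> integrates to \<open>J\<close>, and since
        \<open>(q - 1) * p = q\<close>, so does the \<open>p\<close>-th power of the norm of
        \<open>F\<close>.\<close>
      define h where "h y = indicator (Y n) y * v y powr (q - 2)" for y
      define F where "F y c = cnj (g y c) * complex_of_real (h y)" for y c
      have h0: "0 \<le> h y" for y by (simp add: h_def)
      have vV: "v y \<le> max V 0" for y using V[of y] v[of y] by (cases "0 \<le> V") (auto simp: ennreal_neg)
      have hb: "h y \<le> (1 / real n) powr (q - 2) + max V 0 powr (q - 2)" for y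
      proof (cases "y \<in> Y n")
        case True
        then have n: "0 < real n" "1 / real n < v y" unfolding Y_def using zero_le_dist[of o1 y]
          by (auto simp del: zero_le_dist)
        show ?thesis
        proof (cases "2 \<le> q")
          case True
          then have "v y powr (q - 2) \<le> max V 0 powr (q - 2)" using v(2) vV by (intro powr_mono2) auto
          then show ?thesis by (simp add: h_def indicator_def add_increasing)
        next
          case False
          then have "v y powr (q - 2) \<le> (1 / real n) powr (q - 2)" using n by (intro powr_mono2') auto
          then show ?thesis by (simp add: h_def indicator_def add_increasing2)
        qed
      qed (simp add: h_def)
      have [measurable]: "h \<in> borel_measurable \<mu>" unfolding h_def by measurable
      have [measurable]: "cnj \<in> borel_measurable borel" "complex_of_real \<in> borel_measurable borel"
        by (intro borel_measurable_continuous_onI continuous_intros)+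
      have F: "test_function \<tau> F"
      proof (rule test_functionI[where z=o1 and r="real n"])
        show "(\<lambda>v. F (fst v) (snd v)) \<in> borel_measurable (\<mu> \<Otimes>\<^sub>M \<tau>)" unfolding F_def by measurable
        show "norm (F x c) \<le> m * ((1 / real n) powr (q - 2) + max V 0 powr (q - 2))" for x c
          unfolding F_def norm_mult using m[of x c] hb[of x] h0[of x] m0 by (intro mult_mono) auto
        show "F x c = 0" if "x \<notin> ball o1 (real n)" for x c
          using that by (auto simp: F_def h_def Y_def indicator_def)
      qed
      have gF: "g y c * F y c = complex_of_real ((norm (g y c))\<^sup>2 * h y)" for y c
        by (simp add: F_def complex_norm_square[symmetric] mult.assoc[symmetric])
      have vh: "ennreal (h y) * (fnorm \<tau> g y)\<^sup>2 = ennreal (v y powr q) * indicator (Y n) y" for y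
      proof (cases "y \<in> Y n")
        case True
        then have "0 < v y" unfolding Y_def by (auto intro: le_less_trans[rotated])
        then have "v y powr (q - 2) * (v y)\<^sup>2 = v y powr q"
          by (simp add: powr_diff powr_numeral)
        then show ?thesis using True v(2)[of y] h0[of y]
          by (simp add: v(1) h_def ennreal_power flip: ennreal_mult)
      qed (simp add: h_def)
      have J1: "J = (\<integral>\<^sup>+u. ennreal ((norm (g (fst u) (snd u)))\<^sup>2 * h (fst u)) \<partial>(\<mu> \<Otimes>\<^sub>M \<tau>))"
      proof -
        have "(\<integral>\<^sup>+u. ennreal ((norm (g (fst u) (snd u)))\<^sup>2 * h (fst u)) \<partial>(\<mu> \<Otimes>\<^sub>M \<tau>))
           = (\<integral>\<^sup>+y. \<integral>\<^sup>+c. ennreal (h y) * (ennreal (norm (g y c)))\<^sup>2 \<partial>\<tau> \<partial>\<mu>)"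
          using h0 by (subst T.nn_integral_fst[symmetric]) (auto simp: ennreal_mult ennreal_power mult.commute)
        also have "\<dots> = (\<integral>\<^sup>+y. ennreal (h y) * (fnorm \<tau> g y)\<^sup>2 \<partial>\<mu>)"
          by (intro nn_integral_cong) (simp add: nn_integral_cmult L2_square)
        also have "\<dots> = J" unfolding J_def vh ..
        finally show ?thesis by simp
      qed
      have Jfin: "J < top"
      proof -
        have "J \<le> (\<integral>\<^sup>+y. ennreal (max V 0 powr q) * indicator (ball o1 (real n)) y \<partial>\<mu>)"
          unfolding J_def using vV v(2) pq
          by (intro nn_integral_mono) (auto simp: indicator_def Y_def intro!: ennreal_leI powr_mono2)
        also have "\<dots> < top" by (simp add: nn_integral_cmult ennreal_mult_less_top)
        finally show ?thesis .
      qed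
      have J2: "J = ennreal (norm (\<integral>u. g (fst u) (snd u) * F (fst u) (snd u) \<partial>(\<mu> \<Otimes>\<^sub>M \<tau>)))"
      proof -
        have "(\<integral>u. g (fst u) (snd u) * F (fst u) (snd u) \<partial>(\<mu> \<Otimes>\<^sub>M \<tau>))
           = complex_of_real (\<integral>u. (norm (g (fst u) (snd u)))\<^sup>2 * h (fst u) \<partial>(\<mu> \<Otimes>\<^sub>M \<tau>))"
          unfolding gF by (rule integral_complex_of_real)
        moreover have "(\<integral>u. (norm (g (fst u) (snd u)))\<^sup>2 * h (fst u) \<partial>(\<mu> \<Otimes>\<^sub>M \<tau>)) = enn2real J"
          unfolding J1 using h0 by (intro integral_eq_nn_integral) auto
        ultimately show ?thesis using Jfin by simp
      qed
      have F2: "(\<integral>\<^sup>+y. ennreal_powr (fnorm \<tau> F y) p \<partial>\<mu>) = J"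
        unfolding J_def
      proof (intro nn_integral_cong)
        fix y
        have "fnorm \<tau> F y = L2 \<tau> (\<lambda>c. ennreal (norm (g y c)) * ennreal (h y))"
          using h0 by (intro L2_cong) (simp add: F_def norm_mult ennreal_mult)
        also have "\<dots> = ennreal (v y) * ennreal (h y)" by (simp add: L2_multc v)
        finally have Fy: "fnorm \<tau> F y = ennreal (v y * h y)" using v h0 by (simp add: ennreal_mult)
        show "ennreal_powr (fnorm \<tau> F y) p = ennreal (v y powr q) * indicator (Y n) y"
        proof (cases "y \<in> Y n")
          case True
          then have v0: "0 < v y" unfolding Y_def by (auto intro: le_less_trans[rotated])
          have "v y * h y = v y powr (q - 1)"
            using True v0 by (simp add: h_def powr_mult_base)
          moreover have "(q - 1) * p = q" using pq by (simp add: field_simps)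
          ultimately show ?thesis using True v0 by (simp add: Fy ennreal_powr_ennreal powr_powr)
        qed (simp add: Fy h_def)
      qed
      have "J \<le> ennreal_powr ?N (1 / q) * ennreal_powr (ennreal B * J) (1 / p)"
        using pairing_bound[OF F G st(1) pq]
        unfolding duality_pairing[OF F G] F2 g_def[symmetric] J2[symmetric] .
      also have "ennreal_powr (ennreal B * J) (1 / p) = ennreal_powr (ennreal B) (1 / p) * ennreal_powr J (1 / p)"
        using pq by (intro ennreal_powr_mult) auto
      finally have JJ: "J \<le> ennreal_powr ?N (1 / q) * ennreal_powr (ennreal B) (1 / p) * ennreal_powr J (1 / p)"
        by (simp add: mult.assoc)
      \<comment> \<open>Cancelling the power \<open>1 / p\<close> of \<open>J\<close> on both sides
        is legitimate because the restriction to \<open>Y n\<close> makes \<open>J\<close>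
        finite.\<close>
      have "ennreal_powr J (1 / q) \<le> ennreal_powr ?N (1 / q) * ennreal_powr (ennreal B) (1 / p)"
      proof (cases "J = 0")
        case False
        have "ennreal_powr J (1 / q) * ennreal_powr J (1 / p) = J"
          using pq by (subst ennreal_powr_add[symmetric]) (auto simp: add.commute)
        then have "ennreal_powr J (1 / q) * ennreal_powr J (1 / p)
           \<le> (ennreal_powr ?N (1 / q) * ennreal_powr (ennreal B) (1 / p)) * ennreal_powr J (1 / p)"
          using JJ by simp
        then have "ennreal_powr J (1 / p) * ennreal_powr J (1 / q)
           \<le> ennreal_powr J (1 / p) * (ennreal_powr ?N (1 / q) * ennreal_powr (ennreal B) (1 / p))"
          by (simp add: mult.commute)
        then show ?thesis using False Jfin
          by (subst (asm) ennreal_mult_le_mult_iff) auto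
      qed simp
      then have "ennreal_powr (ennreal_powr J (1 / q)) q \<le> ennreal_powr (ennreal_powr ?N (1 / q) * ennreal_powr (ennreal B) (1 / p)) q"
        using pq by (intro ennreal_powr_mono) auto
      also have "\<dots> = ?N * ennreal (B powr (q / p))"
        using pq st(2) by (simp add: ennreal_powr_mult ennreal_powr_powr ennreal_powr_ennreal powr_powr)
      finally show ?thesis using pq by (simp add: J_def mult.commute)
    qed
    \<comment> \<open>The bounds on \<open>Y n\<close> are uniform in \<open>n\<close>, and these
      sets increase to the set where \<open>v\<close> is positive.\<close>
    have "(\<integral>\<^sup>+y. ennreal_powr (fnorm \<tau> g y) q \<partial>\<mu>) = (\<integral>\<^sup>+y. (SUP n. ennreal (v y powr q) * indicator (Y n) y) \<partial>\<mu>)"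
    proof (intro nn_integral_cong antisym)
      fix y
      show "ennreal_powr (fnorm \<tau> g y) q \<le> (SUP n. ennreal (v y powr q) * indicator (Y n) y)"
      proof (cases "v y = 0")
        case False
        then have v0: "0 < v y" using v(2)[of y] by simp
        obtain n :: nat where n: "max (dist o1 y) (1 / v y) < real n" using reals_Archimedean2 by blast
        have "0 < 1 / v y" using v0 by simp
        then have n0: "0 < real n" using n by linarith
        have "1 / real n < v y" using n n0 v0 by (simp add: field_simps)
        then have "y \<in> Y n" using n by (simp add: Y_def)
        then have "ennreal_powr (fnorm \<tau> g y) q \<le> ennreal (v y powr q) * indicator (Y n) y"
          by (simp add: v ennreal_powr_ennreal)
        then show ?thesis by (rule SUP_upper2[OF UNIV_I])
      qed (simp add: v)
      show "(SUP n. ennreal (v y powr q) * indicator (Y n) y) \<le> ennreal_powr (fnorm \<tau> g y) q"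
        by (intro SUP_least) (simp add: v ennreal_powr_ennreal indicator_def)
    qed
    also have "\<dots> = (SUP n. \<integral>\<^sup>+y. ennreal (v y powr q) * indicator (Y n) y \<partial>\<mu>)"
    proof (rule nn_integral_monotone_convergence_SUP)
      have "Y n \<subseteq> Y (Suc n)" for n
      proof
        fix y assume y: "y \<in> Y n"
        then have "0 < real n" unfolding Y_def using zero_le_dist[of o1 y] by (auto simp del: zero_le_dist)
        then have "1 / real (Suc n) \<le> 1 / real n" by (intro divide_left_mono) auto
        then show "y \<in> Y (Suc n)" using y unfolding Y_def by auto
      qed
      then show "incseq (\<lambda>n y. ennreal (v y powr q) * indicator (Y n) y)"
        by (intro incseq_SucI le_funI mult_left_mono) (auto simp: indicator_def)
    qed measurable
    also have "\<dots> \<le> ennreal (B powr (q / p)) * ?N" by (intro SUP_least step)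
    finally show "(\<integral>\<^sup>+x. ennreal_powr (fnorm \<tau> (T'.appl G) x) q \<partial>\<mu>) \<le> ennreal (B powr (q / p)) * ?N"
      by (simp add: g_def)
  qed
qed

end

context cz_kernel
begin

text \<open>By Tonelli the Hilbert-Schmidt norm does not depend on the order of the two measures,
  and the two regularity conditions change places. The size bound must be recentred from
  \<open>x\<close> to \<open>y\<close>, and \<open>lam_shift\<close> charges the factor
  \<open>Clam\<close> for this.\<close>

lemma transpose_cz: "cz_kernel \<mu> lam Clam N0 \<theta> \<tau> (\<lambda>y c x d. H x d y c) (A * Clam) \<epsilon>"
proof -
  interpret T': kernel_op \<mu> lam Clam N0 \<theta> \<tau> "\<lambda>y c x d. H x d y c" by (rule transpose)
  have hs': "T'.hs y x = hs x y" for x y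
  proof -
    have "(T'.hs y x)\<^sup>2 = (\<integral>\<^sup>+c. \<integral>\<^sup>+d. (ennreal (norm (H x d y c)))\<^sup>2 \<partial>\<theta> \<partial>\<tau>)"
      by (simp add: T'.hs_def L2_square)
    also have "\<dots> = (\<integral>\<^sup>+d. \<integral>\<^sup>+c. (ennreal (norm (H x d y c)))\<^sup>2 \<partial>\<tau> \<partial>\<theta>)"
      by (rule pair_sigma_finite.Fubini') (auto simp: pair_sigma_finite_def T.sigma_finite_measure_axioms D.sigma_finite_measure_axioms)
    also have "\<dots> = (hs x y)\<^sup>2" by (simp add: hs_def L2_square)
    finally have eq: "(T'.hs y x)\<^sup>2 = (hs x y)\<^sup>2" .
    show ?thesis
      by (rule antisym; rule ennreal_power2_le_iff[THEN iffD1]; simp only: eq)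
  qed
  have A: "A \<le> A * Clam" using A_nonneg Clam_ge_1 mult_left_mono[of 1 Clam A] by simp
  show ?thesis
  proof (intro cz_kernel.intro transpose cz_kernel_axioms.intro eps_pos)
    show "0 \<le> A * Clam" using A A_nonneg by linarith
    show "T'.hs x x = 0" for x by (simp add: hs' size_0)
    show "T'.hs y x \<le> ennreal (A * Clam * min 1 (dist y x / \<epsilon>) / lam y (dist y x))" if "y \<noteq> x" for x y
    proof -
      have xy: "0 < dist x y" "x \<noteq> y" using that by auto
      have "A * min 1 (dist x y / \<epsilon>) / lam x (dist x y) \<le> A * min 1 (dist x y / \<epsilon>) / (lam y (dist x y) / Clam)"
        using lam_shift[of "dist x y" y x] xy Clam_pos lam_pos A_nonneg eps_pos
        by (intro divide_left_mono mult_pos_pos mult_nonneg_nonneg) (auto simp: dist_commute field_simps)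
      also have "\<dots> = A * Clam * min 1 (dist y x / \<epsilon>) / lam y (dist y x)"
        by (simp add: dist_commute)
      finally show ?thesis unfolding hs' using size[OF xy(2)] by (elim order_trans) (rule ennreal_leI)
    qed
    show "(\<integral>\<^sup>+x\<in>- ball z (2 * R). L2 \<tau> (\<lambda>d. L2 \<theta> (\<lambda>c. ennreal (norm (H y c x d - H z c x d)))) \<partial>\<mu>) \<le> ennreal (A * Clam)"
      if "0 < R" "dist z y < R" for R y z
      using regular'[OF that] ennreal_leI[OF A] by (rule order_trans)
    show "(\<integral>\<^sup>+y\<in>- ball z (2 * R). L2 \<theta> (\<lambda>c. L2 \<tau> (\<lambda>d. ennreal (norm (H y c x d - H y c z d)))) \<partial>\<mu>) \<le> ennreal (A * Clam)"
      if "0 < R" "dist z x < R" for R x z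
      using regular[OF that] ennreal_leI[OF A] by (rule order_trans)
  qed
qed

lemma strong_below:
  assumes "strong p B" "0 \<le> B" "1 < q" "q < p"
  shows "strong q (q * (2 * weak_const p B / (q - 1) + 2 powr p * B / (p - q)))"
  using assms weak_type[of p B] piece_const_nonneg[of p B]
  by (intro interpolate) (auto simp: weak_const_def)

end

section \<open>The Marcinkiewicz integral as an operator with vector-valued kernel\<close>

text \<open>The set \<open>S\<close> restricts the range of \<open>t\<close>: bounded open intervals
  away from 0 give the finite measures of the truncated operators, \<open>{..R}\<close> and
  \<open>{R<..}\<close> separate small and large \<open>t\<close> in the comparison of two points,
  and \<open>UNIV\<close> belongs to the Marcinkiewicz integral itself.\<close>

definition theta :: "real set \<Rightarrow> real measure" where
  "theta S = density lborel (\<lambda>t. ennreal (if 0 < t \<and> t \<in> S then 1 / t ^ 3 else 0))"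

lemma sets_theta [simp, measurable_cong]: "sets (theta S) = sets borel"
  by (simp add: theta_def)

lemma space_theta [simp]: "space (theta S) = UNIV"
  by (simp add: theta_def)

lemma nn_integral_theta:
  assumes [measurable]: "S \<in> sets borel" "g \<in> borel_measurable borel"
  shows "(\<integral>\<^sup>+t. g t \<partial>theta S) = (\<integral>\<^sup>+t. ennreal (if 0 < t \<and> t \<in> S then 1 / t ^ 3 else 0) * g t \<partial>lborel)"
  unfolding theta_def by (rule nn_integral_density) measurable

lemma nn_integral_theta_tail:
  assumes "0 < s" and [measurable]: "S \<in> sets borel"
  shows "(\<integral>\<^sup>+t. indicator {s..} t \<partial>theta S) \<le> ennreal (1 / (2 * s\<^sup>2))"
proof -
  have "(\<integral>\<^sup>+t. indicator {s..} t \<partial>theta S) \<le> (\<integral>\<^sup>+t. ennreal (if s \<le> t then t powr (- 2 - 1) else 0) \<partial>lborel)"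
    using assms(1) by (subst nn_integral_theta)
      (auto intro!: nn_integral_mono ennreal_leI simp: indicator_def powr_minus_divide powr_numeral)
  also have "\<dots> = ennreal (1 / (2 * s\<^sup>2))"
    using nn_integral_powr_to_inf[of 2 s] assms(1) by (simp add: powr_minus_divide powr_numeral mult.commute)
  finally show ?thesis .
qed

text \<open>The difference of two tails. The tail from \<open>b\<close> is added to both sides and
  cancelled at the end, which avoids subtraction of extended reals.\<close>

lemma nn_integral_theta_between:
  assumes "0 < a" "a \<le> b" and [measurable]: "S \<in> sets borel"
  shows "(\<integral>\<^sup>+t. indicator {a<..b} t \<partial>theta S) \<le> ennreal ((1 / a\<^sup>2 - 1 / b\<^sup>2) / 2)"
proof -
  let ?g = "\<lambda>c t. ennreal (if c \<le> t then t powr (- 2 - 1) else 0)"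
  have g: "(\<integral>\<^sup>+t. ?g c t \<partial>lborel) = ennreal (1 / (2 * c\<^sup>2))" if "0 < c" for c :: real
    using nn_integral_powr_to_inf[of 2 c] that by (simp add: powr_minus_divide powr_numeral mult.commute)
  have "(\<integral>\<^sup>+t. indicator {a<..b} t \<partial>theta S) + ennreal (1 / (2 * b\<^sup>2))
      \<le> (\<integral>\<^sup>+t. ennreal (if a < t \<and> t \<le> b then t powr (- 2 - 1) else 0) \<partial>lborel) + (\<integral>\<^sup>+t. ?g b t \<partial>lborel)"
    unfolding g[OF less_le_trans[OF assms(1,2)]] using assms(1)
    by (subst nn_integral_theta)
      (auto intro!: add_right_mono nn_integral_mono ennreal_leI simp: indicator_def powr_minus_divide powr_numeral)
  also have "\<dots> = (\<integral>\<^sup>+t. ennreal (if a < t \<and> t \<le> b then t powr (- 2 - 1) else 0) + ?g b t \<partial>lborel)"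
    by (rule nn_integral_add[symmetric]) measurable
  also have "\<dots> = (\<integral>\<^sup>+t. ?g a t \<partial>lborel)"
  proof (rule nn_integral_cong_AE)
    show "AE t in lborel. ennreal (if a < t \<and> t \<le> b then t powr (- 2 - 1) else 0) + ?g b t = ?g a t"
      using AE_lborel_singleton[of a] AE_lborel_singleton[of b]
      by eventually_elim (use assms(2) in auto)
  qed
  also have "\<dots> = ennreal ((1 / a\<^sup>2 - 1 / b\<^sup>2) / 2 + 1 / (2 * b\<^sup>2))"
    unfolding g[OF assms(1)] using assms(1,2) by (simp add: field_simps)
  also have "\<dots> = ennreal ((1 / a\<^sup>2 - 1 / b\<^sup>2) / 2) + ennreal (1 / (2 * b\<^sup>2))"
    using assms(1,2) by (intro ennreal_plus) (auto intro!: divide_left_mono power_mono)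
  finally show ?thesis by (simp add: ennreal_add_left_cancel_le add.commute)
qed

lemma L2_theta_indicator_le:
  assumes [measurable]: "S \<in> sets borel" "J \<in> sets borel"
    and "(\<integral>\<^sup>+t. indicator J t \<partial>theta S) \<le> ennreal c" "0 \<le> k" "0 \<le> c"
  shows "L2 (theta S) (\<lambda>t. ennreal k * indicator J t) \<le> ennreal (k * sqrt c)"
proof -
  have "L2 (theta S) (\<lambda>t. ennreal k * indicator J t) = ennreal k * L2 (theta S) (indicator J)"
    by (rule L2_cmult) measurable
  also have "L2 (theta S) (indicator J) \<le> ennreal (sqrt c)"
  proof -
    have "(\<integral>\<^sup>+t. (indicator J t)\<^sup>2 \<partial>theta S) = (\<integral>\<^sup>+t. indicator J t \<partial>theta S)"
      by (intro nn_integral_cong) (simp add: indicator_def)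
    then show ?thesis using assms(3,5) by (simp add: L2_le_iff ennreal_power)
  qed
  finally show ?thesis using assms(4) by (simp add: ennreal_mult' mult_left_mono)
qed

text \<open>The tail of \<open>dt / t^3\<close> beyond \<open>d\<close> has norm of order
  \<open>1 / d\<close>. This converts the size condition \<open>d / lam\<close> on the kernel into
  \<open>1 / lam\<close>.\<close>

lemma L2_theta_cutoff:
  fixes k :: complex
  assumes [measurable]: "S \<in> sets borel" and "0 < d"
  shows "L2 (theta S) (\<lambda>t. ennreal (norm (if d < t \<and> P t then k else 0))) \<le> ennreal (norm k / d)"
proof -
  have "L2 (theta S) (\<lambda>t. ennreal (norm (if d < t \<and> P t then k else 0)))
      \<le> L2 (theta S) (\<lambda>t. ennreal (norm k) * indicator {d..} t)"
    by (intro L2_mono) (auto simp: indicator_def)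
  also have "\<dots> \<le> ennreal (norm k * sqrt (1 / (2 * d\<^sup>2)))"
    using assms by (intro L2_theta_indicator_le nn_integral_theta_tail) auto
  also have "\<dots> \<le> ennreal (norm k / d)"
  proof (rule ennreal_leI)
    have "sqrt (1 / (2 * d\<^sup>2)) \<le> sqrt ((1 / d)\<^sup>2)"
      using assms by (intro real_sqrt_le_mono) (simp add: power_divide field_simps)
    also have "\<dots> = 1 / d" using assms(2) by (simp only: real_sqrt_abs) simp
    finally show "norm k * sqrt (1 / (2 * d\<^sup>2)) \<le> norm k / d"
      using mult_left_mono[of _ "1 / d" "norm k"] by fastforce
  qed
  finally show ?thesis .
qed

text \<open>Where both cutoffs are active only \<open>k1 - k2\<close> is seen. Between the two
  jumps, an interval of length at most \<open>R\<close> at height about \<open>b\<close> and so of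
  measure about \<open>R / b ^ 3\<close>, a full kernel value survives; the square root of that
  measure is \<open>sqrt (R / b) / b\<close>.\<close>

lemma L2_theta_jump:
  fixes k1 k2 :: complex
  assumes S[measurable]: "S \<in> sets borel" and ab: "0 < R" "2 * R \<le> b" "\<bar>a - b\<bar> \<le> R"
  shows "L2 (theta S) (\<lambda>t. ennreal (norm ((if a < t \<and> P t then k1 else 0) - (if b < t \<and> P t then k2 else 0))))
    \<le> ennreal (2 * norm (k1 - k2) / b + 2 * norm k2 * sqrt (R / b) / b)"
proof -
  have b: "0 < b" and a: "b / 2 \<le> a" "a \<le> 3 / 2 * b" "0 < a" using ab by auto
  let ?lo = "min a b" and ?hi = "max a b"
  have "L2 (theta S) (\<lambda>t. ennreal (norm ((if a < t \<and> P t then k1 else 0) - (if b < t \<and> P t then k2 else 0))))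
     \<le> L2 (theta S) (\<lambda>t. ennreal (norm (k1 - k2)) * indicator {a..} t + ennreal (norm k2) * indicator {?lo<..?hi} t)"
  proof (rule L2_mono)
    fix t
    show "ennreal (norm ((if a < t \<and> P t then k1 else 0) - (if b < t \<and> P t then k2 else 0)))
      \<le> ennreal (norm (k1 - k2)) * indicator {a..} t + ennreal (norm k2) * indicator {?lo<..?hi} t"
    proof (cases "P t")
      case True
      consider "a < t" "b < t" | "a < t" "t \<le> b" | "t \<le> a" "b < t" | "t \<le> a" "t \<le> b" by linarith
      then show ?thesis
      proof cases
        case 2
        \<comment> \<open>Only \<open>k1\<close> is active here. The part \<open>k1 - k2\<close>
          joins the first term, and the rest is charged to the interval between the jumps.\<close>
        have "norm k1 \<le> norm (k1 - k2) + norm k2" by norm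
        then show ?thesis using 2 True by (simp flip: ennreal_plus)
      qed (use True in \<open>auto simp: indicator_def\<close>)
    qed simp
  qed
  also have "\<dots> \<le> L2 (theta S) (\<lambda>t. ennreal (norm (k1 - k2)) * indicator {a..} t)
      + L2 (theta S) (\<lambda>t. ennreal (norm k2) * indicator {?lo<..?hi} t)"
    by (intro L2_add) measurable
  also have "\<dots> \<le> ennreal (norm (k1 - k2) * sqrt (1 / (2 * a\<^sup>2))) + ennreal (norm k2 * sqrt ((1 / ?lo\<^sup>2 - 1 / ?hi\<^sup>2) / 2))"
    using a b by (intro add_mono L2_theta_indicator_le nn_integral_theta_tail nn_integral_theta_between)
      (auto intro!: divide_left_mono power_mono mult_pos_pos)
  also have "\<dots> \<le> ennreal (2 * norm (k1 - k2) / b) + ennreal (2 * norm k2 * sqrt (R / b) / b)"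
  proof (intro add_mono ennreal_leI)
    have "1 / (2 * a\<^sup>2) \<le> (2 / b)\<^sup>2"
    proof -
      have "(b / 2)\<^sup>2 \<le> a\<^sup>2" using a b by (intro power_mono) auto
      then have "b\<^sup>2 \<le> 4 * (2 * a\<^sup>2)" by (simp add: power_divide) (use zero_le_power2[of a] in linarith)
      then show ?thesis using a b by (simp add: power_divide field_simps)
    qed
    then have "sqrt (1 / (2 * a\<^sup>2)) \<le> 2 / b" using b by (intro real_le_lsqrt) auto
    then have "norm (k1 - k2) * sqrt (1 / (2 * a\<^sup>2)) \<le> norm (k1 - k2) * (2 / b)"
      by (rule mult_left_mono) simp
    then show "norm (k1 - k2) * sqrt (1 / (2 * a\<^sup>2)) \<le> 2 * norm (k1 - k2) / b" by (simp add: mult.commute)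
  next
    have "(1 / ?lo\<^sup>2 - 1 / ?hi\<^sup>2) / 2 \<le> 3 * R / b ^ 3"
    proof -
      have "1 / ?lo\<^sup>2 - 1 / ?hi\<^sup>2 = (?hi - ?lo) * (1 / (?lo\<^sup>2 * ?hi) + 1 / (?lo * ?hi\<^sup>2))"
      proof -
        have "1 / l\<^sup>2 - 1 / h\<^sup>2 = (h - l) * (1 / (l\<^sup>2 * h) + 1 / (l * h\<^sup>2))" if "0 < l" "0 < h" for l h :: real
          using that by (simp add: divide_simps power2_eq_square) (simp add: algebra_simps)
        then show ?thesis using a b by simp
      qed
      also have "\<dots> \<le> R * (4 / b ^ 3 + 2 / b ^ 3)"
      proof (intro mult_mono add_mono)
        show "?hi - ?lo \<le> R" using ab(3) by linarith
        have lo: "b / 2 \<le> ?lo" "0 < ?lo" "b \<le> ?hi" using a b by auto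
        have "(b / 2)\<^sup>2 * b \<le> ?lo\<^sup>2 * ?hi" using lo b by (intro mult_mono power_mono) auto
        then have "1 / (?lo\<^sup>2 * ?hi) \<le> 1 / ((b / 2)\<^sup>2 * b)"
          using b lo by (intro divide_left_mono mult_pos_pos zero_less_power) auto
        also have "\<dots> = 4 / b ^ 3" by (simp add: power_divide power2_eq_square power3_eq_cube)
        finally show "1 / (?lo\<^sup>2 * ?hi) \<le> 4 / b ^ 3" .
        have "(b / 2) * b\<^sup>2 \<le> ?lo * ?hi\<^sup>2" using lo b by (intro mult_mono power_mono) auto
        then have "1 / (?lo * ?hi\<^sup>2) \<le> 1 / ((b / 2) * b\<^sup>2)"
          using b lo by (intro divide_left_mono mult_pos_pos zero_less_power) auto
        also have "\<dots> = 2 / b ^ 3" by (simp add: power_divide power2_eq_square power3_eq_cube)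
        finally show "1 / (?lo * ?hi\<^sup>2) \<le> 2 / b ^ 3" .
      qed (use ab a b in auto)
      also have "\<dots> = 2 * (3 * R / b ^ 3)" by simp
      finally show ?thesis by simp
    qed
    also have "\<dots> \<le> (2 * sqrt (R / b) / b)\<^sup>2"
      using ab b by (simp add: power_divide power_mult_distrib power2_eq_square power3_eq_cube divide_right_mono)
    finally have "sqrt ((1 / ?lo\<^sup>2 - 1 / ?hi\<^sup>2) / 2) \<le> 2 * sqrt (R / b) / b"
      using ab b by (intro real_le_lsqrt) (auto intro!: divide_left_mono power_mono mult_pos_pos)
    then have "norm k2 * sqrt ((1 / ?lo\<^sup>2 - 1 / ?hi\<^sup>2) / 2) \<le> norm k2 * (2 * sqrt (R / b) / b)"
      by (rule mult_left_mono) simp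
    then show "norm k2 * sqrt ((1 / ?lo\<^sup>2 - 1 / ?hi\<^sup>2) / 2) \<le> 2 * norm k2 * sqrt (R / b) / b"
      by (simp add: mult_ac)
  qed
  also have "\<dots> = ennreal (2 * norm (k1 - k2) / b + 2 * norm k2 * sqrt (R / b) / b)"
    using b ab by (intro ennreal_plus[symmetric]) auto
  finally show ?thesis .
qed

section \<open>The kernel with its diagonal removed\<close>

locale mk_kernel = nonhomogeneous_space \<mu> lam Clam N0
  for \<mu> :: "'a::metric_space measure" and lam Clam N0 +
  fixes K :: "'a \<Rightarrow> 'a \<Rightarrow> complex" and C0 :: real
  assumes K_loc: "locally_integrable_on (\<mu> \<Otimes>\<^sub>M \<mu>) {(x, y). x \<noteq> y} (\<lambda>(x, y). K x y)"
    and C0_pos: "0 < C0"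
    and K_size: "x \<noteq> y \<Longrightarrow> norm (K x y) \<le> C0 * (dist x y / lam x (dist x y))"
    and K_reg: "(\<integral>\<^sup>+x\<in>{x. 2 * dist y y' \<le> dist x y}.
             ennreal ((norm (K x y - K x y') + norm (K y x - K y' x)) * (1 / dist x y)) \<partial>\<mu>) \<le> ennreal C0"
begin

text \<open>Setting the diagonal to zero leaves out the point \<open>y = x\<close>, a possible atom,
  without a set difference in every integral. It also yields a function measurable on the whole
  product, whatever the arbitrary values \<open>K x x\<close>.\<close>

definition K0 :: "'a \<Rightarrow> 'a \<Rightarrow> complex" where
  "K0 x y = (if x = y then 0 else K x y)"

text \<open>Measurability of the kernel is contained in local integrability only. By separability,
  countably many rectangles of balls on which \<open>K\<close> is integrable cover the complement of
  the diagonal, and the pieces are glued.\<close>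

lemma K0_meas: "(\<lambda>w. K0 (fst w) (snd w)) \<in> borel_measurable (\<mu> \<Otimes>\<^sub>M \<mu>)"
proof -
  obtain D :: "'a set" where D: "countable D" "\<And>x e. 0 < e \<Longrightarrow> \<exists>d\<in>D. dist x d < e"
    using separable by blast
  define R where "R = (\<lambda>(d, d', q). ball d q \<times> ball d' q :: ('a \<times> 'a) set)"
  define I where "I = {i \<in> D \<times> D \<times> \<rat>. R i \<subseteq> {(x, y). x \<noteq> y} \<and> set_integrable (\<mu> \<Otimes>\<^sub>M \<mu>) (R i) (\<lambda>(x, y). K x y)}"
  have "countable (D \<times> D \<times> (\<rat> :: real set))" using D(1) countable_rat by (intro countable_SIGMA) auto
  then have cI: "countable I" by (rule countable_subset[rotated]) (auto simp: I_def)
  have Rm: "R i \<in> sets (\<mu> \<Otimes>\<^sub>M \<mu>)" for i by (auto simp: R_def split: prod.split)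
  let ?diag = "{w. fst w = snd w} :: ('a \<times> 'a) set"
  have diag: "?diag \<in> sets (\<mu> \<Otimes>\<^sub>M \<mu>)"
  proof -
    have "{w\<in>space (\<mu> \<Otimes>\<^sub>M \<mu>). dist (fst w) (snd w) = 0} \<in> sets (\<mu> \<Otimes>\<^sub>M \<mu>)" by measurable
    then show ?thesis by (simp add: space_pair_measure)
  qed
  show ?thesis
  proof (rule measurable_piecewise_restrict[where C="insert ?diag (R ` I)"])
    show "countable (insert ?diag (R ` I))" using cI by simp
    show "\<Omega> \<inter> space (\<mu> \<Otimes>\<^sub>M \<mu>) \<in> sets (\<mu> \<Otimes>\<^sub>M \<mu>)" if "\<Omega> \<in> insert ?diag (R ` I)" for \<Omega>
      using that Rm diag by (auto simp: space_pair_measure)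
    show "space (\<mu> \<Otimes>\<^sub>M \<mu>) \<subseteq> \<Union> (insert ?diag (R ` I))"
    proof
      fix w :: "'a \<times> 'a"
      obtain x y where w: "w = (x, y)" by (cases w)
      show "w \<in> \<Union> (insert ?diag (R ` I))"
      proof (cases "x = y")
        case False
        then obtain U where U: "open U" "(x, y) \<in> U" "set_integrable (\<mu> \<Otimes>\<^sub>M \<mu>) (U \<inter> {(x, y). x \<noteq> y}) (\<lambda>(x, y). K x y)"
          using K_loc unfolding locally_integrable_on_def by blast
        obtain A B where AB: "open A" "open B" "(x, y) \<in> A \<times> B" "A \<times> B \<subseteq> U"
          using open_prod_elim[OF U(1,2)] by blast
        obtain e1 where e1: "0 < e1" "ball x e1 \<subseteq> A" using AB open_contains_ball by (metis mem_Sigma_iff)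
        obtain e2 where e2: "0 < e2" "ball y e2 \<subseteq> B" using AB open_contains_ball by (metis mem_Sigma_iff)
        \<comment> \<open>The third bound separates the two factors of the rectangle, which
          therefore misses the diagonal.\<close>
        define e where "e = min (min e1 e2) (dist x y / 2)"
        have e: "0 < e" "e \<le> e1" "e \<le> e2" "2 * e \<le> dist x y" using e1 e2 False by (auto simp: e_def)
        obtain q where q: "q \<in> \<rat>" "0 < q" "q < e / 2" using Rats_dense_in_real[of 0 "e / 2"] e by auto
        obtain d where d: "d \<in> D" "dist x d < q" using D(2) q by blast
        obtain d' where d': "d' \<in> D" "dist y d' < q" using D(2) q by blast
        have b1: "dist x z < e" if "z \<in> ball d q" for z
          using that d q dist_triangle[of x z d] by simp
        have b2: "dist y z < e" if "z \<in> ball d' q" for z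
          using that d' q dist_triangle[of y z d'] by simp
        have sub: "R (d, d', q) \<subseteq> U \<inter> {(x, y). x \<noteq> y}"
        proof
          fix v assume v: "v \<in> R (d, d', q)"
          obtain v1 v2 where v12: "v = (v1, v2)" by (cases v)
          have 1: "dist x v1 < e" "dist y v2 < e" using v b1 b2 by (auto simp: R_def v12)
          then have "v1 \<in> A" "v2 \<in> B" using e e1 e2 by auto
          moreover have "v1 \<noteq> v2" using 1 e(4) dist_triangle2[of x y v1] by (auto simp: dist_commute)
          ultimately show "v \<in> U \<inter> {(x, y). x \<noteq> y}" using AB(4) by (auto simp: v12)
        qed
        have "set_integrable (\<mu> \<Otimes>\<^sub>M \<mu>) (R (d, d', q)) (\<lambda>(x, y). K x y)"
          by (rule set_integrable_subset[OF U(3) Rm sub])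
        then have "(d, d', q) \<in> I" using d d' q sub by (auto simp: I_def)
        moreover have "w \<in> R (d, d', q)" using d d' by (simp add: R_def w dist_commute)
        ultimately show ?thesis by blast
      qed (simp add: w)
    qed
    show "(\<lambda>w. K0 (fst w) (snd w)) \<in> borel_measurable (restrict_space (\<mu> \<Otimes>\<^sub>M \<mu>) \<Omega>)"
      if \<Omega>: "\<Omega> \<in> insert ?diag (R ` I)" for \<Omega>
    proof (cases "\<Omega> = ?diag")
      case True
      have "(\<lambda>w. indicator ?diag w *\<^sub>R K0 (fst w) (snd w)) = (\<lambda>w. 0)"
        by (auto simp: K0_def indicator_def)
      then show ?thesis using diag True
        by (subst borel_measurable_restrict_space_iff) (auto simp: space_pair_measure)
    next
      case False
      then obtain i where i: "i \<in> I" "\<Omega> = R i" using \<Omega> by blast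
      have "(\<lambda>w. indicator (R i) w *\<^sub>R K0 (fst w) (snd w)) = (\<lambda>w. indicator (R i) w *\<^sub>R (case w of (x, y) \<Rightarrow> K x y))"
      proof
        fix w
        have "w \<in> R i \<Longrightarrow> fst w \<noteq> snd w" using i(1) by (auto simp: I_def)
        then show "indicator (R i) w *\<^sub>R K0 (fst w) (snd w) = indicator (R i) w *\<^sub>R (case w of (x, y) \<Rightarrow> K x y)"
          by (cases "w \<in> R i") (auto simp: K0_def split: prod.split)
      qed
      moreover have "(\<lambda>w. indicator (R i) w *\<^sub>R (case w of (x, y) \<Rightarrow> K x y)) \<in> borel_measurable (\<mu> \<Otimes>\<^sub>M \<mu>)"
        using i unfolding I_def set_integrable_def by (auto dest: borel_measurable_integrable)
      ultimately show ?thesis using Rm[of i] i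
        by (subst borel_measurable_restrict_space_iff) (auto simp: space_pair_measure)
    qed
  qed
qed

lemma K0_measurable [measurable (raw)]:
  assumes "f \<in> M \<rightarrow>\<^sub>M \<mu>" "g \<in> M \<rightarrow>\<^sub>M \<mu>"
  shows "(\<lambda>w. K0 (f w) (g w)) \<in> borel_measurable M"
  using measurable_compose[OF measurable_Pair[OF assms] K0_meas] by simp

lemma K0_self [simp]: "K0 x x = 0"
  by (simp add: K0_def)

lemma K0_size: "norm (K0 x y) \<le> C0 * (dist x y / lam x (dist x y))"
  using K_size[of x y] by (auto simp: K0_def)

lemma K0_size': "norm (K0 x y) \<le> C0 * Clam * (dist y x / lam y (dist y x))"
proof (cases "x = y")
  case False
  then have d: "0 < dist x y" by simp
  have "norm (K0 x y) \<le> C0 * (dist x y / lam x (dist x y))" by (rule K0_size)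
  also have "\<dots> \<le> C0 * (dist x y / (lam y (dist x y) / Clam))"
    using lam_shift[of "dist x y" y x] d Clam_pos lam_pos C0_pos
    by (intro mult_left_mono divide_left_mono mult_pos_pos) (auto simp: dist_commute field_simps)
  finally show ?thesis by (simp add: dist_commute mult_ac)
qed simp

lemma K0_near:
  assumes "0 < s"
  shows "(\<integral>\<^sup>+y\<in>ball x s. ennreal (norm (K0 x y)) \<partial>\<mu>) \<le> ennreal (C0 * (2 * Clam * s))"
    "(\<integral>\<^sup>+y\<in>ball x s. ennreal (norm (K0 y x)) \<partial>\<mu>) \<le> ennreal (C0 * Clam * (2 * Clam * s))"
proof -
  have [measurable]: "(\<lambda>y. dist x y) \<in> borel_measurable \<mu>" by measurable
  have gen: "(\<integral>\<^sup>+y\<in>ball x s. ennreal (k y) \<partial>\<mu>) \<le> ennreal (c * (2 * Clam * s))"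
    if k: "\<And>y. k y \<le> c * (dist x y / lam x (dist x y))" and c: "0 \<le> c" for k c
  proof -
    have "(\<integral>\<^sup>+y\<in>ball x s. ennreal (k y) \<partial>\<mu>)
        \<le> (\<integral>\<^sup>+y. ennreal c * (ennreal (dist x y / lam x (dist x y)) * indicator (ball x s) y) \<partial>\<mu>)"
    proof (intro nn_integral_mono)
      fix y
      have "ennreal (k y) \<le> ennreal c * ennreal (dist x y / lam x (dist x y))"
        using ennreal_leI[OF k[of y]] unfolding ennreal_mult'[OF c] .
      then show "ennreal (k y) * indicator (ball x s) y
        \<le> ennreal c * (ennreal (dist x y / lam x (dist x y)) * indicator (ball x s) y)"
        by (simp add: indicator_def)
    qed
    also have "\<dots> \<le> ennreal c * ennreal (2 * Clam * s)"
      by (subst nn_integral_cmult) (auto intro!: mult_left_mono near_integral assms)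
    finally show ?thesis using c by (simp add: ennreal_mult')
  qed
  show "(\<integral>\<^sup>+y\<in>ball x s. ennreal (norm (K0 x y)) \<partial>\<mu>) \<le> ennreal (C0 * (2 * Clam * s))"
    by (rule gen[OF K0_size]) (use C0_pos in simp)
  show "(\<integral>\<^sup>+y\<in>ball x s. ennreal (norm (K0 y x)) \<partial>\<mu>) \<le> ennreal (C0 * Clam * (2 * Clam * s))"
    by (rule gen[OF K0_size']) (use C0_pos Clam_pos in simp)
qed

end

lemma AE_theta:
  assumes [measurable]: "S \<in> sets borel" shows "AE t in theta S. 0 < t \<and> t \<in> S"
  unfolding theta_def by (subst AE_density) (auto split: if_splits)

lemma finite_measure_theta:
  assumes "0 < \<epsilon>" shows "finite_measure (theta {\<epsilon><..<L})"
proof (rule finite_measureI)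
  have "emeasure (theta {\<epsilon><..<L}) UNIV = (\<integral>\<^sup>+t. indicator {\<epsilon>..} t \<partial>theta {\<epsilon><..<L})"
    by (subst nn_integral_theta) (auto simp: theta_def emeasure_density indicator_def intro!: nn_integral_cong)
  also have "\<dots> \<le> ennreal (1 / (2 * \<epsilon>\<^sup>2))" by (rule nn_integral_theta_tail[OF assms]) simp
  also have "\<dots> < top" by simp
  finally show "emeasure (theta {\<epsilon><..<L}) (space (theta {\<epsilon><..<L})) \<noteq> \<infinity>" by simp
qed

lemma sigma_finite_theta:
  assumes [measurable]: "S \<in> sets borel" shows "sigma_finite_measure (theta S)"
  unfolding theta_def
  by (subst sigma_finite_measure.sigma_finite_iff_density_finite'[OF sigma_finite_lborel]) auto

abbreviation "unit_measure \<equiv> count_space (UNIV :: unit set)"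

lemma L2_unit [simp]: "L2 unit_measure f = f ()"
proof -
  have "ennreal_powr ((f ())\<^sup>2) (1 / 2) = f ()"
    using ennreal_powr_inverse(1)[of 2 "f ()"] by simp
  then show ?thesis by (simp add: L2_def nn_integral_count_space_finite UNIV_unit)
qed

lemma finite_measure_unit: "finite_measure unit_measure"
  by (rule finite_measure_count_space) simp

section \<open>Regularity of the truncated vector-valued kernel\<close>

context mk_kernel
begin

text \<open>The first summand is twice the regularity hypothesis. The second is
  \<open>2 * C0 * Clam\<close> from the size of the kernel times \<open>4 * Clam\<close> from
  \<open>far_integral\<close>.\<close>

definition reg_const :: real where "reg_const = 2 * C0 + 8 * C0 * Clam\<^sup>2"

lemma reg_const: "0 \<le> reg_const" "C0 \<le> reg_const"
  unfolding reg_const_def using C0_pos by (auto intro: add_increasing2)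

text \<open>\<open>L2_theta_jump\<close> is integrated over the outside of the double ball: its
  first term is the regularity hypothesis, its second is the size bound with a square root gain,
  summed by \<open>far_integral\<close> at radius \<open>2 * R\<close>. Keeping \<open>k1\<close>
  and \<open>k2\<close> abstract covers differences in either variable of the kernel.\<close>

lemma jump_integral:
  assumes S[measurable]: "S \<in> sets borel" and R: "0 < R" "dist z y < R"
    and [measurable]: "k1 \<in> borel_measurable \<mu>" "k2 \<in> borel_measurable \<mu>"
    and k2: "\<And>w. norm (k2 w) \<le> C0 * Clam * (dist z w / lam z (dist z w))"
    and k12: "(\<integral>\<^sup>+w\<in>- ball z (2 * R). ennreal (norm (k1 w - k2 w) * (1 / dist w z)) \<partial>\<mu>) \<le> ennreal C0"
  shows "(\<integral>\<^sup>+w\<in>- ball z (2 * R). L2 (theta S) (\<lambda>t. ennreal (norm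
      ((if dist y w < t \<and> P t then k1 w else 0) - (if dist z w < t \<and> P t then k2 w else (0::complex))))) \<partial>\<mu>) \<le> ennreal reg_const"
proof -
  have [measurable]: "(\<lambda>w. dist z w) \<in> borel_measurable \<mu>" by measurable
  have [measurable]: "(\<lambda>w. dist w z) \<in> borel_measurable \<mu>" by measurable
  have C: "- ball z (2 * R) = space \<mu> - ball z (2 * R)" by auto
  have [measurable]: "- ball z (2 * R) \<in> sets \<mu>" unfolding C by measurable
  let ?g1 = "\<lambda>w. ennreal (norm (k1 w - k2 w) * (1 / dist w z)) * indicator (- ball z (2 * R)) w"
  let ?g2 = "\<lambda>w. ennreal (sqrt (2 * R / dist z w) / lam z (dist z w)) * indicator (- ball z (2 * R)) w"
  have "L2 (theta S) (\<lambda>t. ennreal (norm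
      ((if dist y w < t \<and> P t then k1 w else 0) - (if dist z w < t \<and> P t then k2 w else 0)))) * indicator (- ball z (2 * R)) w
      \<le> 2 * ?g1 w + ennreal (2 * C0 * Clam) * ?g2 w" for w
  proof (cases "w \<in> ball z (2 * R)")
    case False
    let ?b = "dist z w"
    have b: "2 * R \<le> ?b" "0 < ?b" using False R by auto
    have "\<bar>dist y w - ?b\<bar> \<le> R"
      using dist_triangle[of y w z] dist_triangle[of z w y] R by (simp add: dist_commute abs_le_iff)
    then have "L2 (theta S) (\<lambda>t. ennreal (norm
      ((if dist y w < t \<and> P t then k1 w else 0) - (if ?b < t \<and> P t then k2 w else 0))))
      \<le> ennreal (2 * norm (k1 w - k2 w) / ?b + 2 * norm (k2 w) * sqrt (R / ?b) / ?b)"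
      by (intro L2_theta_jump S R b)
    also have "\<dots> \<le> ennreal (2 * (norm (k1 w - k2 w) * (1 / dist w z)) + 2 * C0 * Clam * (sqrt (2 * R / ?b) / lam z ?b))"
    proof (intro ennreal_leI add_mono)
      have "norm (k2 w) * (sqrt (R / ?b) / ?b) \<le> (C0 * Clam * (?b / lam z ?b)) * (sqrt (2 * R / ?b) / ?b)"
        using k2[of w] R b C0_pos Clam_pos lam_pos[OF b(2), of z]
        by (intro mult_mono divide_right_mono real_sqrt_le_mono) auto
      also have "\<dots> = C0 * Clam * (sqrt (2 * R / ?b) / lam z ?b)" using b by simp
      finally show "2 * norm (k2 w) * sqrt (R / ?b) / ?b \<le> 2 * C0 * Clam * (sqrt (2 * R / ?b) / lam z ?b)"
        by simp
    qed (simp add: dist_commute)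
    also have "\<dots> = ennreal 2 * ennreal (norm (k1 w - k2 w) * (1 / dist w z))
        + ennreal (2 * C0 * Clam) * ennreal (sqrt (2 * R / ?b) / lam z ?b)"
      using C0_pos Clam_pos R b lam_pos[OF b(2), of z]
      by (subst ennreal_plus) (auto simp: ennreal_mult' simp del: ennreal_numeral times_divide_eq_right)
    finally show ?thesis using False by simp
  qed simp
  then have "(\<integral>\<^sup>+w\<in>- ball z (2 * R). L2 (theta S) (\<lambda>t. ennreal (norm
      ((if dist y w < t \<and> P t then k1 w else 0) - (if dist z w < t \<and> P t then k2 w else (0::complex))))) \<partial>\<mu>)
      \<le> (\<integral>\<^sup>+w. 2 * ?g1 w + ennreal (2 * C0 * Clam) * ?g2 w \<partial>\<mu>)"
    by (intro nn_integral_mono)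
  also have "\<dots> = 2 * (\<integral>\<^sup>+w. ?g1 w \<partial>\<mu>) + ennreal (2 * C0 * Clam) * (\<integral>\<^sup>+w. ?g2 w \<partial>\<mu>)"
    by (simp add: nn_integral_add nn_integral_cmult)
  also have "\<dots> \<le> 2 * ennreal C0 + ennreal (2 * C0 * Clam) * ennreal (4 * Clam)"
    using R by (intro add_mono mult_left_mono k12 far_integral) auto
  also have "2 * ennreal C0 = ennreal (2 * C0)" using C0_pos by (simp add: ennreal_mult)
  also have "ennreal (2 * C0) + ennreal (2 * C0 * Clam) * ennreal (4 * Clam) = ennreal reg_const"
    using C0_pos Clam_pos
    by (simp add: reg_const_def power2_eq_square mult_ac flip: ennreal_mult ennreal_plus)
  finally show ?thesis .
qed

lemma K_reg_0:
  assumes R: "0 < R" "dist z y < R"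
  shows "(\<integral>\<^sup>+w\<in>- ball z (2 * R). ennreal (norm (K0 w y - K0 w z) * (1 / dist w z)) \<partial>\<mu>) \<le> ennreal C0"
    "(\<integral>\<^sup>+w\<in>- ball z (2 * R). ennreal (norm (K0 y w - K0 z w) * (1 / dist w z)) \<partial>\<mu>) \<le> ennreal C0"
proof -
  have w: "w \<noteq> y" "w \<noteq> z" "2 * dist z y \<le> dist w z" if "w \<notin> ball z (2 * R)" for w
    using that R by (auto simp: dist_commute)
  show "(\<integral>\<^sup>+w\<in>- ball z (2 * R). ennreal (norm (K0 w y - K0 w z) * (1 / dist w z)) \<partial>\<mu>) \<le> ennreal C0"
  proof (rule order_trans[OF nn_integral_mono K_reg[of z y]])
    fix w
    show "ennreal (norm (K0 w y - K0 w z) * (1 / dist w z)) * indicator (- ball z (2 * R)) w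
      \<le> ennreal ((norm (K w z - K w y) + norm (K z w - K y w)) * (1 / dist w z)) * indicator {x. 2 * dist z y \<le> dist x z} w"
      using w[of w] by (cases "w \<in> ball z (2 * R)")
        (auto simp: K0_def norm_minus_commute intro!: ennreal_leI divide_right_mono)
  qed
  show "(\<integral>\<^sup>+w\<in>- ball z (2 * R). ennreal (norm (K0 y w - K0 z w) * (1 / dist w z)) \<partial>\<mu>) \<le> ennreal C0"
  proof (rule order_trans[OF nn_integral_mono K_reg[of z y]])
    fix w
    show "ennreal (norm (K0 y w - K0 z w) * (1 / dist w z)) * indicator (- ball z (2 * R)) w
      \<le> ennreal ((norm (K w z - K w y) + norm (K z w - K y w)) * (1 / dist w z)) * indicator {x. 2 * dist z y \<le> dist x z} w"
      using w[of w] by (cases "w \<in> ball z (2 * R)")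
        (auto simp: K0_def norm_minus_commute intro!: ennreal_leI divide_right_mono)
  qed
qed

lemma jump_first:
  assumes "S \<in> sets borel" "0 < R" "dist z y < R"
  shows "(\<integral>\<^sup>+w\<in>- ball z (2 * R). L2 (theta S) (\<lambda>t. ennreal (norm
      ((if dist w y < t \<and> P t then K0 w y else 0) - (if dist w z < t \<and> P t then K0 w z else 0)))) \<partial>\<mu>) \<le> ennreal reg_const"
  using jump_integral[OF assms _ _ K0_size' K_reg_0(1)[OF assms(2,3)], of P]
  by (simp add: dist_commute)

lemma jump_second:
  assumes "S \<in> sets borel" "0 < R" "dist z y < R"
  shows "(\<integral>\<^sup>+w\<in>- ball z (2 * R). L2 (theta S) (\<lambda>t. ennreal (norm
      ((if dist y w < t \<and> P t then K0 y w else 0) - (if dist z w < t \<and> P t then K0 z w else 0)))) \<partial>\<mu>) \<le> ennreal reg_const"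
proof (rule jump_integral[OF assms _ _ _ K_reg_0(2)[OF assms(2,3)]])
  fix w
  have "norm (K0 z w) \<le> C0 * (dist z w / lam z (dist z w))" by (rule K0_size)
  also have "\<dots> \<le> C0 * Clam * (dist z w / lam z (dist z w))"
  proof (cases "z = w")
    case False
    then show ?thesis using C0_pos Clam_ge_1 lam_pos[of "dist z w" z]
      by (intro mult_right_mono) auto
  qed simp
  finally show "norm (K0 z w) \<le> C0 * Clam * (dist z w / lam z (dist z w))" .
qed measurable

text \<open>
  The scalar functions on which the Marcinkiewicz integral acts take values in
  \<open>L\<^sup>2(unit_measure)\<close>; hence the dummy argument of type \<^typ>\<open>unit\<close>.
\<close>

definition HK :: "real \<Rightarrow> 'a \<Rightarrow> real \<Rightarrow> 'a \<Rightarrow> unit \<Rightarrow> complex" where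
  "HK L x t y c = (if dist x y < t \<and> t < L then K0 x y else 0)"

lemma HK_nn_le: "ennreal (norm (HK L x t y c)) \<le> ennreal (norm (K0 x y)) * indicator (ball x L) y"
  by (auto simp: HK_def)

text \<open>Since \<open>t > \<epsilon>\<close>, the measure is finite; since \<open>t < L\<close>,
  the kernel vanishes for \<open>dist x y \<ge> L\<close>, and \<open>K0_near\<close> bounds its
  integrals. The second cutoff appears in \<open>HK\<close> although the measure ignores larger
  \<open>t\<close>, because the bounds are demanded for every \<open>t\<close> and not just almost
  every one.\<close>

lemma kernel_op_HK:
  assumes e: "0 < \<epsilon>" and L: "0 < L"
  shows "kernel_op \<mu> lam Clam N0 unit_measure (theta {\<epsilon><..<L}) (HK L)"
proof -
  interpret D: finite_measure "theta {\<epsilon><..<L}" by (rule finite_measure_theta[OF e])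
  interpret U: finite_measure unit_measure by (rule finite_measure_unit)
  let ?\<theta> = "theta {\<epsilon><..<L}"
  have fin: "emeasure ?\<theta> UNIV < top" using D.emeasure_finite[of UNIV] by (simp add: less_top[symmetric])
  show ?thesis
  proof (intro kernel_op.intro nonhomogeneous_space_axioms kernel_op_axioms.intro finite_measure_unit finite_measure_theta[OF e])
    show "(\<lambda>w. HK L (fst (fst w)) (snd (fst w)) (fst (snd w)) (snd (snd w)))
      \<in> borel_measurable ((\<mu> \<Otimes>\<^sub>M ?\<theta>) \<Otimes>\<^sub>M (\<mu> \<Otimes>\<^sub>M unit_measure))"
      unfolding HK_def by measurable
    show "\<exists>M. \<forall>x d. (\<integral>\<^sup>+v. ennreal (norm (HK L x d (fst v) (snd v))) \<partial>(\<mu> \<Otimes>\<^sub>M unit_measure)) \<le> ennreal M"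
    proof (intro exI allI)
      fix x t
      have "(\<integral>\<^sup>+v. ennreal (norm (HK L x t (fst v) (snd v))) \<partial>(\<mu> \<Otimes>\<^sub>M unit_measure))
        \<le> (\<integral>\<^sup>+v. ennreal (norm (K0 x (fst v))) * indicator (ball x L) (fst v) \<partial>(\<mu> \<Otimes>\<^sub>M unit_measure))"
        by (intro nn_integral_mono HK_nn_le)
      also have "\<dots> = (\<integral>\<^sup>+y\<in>ball x L. ennreal (norm (K0 x y)) \<partial>\<mu>)"
        by (subst U.nn_integral_fst[symmetric]) (auto simp: nn_integral_count_space_finite UNIV_unit)
      also have "\<dots> \<le> ennreal (C0 * (2 * Clam * L))" by (rule K0_near[OF L])
      finally show "(\<integral>\<^sup>+v. ennreal (norm (HK L x t (fst v) (snd v))) \<partial>(\<mu> \<Otimes>\<^sub>M unit_measure)) \<le> ennreal (C0 * (2 * Clam * L))" .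
    qed
    show "\<exists>M. \<forall>y c. (\<integral>\<^sup>+w. ennreal (norm (HK L (fst w) (snd w) y c)) \<partial>(\<mu> \<Otimes>\<^sub>M ?\<theta>)) \<le> ennreal M"
    proof (intro exI allI)
      fix y and c :: unit
      have "(\<integral>\<^sup>+w. ennreal (norm (HK L (fst w) (snd w) y c)) \<partial>(\<mu> \<Otimes>\<^sub>M ?\<theta>))
        \<le> (\<integral>\<^sup>+w. ennreal (norm (K0 (fst w) y)) * indicator (ball y L) (fst w) \<partial>(\<mu> \<Otimes>\<^sub>M ?\<theta>))"
        by (intro nn_integral_mono order_trans[OF HK_nn_le]) (auto simp: indicator_def dist_commute)
      also have "\<dots> = (\<integral>\<^sup>+x\<in>ball y L. ennreal (norm (K0 x y)) \<partial>\<mu>) * emeasure ?\<theta> UNIV"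
        by (subst D.nn_integral_fst[symmetric]) (auto simp: nn_integral_multc)
      also have "\<dots> \<le> ennreal (C0 * Clam * (2 * Clam * L)) * ennreal (measure ?\<theta> UNIV)"
        by (intro mult_mono K0_near[OF L]) (auto simp: D.emeasure_eq_measure)
      also have "\<dots> = ennreal (C0 * Clam * (2 * Clam * L) * measure ?\<theta> UNIV)"
        by (simp add: ennreal_mult'')
      finally show "(\<integral>\<^sup>+w. ennreal (norm (HK L (fst w) (snd w) y c)) \<partial>(\<mu> \<Otimes>\<^sub>M ?\<theta>)) \<le> ennreal (C0 * Clam * (2 * Clam * L) * measure ?\<theta> UNIV)" .
    qed
    show "(\<integral>\<^sup>+c. ennreal (norm (HK L x d z c)) \<partial>unit_measure) < top" for x d z
      by (simp add: nn_integral_count_space_finite UNIV_unit)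
    show "(\<integral>\<^sup>+d. ennreal (norm (HK L x d z c)) \<partial>?\<theta>) < top" for x z and c :: unit
    proof -
      have "(\<integral>\<^sup>+d. ennreal (norm (HK L x d z c)) \<partial>?\<theta>) \<le> (\<integral>\<^sup>+d. ennreal (norm (K0 x z)) \<partial>?\<theta>)"
        by (intro nn_integral_mono) (auto simp: HK_def)
      also have "\<dots> < top" using fin by (simp add: ennreal_mult_less_top)
      finally show ?thesis .
    qed
  qed auto
qed

section \<open>Bounds uniform in the truncation\<close>

abbreviation strong_HK :: "real \<Rightarrow> real \<Rightarrow> real \<Rightarrow> real \<Rightarrow> bool" where
  "strong_HK \<epsilon> L \<equiv> kernel_op.strong \<mu> unit_measure (theta {\<epsilon><..<L}) (HK L)"

abbreviation weak_HK :: "real \<Rightarrow> real \<Rightarrow> real \<Rightarrow> bool" where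
  "weak_HK \<epsilon> L \<equiv> kernel_op.weak \<mu> unit_measure (theta {\<epsilon><..<L}) (HK L)"

text \<open>The cutoff starts at \<open>max (dist x y) \<epsilon>\<close>, so the norm in
  \<open>t\<close> is at most \<open>norm (K0 x y)\<close> divided by that maximum; the quotient
  \<open>dist x y / max (dist x y) \<epsilon>\<close> is the factor
  \<open>min 1 (dist x y / \<epsilon>)\<close>. The constant \<open>reg_const\<close> involves
  neither \<open>\<epsilon>\<close> nor \<open>L\<close>.\<close>

lemma cz_kernel_HK:
  assumes e: "0 < \<epsilon>" and L: "0 < L"
  shows "cz_kernel \<mu> lam Clam N0 unit_measure (theta {\<epsilon><..<L}) (HK L) reg_const \<epsilon>"
proof -
  let ?\<theta> = "theta {\<epsilon><..<L}"
  interpret T: kernel_op \<mu> lam Clam N0 unit_measure ?\<theta> "HK L" by (rule kernel_op_HK[OF e L])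
  have hs: "T.hs x y \<le> ennreal (norm (K0 x y) / max (dist x y) \<epsilon>)" for x y
  proof -
    have "T.hs x y = L2 ?\<theta> (\<lambda>t. ennreal (norm (if dist x y < t \<and> t < L then K0 x y else 0)))"
      by (simp add: T.hs_def HK_def)
    also have "\<dots> \<le> L2 ?\<theta> (\<lambda>t. ennreal (norm (if max (dist x y) \<epsilon> < t \<and> t < L then K0 x y else 0)))"
    proof (rule L2_mono_AE)
      have "AE t in ?\<theta>. 0 < t \<and> t \<in> {\<epsilon><..<L}" by (rule AE_theta) simp
      then show "AE t in ?\<theta>. ennreal (norm (if dist x y < t \<and> t < L then K0 x y else 0))
          \<le> ennreal (norm (if max (dist x y) \<epsilon> < t \<and> t < L then K0 x y else 0))"
        by eventually_elim auto
    qed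
    also have "\<dots> \<le> ennreal (norm (K0 x y) / max (dist x y) \<epsilon>)"
      using e by (intro L2_theta_cutoff) auto
    finally show ?thesis .
  qed
  show ?thesis
  proof (intro cz_kernel.intro kernel_op_HK[OF e L] cz_kernel_axioms.intro reg_const e)
    show "T.hs x x = 0" for x using hs[of x x] by simp
    show "T.hs x y \<le> ennreal (reg_const * min 1 (dist x y / \<epsilon>) / lam x (dist x y))" if "x \<noteq> y" for x y
    proof -
      have d: "0 < dist x y" using that by simp
      have l: "0 < lam x (dist x y)" using d by (rule lam_pos)
      have "norm (K0 x y) / max (dist x y) \<epsilon> \<le> reg_const * (dist x y / lam x (dist x y)) / max (dist x y) \<epsilon>"
      proof (intro divide_right_mono order_trans[OF K0_size] mult_right_mono reg_const)
        show "0 \<le> dist x y / lam x (dist x y)" using d l by simp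
      qed (use e in auto)
      also have "\<dots> = reg_const * (dist x y / max (dist x y) \<epsilon>) / lam x (dist x y)" by simp
      also have "dist x y / max (dist x y) \<epsilon> = min 1 (dist x y / \<epsilon>)"
        using d e by (cases "dist x y \<le> \<epsilon>") (auto simp: max_def min_def)
      finally show ?thesis using hs[of x y] by (elim order_trans) (rule ennreal_leI)
    qed
    show "(\<integral>\<^sup>+x\<in>- ball z (2 * R). L2 ?\<theta> (\<lambda>d. L2 unit_measure (\<lambda>c. ennreal (norm (HK L x d y c - HK L x d z c)))) \<partial>\<mu>) \<le> ennreal reg_const"
      if "0 < R" "dist z y < R" for R y z
      unfolding HK_def L2_unit by (rule jump_first[OF _ that]) simp
    show "(\<integral>\<^sup>+y\<in>- ball z (2 * R). L2 unit_measure (\<lambda>c. L2 ?\<theta> (\<lambda>d. ennreal (norm (HK L x d y c - HK L z d y c)))) \<partial>\<mu>) \<le> ennreal reg_const"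
      if "0 < R" "dist z x < R" for R x z
      unfolding HK_def L2_unit by (rule jump_second[OF _ that]) simp
  qed
qed

text \<open>Exponents below \<open>p\<close> come from interpolation. For \<open>q > p\<close> the
  conjugate exponents satisfy \<open>q' < p'\<close>: dualise to the transpose at \<open>p'\<close>,
  interpolate there down to \<open>q'\<close>, and dualise back.\<close>

lemma strong_all:
  assumes p: "1 < p" and B: "0 \<le> B" and q: "1 < q"
    and st: "\<And>\<epsilon> L. 0 < \<epsilon> \<Longrightarrow> 0 < L \<Longrightarrow> strong_HK \<epsilon> L p B"
  shows "\<exists>B'\<ge>0. \<forall>\<epsilon> L. 0 < \<epsilon> \<longrightarrow> 0 < L \<longrightarrow> strong_HK \<epsilon> L q B'"
proof -
  consider "q < p" | "q = p" | "p < q" by linarith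
  then show ?thesis
  proof cases
    case 1
    define B' where "B' = q * (2 * cz_kernel.weak_const Clam N0 reg_const p B / (q - 1) + 2 powr p * B / (p - q))"
    have "0 \<le> B'"
    proof -
      \<comment> \<open>Any truncation would do: the constant does not involve
        \<open>\<epsilon>\<close> or \<open>L\<close>, and the instance gives access to its
        sign.\<close>
      interpret T: cz_kernel \<mu> lam Clam N0 unit_measure "theta {1<..<1}" "HK 1" reg_const 1
        by (rule cz_kernel_HK) auto
      show ?thesis unfolding B'_def using 1 q B T.piece_const_nonneg[of p B]
        by (intro mult_nonneg_nonneg add_nonneg_nonneg divide_nonneg_nonneg) (auto simp: T.weak_const_def)
    qed
    moreover have "strong_HK \<epsilon> L q B'" if "0 < \<epsilon>" "0 < L" for \<epsilon> L
    proof -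
      interpret T: cz_kernel \<mu> lam Clam N0 unit_measure "theta {\<epsilon><..<L}" "HK L" reg_const \<epsilon>
        by (rule cz_kernel_HK[OF that])
      show ?thesis unfolding B'_def by (rule T.strong_below[OF st[OF that] B q 1])
    qed
    ultimately show ?thesis by blast
  next
    case 2
    then show ?thesis using st B by blast
  next
    case 3
    define p' where "p' = p / (p - 1)"
    define q' where "q' = q / (q - 1)"
    have p': "1 < p'" "1 / p + 1 / p' = 1" and q': "1 < q'" "1 / q' + 1 / q = 1"
      using p q by (auto simp: p'_def q'_def field_simps)
    have qp': "q' < p'" using 3 p q by (simp add: p'_def q'_def field_simps)
    define B1 where "B1 = B powr (p' / p)"
    define B2 where "B2 = q' * (2 * cz_kernel.weak_const Clam N0 (reg_const * Clam) p' B1 / (q' - 1) + 2 powr p' * B1 / (p' - q'))"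
    have B1: "0 \<le> B1" by (simp add: B1_def)
    have "strong_HK \<epsilon> L q (B2 powr (q / q'))" if "0 < \<epsilon>" "0 < L" for \<epsilon> L
    proof -
      interpret T: cz_kernel \<mu> lam Clam N0 unit_measure "theta {\<epsilon><..<L}" "HK L" reg_const \<epsilon>
        by (rule cz_kernel_HK[OF that])
      interpret T': cz_kernel \<mu> lam Clam N0 "theta {\<epsilon><..<L}" unit_measure "\<lambda>y c x d. HK L x d y c" "reg_const * Clam" \<epsilon>
        by (rule T.transpose_cz)
      have "T'.strong p' B1" unfolding B1_def by (rule T.duality[OF st[OF that] B p p'])
      then have s: "T'.strong q' B2" unfolding B2_def using B1 q'(1) qp' by (intro T'.strong_below)
      have "0 \<le> B2" unfolding B2_def using qp' q' B1 T'.piece_const_nonneg[of p' B1]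
        by (intro mult_nonneg_nonneg add_nonneg_nonneg divide_nonneg_nonneg) (auto simp: T'.weak_const_def)
      from T'.duality[OF s this q'(1) q q'(2)] show ?thesis .
    qed
    then show ?thesis by (intro exI[of _ "B2 powr (q / q')"]) auto
  qed
qed

lemma weak_all:
  assumes p: "1 < p" and B: "0 \<le> B"
    and st: "\<And>\<epsilon> L. 0 < \<epsilon> \<Longrightarrow> 0 < L \<Longrightarrow> strong_HK \<epsilon> L p B"
  shows "\<exists>W\<ge>0. \<forall>\<epsilon> L. 0 < \<epsilon> \<longrightarrow> 0 < L \<longrightarrow> weak_HK \<epsilon> L W"
proof (intro exI[of _ "cz_kernel.weak_const Clam N0 reg_const p B"] conjI allI impI)
  interpret T: cz_kernel \<mu> lam Clam N0 unit_measure "theta {1<..<1}" "HK 1" reg_const 1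
    by (rule cz_kernel_HK) auto
  show "0 \<le> cz_kernel.weak_const Clam N0 reg_const p B"
    using B T.piece_const_nonneg[of p B] by (simp add: T.weak_const_def)
  fix \<epsilon> L :: real assume "0 < \<epsilon>" "0 < L"
  then interpret T': cz_kernel \<mu> lam Clam N0 unit_measure "theta {\<epsilon><..<L}" "HK L" reg_const \<epsilon>
    by (rule cz_kernel_HK)
  show "weak_HK \<epsilon> L (cz_kernel.weak_const Clam N0 reg_const p B)"
    by (rule T'.weak_type[OF st p B]) fact+
qed

end

section \<open>Boundedness of the Marcinkiewicz integral on Lebesgue spaces\<close>

context mk_kernel
begin

definition Kint :: "('a \<Rightarrow> complex) \<Rightarrow> 'a \<Rightarrow> real \<Rightarrow> complex" where
  "Kint f x t = (\<integral>y. (if dist x y < t then K0 x y * f y else 0) \<partial>\<mu>)"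

definition MI :: "real set \<Rightarrow> ('a \<Rightarrow> complex) \<Rightarrow> 'a \<Rightarrow> ennreal" where
  "MI S f x = L2 (theta S) (\<lambda>t. ennreal (norm (Kint f x t)))"

lemma Kint_measurable [measurable (raw)]:
  assumes [measurable]: "f \<in> borel_measurable \<mu>" "g \<in> M \<rightarrow>\<^sub>M \<mu>" "h \<in> borel_measurable M"
  shows "(\<lambda>w. Kint f (g w) (h w)) \<in> borel_measurable M"
  unfolding Kint_def by (rule borel_measurable_lebesgue_integral) (simp add: split_beta)

lemma MI_measurable [measurable]:
  assumes [measurable]: "f \<in> borel_measurable \<mu>" "S \<in> sets borel"
  shows "MI S f \<in> borel_measurable \<mu>"
  unfolding MI_def[abs_def] by (rule L2_measurable[OF sigma_finite_theta]) (auto simp: split_beta)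

lemma MI_eq:
  assumes [measurable]: "f \<in> borel_measurable \<mu>" "S \<in> sets borel"
  shows "MI S f x = ennreal_powr (\<integral>\<^sup>+t. ennreal (if 0 < t \<and> t \<in> S then 1 / t ^ 3 else 0)
     * (ennreal (norm (Kint f x t)))\<^sup>2 \<partial>lborel) (1 / 2)"
  unfolding MI_def L2_def by (subst nn_integral_theta) auto

lemma marcinkiewicz_eq:
  assumes [measurable]: "f \<in> borel_measurable \<mu>"
  shows "marcinkiewicz \<mu> K f x = MI UNIV f x"
proof -
  have "(LINT y:(ball x t - {x})|\<mu>. K x y * f y) = Kint f x t" for t
    unfolding Kint_def set_lebesgue_integral_def
    by (intro Bochner_Integration.integral_cong refl) (auto simp: K0_def indicator_def)
  moreover have "ennreal ((norm (Kint f x t))\<^sup>2 / t ^ 3) * indicator {0<..} t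
      = ennreal (if 0 < t \<and> t \<in> UNIV then 1 / t ^ 3 else 0) * (ennreal (norm (Kint f x t)))\<^sup>2" for t
    by (auto simp: indicator_def ennreal_power mult.commute simp flip: ennreal_mult'' intro!: arg_cong[where f=ennreal])
  ultimately show ?thesis by (simp add: marcinkiewicz_def MI_eq)
qed

lemma MI_mono_set:
  assumes [measurable]: "f \<in> borel_measurable \<mu>" "S \<in> sets borel" "S' \<in> sets borel" and "S \<subseteq> S'"
  shows "MI S f x \<le> MI S' f x"
  unfolding MI_eq[OF assms(1,2)] MI_eq[OF assms(1,3)] using assms(4)
  by (intro ennreal_powr_mono nn_integral_mono mult_right_mono) (auto intro!: ennreal_leI)

lemma MI_split:
  assumes [measurable]: "f \<in> borel_measurable \<mu>" "S \<in> sets borel" "S' \<in> sets borel"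
  shows "MI (S \<union> S') f x \<le> MI S f x + MI S' f x"
proof -
  let ?k = "\<lambda>S t. ennreal (if 0 < t \<and> t \<in> S then 1 / t ^ 3 else 0) * (ennreal (norm (Kint f x t)))\<^sup>2"
  have sq: "(MI S f x)\<^sup>2 = (\<integral>\<^sup>+t. ?k S t \<partial>lborel)" if "S \<in> sets borel" for S
    unfolding MI_eq[OF assms(1) that] by simp
  have "(MI (S \<union> S') f x)\<^sup>2 \<le> (\<integral>\<^sup>+t. ?k S t + ?k S' t \<partial>lborel)"
    unfolding sq[OF sets.Un[OF assms(2,3)]] by (intro nn_integral_mono) auto
  also have "\<dots> = (MI S f x)\<^sup>2 + (MI S' f x)\<^sup>2"
    by (simp add: nn_integral_add sq)
  also have "\<dots> \<le> (MI S f x + MI S' f x)\<^sup>2" by (simp add: power2_sum)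
  finally show ?thesis by (simp add: ennreal_power2_le_iff)
qed

text \<open>
  Where this fails, the inner Bochner integrals may have the junk value \<open>0\<close>, and additivity in \<open>f\<close>
  is lost.
\<close>

definition convergent_at :: "('a \<Rightarrow> complex) \<Rightarrow> 'a \<Rightarrow> bool" where
  "convergent_at f x \<longleftrightarrow> (\<forall>m::nat. (\<integral>\<^sup>+y\<in>ball x (real m). ennreal (norm (K0 x y * f y)) \<partial>\<mu>) < top)"

lemma convergent_at_integrable:
  assumes [measurable]: "f \<in> borel_measurable \<mu>" and g: "convergent_at f x"
  shows "integrable \<mu> (\<lambda>y. if dist x y < t then K0 x y * f y else 0)"
proof (rule integrableI_bounded)
  show "(\<lambda>y. if dist x y < t then K0 x y * f y else 0) \<in> borel_measurable \<mu>" by measurable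
  obtain m :: nat where m: "t < real m" using reals_Archimedean2 by blast
  have "(\<integral>\<^sup>+y. ennreal (norm (if dist x y < t then K0 x y * f y else 0)) \<partial>\<mu>)
      \<le> (\<integral>\<^sup>+y\<in>ball x (real m). ennreal (norm (K0 x y * f y)) \<partial>\<mu>)"
    using m by (intro nn_integral_mono) (auto simp: indicator_def)
  also have "\<dots> < \<infinity>" using g by (simp add: convergent_at_def)
  finally show "(\<integral>\<^sup>+y. ennreal (norm (if dist x y < t then K0 x y * f y else 0)) \<partial>\<mu>) < \<infinity>" .
qed

lemma Kint_add:
  assumes "f \<in> borel_measurable \<mu>" "convergent_at f x" "g \<in> borel_measurable \<mu>" "convergent_at g x"
  shows "Kint (\<lambda>y. f y + g y) x t = Kint f x t + Kint g x t"
proof -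
  have "Kint (\<lambda>y. f y + g y) x t = (\<integral>y. (if dist x y < t then K0 x y * f y else 0) + (if dist x y < t then K0 x y * g y else 0) \<partial>\<mu>)"
    unfolding Kint_def by (intro Bochner_Integration.integral_cong refl) (simp add: distrib_left)
  also have "\<dots> = Kint f x t + Kint g x t"
    unfolding Kint_def by (intro Bochner_Integration.integral_add convergent_at_integrable assms)
  finally show ?thesis .
qed

lemma MI_add:
  assumes [measurable]: "f \<in> borel_measurable \<mu>" "g \<in> borel_measurable \<mu>" "S \<in> sets borel" and "convergent_at f x" "convergent_at g x"
  shows "MI S (\<lambda>y. f y + g y) x \<le> MI S f x + MI S g x"
proof -
  have "MI S (\<lambda>y. f y + g y) x \<le> L2 (theta S) (\<lambda>t. ennreal (norm (Kint f x t)) + ennreal (norm (Kint g x t)))"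
    unfolding MI_def Kint_add[OF assms(1,4,2,5)]
    by (intro L2_mono) (simp add: norm_triangle_ineq flip: ennreal_plus)
  also have "\<dots> \<le> MI S f x + MI S g x" unfolding MI_def by (intro L2_add) measurable
  finally show ?thesis .
qed

lemma Kint_cmult: "Kint (\<lambda>y. c * f y) x t = c * Kint f x t"
proof -
  have "Kint (\<lambda>y. c * f y) x t = (\<integral>y. c * (if dist x y < t then K0 x y * f y else 0) \<partial>\<mu>)"
    unfolding Kint_def by (intro Bochner_Integration.integral_cong refl) simp
  then show ?thesis by (simp add: Kint_def)
qed

lemma MI_cmult:
  assumes [measurable]: "f \<in> borel_measurable \<mu>" "S \<in> sets borel"
  shows "MI S (\<lambda>y. c * f y) x = ennreal (norm c) * MI S f x"
  unfolding MI_def Kint_cmult by (simp add: norm_mult ennreal_mult L2_cmult)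

lemma local_L1:
  assumes "1 \<le> q" and "(\<integral>\<^sup>+y. ennreal_powr (ennreal (norm (f y))) q \<partial>\<mu>) < top"
    and [measurable]: "f \<in> borel_measurable \<mu>"
  shows "(\<integral>\<^sup>+y\<in>ball z r. ennreal (norm (f y)) \<partial>\<mu>) < top"
proof -
  have "(\<integral>\<^sup>+y\<in>ball z r. ennreal (norm (f y)) \<partial>\<mu>) \<le> (\<integral>\<^sup>+y. indicator (ball z r) y + ennreal_powr (ennreal (norm (f y))) q \<partial>\<mu>)"
  proof (intro nn_integral_mono)
    fix y
    have "ennreal (norm (f y)) \<le> 1 + ennreal_powr (ennreal (norm (f y))) q"
    proof (cases "norm (f y) \<le> 1")
      case True
      then show ?thesis by (simp add: add_increasing2)
    next
      case False
      then have "norm (f y) powr 1 \<le> norm (f y) powr q" using assms(1) by (intro powr_mono) auto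
      then have "norm (f y) \<le> norm (f y) powr q" by simp
      then have "ennreal (norm (f y)) \<le> ennreal_powr (ennreal (norm (f y))) q" by (simp add: ennreal_powr_ennreal)
      then show ?thesis by (rule add_increasing[rotated]) simp
    qed
    then show "ennreal (norm (f y)) * indicator (ball z r) y \<le> indicator (ball z r) y + ennreal_powr (ennreal (norm (f y))) q"
      by (simp add: indicator_def)
  qed
  also have "\<dots> = emeasure \<mu> (ball z r) + (\<integral>\<^sup>+y. ennreal_powr (ennreal (norm (f y))) q \<partial>\<mu>)"
    by (simp add: nn_integral_add)
  also have "\<dots> < top" using assms(2) by simp
  finally show ?thesis .
qed

text \<open>Tonelli over a ball in \<open>x\<close>: for fixed \<open>y\<close> the kernel is
  integrable in its first variable near \<open>y\<close>, and the inner radius keeps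
  \<open>y\<close> in a bounded set, where \<open>f\<close> is integrable. Countably many balls and
  radii suffice.\<close>

lemma convergent_at_AE:
  assumes [measurable]: "f \<in> borel_measurable \<mu>"
    and loc: "\<And>z r. (\<integral>\<^sup>+y\<in>ball z r. ennreal (norm (f y)) \<partial>\<mu>) < top"
  shows "AE x in \<mu>. convergent_at f x"
proof -
  fix o1 :: 'a
  have one: "AE x in \<mu>. x \<in> ball o1 (real k) \<longrightarrow> (\<integral>\<^sup>+y\<in>ball x (real m). ennreal (norm (K0 x y * f y)) \<partial>\<mu>) < top"
    for k m :: nat
  proof -
    let ?g = "\<lambda>x. (\<integral>\<^sup>+y. ennreal (norm (K0 x y * f y)) * (if dist x y < real m then 1 else 0) \<partial>\<mu>)"
    have [measurable]: "?g \<in> borel_measurable \<mu>" by measurable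
    have "(\<integral>\<^sup>+x\<in>ball o1 (real k). ?g x \<partial>\<mu>)
        = (\<integral>\<^sup>+x. (\<integral>\<^sup>+y. ennreal (norm (K0 x y * f y)) * (if dist x y < real m then 1 else 0) * indicator (ball o1 (real k)) x \<partial>\<mu>) \<partial>\<mu>)"
      by (intro nn_integral_cong) (simp add: nn_integral_multc)
    also have "\<dots> = (\<integral>\<^sup>+y. (\<integral>\<^sup>+x. ennreal (norm (K0 x y * f y)) * (if dist x y < real m then 1 else 0) * indicator (ball o1 (real k)) x \<partial>\<mu>) \<partial>\<mu>)"
      by (rule pair_sigma_finite.Fubini') (auto simp: pair_sigma_finite_def sigma_finite)
    also have "\<dots> \<le> (\<integral>\<^sup>+y. ennreal (C0 * Clam * (2 * Clam * real (Suc m))) * (ennreal (norm (f y)) * indicator (ball o1 (real k + real m)) y) \<partial>\<mu>)"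
    proof (intro nn_integral_mono)
      fix y
      have "(\<integral>\<^sup>+x. ennreal (norm (K0 x y * f y)) * (if dist x y < real m then 1 else 0) * indicator (ball o1 (real k)) x \<partial>\<mu>)
         \<le> (\<integral>\<^sup>+x. (ennreal (norm (K0 x y)) * indicator (ball y (real (Suc m))) x) * (ennreal (norm (f y)) * indicator (ball o1 (real k + real m)) y) \<partial>\<mu>)"
      proof (intro nn_integral_mono)
        fix x
        have "dist o1 y < real k + real m" if "dist x y < real m" "dist o1 x < real k"
          using that dist_triangle[of o1 y x] by linarith
        then show "ennreal (norm (K0 x y * f y)) * (if dist x y < real m then 1 else 0) * indicator (ball o1 (real k)) x
          \<le> (ennreal (norm (K0 x y)) * indicator (ball y (real (Suc m))) x) * (ennreal (norm (f y)) * indicator (ball o1 (real k + real m)) y)"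
          by (auto simp: indicator_def norm_mult ennreal_mult dist_commute)
      qed
      also have "\<dots> = (\<integral>\<^sup>+x\<in>ball y (real (Suc m)). ennreal (norm (K0 x y)) \<partial>\<mu>) * (ennreal (norm (f y)) * indicator (ball o1 (real k + real m)) y)"
        by (rule nn_integral_multc) measurable
      also have "\<dots> \<le> ennreal (C0 * Clam * (2 * Clam * real (Suc m))) * (ennreal (norm (f y)) * indicator (ball o1 (real k + real m)) y)"
        by (intro mult_right_mono K0_near) auto
      finally show "(\<integral>\<^sup>+x. ennreal (norm (K0 x y * f y)) * (if dist x y < real m then 1 else 0) * indicator (ball o1 (real k)) x \<partial>\<mu>)
        \<le> ennreal (C0 * Clam * (2 * Clam * real (Suc m))) * (ennreal (norm (f y)) * indicator (ball o1 (real k + real m)) y)" .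
    qed
    also have "\<dots> = ennreal (C0 * Clam * (2 * Clam * real (Suc m))) * (\<integral>\<^sup>+y\<in>ball o1 (real k + real m). ennreal (norm (f y)) \<partial>\<mu>)"
      by (rule nn_integral_cmult) measurable
    also have "\<dots> < top" using loc by (simp add: ennreal_mult_less_top)
    finally have "(\<integral>\<^sup>+x\<in>ball o1 (real k). ?g x \<partial>\<mu>) \<noteq> \<infinity>" by simp
    then have "AE x in \<mu>. ?g x * indicator (ball o1 (real k)) x \<noteq> \<infinity>"
      by (intro nn_integral_PInf_AE) auto
    then show ?thesis
    proof eventually_elim
      case (elim x)
      have "(\<integral>\<^sup>+y\<in>ball x (real m). ennreal (norm (K0 x y * f y)) \<partial>\<mu>) = ?g x"
        by (intro nn_integral_cong) (simp add: indicator_def)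
      then show ?case using elim by (auto simp: less_top)
    qed
  qed
  then have "AE x in \<mu>. \<forall>k m. x \<in> ball o1 (real k) \<longrightarrow> (\<integral>\<^sup>+y\<in>ball x (real m). ennreal (norm (K0 x y * f y)) \<partial>\<mu>) < top"
    unfolding AE_all_countable by blast
  then show ?thesis
  proof eventually_elim
    case (elim x)
    obtain k :: nat where "dist o1 x < real k" using reals_Archimedean2 by blast
    then show ?case using elim by (auto simp: convergent_at_def)
  qed
qed

section \<open>Removal of the truncation\<close>

lemma MI_test_function:
  assumes e: "0 < \<epsilon>" and L: "0 < L" and f: "test_function unit_measure (\<lambda>y c. f y)"
  shows "MI {\<epsilon><..<L} f x = fnorm (theta {\<epsilon><..<L}) (kernel_op.appl \<mu> unit_measure (HK L) (\<lambda>y c. f y)) x"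
proof -
  interpret T: kernel_op \<mu> lam Clam N0 unit_measure "theta {\<epsilon><..<L}" "HK L" by (rule kernel_op_HK[OF e L])
  have eq: "T.appl (\<lambda>y c. f y) x t = Kint f x t" if "t < L" for t
  proof -
    have "T.appl (\<lambda>y c. f y) x t = (\<integral>y. \<integral>c. HK L x t y c * f y \<partial>unit_measure \<partial>\<mu>)"
      unfolding T.appl_def
      using T.MT.integral_fst[of "\<lambda>y c. HK L x t y c * f y", unfolded split_beta, OF T.integrable_appl[OF f]]
      by (rule sym)
    also have "\<dots> = Kint f x t"
      unfolding Kint_def
      by (intro Bochner_Integration.integral_cong refl)
        (simp add: HK_def that lebesgue_integral_count_space_finite UNIV_unit)
    finally show ?thesis .
  qed
  have "AE t in theta {\<epsilon><..<L}. ennreal (norm (Kint f x t)) = ennreal (norm (T.appl (\<lambda>y c. f y) x t))"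
  proof -
    have "AE t in theta {\<epsilon><..<L}. 0 < t \<and> t \<in> {\<epsilon><..<L}" by (rule AE_theta) simp
    then show ?thesis by eventually_elim (simp add: eq)
  qed
  then show ?thesis unfolding MI_def
    by (intro antisym L2_mono_AE) (auto elim: eventually_mono)
qed

text \<open>Support and height are cut simultaneously, which produces test functions;
  \<open>SOME z. True\<close> is an arbitrary base point.\<close>

definition truncate :: "nat \<Rightarrow> ('a \<Rightarrow> complex) \<Rightarrow> 'a \<Rightarrow> complex" where
  "truncate n f y = (if dist (SOME z. True) y < real n \<and> norm (f y) \<le> real n then f y else 0)"

lemma truncate_measurable [measurable]:
  assumes [measurable]: "f \<in> borel_measurable \<mu>" shows "truncate n f \<in> borel_measurable \<mu>"
  unfolding truncate_def[abs_def] by measurable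

lemma test_function_truncate: "f \<in> borel_measurable \<mu> \<Longrightarrow> test_function unit_measure (\<lambda>y c. truncate n f y)"
  by (rule test_functionI[where m="real n" and z="SOME z. True" and r="real n"]) (measurable, auto simp: truncate_def)

lemma norm_truncate_le: "norm (truncate n f y) \<le> norm (f y)"
  by (simp add: truncate_def)

lemma truncate_eventually: "\<forall>\<^sub>F n in sequentially. truncate n f y = f y"
proof -
  obtain N :: nat where N: "max (dist (SOME z. True) y) (norm (f y)) < real N" using reals_Archimedean2 by blast
  have "truncate n f y = f y" if "N \<le> n" for n
  proof -
    have "real N \<le> real n" using that by simp
    then show ?thesis using N by (auto simp: truncate_def)
  qed
  then show ?thesis by (auto simp: eventually_sequentially)
qed

text \<open>At a point where \<open>f\<close> is \<open>convergent_at\<close>, dominated convergence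
  gives the limit of the inner integral for each \<open>t\<close>; Fatou's lemma in \<open>t\<close>
  does the rest while the range of \<open>t\<close> grows to the half-line.\<close>

lemma MI_liminf:
  assumes [measurable]: "f \<in> borel_measurable \<mu>" and g: "convergent_at f x"
  shows "MI UNIV f x \<le> liminf (\<lambda>n. MI {1 / real (Suc n)<..<real (Suc n)} (truncate n f) x)"
proof -
  let ?S = "\<lambda>n::nat. {1 / real (Suc n)<..<real (Suc n)}"
  let ?k = "\<lambda>S f t. ennreal (if 0 < t \<and> t \<in> S then 1 / t ^ 3 else 0) * (ennreal (norm (Kint f x t)))\<^sup>2"
  have conv: "(\<lambda>n. Kint (truncate n f) x t) \<longlonglongrightarrow> Kint f x t" for t
    unfolding Kint_def
  proof (rule integral_dominated_convergence[where w="\<lambda>y. norm (if dist x y < t then K0 x y * f y else 0)"])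
    show "integrable \<mu> (\<lambda>y. norm (if dist x y < t then K0 x y * f y else 0))"
      by (intro integrable_norm convergent_at_integrable g) measurable
    show "AE y in \<mu>. (\<lambda>n. if dist x y < t then K0 x y * truncate n f y else 0) \<longlonglongrightarrow> (if dist x y < t then K0 x y * f y else 0)"
      by (intro AE_I2 tendsto_eventually) (use truncate_eventually[of f] in \<open>auto elim: eventually_mono\<close>)
    show "AE y in \<mu>. norm (if dist x y < t then K0 x y * truncate n f y else 0) \<le> norm (if dist x y < t then K0 x y * f y else 0)" for n
      by (intro AE_I2) (auto simp: norm_mult norm_truncate_le mult_left_mono)
  qed measurable
  have lim: "(\<lambda>n. ?k (?S n) (truncate n f) t) \<longlonglongrightarrow> ?k UNIV f t" for t
  proof (cases "0 < t")
    case True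
    obtain N :: nat where N: "max t (1 / t) < real N" using reals_Archimedean2 by blast
    have "t \<in> ?S n" if "N \<le> n" for n
    proof -
      have "real N \<le> real (Suc n)" using that by simp
      then have "t < real (Suc n)" "1 / t < real (Suc n)" using N by auto
      then show ?thesis using True by (simp add: field_simps)
    qed
    then have ev: "\<forall>\<^sub>F n in sequentially. t \<in> ?S n" unfolding eventually_sequentially by blast
    have 1: "(\<lambda>n. ennreal (1 / t ^ 3 * (norm (Kint (truncate n f) x t))\<^sup>2)) \<longlonglongrightarrow> ennreal (1 / t ^ 3 * (norm (Kint f x t))\<^sup>2)"
      by (intro tendsto_intros conv)
    have 2: "ennreal (1 / t ^ 3 * (norm (Kint f x t))\<^sup>2) = ?k UNIV f t"
      using True by (simp add: ennreal_power flip: ennreal_mult)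
    have 3: "\<forall>\<^sub>F n in sequentially. ennreal (1 / t ^ 3 * (norm (Kint (truncate n f) x t))\<^sup>2) = ?k (?S n) (truncate n f) t"
      using ev by eventually_elim (use True in \<open>simp add: ennreal_power flip: ennreal_mult\<close>)
    show ?thesis using Lim_transform_eventually[OF 1 3] unfolding 2 .
  qed simp
  have "(\<integral>\<^sup>+t. ?k UNIV f t \<partial>lborel) = (\<integral>\<^sup>+t. liminf (\<lambda>n. ?k (?S n) (truncate n f) t) \<partial>lborel)"
    by (intro nn_integral_cong lim_imp_Liminf[symmetric] lim) simp
  also have "\<dots> \<le> liminf (\<lambda>n. \<integral>\<^sup>+t. ?k (?S n) (truncate n f) t \<partial>lborel)"
    by (rule nn_integral_liminf) measurable
  finally have "ennreal_powr (\<integral>\<^sup>+t. ?k UNIV f t \<partial>lborel) (1 / 2)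
      \<le> ennreal_powr (liminf (\<lambda>n. \<integral>\<^sup>+t. ?k (?S n) (truncate n f) t \<partial>lborel)) (1 / 2)"
    by (intro ennreal_powr_mono) auto
  also have "\<dots> \<le> liminf (\<lambda>n. ennreal_powr (\<integral>\<^sup>+t. ?k (?S n) (truncate n f) t \<partial>lborel) (1 / 2))"
    by (rule ennreal_powr_liminf) simp
  finally show ?thesis by (simp add: MI_eq)
qed

lemma strong_MI:
  assumes q: "1 < q" and f[measurable]: "f \<in> borel_measurable \<mu>"
    and st: "\<And>\<epsilon> L. 0 < \<epsilon> \<Longrightarrow> 0 < L \<Longrightarrow> strong_HK \<epsilon> L q B"
    and fin: "(\<integral>\<^sup>+y. ennreal_powr (ennreal (norm (f y))) q \<partial>\<mu>) < top"
  shows "(\<integral>\<^sup>+x. ennreal_powr (MI UNIV f x) q \<partial>\<mu>) \<le> ennreal B * (\<integral>\<^sup>+y. ennreal_powr (ennreal (norm (f y))) q \<partial>\<mu>)"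
proof -
  let ?S = "\<lambda>n::nat. {1 / real (Suc n)<..<real (Suc n)}"
  have "AE x in \<mu>. convergent_at f x" using q fin by (intro convergent_at_AE local_L1[where q=q]) auto
  then have "AE x in \<mu>. ennreal_powr (MI UNIV f x) q \<le> liminf (\<lambda>n. ennreal_powr (MI (?S n) (truncate n f) x) q)"
  proof eventually_elim
    case (elim x)
    have "ennreal_powr (MI UNIV f x) q \<le> ennreal_powr (liminf (\<lambda>n. MI (?S n) (truncate n f) x)) q"
      using q MI_liminf[OF f elim] by (intro ennreal_powr_mono) auto
    also have "\<dots> \<le> liminf (\<lambda>n. ennreal_powr (MI (?S n) (truncate n f) x) q)"
      by (rule ennreal_powr_liminf) (use q in simp)
    finally show ?case .
  qed
  then have "(\<integral>\<^sup>+x. ennreal_powr (MI UNIV f x) q \<partial>\<mu>) \<le> (\<integral>\<^sup>+x. liminf (\<lambda>n. ennreal_powr (MI (?S n) (truncate n f) x) q) \<partial>\<mu>)"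
    by (rule nn_integral_mono_AE)
  also have "\<dots> \<le> liminf (\<lambda>n. \<integral>\<^sup>+x. ennreal_powr (MI (?S n) (truncate n f) x) q \<partial>\<mu>)"
    by (rule nn_integral_liminf) measurable
  also have "\<dots> \<le> liminf (\<lambda>n. ennreal B * (\<integral>\<^sup>+y. ennreal_powr (ennreal (norm (f y))) q \<partial>\<mu>))"
  proof (intro Liminf_mono always_eventually allI)
    fix n
    interpret T: kernel_op \<mu> lam Clam N0 unit_measure "theta (?S n)" "HK (real (Suc n))"
      by (rule kernel_op_HK) auto
    have "(\<integral>\<^sup>+x. ennreal_powr (MI (?S n) (truncate n f) x) q \<partial>\<mu>)
        = (\<integral>\<^sup>+x. ennreal_powr (fnorm (theta (?S n)) (T.appl (\<lambda>y c. truncate n f y)) x) q \<partial>\<mu>)"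
      by (subst MI_test_function[OF _ _ test_function_truncate[OF f]]) auto
    also have "\<dots> \<le> ennreal B * (\<integral>\<^sup>+x. ennreal_powr (fnorm unit_measure (\<lambda>y c. truncate n f y) x) q \<partial>\<mu>)"
      by (rule T.strong_def[THEN iffD1, THEN spec, THEN mp, OF st test_function_truncate[OF f]]) auto
    also have "\<dots> \<le> ennreal B * (\<integral>\<^sup>+y. ennreal_powr (ennreal (norm (f y))) q \<partial>\<mu>)"
      using q by (intro mult_left_mono nn_integral_mono ennreal_powr_mono) (auto intro!: ennreal_leI norm_truncate_le)
    finally show "(\<integral>\<^sup>+x. ennreal_powr (MI (?S n) (truncate n f) x) q \<partial>\<mu>)
      \<le> ennreal B * (\<integral>\<^sup>+y. ennreal_powr (ennreal (norm (f y))) q \<partial>\<mu>)" .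
  qed
  also have "\<dots> = ennreal B * (\<integral>\<^sup>+y. ennreal_powr (ennreal (norm (f y))) q \<partial>\<mu>)" by (simp add: Liminf_const)
  finally show ?thesis .
qed

text \<open>The inequality defining the superlevel set is strict, so by \<open>MI_liminf\<close> it
  holds for all large truncations; Fatou's lemma is applied to the indicators.\<close>

lemma weak_MI:
  assumes f[measurable]: "f \<in> borel_measurable \<mu>" and s: "0 < s"
    and wk: "\<And>\<epsilon> L. 0 < \<epsilon> \<Longrightarrow> 0 < L \<Longrightarrow> weak_HK \<epsilon> L W"
    and fin: "(\<integral>\<^sup>+y. ennreal (norm (f y)) \<partial>\<mu>) < top"
  shows "ennreal s * emeasure \<mu> {x. ennreal s < MI UNIV f x} \<le> ennreal W * (\<integral>\<^sup>+y. ennreal (norm (f y)) \<partial>\<mu>)"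
proof -
  let ?S = "\<lambda>n::nat. {1 / real (Suc n)<..<real (Suc n)}"
  have m: "{x. ennreal s < MI S g x} \<in> sets \<mu>" if [measurable]: "g \<in> borel_measurable \<mu>" "S \<in> sets borel" for g S
  proof -
    have "{x\<in>space \<mu>. ennreal s < MI S g x} \<in> sets \<mu>" by measurable
    then show ?thesis by simp
  qed
  have "AE x in \<mu>. convergent_at f x" using fin local_L1[of 1 f] by (intro convergent_at_AE) auto
  then have "AE x in \<mu>. indicator {x. ennreal s < MI UNIV f x} x
      \<le> liminf (\<lambda>n. indicator {x. ennreal s < MI (?S n) (truncate n f) x} x :: ennreal)"
  proof eventually_elim
    case (elim x)
    show ?case
    proof (cases "ennreal s < MI UNIV f x")
      case True
      then have "ennreal s < liminf (\<lambda>n. MI (?S n) (truncate n f) x)" using MI_liminf[OF f elim] by (rule less_le_trans)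
      then have "\<forall>\<^sub>F n in sequentially. ennreal s < MI (?S n) (truncate n f) x" by (rule less_LiminfD)
      then have "1 \<le> liminf (\<lambda>n. indicator {x. ennreal s < MI (?S n) (truncate n f) x} x :: ennreal)"
        by (intro Liminf_bounded) (auto elim: eventually_mono)
      then show ?thesis using True by simp
    qed simp
  qed
  then have "(\<integral>\<^sup>+x. indicator {x. ennreal s < MI UNIV f x} x \<partial>\<mu>)
      \<le> (\<integral>\<^sup>+x. liminf (\<lambda>n. indicator {x. ennreal s < MI (?S n) (truncate n f) x} x) \<partial>\<mu>)"
    by (rule nn_integral_mono_AE)
  also have "\<dots> \<le> liminf (\<lambda>n. \<integral>\<^sup>+x. indicator {x. ennreal s < MI (?S n) (truncate n f) x} x \<partial>\<mu>)"
    by (rule nn_integral_liminf) (intro borel_measurable_indicator m; measurable)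
  also have "\<dots> \<le> liminf (\<lambda>n. ennreal (1 / s) * (ennreal W * (\<integral>\<^sup>+y. ennreal (norm (f y)) \<partial>\<mu>)))"
  proof (intro Liminf_mono always_eventually allI)
    fix n
    interpret T: kernel_op \<mu> lam Clam N0 unit_measure "theta (?S n)" "HK (real (Suc n))"
      by (rule kernel_op_HK) auto
    have eq: "{x. ennreal s < MI (?S n) (truncate n f) x}
        = {x. ennreal s < fnorm (theta (?S n)) (T.appl (\<lambda>y c. truncate n f y)) x}"
      by (subst MI_test_function[OF _ _ test_function_truncate[OF f]]) auto
    have "(\<integral>\<^sup>+x. indicator {x. ennreal s < MI (?S n) (truncate n f) x} x \<partial>\<mu>) = emeasure \<mu> {x. ennreal s < MI (?S n) (truncate n f) x}"
      by (intro nn_integral_indicator m) measurable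
    also have "\<dots> = ennreal (1 / s) * (ennreal s * emeasure \<mu> {x. ennreal s < fnorm (theta (?S n)) (T.appl (\<lambda>y c. truncate n f y)) x})"
      unfolding eq using s by (simp add: mult.assoc[symmetric] flip: ennreal_mult)
    also have "\<dots> \<le> ennreal (1 / s) * (ennreal W * (\<integral>\<^sup>+x. fnorm unit_measure (\<lambda>y c. truncate n f y) x \<partial>\<mu>))"
      using wk[of "1 / real (Suc n)" "real (Suc n)"] test_function_truncate[OF f] s unfolding T.weak_def
      by (intro mult_left_mono) auto
    also have "\<dots> \<le> ennreal (1 / s) * (ennreal W * (\<integral>\<^sup>+y. ennreal (norm (f y)) \<partial>\<mu>))"
      by (intro mult_left_mono nn_integral_mono) (auto intro!: ennreal_leI norm_truncate_le)
    finally show "(\<integral>\<^sup>+x. indicator {x. ennreal s < MI (?S n) (truncate n f) x} x \<partial>\<mu>)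
       \<le> ennreal (1 / s) * (ennreal W * (\<integral>\<^sup>+y. ennreal (norm (f y)) \<partial>\<mu>))" .
  qed
  also have "\<dots> = ennreal (1 / s) * (ennreal W * (\<integral>\<^sup>+y. ennreal (norm (f y)) \<partial>\<mu>))" by (simp add: Liminf_const)
  also have "(\<integral>\<^sup>+x. indicator {x. ennreal s < MI UNIV f x} x \<partial>\<mu>) = emeasure \<mu> {x. ennreal s < MI UNIV f x}"
    by (intro nn_integral_indicator m) measurable
  finally have "ennreal s * emeasure \<mu> {x. ennreal s < MI UNIV f x}
     \<le> ennreal s * (ennreal (1 / s) * (ennreal W * (\<integral>\<^sup>+y. ennreal (norm (f y)) \<partial>\<mu>)))"
    by (rule mult_left_mono) simp
  also have "\<dots> = ennreal W * (\<integral>\<^sup>+y. ennreal (norm (f y)) \<partial>\<mu>)"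
    using s by (simp add: mult.assoc[symmetric] flip: ennreal_mult)
  finally show ?thesis .
qed

text \<open>Shrinking the range of \<open>t\<close> decreases the integral, so the hypothesis on the
  full operator passes to all truncated ones with the same constant.\<close>

lemma strong_truncated:
  assumes bd: "\<And>f. f \<in> borel_measurable \<mu> \<Longrightarrow>
      (\<integral>\<^sup>+x. ennreal_powr (MI UNIV f x) p \<partial>\<mu>) \<le> ennreal B * (\<integral>\<^sup>+y. ennreal_powr (ennreal (norm (f y))) p \<partial>\<mu>)"
    and p: "1 < p" and e: "0 < \<epsilon>" and L: "0 < L"
  shows "strong_HK \<epsilon> L p B"
proof -
  interpret T: kernel_op \<mu> lam Clam N0 unit_measure "theta {\<epsilon><..<L}" "HK L" by (rule kernel_op_HK[OF e L])
  show ?thesis unfolding T.strong_def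
  proof (intro allI impI)
    fix F :: "'a \<Rightarrow> unit \<Rightarrow> complex" assume F: "test_function unit_measure F"
    define f where "f y = F y ()" for y
    have eq: "F = (\<lambda>y c. f y)" by (intro ext) (simp add: f_def)
    have f[measurable]: "f \<in> borel_measurable \<mu>"
      unfolding f_def by (rule test_functionD_measurable[OF F]) auto
    have n: "test_function unit_measure (\<lambda>y c. f y)" using F eq by simp
    have "(\<integral>\<^sup>+x. ennreal_powr (fnorm (theta {\<epsilon><..<L}) (T.appl F) x) p \<partial>\<mu>) = (\<integral>\<^sup>+x. ennreal_powr (MI {\<epsilon><..<L} f x) p \<partial>\<mu>)"
      unfolding eq MI_test_function[OF e L n] ..
    also have "\<dots> \<le> (\<integral>\<^sup>+x. ennreal_powr (MI UNIV f x) p \<partial>\<mu>)"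
      using p by (intro nn_integral_mono ennreal_powr_mono MI_mono_set) auto
    also have "\<dots> \<le> ennreal B * (\<integral>\<^sup>+y. ennreal_powr (ennreal (norm (f y))) p \<partial>\<mu>)" by (rule bd[OF f])
    also have "\<dots> = ennreal B * (\<integral>\<^sup>+x. ennreal_powr (fnorm unit_measure F x) p \<partial>\<mu>)" by (simp add: eq)
    finally show "(\<integral>\<^sup>+x. ennreal_powr (fnorm (theta {\<epsilon><..<L}) (T.appl F) x) p \<partial>\<mu>)
      \<le> ennreal B * (\<integral>\<^sup>+x. ennreal_powr (fnorm unit_measure F x) p \<partial>\<mu>)" .
  qed
qed

end

section \<open>Bounded functions and RBLO\<close>

context nonhomogeneous_space
begin

text \<open>Outside the smaller ball the integrand is at most \<open>1 / lam c r\<close>, and the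
  double of the larger ball has finite measure. The function is thus integrable, and the Bochner
  integral is not the default value 0.\<close>

lemma ennreal_ball_delta:
  assumes "0 < r" "0 < r'"
  shows "ennreal (ball_delta \<mu> lam c r c' r') = (\<integral>\<^sup>+y\<in>ball c' (2 * r') - ball c r. ennreal (1 / lam c (dist c y)) \<partial>\<mu>)"
    and "0 \<le> ball_delta \<mu> lam c r c' r'"
proof -
  let ?A = "ball c' (2 * r') - ball c r"
  let ?g = "\<lambda>y. indicator ?A y * (1 / lam c (dist c y))"
  have g0: "0 \<le> ?g y" for y
  proof (cases "y \<in> ?A")
    case True
    then have "0 < dist c y" using assms(1) by auto
    then show ?thesis using lam_pos[of "dist c y" c] by simp
  qed simp
  have eq: "ball_delta \<mu> lam c r c' r' = (\<integral>y. ?g y \<partial>\<mu>)"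
    by (simp add: ball_delta_def set_lebesgue_integral_def dist_commute)
  then show "0 \<le> ball_delta \<mu> lam c r c' r'" using g0 by (simp add: integral_nonneg_AE)
  have nn: "(\<integral>\<^sup>+y. ennreal (?g y) \<partial>\<mu>) = (\<integral>\<^sup>+y\<in>?A. ennreal (1 / lam c (dist c y)) \<partial>\<mu>)"
    by (intro nn_integral_cong) (auto simp: indicator_def)
  have "(\<integral>\<^sup>+y. ennreal (?g y) \<partial>\<mu>) \<le> (\<integral>\<^sup>+y. ennreal (1 / lam c r) * indicator (ball c' (2 * r')) y \<partial>\<mu>)"
  proof (intro nn_integral_mono)
    fix y
    show "ennreal (?g y) \<le> ennreal (1 / lam c r) * indicator (ball c' (2 * r')) y"
    proof (cases "y \<in> ?A")
      case True
      then have y: "r \<le> dist c y" by auto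
      have "1 / lam c (dist c y) \<le> 1 / lam c r"
        using y assms(1) lam_mono[OF assms(1) y, of c] lam_pos[OF assms(1), of c]
        by (intro divide_left_mono) (auto intro!: mult_pos_pos lam_pos)
      then show ?thesis using True by (auto intro: ennreal_leI)
    qed simp
  qed
  also have "\<dots> < top" by (simp add: nn_integral_cmult ennreal_mult_less_top)
  finally have fin: "(\<integral>\<^sup>+y. ennreal (?g y) \<partial>\<mu>) < top" .
  have [measurable]: "?A \<in> sets \<mu>" by measurable
  have "integrable \<mu> ?g"
    by (rule integrableI_nonneg) (use g0 fin in auto)
  then show "ennreal (ball_delta \<mu> lam c r c' r') = (\<integral>\<^sup>+y\<in>?A. ennreal (1 / lam c (dist c y)) \<partial>\<mu>)"
    unfolding eq nn[symmetric] using g0 by (intro nn_integral_eq_integral[symmetric]) auto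
qed

end

lemma essinf_on_AE:
  assumes [measurable]: "A \<in> sets M" "g \<in> borel_measurable M"
  shows "AE y in M. y \<in> A \<longrightarrow> essinf_on M A g \<le> ereal (g y)"
proof -
  have "AE y in restrict_space M A. - ereal (g y) \<le> esssup (restrict_space M A) (\<lambda>x. - ereal (g x))"
    by (rule esssup_AE)
  then have "AE y in M. y \<in> A \<longrightarrow> - ereal (g y) \<le> esssup (restrict_space M A) (\<lambda>x. - ereal (g x))"
    using assms(1) by (subst (asm) AE_restrict_space_iff) (auto simp: sets.Int_space_eq2)
  then show ?thesis unfolding essinf_on_def
    by eventually_elim (use ereal_uminus_le_reorder in auto)
qed

lemma essinf_on_ge:
  assumes [measurable]: "A \<in> sets M" "g \<in> borel_measurable M"
    and "AE y in M. y \<in> A \<longrightarrow> c \<le> ereal (g y)"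
  shows "c \<le> essinf_on M A g"
proof -
  have [measurable]: "(\<lambda>x. - ereal (g x)) \<in> borel_measurable (restrict_space M A)"
    by (intro measurable_restrict_space1) measurable
  have "AE y in restrict_space M A. - ereal (g y) \<le> - c"
  proof -
    have "AE y in M. y \<in> A \<longrightarrow> - ereal (g y) \<le> - c"
      using assms(3) by eventually_elim (simp only: ereal_minus_le_minus)
    then show ?thesis using assms(1) by (subst AE_restrict_space_iff) (auto simp: sets.Int_space_eq2)
  qed
  then have "esssup (restrict_space M A) (\<lambda>x. - ereal (g x)) \<le> - c" by (intro esssup_I) measurable
  then show ?thesis unfolding essinf_on_def using ereal_minus_le_minus by fastforce
qed

context mk_kernel
begin

section \<open>Comparison of the Marcinkiewicz integral at two points\<close>

lemma Minkowski_scalar: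
  assumes [measurable]: "S \<in> sets borel" "(\<lambda>(t, y). h t y) \<in> borel_measurable (borel \<Otimes>\<^sub>M \<mu>)" "b \<in> borel_measurable \<mu>"
  shows "L2 (theta S) (\<lambda>t. ennreal (norm (\<integral>y. h t y * b y \<partial>\<mu> :: complex)))
    \<le> (\<integral>\<^sup>+y. L2 (theta S) (\<lambda>t. ennreal (norm (h t y))) * ennreal (norm (b y)) \<partial>\<mu>)"
proof -
  have "L2 (theta S) (\<lambda>t. ennreal (norm (\<integral>y. h t y * b y \<partial>\<mu>)))
      \<le> L2 (theta S) (\<lambda>t. \<integral>\<^sup>+y. ennreal (norm (h t y)) * ennreal (norm (b y)) \<partial>\<mu>)"
    by (intro L2_mono order_trans[OF norm_integral_le_nn_integral]) (simp add: norm_mult ennreal_mult)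
  also have "\<dots> \<le> (\<integral>\<^sup>+y. L2 (theta S) (\<lambda>t. ennreal (norm (h t y)) * ennreal (norm (b y))) \<partial>\<mu>)"
    by (rule L2_Minkowski[OF sigma_finite_theta sigma_finite]) measurable
  also have "\<dots> = (\<integral>\<^sup>+y. L2 (theta S) (\<lambda>t. ennreal (norm (h t y))) * ennreal (norm (b y)) \<partial>\<mu>)"
    by (intro nn_integral_cong L2_multc) measurable
  finally show ?thesis .
qed

definition far_const :: "real \<Rightarrow> real" where
  "far_const \<eta> = C0 * Clam\<^sup>2 * (\<eta> / (\<eta> - 1)) powr (log 2 Clam)"

lemma far_const_nonneg: "0 \<le> far_const \<eta>"
  using C0_pos by (simp add: far_const_def)

text \<open>The factor \<open>\<eta> / (\<eta> - 1)\<close> is the ratio between the distances from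
  a point outside an \<open>\<eta>\<close>-fold ball to the centre and to a point of the ball.
  Either \<open>x\<close> or \<open>y\<close> may be the outer point, so the distance
  \<open>d\<close> and the recentring inequality for \<open>lam\<close> are left as
  hypotheses.\<close>

lemma lam_far:
  assumes "1 < \<eta>" "0 < d" "d \<le> \<eta> / (\<eta> - 1) * dist x y" and l: "lam c d \<le> Clam * lam x d" and "x \<noteq> y"
  shows "norm (K0 x y) / dist x y \<le> far_const \<eta> / lam c d"
proof -
  let ?k = "\<eta> / (\<eta> - 1)"
  have k: "1 \<le> ?k" using assms(1) by (simp add: field_simps)
  have xy: "0 < dist x y" using assms(5) by simp
  have "lam c d \<le> Clam * lam x d" by (rule l)
  also have "\<dots> \<le> Clam * lam x (?k * dist x y)" using assms Clam_pos by (intro mult_left_mono lam_mono) auto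
  also have "\<dots> \<le> Clam * (Clam * ?k powr (log 2 Clam) * lam x (dist x y))"
    using Clam_pos by (intro mult_left_mono lam_growth xy k) auto
  finally have L: "lam c d \<le> Clam\<^sup>2 * ?k powr (log 2 Clam) * lam x (dist x y)"
    by (simp add: power2_eq_square mult.assoc)
  have "norm (K0 x y) / dist x y \<le> C0 * (dist x y / lam x (dist x y)) / dist x y"
    using xy by (intro divide_right_mono K0_size) auto
  also have "\<dots> = C0 / lam x (dist x y)" using xy by simp
  also have "\<dots> \<le> far_const \<eta> / lam c d"
    using L C0_pos lam_pos[OF xy, of x] lam_pos[OF assms(2), of c]
    by (simp add: far_const_def field_simps)
  finally show ?thesis .
qed

lemma convergent_at_bounded:
  assumes [measurable]: "f \<in> borel_measurable \<mu>" and a: "0 \<le> a" "AE y in \<mu>. norm (f y) \<le> a"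
  shows "convergent_at f x"
  unfolding convergent_at_def
proof
  fix m :: nat
  have "(\<integral>\<^sup>+y\<in>ball x (real m). ennreal (norm (K0 x y * f y)) \<partial>\<mu>)
      \<le> (\<integral>\<^sup>+y. ennreal a * (ennreal (norm (K0 x y)) * indicator (ball x (real (Suc m))) y) \<partial>\<mu>)"
  proof (rule nn_integral_mono_AE)
    show "AE y in \<mu>. ennreal (norm (K0 x y * f y)) * indicator (ball x (real m)) y
        \<le> ennreal a * (ennreal (norm (K0 x y)) * indicator (ball x (real (Suc m))) y)"
      using a(2)
    proof eventually_elim
      case (elim y)
      have "norm (K0 x y * f y) \<le> a * norm (K0 x y)"
        using mult_left_mono[OF elim norm_ge_zero[of "K0 x y"]] by (simp add: norm_mult mult.commute)
      then have "ennreal (norm (K0 x y * f y)) \<le> ennreal (a * norm (K0 x y))" by (rule ennreal_leI)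
      also have "\<dots> = ennreal a * ennreal (norm (K0 x y))" using a(1) by (simp add: ennreal_mult)
      finally have "ennreal (norm (K0 x y * f y)) \<le> ennreal a * ennreal (norm (K0 x y))" .
      then show ?case by (auto simp: indicator_def)
    qed
  qed
  also have "\<dots> = ennreal a * (\<integral>\<^sup>+y\<in>ball x (real (Suc m)). ennreal (norm (K0 x y)) \<partial>\<mu>)"
    by (rule nn_integral_cmult) measurable
  also have "\<dots> \<le> ennreal a * ennreal (C0 * (2 * Clam * real (Suc m)))"
    by (intro mult_left_mono K0_near) auto
  also have "\<dots> < top" by (simp add: ennreal_mult_less_top)
  finally show "(\<integral>\<^sup>+y\<in>ball x (real m). ennreal (norm (K0 x y * f y)) \<partial>\<mu>) < top" .
qed

text \<open>The number 20 is \<open>2 * 6 + 2 * 4\<close>, from \<open>near_integral\<close> at the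
  radii \<open>6 * R\<close> and \<open>4 * R\<close> around the two points.\<close>

definition tail_const :: real where "tail_const = reg_const + 20 * C0 * Clam"

lemma tail_const_nonneg: "0 \<le> tail_const"
  unfolding tail_const_def using reg_const C0_pos Clam_pos by simp

lemma L2_theta_K0_tail:
  assumes "0 < R"
  shows "L2 (theta {R<..}) (\<lambda>t. ennreal (norm (if dist x y < t then K0 x y else 0))) \<le> ennreal (norm (K0 x y) / R)"
proof -
  have "L2 (theta {R<..}) (\<lambda>t. ennreal (norm (if dist x y < t then K0 x y else 0)))
     \<le> L2 (theta {R<..}) (\<lambda>t. ennreal (norm (if R < t \<and> dist x y < t then K0 x y else 0)))"
  proof (rule L2_mono_AE)
    have "AE t in theta {R<..}. 0 < t \<and> t \<in> {R<..}" by (rule AE_theta) simp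
    then show "AE t in theta {R<..}. ennreal (norm (if dist x y < t then K0 x y else 0))
       \<le> ennreal (norm (if R < t \<and> dist x y < t then K0 x y else 0))" by eventually_elim auto
  qed
  also have "\<dots> \<le> ennreal (norm (K0 x y) / R)" using assms by (intro L2_theta_cutoff) auto
  finally show ?thesis .
qed

text \<open>For \<open>t > R\<close> moving from \<open>x\<close> to \<open>z\<close> costs a
  bounded amount. Near the points the kernels are estimated separately, the cutoff at
  \<open>R\<close> supplying the factor \<open>1 / R\<close>; far away the regularity in the first
  variable applies, at radius \<open>2 * R\<close>.\<close>

lemma MI_tail:
  assumes f[measurable]: "f \<in> borel_measurable \<mu>" and a: "0 \<le> a" "AE y in \<mu>. norm (f y) \<le> a"
    and R: "0 < R" "dist z x < 2 * R"
  shows "MI {R<..} f x \<le> MI {R<..} f z + ennreal (tail_const * a)"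
proof -
  let ?S = "{R<..}"
  let ?H = "\<lambda>x t y. if dist x y < t then K0 x y else 0"
  let ?D = "\<lambda>y. L2 (theta ?S) (\<lambda>t. ennreal (norm (?H x t y - ?H z t y)))"
  have [measurable]: "(\<lambda>y. dist z y) \<in> borel_measurable \<mu>" "(\<lambda>y. dist x y) \<in> borel_measurable \<mu>" by measurable
  have D[measurable]: "?D \<in> borel_measurable \<mu>"
    by (rule L2_measurable[OF sigma_finite_theta]) (auto simp: split_beta)
  have diff: "Kint f x t - Kint f z t = (\<integral>y. (?H x t y - ?H z t y) * f y \<partial>\<mu>)" for t
  proof -
    have "(\<integral>y. (?H x t y - ?H z t y) * f y \<partial>\<mu>)
        = (\<integral>y. (if dist x y < t then K0 x y * f y else 0) - (if dist z y < t then K0 z y * f y else 0) \<partial>\<mu>)"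
      by (intro Bochner_Integration.integral_cong refl) (simp add: left_diff_distrib)
    also have "\<dots> = Kint f x t - Kint f z t" unfolding Kint_def
      by (intro Bochner_Integration.integral_diff convergent_at_integrable f convergent_at_bounded[OF f a])
    finally show ?thesis by simp
  qed
  have "MI ?S f x \<le> L2 (theta ?S) (\<lambda>t. ennreal (norm (Kint f z t)) + ennreal (norm (\<integral>y. (?H x t y - ?H z t y) * f y \<partial>\<mu>)))"
    unfolding MI_def
  proof (rule L2_mono)
    fix t
    have "norm (Kint f x t) \<le> norm (Kint f z t) + norm (Kint f x t - Kint f z t)" by norm
    then show "ennreal (norm (Kint f x t)) \<le> ennreal (norm (Kint f z t)) + ennreal (norm (\<integral>y. (?H x t y - ?H z t y) * f y \<partial>\<mu>))"
      unfolding diff[symmetric] by (simp flip: ennreal_plus)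
  qed
  also have "\<dots> \<le> MI ?S f z + L2 (theta ?S) (\<lambda>t. ennreal (norm (\<integral>y. (?H x t y - ?H z t y) * f y \<partial>\<mu>)))"
    unfolding MI_def diff[symmetric] by (intro L2_add) measurable
  also have "L2 (theta ?S) (\<lambda>t. ennreal (norm (\<integral>y. (?H x t y - ?H z t y) * f y \<partial>\<mu>))) \<le> (\<integral>\<^sup>+y. ?D y * ennreal (norm (f y)) \<partial>\<mu>)"
    by (rule Minkowski_scalar) (auto simp: split_beta)
  also have "\<dots> \<le> (\<integral>\<^sup>+y. ?D y * ennreal a \<partial>\<mu>)"
    using a(2) by (intro nn_integral_mono_AE) (auto elim!: eventually_mono intro!: mult_left_mono ennreal_leI)
  also have "\<dots> = (\<integral>\<^sup>+y. ?D y \<partial>\<mu>) * ennreal a" by (rule nn_integral_multc) measurable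
  also have "(\<integral>\<^sup>+y. ?D y \<partial>\<mu>) \<le> ennreal tail_const"
  proof -
    let ?B = "ball z (2 * (2 * R))"
    have mB: "- ?B \<in> sets \<mu>" by (simp add: Compl_eq_Diff_UNIV sets_borel)
    have "(\<integral>\<^sup>+y. ?D y \<partial>\<mu>) = (\<integral>\<^sup>+y\<in>UNIV. ?D y \<partial>\<mu>)" by simp
    also have "\<dots> \<le> (\<integral>\<^sup>+y\<in>?B. ?D y \<partial>\<mu>) + (\<integral>\<^sup>+y\<in>- ?B. ?D y \<partial>\<mu>)"
      using mB by (intro nn_integral_union_le) auto
    also have "(\<integral>\<^sup>+y\<in>?B. ?D y \<partial>\<mu>) \<le> ennreal (20 * C0 * Clam)"
    proof -
      have "(\<integral>\<^sup>+y\<in>?B. ?D y \<partial>\<mu>)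
          \<le> (\<integral>\<^sup>+y. ennreal (1 / R) * (ennreal (norm (K0 x y)) * indicator (ball x (6 * R)) y)
             + ennreal (1 / R) * (ennreal (norm (K0 z y)) * indicator (ball z (4 * R)) y) \<partial>\<mu>)"
      proof (intro nn_integral_mono)
        fix y
        show "?D y * indicator ?B y \<le> ennreal (1 / R) * (ennreal (norm (K0 x y)) * indicator (ball x (6 * R)) y)
             + ennreal (1 / R) * (ennreal (norm (K0 z y)) * indicator (ball z (4 * R)) y)"
        proof (cases "y \<in> ?B")
          case True
          then have zy: "dist z y < 4 * R" by simp
          have xy: "dist x y < 6 * R" using zy R(2) dist_triangle3[of x y z] by simp
          have "?D y \<le> L2 (theta ?S) (\<lambda>t. ennreal (norm (?H x t y)) + ennreal (norm (?H z t y)))"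
            by (intro L2_mono) (simp add: norm_triangle_ineq4 del: ennreal_plus flip: ennreal_plus)
          also have "\<dots> \<le> L2 (theta ?S) (\<lambda>t. ennreal (norm (?H x t y))) + L2 (theta ?S) (\<lambda>t. ennreal (norm (?H z t y)))"
            by (intro L2_add) measurable
          also have "\<dots> \<le> ennreal (norm (K0 x y) / R) + ennreal (norm (K0 z y) / R)"
            by (intro add_mono L2_theta_K0_tail R)
          also have "\<dots> = ennreal (1 / R) * ennreal (norm (K0 x y)) + ennreal (1 / R) * ennreal (norm (K0 z y))"
            using R by (simp flip: ennreal_mult)
          finally show ?thesis using True xy zy by simp
        qed simp
      qed
      also have "\<dots> = ennreal (1 / R) * (\<integral>\<^sup>+y\<in>ball x (6 * R). ennreal (norm (K0 x y)) \<partial>\<mu>)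
          + ennreal (1 / R) * (\<integral>\<^sup>+y\<in>ball z (4 * R). ennreal (norm (K0 z y)) \<partial>\<mu>)"
        by (simp add: nn_integral_add nn_integral_cmult)
      also have "\<dots> \<le> ennreal (1 / R) * ennreal (C0 * (2 * Clam * (6 * R))) + ennreal (1 / R) * ennreal (C0 * (2 * Clam * (4 * R)))"
        using R by (intro add_mono mult_left_mono K0_near) auto
      also have "\<dots> = ennreal (20 * C0 * Clam)"
        using R C0_pos Clam_pos by (simp flip: ennreal_mult ennreal_plus)
      finally show ?thesis .
    qed
    also have "(\<integral>\<^sup>+y\<in>- ?B. ?D y \<partial>\<mu>) \<le> ennreal reg_const"
      using jump_second[of ?S "2 * R" z x "\<lambda>_. True"] R by simp
    finally show ?thesis using reg_const C0_pos Clam_pos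
      by (simp add: tail_const_def add_mono add.commute)
  qed
  finally show ?thesis using tail_const_nonneg a(1) by (simp add: ennreal_mult add_left_mono mult_right_mono)
qed

text \<open>For \<open>t \<le> R\<close> only points within \<open>R\<close> of \<open>x\<close> are
  seen, and these lie in the double of the large ball. The part of \<open>f\<close> on the
  \<open>\<eta>\<close>-fold small ball is kept as it is; for the rest the size of the kernel,
  recentred at \<open>c\<close>, leaves the integral that defines \<open>\<delta>\<close>.\<close>

lemma MI_near:
  assumes f[measurable]: "f \<in> borel_measurable \<mu>" and a: "0 \<le> a" "AE y in \<mu>. norm (f y) \<le> a"
    and \<eta>: "1 < \<eta>" and r: "0 < r" and sub: "ball c r \<subseteq> ball c' R" and x: "x \<in> ball c r"
  shows "MI {..R} f x \<le> MI UNIV (\<lambda>y. indicator (ball c (\<eta> * r)) y * f y) x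
     + ennreal (far_const \<eta> * a) * (\<integral>\<^sup>+y\<in>ball c' (2 * R) - ball c r. ennreal (1 / lam c (dist c y)) \<partial>\<mu>)"
proof -
  let ?B = "ball c (\<eta> * r)"
  define f1 where "f1 y = indicator ?B y * f y" for y
  define f2 where "f2 y = indicator (- ?B) y * f y" for y
  have mB[measurable]: "- ?B \<in> sets \<mu>" by (simp add: Compl_eq_Diff_UNIV sets_borel)
  have [measurable]: "f1 \<in> borel_measurable \<mu>" "f2 \<in> borel_measurable \<mu>"
    unfolding f1_def f2_def by measurable
  have b1: "AE y in \<mu>. norm (f1 y) \<le> a" "AE y in \<mu>. norm (f2 y) \<le> a"
    using a by (auto simp: f1_def f2_def indicator_def elim!: eventually_mono)
  have g: "convergent_at f1 x" "convergent_at f2 x" using a(1) b1 by (auto intro!: convergent_at_bounded)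
  have f12: "f = (\<lambda>y. f1 y + f2 y)" by (auto simp: f1_def f2_def indicator_def)
  let ?H = "\<lambda>t y. if dist x y < t then K0 x y else 0"
  have "MI {..R} f x \<le> MI {..R} f1 x + MI {..R} f2 x"
    by (subst f12) (rule MI_add, use g in auto)
  also have "MI {..R} f1 x \<le> MI UNIV f1 x" by (intro MI_mono_set) auto
  also have "MI {..R} f2 x = L2 (theta {..R}) (\<lambda>t. ennreal (norm (\<integral>y. ?H t y * f2 y \<partial>\<mu>)))"
    unfolding MI_def Kint_def by (intro L2_cong arg_cong[where f=ennreal] arg_cong[where f=norm] Bochner_Integration.integral_cong refl) simp
  also have "\<dots> \<le> (\<integral>\<^sup>+y. L2 (theta {..R}) (\<lambda>t. ennreal (norm (?H t y))) * ennreal (norm (f2 y)) \<partial>\<mu>)"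
    by (rule Minkowski_scalar) (auto simp: split_beta)
  also have "\<dots> \<le> (\<integral>\<^sup>+y. ennreal (far_const \<eta> * a) * (ennreal (1 / lam c (dist c y)) * indicator (ball c' (2 * R) - ball c r) y) \<partial>\<mu>)"
  proof (rule nn_integral_mono_AE)
    show "AE y in \<mu>. L2 (theta {..R}) (\<lambda>t. ennreal (norm (?H t y))) * ennreal (norm (f2 y))
      \<le> ennreal (far_const \<eta> * a) * (ennreal (1 / lam c (dist c y)) * indicator (ball c' (2 * R) - ball c r) y)"
      using b1(2)
    proof eventually_elim
      case (elim y)
      show ?case
      proof (cases "y \<in> ?B \<or> R \<le> dist x y")
        case True
        have "L2 (theta {..R}) (\<lambda>t. ennreal (norm (?H t y))) = 0" if "R \<le> dist x y"
        proof -
          have "L2 (theta {..R}) (\<lambda>t. ennreal (norm (?H t y))) \<le> L2 (theta {..R}) (\<lambda>t. 0)"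
          proof (rule L2_mono_AE)
            have "AE t in theta {..R}. 0 < t \<and> t \<in> {..R}" by (rule AE_theta) simp
            then show "AE t in theta {..R}. ennreal (norm (?H t y)) \<le> 0" by eventually_elim (use that in auto)
          qed
          then show ?thesis by simp
        qed
        then show ?thesis using True by (auto simp: f2_def)
      next
        case False
        then have y: "\<eta> * r \<le> dist c y" "dist x y < R" by auto
        have cx: "dist c x < r" using x by simp
        have "1 * r < \<eta> * r" using \<eta> r by (intro mult_strict_right_mono) auto
        then have rcy: "r \<le> dist c y" "r < dist c y" using y by auto
        have ne: "x \<noteq> y" using cx rcy by auto
        have "dist c' x < R" using x sub by auto
        then have yc': "dist c' y < 2 * R" using y dist_triangle[of c' y x] by simp
        have "dist c y - r \<le> dist x y" using dist_triangle[of c y x] cx by linarith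
        moreover have "(\<eta> - 1) * dist c y \<le> \<eta> * (dist c y - r)"
          using y(1) by (simp add: algebra_simps)
        ultimately have "(\<eta> - 1) * dist c y \<le> \<eta> * dist x y"
          using \<eta> by (meson mult_left_mono order_trans less_imp_le zero_less_one less_trans)
        then have d: "dist c y \<le> \<eta> / (\<eta> - 1) * dist x y" using \<eta> by (simp add: field_simps)
        have "norm (K0 x y) / dist x y \<le> far_const \<eta> / lam c (dist c y)"
          by (rule lam_far[OF \<eta> _ d _ ne]) (use rcy r cx in \<open>auto intro!: lam_shift\<close>)
        moreover have "L2 (theta {..R}) (\<lambda>t. ennreal (norm (?H t y))) \<le> ennreal (norm (K0 x y) / dist x y)"
          using L2_theta_cutoff[of "{..R}" "dist x y" "\<lambda>_. True" "K0 x y"] ne by simp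
        ultimately have "L2 (theta {..R}) (\<lambda>t. ennreal (norm (?H t y))) \<le> ennreal (far_const \<eta> / lam c (dist c y))"
          using ennreal_leI order_trans by blast
        then have "L2 (theta {..R}) (\<lambda>t. ennreal (norm (?H t y))) * ennreal (norm (f2 y))
          \<le> ennreal (far_const \<eta> / lam c (dist c y)) * ennreal a"
          using elim by (intro mult_mono ennreal_leI) auto
        also have "\<dots> = ennreal (far_const \<eta> * a) * ennreal (1 / lam c (dist c y))"
        proof -
          have "0 < lam c (dist c y)" using rcy r by (intro lam_pos) auto
          then show ?thesis using far_const_nonneg[of \<eta>] a(1) by (simp flip: ennreal_mult)
        qed
        finally show ?thesis using yc' rcy by simp
      qed
    qed
  qed
  also have "\<dots> = ennreal (far_const \<eta> * a) * (\<integral>\<^sup>+y\<in>ball c' (2 * R) - ball c r. ennreal (1 / lam c (dist c y)) \<partial>\<mu>)"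
    by (rule nn_integral_cmult) measurable
  finally show ?thesis by (simp add: f1_def[abs_def] add_mono)
qed

text \<open>The range of \<open>t\<close> is split at the radius of the larger ball. The estimate is
  one-sided and holds for every \<open>z\<close> there, so it yields finiteness from a single point
  as well as a lower bound for the essential infimum.\<close>

lemma MI_compare:
  assumes f[measurable]: "f \<in> borel_measurable \<mu>" and a: "0 \<le> a" "AE y in \<mu>. norm (f y) \<le> a"
    and \<eta>: "1 < \<eta>" and r: "0 < r" "0 < R" and sub: "ball c r \<subseteq> ball c' R" and x: "x \<in> ball c r" and z: "z \<in> ball c' R"
  shows "MI UNIV f x \<le> MI UNIV f z + (MI UNIV (\<lambda>y. indicator (ball c (\<eta> * r)) y * f y) x
     + ennreal ((tail_const + far_const \<eta> * ball_delta \<mu> lam c r c' R) * a))"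
proof -
  let ?d = "ball_delta \<mu> lam c r c' R"
  have d0: "0 \<le> ?d" by (rule ennreal_ball_delta(2)[OF r])
  have "dist c' x < R" "dist c' z < R" using x z sub by auto
  then have zx: "dist z x < 2 * R" using dist_triangle3[of z x c'] by simp
  have "MI UNIV f x = MI ({..R} \<union> {R<..}) f x" by (rule arg_cong[where f="\<lambda>S. MI S f x"]) auto
  also have "\<dots> \<le> MI {..R} f x + MI {R<..} f x" by (rule MI_split) auto
  also have "\<dots> \<le> (MI UNIV (\<lambda>y. indicator (ball c (\<eta> * r)) y * f y) x + ennreal (far_const \<eta> * a) * ennreal ?d)
      + (MI {R<..} f z + ennreal (tail_const * a))"
    unfolding ennreal_ball_delta(1)[OF r]
    by (intro add_mono MI_near[OF f a \<eta> r(1) sub x] MI_tail[OF f a r(2) zx])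
  also have "\<dots> \<le> (MI UNIV (\<lambda>y. indicator (ball c (\<eta> * r)) y * f y) x + ennreal (far_const \<eta> * a) * ennreal ?d)
      + (MI UNIV f z + ennreal (tail_const * a))"
    by (intro add_mono MI_mono_set order_refl) auto
  also have "\<dots> = MI UNIV f z + (MI UNIV (\<lambda>y. indicator (ball c (\<eta> * r)) y * f y) x
     + (ennreal (far_const \<eta> * a) * ennreal ?d + ennreal (tail_const * a)))"
    by (simp add: ac_simps)
  also have "ennreal (far_const \<eta> * a) * ennreal ?d + ennreal (tail_const * a)
     = ennreal ((tail_const + far_const \<eta> * ?d) * a)"
    using a(1) d0 far_const_nonneg[of \<eta>] tail_const_nonneg
    by (simp add: algebra_simps flip: ennreal_mult ennreal_plus)
  finally show ?thesis .
qed

section \<open>Passage from Lp bounds to RBLO\<close>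

definition MI_bounded :: "real \<Rightarrow> real \<Rightarrow> bool" where
  "MI_bounded p B \<longleftrightarrow> (\<forall>f\<in>borel_measurable \<mu>. (\<integral>\<^sup>+y. ennreal_powr (ennreal (norm (f y))) p \<partial>\<mu>) < top \<longrightarrow>
     (\<integral>\<^sup>+x. ennreal_powr (MI UNIV f x) p \<partial>\<mu>) \<le> ennreal B * (\<integral>\<^sup>+y. ennreal_powr (ennreal (norm (f y))) p \<partial>\<mu>))"

lemma Holder_set:
  assumes p: "1 < p" and [measurable]: "g \<in> borel_measurable \<mu>" "S \<in> sets \<mu>" and "emeasure \<mu> S < top"
  shows "(\<integral>\<^sup>+x\<in>S. g x \<partial>\<mu>) \<le> ennreal (measure \<mu> S powr (1 - 1 / p))
     * ennreal_powr (\<integral>\<^sup>+x. ennreal_powr (g x) p \<partial>\<mu>) (1 / p)"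
proof -
  define q where "q = p / (p - 1)"
  have q: "1 < q" "1 / p + 1 / q = 1" "1 / q = 1 - 1 / p" using p by (auto simp: q_def field_simps)
  have "(\<integral>\<^sup>+x\<in>S. g x \<partial>\<mu>) \<le> ennreal_powr (\<integral>\<^sup>+x. ennreal_powr (g x) p \<partial>\<mu>) (1 / p)
         * ennreal_powr (\<integral>\<^sup>+x. ennreal_powr (indicator S x) q \<partial>\<mu>) (1 / q)"
    by (rule Holder_nn_integral[OF p q(1,2)]) measurable
  also have "(\<integral>\<^sup>+x. ennreal_powr (indicator S x) q \<partial>\<mu>) = (\<integral>\<^sup>+x. indicator S x \<partial>\<mu>)"
    by (intro nn_integral_cong) (auto simp: indicator_def ennreal_powr_def)
  also have "\<dots> = ennreal (measure \<mu> S)" using assms(4) by (simp add: emeasure_eq_ennreal_measure less_top)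
  also have "ennreal_powr (ennreal (measure \<mu> S)) (1 / q) = ennreal (measure \<mu> S powr (1 - 1 / p))"
    by (simp add: ennreal_powr_ennreal q(3))
  finally show ?thesis by (simp add: mult.commute)
qed

lemma Holder_MI:
  assumes bd: "MI_bounded p B" and p: "1 < p" and f[measurable]: "f \<in> borel_measurable \<mu>"
    and fin: "(\<integral>\<^sup>+y. ennreal_powr (ennreal (norm (f y))) p \<partial>\<mu>) < top"
    and S: "S \<in> sets \<mu>" "emeasure \<mu> S < top"
  shows "(\<integral>\<^sup>+x\<in>S. MI UNIV f x \<partial>\<mu>) \<le> ennreal (measure \<mu> S powr (1 - 1 / p))
     * ennreal_powr (ennreal B * (\<integral>\<^sup>+y. ennreal_powr (ennreal (norm (f y))) p \<partial>\<mu>)) (1 / p)"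
proof -
  have "(\<integral>\<^sup>+x\<in>S. MI UNIV f x \<partial>\<mu>) \<le> ennreal (measure \<mu> S powr (1 - 1 / p))
     * ennreal_powr (\<integral>\<^sup>+x. ennreal_powr (MI UNIV f x) p \<partial>\<mu>) (1 / p)"
    by (rule Holder_set[OF p _ S]) measurable
  also have "\<dots> \<le> ennreal (measure \<mu> S powr (1 - 1 / p))
     * ennreal_powr (ennreal B * (\<integral>\<^sup>+y. ennreal_powr (ennreal (norm (f y))) p \<partial>\<mu>)) (1 / p)"
    using bd f fin p unfolding MI_bounded_def by (intro mult_left_mono ennreal_powr_mono) auto
  finally show ?thesis .
qed

lemma MI_ball_average:
  assumes bd: "MI_bounded p B" and p: "1 < p" "0 \<le> B" and f[measurable]: "f \<in> borel_measurable \<mu>"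
    and a: "0 \<le> a" "AE y in \<mu>. norm (f y) \<le> a"
  shows "(\<integral>\<^sup>+x\<in>ball c s. MI UNIV (\<lambda>y. indicator (ball c s) y * f y) x \<partial>\<mu>)
      \<le> ennreal (B powr (1 / p) * a) * emeasure \<mu> (ball c s)"
    and "AE x in \<mu>. MI UNIV (\<lambda>y. indicator (ball c s) y * f y) x < top"
proof -
  let ?f = "\<lambda>y. indicator (ball c s) y * f y"
  let ?m = "measure \<mu> (ball c s)"
  have fp: "(\<integral>\<^sup>+y. ennreal_powr (ennreal (norm (?f y))) p \<partial>\<mu>) \<le> ennreal (a powr p * ?m)"
  proof -
    have "(\<integral>\<^sup>+y. ennreal_powr (ennreal (norm (?f y))) p \<partial>\<mu>) \<le> (\<integral>\<^sup>+y. ennreal (a powr p) * indicator (ball c s) y \<partial>\<mu>)"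
    proof (rule nn_integral_mono_AE)
      show "AE y in \<mu>. ennreal_powr (ennreal (norm (?f y))) p \<le> ennreal (a powr p) * indicator (ball c s) y"
        using a(2)
        by eventually_elim (use p in \<open>auto simp: indicator_def ennreal_powr_ennreal intro!: ennreal_leI powr_mono2\<close>)
    qed
    also have "\<dots> = ennreal (a powr p * ?m)"
      by (simp add: nn_integral_cmult emeasure_ball_eq ennreal_mult)
    finally show ?thesis .
  qed
  then have fin: "(\<integral>\<^sup>+y. ennreal_powr (ennreal (norm (?f y))) p \<partial>\<mu>) < top"
    using ennreal_less_top le_less_trans by blast
  have [measurable]: "?f \<in> borel_measurable \<mu>" by measurable
  have "(\<integral>\<^sup>+x\<in>ball c s. MI UNIV ?f x \<partial>\<mu>) \<le> ennreal (?m powr (1 - 1 / p))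
     * ennreal_powr (ennreal B * (\<integral>\<^sup>+y. ennreal_powr (ennreal (norm (?f y))) p \<partial>\<mu>)) (1 / p)"
    by (rule Holder_MI[OF bd p(1) _ fin]) auto
  also have "\<dots> \<le> ennreal (?m powr (1 - 1 / p)) * ennreal_powr (ennreal B * ennreal (a powr p * ?m)) (1 / p)"
    using p fp by (intro mult_left_mono ennreal_powr_mono) auto
  also have "\<dots> = ennreal (?m powr (1 - 1 / p) * (B * (a powr p * ?m)) powr (1 / p))"
    using p by (simp add: ennreal_powr_ennreal flip: ennreal_mult)
  also have "?m powr (1 - 1 / p) * (B * (a powr p * ?m)) powr (1 / p) = B powr (1 / p) * a * ?m"
  proof (cases "?m = 0")
    case False
    then have m: "0 < ?m" by (simp add: zero_less_measure_iff)
    have "?m powr (1 - 1 / p) * ?m powr (1 / p) = ?m" using m by (simp flip: powr_add)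
    then show ?thesis using p a(1) m
      by (simp add: powr_mult powr_powr)
  qed simp
  also have "ennreal (B powr (1 / p) * a * ?m) = ennreal (B powr (1 / p) * a) * emeasure \<mu> (ball c s)"
    using a(1) by (simp add: emeasure_ball_eq ennreal_mult)
  finally show "(\<integral>\<^sup>+x\<in>ball c s. MI UNIV ?f x \<partial>\<mu>) \<le> ennreal (B powr (1 / p) * a) * emeasure \<mu> (ball c s)" .
  have "(\<integral>\<^sup>+x. ennreal_powr (MI UNIV ?f x) p \<partial>\<mu>) \<le> ennreal B * (\<integral>\<^sup>+y. ennreal_powr (ennreal (norm (?f y))) p \<partial>\<mu>)"
    using bd fin unfolding MI_bounded_def by simp
  also have "\<dots> < top" using fin by (simp add: ennreal_mult_less_top)
  finally have "AE x in \<mu>. ennreal_powr (MI UNIV ?f x) p \<noteq> \<infinity>" by (intro nn_integral_PInf_AE) auto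
  then show "AE x in \<mu>. MI UNIV ?f x < top" by eventually_elim (simp add: less_top)
qed

text \<open>\<open>x0\<close> is the comparison point on all balls around itself. The local part of
  \<open>f\<close> has a Marcinkiewicz integral that is finite almost everywhere by
  \<open>L\<^sup>p\<close> boundedness, and integer radii exhaust the space.\<close>

lemma MI_finite_AE:
  assumes bd: "MI_bounded p B" and p: "1 < p" "0 \<le> B" and f[measurable]: "f \<in> borel_measurable \<mu>"
    and a: "0 \<le> a" "AE y in \<mu>. norm (f y) \<le> a" and x0: "MI UNIV f x0 < top"
  shows "AE x in \<mu>. MI UNIV f x < top"
    and "(\<integral>\<^sup>+x\<in>ball c r. MI UNIV f x \<partial>\<mu>) < top"
proof -
  have cmp: "MI UNIV f x \<le> MI UNIV f x0 + (MI UNIV (\<lambda>y. indicator (ball x0 (2 * k)) y * f y) x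
     + ennreal ((tail_const + far_const 2 * ball_delta \<mu> lam x0 k x0 k) * a))" if "0 < k" "x \<in> ball x0 k" for k x
    by (rule MI_compare[OF f a]) (use that in auto)
  have "AE x in \<mu>. \<forall>k::nat. MI UNIV (\<lambda>y. indicator (ball x0 (2 * real k)) y * f y) x < top"
    unfolding AE_all_countable using MI_ball_average(2)[OF bd p f a] by blast
  then show "AE x in \<mu>. MI UNIV f x < top"
  proof eventually_elim
    case (elim x)
    obtain k :: nat where k: "dist x0 x < real k" using reals_Archimedean2 by blast
    then have "0 < real k" using zero_le_dist[of x0 x] by linarith
    then have "MI UNIV f x \<le> MI UNIV f x0 + (MI UNIV (\<lambda>y. indicator (ball x0 (2 * real k)) y * f y) x
       + ennreal ((tail_const + far_const 2 * ball_delta \<mu> lam x0 (real k) x0 (real k)) * a))" using k by (intro cmp) auto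
    also have "\<dots> < top" using x0 elim by simp
    finally show ?case .
  qed
  define k where "k = \<bar>r\<bar> + dist x0 c + 1"
  have k: "0 < k" unfolding k_def using zero_le_dist[of x0 c] by linarith
  have sub: "ball c r \<subseteq> ball x0 k"
  proof
    fix y assume "y \<in> ball c r"
    then show "y \<in> ball x0 k" using dist_triangle[of x0 y c] by (simp add: k_def)
  qed
  let ?h = "MI UNIV (\<lambda>y. indicator (ball x0 (2 * k)) y * f y)"
  let ?e = "ennreal ((tail_const + far_const 2 * ball_delta \<mu> lam x0 k x0 k) * a)"
  have "(\<integral>\<^sup>+x\<in>ball c r. MI UNIV f x \<partial>\<mu>)
      \<le> (\<integral>\<^sup>+x. ?h x * indicator (ball x0 (2 * k)) x + (MI UNIV f x0 + ?e) * indicator (ball x0 (2 * k)) x \<partial>\<mu>)"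
  proof (intro nn_integral_mono)
    fix x
    show "MI UNIV f x * indicator (ball c r) x
      \<le> ?h x * indicator (ball x0 (2 * k)) x + (MI UNIV f x0 + ?e) * indicator (ball x0 (2 * k)) x"
    proof (cases "x \<in> ball c r")
      case True
      then have 1: "x \<in> ball x0 k" using sub by blast
      then have "x \<in> ball x0 (2 * k)" using k by simp
      then show ?thesis using cmp[OF k 1] True by (simp add: ac_simps)
    qed simp
  qed
  also have "\<dots> = (\<integral>\<^sup>+x\<in>ball x0 (2 * k). ?h x \<partial>\<mu>) + (MI UNIV f x0 + ?e) * emeasure \<mu> (ball x0 (2 * k))"
    by (simp add: nn_integral_add nn_integral_cmult)
  also have "\<dots> < top"
    using le_less_trans[OF MI_ball_average(1)[OF bd p f a], of x0 "2 * k" top] x0 by (simp add: ennreal_mult_less_top)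
  finally show "(\<integral>\<^sup>+x\<in>ball c r. MI UNIV f x \<partial>\<mu>) < top" .
qed

lemma essinf_MI_ge:
  assumes f[measurable]: "f \<in> borel_measurable \<mu>" and a: "0 \<le> a" "AE y in \<mu>. norm (f y) \<le> a"
    and fin: "AE x in \<mu>. MI UNIV f x < top"
    and \<eta>: "1 < \<eta>" and r: "0 < r" "0 < R" and sub: "ball c r \<subseteq> ball c' R" and x: "x \<in> ball c r"
    and xf: "MI UNIV f x < top" and h: "MI UNIV (\<lambda>y. indicator (ball c (\<eta> * r)) y * f y) x \<le> ennreal h" "0 \<le> h"
  shows "ereal (enn2real (MI UNIV f x) - (h + (tail_const + far_const \<eta> * ball_delta \<mu> lam c r c' R) * a))
    \<le> essinf_on \<mu> (ball c' R) (\<lambda>x. enn2real (MI UNIV f x))"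
proof (rule essinf_on_ge)
  let ?k = "(tail_const + far_const \<eta> * ball_delta \<mu> lam c r c' R) * a"
  have k0: "0 \<le> ?k" using tail_const_nonneg far_const_nonneg[of \<eta>] ennreal_ball_delta(2)[OF r, of c c'] a(1) by simp
  show "AE z in \<mu>. z \<in> ball c' R \<longrightarrow> ereal (enn2real (MI UNIV f x) - (h + ?k)) \<le> ereal (enn2real (MI UNIV f z))"
    using fin
  proof eventually_elim
    case (elim z)
    show ?case
    proof
      assume z: "z \<in> ball c' R"
      have "ennreal (enn2real (MI UNIV f x)) \<le> MI UNIV f z + (MI UNIV (\<lambda>y. indicator (ball c (\<eta> * r)) y * f y) x + ennreal ?k)"
        using MI_compare[OF f a \<eta> r sub x z] xf by simp
      also have "\<dots> \<le> ennreal (enn2real (MI UNIV f z)) + (ennreal h + ennreal ?k)"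
        using elim h by (intro add_mono) auto
      also have "\<dots> = ennreal (enn2real (MI UNIV f z) + (h + ?k))"
        using h(2) k0 by simp
      finally have "enn2real (MI UNIV f x) \<le> enn2real (MI UNIV f z) + (h + ?k)"
        using h(2) k0 by (subst (asm) ennreal_le_iff) auto
      then show "ereal (enn2real (MI UNIV f x) - (h + ?k)) \<le> ereal (enn2real (MI UNIV f z))" by simp
    qed
  qed
qed measurable

text \<open>The term with \<open>beta \<rho>\<close> and the final \<open>far_const \<rho>\<close>
  come from the second RBLO condition, whose local ball is the \<open>\<rho>\<close>-fold ball so
  that doubling applies; \<open>far_const \<eta>\<close> with the bound for \<open>\<delta>\<close>
  comes from the first.\<close>

definition RBLO_const :: "real \<Rightarrow> real \<Rightarrow> real \<Rightarrow> real \<Rightarrow> real" where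
  "RBLO_const p B \<eta> \<rho> = B powr (1 / p) * (1 + beta \<rho>) + tail_const
     + far_const \<eta> * doubling_delta_const \<rho> + far_const \<rho>"

text \<open>In the first condition the ball is compared with its doubling dilate, where
  \<open>\<delta>\<close> is bounded, and the local part is averaged by \<open>L\<^sup>p\<close>
  boundedness. In the second a single well chosen point of the small ball is compared with almost
  every point of the large one.\<close>

lemma RBLO_MI:
  assumes bd: "MI_bounded p B" and p: "1 < p" "0 \<le> B" and f[measurable]: "f \<in> borel_measurable \<mu>"
    and a: "0 \<le> a" "AE y in \<mu>. norm (f y) \<le> a" and x0: "MI UNIV f x0 < top"
    and \<eta>: "1 < \<eta>" and \<rho>: "1 < \<rho>"
  shows "L1_loc \<mu> (\<lambda>x. enn2real (MI UNIV f x))"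
    and "RBLO_bound \<mu> lam Clam N0 \<eta> \<rho> (\<lambda>x. enn2real (MI UNIV f x)) (RBLO_const p B \<eta> \<rho> * a)"
proof -
  let ?g = "\<lambda>x. enn2real (MI UNIV f x)"
  have fin: "AE x in \<mu>. MI UNIV f x < top" by (rule MI_finite_AE(1)[OF bd p f a x0])
  have bpos: "0 < beta \<rho>" by (rule beta_pos[OF \<rho>])
  show "L1_loc \<mu> ?g"
    unfolding L1_loc_def set_integrable_def
  proof (intro allI impI)
    fix c r
    have "(\<integral>\<^sup>+x. ennreal (norm (indicator (ball c r) x *\<^sub>R ?g x)) \<partial>\<mu>) \<le> (\<integral>\<^sup>+x\<in>ball c r. MI UNIV f x \<partial>\<mu>)"
      by (intro nn_integral_mono) (auto simp: indicator_def ennreal_enn2real_if)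
    also have "\<dots> < \<infinity>" using MI_finite_AE(2)[OF bd p f a x0] by simp
    finally show "integrable \<mu> (\<lambda>x. indicator (ball c r) x *\<^sub>R ?g x)"
      by (intro integrableI_bounded) auto
  qed
  show "RBLO_bound \<mu> lam Clam N0 \<eta> \<rho> ?g (RBLO_const p B \<eta> \<rho> * a)"
    unfolding RBLO_bound_def
  proof (intro conjI allI impI)
    show "0 \<le> RBLO_const p B \<eta> \<rho> * a"
      unfolding RBLO_const_def using a(1) bpos tail_const_nonneg far_const_nonneg doubling_delta_const_nonneg[OF \<rho>]
      by (intro mult_nonneg_nonneg add_nonneg_nonneg) auto
  next
    fix c and r :: real assume r: "0 < r"
    obtain J where J: "1 \<le> J" "doubling_radius \<mu> Clam N0 \<rho> c r = \<rho> ^ J * r"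
      by (rule doubling_radius_props[OF \<rho> r, of c])
    define R where "R = doubling_radius \<mu> Clam N0 \<rho> c r"
    have "1 * r \<le> \<rho> ^ J * r" using \<rho> r by (intro mult_right_mono one_le_power) auto
    then have R: "r \<le> R" "0 < R" using r by (simp_all add: R_def J(2))
    define d where "d = ball_delta \<mu> lam c r c R"
    have "ennreal d \<le> ennreal (doubling_delta_const \<rho>)"
      unfolding d_def ennreal_ball_delta(1)[OF r R(2)] unfolding R_def by (rule doubling_delta[OF \<rho> r])
    moreover have "0 \<le> d" unfolding d_def by (rule ennreal_ball_delta(2)[OF r R(2)])
    ultimately have d: "0 \<le> d" "d \<le> doubling_delta_const \<rho>"
      using doubling_delta_const_nonneg[OF \<rho>] by simp_all
    let ?h = "MI UNIV (\<lambda>y. indicator (ball c (\<eta> * r)) y * f y)"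
    let ?k = "(tail_const + far_const \<eta> * d) * a"
    have k0: "0 \<le> ?k" using tail_const_nonneg far_const_nonneg[of \<eta>] d(1) a(1) by simp
    have sub: "ball c r \<subseteq> ball c (\<eta> * r)"
    proof (rule subset_ball)
      have "1 * r \<le> \<eta> * r" using \<eta> r by (intro mult_right_mono) auto
      then show "r \<le> \<eta> * r" by simp
    qed
    have "(\<integral>\<^sup>+y\<in>ball c r. e2ennreal (ereal (?g y) - essinf_on \<mu> (ball c R) ?g) \<partial>\<mu>)
        \<le> (\<integral>\<^sup>+y. ?h y * indicator (ball c (\<eta> * r)) y + ennreal ?k * indicator (ball c (\<eta> * r)) y \<partial>\<mu>)"
    proof (rule nn_integral_mono_AE)
      show "AE y in \<mu>. e2ennreal (ereal (?g y) - essinf_on \<mu> (ball c R) ?g) * indicator (ball c r) y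
        \<le> ?h y * indicator (ball c (\<eta> * r)) y + ennreal ?k * indicator (ball c (\<eta> * r)) y"
        using fin MI_ball_average(2)[OF bd p f a, of c "\<eta> * r"]
      proof eventually_elim
        case (elim y)
        show ?case
        proof (cases "y \<in> ball c r")
          case True
          define hy where "hy = enn2real (?h y)"
          have hy: "?h y = ennreal hy" "0 \<le> hy" using elim(2) by (simp_all add: hy_def)
          have "ereal (?g y - (hy + ?k)) \<le> essinf_on \<mu> (ball c R) ?g"
            using essinf_MI_ge[OF f a fin \<eta> r R(2) subset_ball[OF R(1)] True elim(1), of hy] hy unfolding d_def by simp
          then have "ereal (?g y) - essinf_on \<mu> (ball c R) ?g \<le> ereal (?g y) - ereal (?g y - (hy + ?k))"
            by (intro ereal_minus_mono) auto
          also have "\<dots> = ereal (hy + ?k)" by simp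
          finally have "e2ennreal (ereal (?g y) - essinf_on \<mu> (ball c R) ?g) \<le> e2ennreal (ereal (hy + ?k))"
            by (rule e2ennreal_mono)
          also have "\<dots> = ennreal (hy + ?k)" by (simp add: ennreal.rep_eq)
          also have "\<dots> = ?h y + ennreal ?k" using hy k0 by simp
          finally show ?thesis using True sub by (auto simp: indicator_def)
        qed simp
      qed
    qed
    also have "\<dots> = (\<integral>\<^sup>+y\<in>ball c (\<eta> * r). ?h y \<partial>\<mu>) + ennreal ?k * emeasure \<mu> (ball c (\<eta> * r))"
      by (simp add: nn_integral_add nn_integral_cmult)
    also have "\<dots> \<le> ennreal (B powr (1 / p) * a) * emeasure \<mu> (ball c (\<eta> * r)) + ennreal ?k * emeasure \<mu> (ball c (\<eta> * r))"
      by (intro add_mono MI_ball_average(1)[OF bd p f a] order_refl)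
    also have "\<dots> = ennreal (B powr (1 / p) * a + ?k) * emeasure \<mu> (ball c (\<eta> * r))"
      using a(1) k0 by (simp add: distrib_right)
    also have "\<dots> \<le> ennreal (RBLO_const p B \<eta> \<rho> * a) * emeasure \<mu> (ball c (\<eta> * r))"
    proof (intro mult_right_mono ennreal_leI)
      have "far_const \<eta> * d \<le> far_const \<eta> * doubling_delta_const \<rho>" using d(2) far_const_nonneg by (intro mult_left_mono)
      moreover have "0 \<le> B powr (1 / p) * beta \<rho>" using bpos by simp
      ultimately have "B powr (1 / p) + (tail_const + far_const \<eta> * d) \<le> RBLO_const p B \<eta> \<rho>"
        unfolding RBLO_const_def using far_const_nonneg[of \<rho>] by (simp add: algebra_simps)
      then have "(B powr (1 / p) + (tail_const + far_const \<eta> * d)) * a \<le> RBLO_const p B \<eta> \<rho> * a"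
        using a(1) by (rule mult_right_mono)
      then show "B powr (1 / p) * a + ?k \<le> RBLO_const p B \<eta> \<rho> * a"
        by (simp only: distrib_right)
    qed simp
    finally have le: "(\<integral>\<^sup>+y\<in>ball c r. e2ennreal (ereal (?g y) - essinf_on \<mu> (ball c R) ?g) \<partial>\<mu>)
        \<le> ennreal (RBLO_const p B \<eta> \<rho> * a) * emeasure \<mu> (ball c (\<eta> * r))" .
    show "(\<integral>\<^sup>+y\<in>ball c r. e2ennreal (ereal (?g y) - essinf_on \<mu> (ball c (doubling_radius \<mu> Clam N0 \<rho> c r)) ?g) \<partial>\<mu>)
        / emeasure \<mu> (ball c (\<eta> * r)) \<le> ennreal (RBLO_const p B \<eta> \<rho> * a)"
      using le unfolding R_def[symmetric]
      by (cases "emeasure \<mu> (ball c (\<eta> * r)) = 0") (auto intro!: divide_le_posI_ennreal simp: zero_less_iff_neq_zero mult.commute)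
  next
    fix c c' and r r' :: real
    assume as: "0 < r \<and> 0 < r' \<and> ball c r \<subseteq> ball c' r' \<and>
        doubling_ball \<mu> \<rho> (beta \<rho>) c r \<and> doubling_ball \<mu> \<rho> (beta \<rho>) c' r' \<and> 0 < emeasure \<mu> (ball c r)"
    then have r: "0 < r" "0 < r'" and sub: "ball c r \<subseteq> ball c' r'" and db: "doubling_ball \<mu> \<rho> (beta \<rho>) c r"
      and pos: "0 < emeasure \<mu> (ball c r)" by auto
    define d where "d = ball_delta \<mu> lam c r c' r'"
    have d: "0 \<le> d" unfolding d_def by (rule ennreal_ball_delta(2)[OF r])
    let ?h = "MI UNIV (\<lambda>y. indicator (ball c (\<rho> * r)) y * f y)"
    let ?k = "(tail_const + far_const \<rho> * d) * a"
    define hb where "hb = B powr (1 / p) * a * beta \<rho>"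
    have hb0: "0 \<le> hb" using a(1) bpos by (simp add: hb_def)
    have rr: "ball c r \<subseteq> ball c (\<rho> * r)"
    proof (rule subset_ball)
      have "1 * r \<le> \<rho> * r" using \<rho> r by (intro mult_right_mono) auto
      then show "r \<le> \<rho> * r" by simp
    qed
    have int: "(\<integral>\<^sup>+y\<in>ball c r. ?h y \<partial>\<mu>) \<le> ennreal hb * emeasure \<mu> (ball c r)"
    proof -
      have "(\<integral>\<^sup>+y\<in>ball c r. ?h y \<partial>\<mu>) \<le> (\<integral>\<^sup>+y\<in>ball c (\<rho> * r). ?h y \<partial>\<mu>)"
        using rr by (intro nn_integral_mono mult_left_mono) (auto simp: indicator_def)
      also have "\<dots> \<le> ennreal (B powr (1 / p) * a) * emeasure \<mu> (ball c (\<rho> * r))"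
        by (rule MI_ball_average(1)[OF bd p f a])
      also have "\<dots> \<le> ennreal (B powr (1 / p) * a) * (ennreal (beta \<rho>) * emeasure \<mu> (ball c r))"
        using db unfolding doubling_ball_def by (rule mult_left_mono) simp
      also have "\<dots> = ennreal hb * emeasure \<mu> (ball c r)"
        using a(1) bpos by (simp add: hb_def ennreal_mult mult.assoc)
      finally show ?thesis .
    qed
    \<comment> \<open>A point at which the local part does not exceed its average bound
      \<open>hb\<close> and the value is at least the essential infimum. If there were none, the
      local part would exceed \<open>hb\<close> almost everywhere on a ball of positive measure,
      contradicting \<open>int\<close>.\<close>
    have "\<exists>y. y \<in> ball c r \<and> MI UNIV f y < top \<and> ?h y \<le> ennreal hb \<and> essinf_on \<mu> (ball c r) ?g \<le> ereal (?g y)"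
    proof (rule ccontr)
      assume no: "\<not> ?thesis"
      have ess: "AE y in \<mu>. y \<in> ball c r \<longrightarrow> essinf_on \<mu> (ball c r) ?g \<le> ereal (?g y)"
        by (rule essinf_on_AE) measurable
      have ae: "AE y in \<mu>. y \<in> ball c r \<longrightarrow> ennreal hb < ?h y"
        using fin ess by eventually_elim (use no in \<open>auto simp: not_le\<close>)
      have lt: "(\<integral>\<^sup>+y. ennreal hb * indicator (ball c r) y \<partial>\<mu>) < (\<integral>\<^sup>+y\<in>ball c r. ?h y \<partial>\<mu>)"
      proof (rule nn_integral_less)
        show "(\<integral>\<^sup>+y. ennreal hb * indicator (ball c r) y \<partial>\<mu>) \<noteq> \<infinity>"
          by (simp add: nn_integral_cmult ennreal_mult_eq_top_iff)
        show "AE y in \<mu>. ennreal hb * indicator (ball c r) y \<le> ?h y * indicator (ball c r) y"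
          using ae by eventually_elim (auto simp: indicator_def)
        show "\<not> (AE y in \<mu>. ?h y * indicator (ball c r) y \<le> ennreal hb * indicator (ball c r) y)"
        proof
          assume "AE y in \<mu>. ?h y * indicator (ball c r) y \<le> ennreal hb * indicator (ball c r) y"
          then have ae': "AE y in \<mu>. y \<notin> ball c r" using ae by eventually_elim (auto simp: indicator_def)
          have "{y\<in>space \<mu>. \<not> y \<notin> ball c r} = ball c r" by auto
          with ae' have "emeasure \<mu> (ball c r) = 0"
            using AE_iff_measurable[OF ball_sets, of "\<lambda>y. y \<notin> ball c r" c r] by simp
          then show False using pos by simp
        qed
      qed measurable
      then show False using int by (simp add: nn_integral_cmult)
    qed
    then obtain y where y: "y \<in> ball c r" "MI UNIV f y < top" "?h y \<le> ennreal hb" "essinf_on \<mu> (ball c r) ?g \<le> ereal (?g y)"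
      by blast
    have "ereal (?g y - (hb + ?k)) \<le> essinf_on \<mu> (ball c' r') ?g"
      using essinf_MI_ge[OF f a fin \<rho> r sub y(1,2,3) hb0] unfolding d_def .
    then have "essinf_on \<mu> (ball c r) ?g - essinf_on \<mu> (ball c' r') ?g \<le> ereal (?g y) - ereal (?g y - (hb + ?k))"
      using y(4) by (intro ereal_minus_mono)
    also have "\<dots> = ereal (hb + ?k)" by simp
    also have "\<dots> \<le> ereal (RBLO_const p B \<eta> \<rho> * a * (1 + d))"
    proof -
      define u where "u = B powr (1 / p) + far_const \<eta> * doubling_delta_const \<rho>"
      have u: "0 \<le> u" using far_const_nonneg[of \<eta>] doubling_delta_const_nonneg[OF \<rho>] by (simp add: u_def)
      have C: "RBLO_const p B \<eta> \<rho> = u + B powr (1 / p) * beta \<rho> + tail_const + far_const \<rho>"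
        by (simp add: RBLO_const_def u_def algebra_simps)
      have b1: "0 \<le> B powr (1 / p) * beta \<rho>" using bpos by simp
      have "RBLO_const p B \<eta> \<rho> * (1 + d) = (B powr (1 / p) * beta \<rho> + tail_const + far_const \<rho> * d)
         + (u * (1 + d) + B powr (1 / p) * beta \<rho> * d + tail_const * d + far_const \<rho>)"
        unfolding C by (simp add: algebra_simps)
      moreover have "0 \<le> u * (1 + d) + B powr (1 / p) * beta \<rho> * d + tail_const * d + far_const \<rho>"
        using u bpos d tail_const_nonneg far_const_nonneg[of \<rho>] by (intro add_nonneg_nonneg mult_nonneg_nonneg) auto
      ultimately have "B powr (1 / p) * beta \<rho> + tail_const + far_const \<rho> * d \<le> RBLO_const p B \<eta> \<rho> * (1 + d)" by linarith
      then have "(B powr (1 / p) * beta \<rho> + tail_const + far_const \<rho> * d) * a \<le> RBLO_const p B \<eta> \<rho> * (1 + d) * a"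
        using a(1) by (rule mult_right_mono)
      then show ?thesis by (simp add: hb_def algebra_simps)
    qed
    finally show "essinf_on \<mu> (ball c r) ?g - essinf_on \<mu> (ball c' r') ?g
       \<le> ereal (RBLO_const p B \<eta> \<rho> * a * (1 + ball_delta \<mu> lam c r c' r'))"
      unfolding d_def .
  qed
qed

end

section \<open>The atomic Hardy space\<close>

lemma Lp_norm_finite_exponent:
  assumes "0 < p"
  shows "Lp_norm M (ennreal p) g = ennreal_powr (\<integral>\<^sup>+x. ennreal_powr (g x) p \<partial>M) (1 / p)"
  using assms by (simp add: Lp_norm_def)

lemma Lp_norm_1: "Lp_norm M 1 g = (\<integral>\<^sup>+x. g x \<partial>M)"
  using Lp_norm_finite_exponent[of 1 M g] by simp

context nonhomogeneous_space
begin

text \<open>The exponent \<open>\<infinity>\<close> is reduced to 2, where the operator is bounded: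
  on a set of measure at most \<open>m\<close> the bound \<open>m powr (- 1)\<close> gives the
  \<open>L\<^sup>2\<close> norm \<open>m powr (1 / 2 - 1)\<close>, which is the normalisation of an
  atom with exponent 2.\<close>

lemma atom_L2:
  assumes \<rho>: "1 < \<rho>" and at: "atom_in \<mu> lam \<rho> \<infinity> c r a" and r: "0 < r"
  shows "atom_in \<mu> lam \<rho> (ennreal 2) c r a"
proof -
  obtain c' r' where a: "0 < r'" "ball c' r' \<subseteq> ball c r" "a \<in> borel_measurable \<mu>" "\<forall>x. x \<notin> ball c' r' \<longrightarrow> a x = 0"
    "Lp_cnorm \<mu> \<infinity> a \<le> ennreal (measure \<mu> (ball c' (\<rho> * r')) powr (enn2real (1 / \<infinity>) - 1) * inverse (1 + ball_delta \<mu> lam c' r' c r))"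
    using at unfolding atom_in_def by blast
  note [measurable] = a(3)
  define m where "m = measure \<mu> (ball c' (\<rho> * r'))"
  define d where "d = inverse (1 + ball_delta \<mu> lam c' r' c r)"
  have d0: "0 \<le> d" unfolding d_def using ennreal_ball_delta(2)[OF a(1) r, of c' c] by simp
  have "esssup \<mu> (\<lambda>x. ennreal (norm (a x))) \<le> ennreal (m powr (- 1) * d)"
    using a(5) by (simp add: Lp_norm_def m_def d_def)
  then have ae: "AE x in \<mu>. ennreal (norm (a x)) \<le> ennreal (m powr (- 1) * d)"
    using esssup_AE[of "\<lambda>x. ennreal (norm (a x))" \<mu>] by (auto elim!: eventually_mono)
  have sub: "ball c' r' \<subseteq> ball c' (\<rho> * r')"
  proof (rule subset_ball)
    have "1 * r' \<le> \<rho> * r'" using \<rho> a(1) by (intro mult_right_mono) auto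
    then show "r' \<le> \<rho> * r'" by simp
  qed
  have "(\<integral>\<^sup>+x. ennreal_powr (ennreal (norm (a x))) 2 \<partial>\<mu>) \<le> (\<integral>\<^sup>+x. ennreal ((m powr (- 1) * d)\<^sup>2) * indicator (ball c' (\<rho> * r')) x \<partial>\<mu>)"
  proof (rule nn_integral_mono_AE)
    show "AE x in \<mu>. ennreal_powr (ennreal (norm (a x))) 2 \<le> ennreal ((m powr (- 1) * d)\<^sup>2) * indicator (ball c' (\<rho> * r')) x"
      using ae
    proof eventually_elim
      case (elim x)
      then have "norm (a x) \<le> m powr (- 1) * d" using d0 by (simp add: m_def)
      then have "(norm (a x))\<^sup>2 \<le> (m powr (- 1) * d)\<^sup>2" by (intro power_mono) auto
      then show ?case using a(4) sub
        by (cases "x \<in> ball c' r'") (auto simp: ennreal_power intro!: ennreal_leI)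
    qed
  qed
  also have "\<dots> = ennreal ((m powr (- 1) * d)\<^sup>2 * m)"
    by (simp add: nn_integral_cmult emeasure_ball_eq m_def ennreal_mult)
  finally have sq: "(\<integral>\<^sup>+x. ennreal_powr (ennreal (norm (a x))) 2 \<partial>\<mu>) \<le> ennreal ((m powr (- 1) * d)\<^sup>2 * m)" .
  have "Lp_cnorm \<mu> (ennreal 2) a = ennreal_powr (\<integral>\<^sup>+x. ennreal_powr (ennreal (norm (a x))) 2 \<partial>\<mu>) (1 / 2)"
    by (rule Lp_norm_finite_exponent) simp
  also have "\<dots> \<le> ennreal_powr (ennreal ((m powr (- 1) * d)\<^sup>2 * m)) (1 / 2)"
    by (intro ennreal_powr_mono sq) simp
  \<comment> \<open>For \<open>m = 0\<close> both sides vanish, as every power of 0 is 0.\<close>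
  also have "\<dots> = ennreal (m powr (1 / 2 - 1) * d)"
  proof (cases "m = 0")
    case False
    then have m: "0 < m" by (simp add: m_def zero_less_measure_iff)
    have "((m powr (- 1) * d)\<^sup>2 * m) powr (1 / 2) = (m powr (- 1) * d) * m powr (1 / 2)"
      using m d0 by (simp add: powr_mult powr_half_sqrt)
    also have "\<dots> = m powr (1 / 2 - 1) * d" using m by (simp add: powr_minus field_simps powr_mult_base flip: powr_add)
    finally show ?thesis using m by (simp add: ennreal_powr_ennreal)
  qed simp
  also have "1 / 2 - 1 = enn2real (1 / ennreal 2) - 1"
  proof -
    have "(1::ennreal) / ennreal 2 = ennreal (1 / 2)"
      using divide_ennreal[of 1 2] by simp
    then have "enn2real (1 / ennreal 2) = 1 / 2" by (simp only: enn2real_ennreal)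
    then show ?thesis by simp
  qed
  finally show ?thesis unfolding atom_in_def m_def d_def using a(1-4) by blast
qed

lemma atomic_block_L2:
  assumes "1 < \<rho>" "atomic_block \<mu> lam \<rho> \<infinity> b s"
  shows "atomic_block \<mu> lam \<rho> (ennreal 2) b s"
  using assms(2) atom_L2[OF assms(1)] unfolding atomic_block_def by blast

end

context mk_kernel
begin

section \<open>Estimates for atoms and atomic blocks\<close>

definition locL1 :: "('a \<Rightarrow> complex) \<Rightarrow> bool" where
  "locL1 f \<longleftrightarrow> f \<in> borel_measurable \<mu> \<and> (\<forall>z r. (\<integral>\<^sup>+y\<in>ball z r. ennreal (norm (f y)) \<partial>\<mu>) < top)"

lemma locL1_measurable: "locL1 f \<Longrightarrow> f \<in> borel_measurable \<mu>"
  by (simp add: locL1_def)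

lemma locL1_convergent_at: "locL1 f \<Longrightarrow> AE x in \<mu>. convergent_at f x"
  by (intro convergent_at_AE) (auto simp: locL1_def)

lemma locL1_of_L1:
  assumes "f \<in> borel_measurable \<mu>" "(\<integral>\<^sup>+y. ennreal (norm (f y)) \<partial>\<mu>) < top"
  shows "locL1 f"
  unfolding locL1_def using assms local_L1[of 1 f] by simp

lemma locL1_add:
  assumes "locL1 f" "locL1 g" shows "locL1 (\<lambda>y. f y + g y)"
  unfolding locL1_def
proof (intro conjI allI)
  have [measurable]: "f \<in> borel_measurable \<mu>" "g \<in> borel_measurable \<mu>" using assms by (auto simp: locL1_def)
  show "(\<lambda>y. f y + g y) \<in> borel_measurable \<mu>" by measurable
  fix z r
  have "(\<integral>\<^sup>+y\<in>ball z r. ennreal (norm (f y + g y)) \<partial>\<mu>)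
      \<le> (\<integral>\<^sup>+y. ennreal (norm (f y)) * indicator (ball z r) y + ennreal (norm (g y)) * indicator (ball z r) y \<partial>\<mu>)"
    by (intro nn_integral_mono) (auto simp: indicator_def norm_triangle_ineq simp flip: ennreal_plus)
  also have "\<dots> < top" using assms by (simp add: nn_integral_add locL1_def)
  finally show "(\<integral>\<^sup>+y\<in>ball z r. ennreal (norm (f y + g y)) \<partial>\<mu>) < top" .
qed

lemma locL1_cmult:
  assumes "locL1 f" shows "locL1 (\<lambda>y. k * f y)"
  unfolding locL1_def
proof (intro conjI allI)
  have [measurable]: "f \<in> borel_measurable \<mu>" using assms by (auto simp: locL1_def)
  show "(\<lambda>y. k * f y) \<in> borel_measurable \<mu>" by measurable
  fix z r
  have "(\<integral>\<^sup>+y\<in>ball z r. ennreal (norm (k * f y)) \<partial>\<mu>)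
      = (\<integral>\<^sup>+y. ennreal (norm k) * (ennreal (norm (f y)) * indicator (ball z r) y) \<partial>\<mu>)"
    by (intro nn_integral_cong) (simp add: norm_mult ennreal_mult mult.assoc)
  also have "\<dots> < top" using assms by (simp add: nn_integral_cmult locL1_def ennreal_mult_less_top)
  finally show "(\<integral>\<^sup>+y\<in>ball z r. ennreal (norm (k * f y)) \<partial>\<mu>) < top" .
qed

lemma locL1_diff: "locL1 f \<Longrightarrow> locL1 g \<Longrightarrow> locL1 (\<lambda>y. f y - g y)"
  using locL1_add[OF _ locL1_cmult[of g "- 1"], of f] by simp

lemma locL1_sum:
  assumes "\<And>j. locL1 (b j)" shows "locL1 (\<lambda>y. \<Sum>j<(n::nat). b j y)"
proof (induction n)
  case 0
  show ?case by (simp add: locL1_def)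
next
  case (Suc n)
  show ?case using locL1_add[OF Suc assms[of n]] by simp
qed

text \<open>On the \<open>\<rho>\<close>-fold atom ball Hoelder and the bound at exponent
  \<open>q\<close> apply. Between it and \<open>ball c (2 * r)\<close> the size of the kernel leaves
  the integral \<open>\<delta>\<close>, which the normalising factor
  \<open>inverse (1 + \<delta>)\<close> of the atom compensates.\<close>

lemma atom_estimates:
  assumes bd: "MI_bounded q B" and q: "1 < q" "0 \<le> B" and \<rho>: "1 < \<rho>" and r: "0 < r"
    and at: "atom_in \<mu> lam \<rho> (ennreal q) c r a"
  shows "a \<in> borel_measurable \<mu>" and "(\<integral>\<^sup>+y. ennreal (norm (a y)) \<partial>\<mu>) \<le> 1"
    and "(\<integral>\<^sup>+x\<in>ball c (2 * r). MI UNIV a x \<partial>\<mu>) \<le> ennreal (B powr (1 / q) + far_const \<rho>)"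
proof -
  obtain c' r' where a: "0 < r'" "ball c' r' \<subseteq> ball c r" "a \<in> borel_measurable \<mu>" "\<forall>x. x \<notin> ball c' r' \<longrightarrow> a x = 0"
    "Lp_cnorm \<mu> (ennreal q) a \<le> ennreal (measure \<mu> (ball c' (\<rho> * r')) powr (enn2real (1 / ennreal q) - 1)
        * inverse (1 + ball_delta \<mu> lam c' r' c r))"
    using at unfolding atom_in_def by blast
  show a3[measurable]: "a \<in> borel_measurable \<mu>" by fact
  define m where "m = measure \<mu> (ball c' (\<rho> * r'))"
  define \<delta> where "\<delta> = ball_delta \<mu> lam c' r' c r"
  have \<delta>: "0 \<le> \<delta>" unfolding \<delta>_def by (rule ennreal_ball_delta(2)[OF a(1) r])
  have "(1::ennreal) / ennreal q = ennreal (1 / q)"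
    using divide_ennreal[of 1 q] q by simp
  then have "enn2real (1 / ennreal q) = 1 / q" using q by simp
  then have nrm: "ennreal_powr (\<integral>\<^sup>+x. ennreal_powr (ennreal (norm (a x))) q \<partial>\<mu>) (1 / q)
      \<le> ennreal (m powr (1 / q - 1) * inverse (1 + \<delta>))"
    using a(5) q by (simp add: Lp_norm_finite_exponent m_def \<delta>_def)
  have fin: "(\<integral>\<^sup>+x. ennreal_powr (ennreal (norm (a x))) q \<partial>\<mu>) < top"
    using le_less_trans[OF nrm ennreal_less_top] by simp
  have sub: "ball c' r' \<subseteq> ball c' (\<rho> * r')"
  proof (rule subset_ball)
    have "1 * r' \<le> \<rho> * r'" using \<rho> a(1) by (intro mult_right_mono) auto
    then show "r' \<le> \<rho> * r'" by simp
  qed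
  have mm: "m powr (1 - 1 / q) * m powr (1 / q - 1) \<le> 1" by (simp flip: powr_add)
  have cancel: "ennreal (m powr (1 - 1 / q)) * ennreal (m powr (1 / q - 1) * inverse (1 + \<delta>)) \<le> ennreal (inverse (1 + \<delta>))"
  proof -
    have "m powr (1 - 1 / q) * (m powr (1 / q - 1) * inverse (1 + \<delta>)) = (m powr (1 - 1 / q) * m powr (1 / q - 1)) * inverse (1 + \<delta>)"
      by simp
    also have "\<dots> \<le> 1 * inverse (1 + \<delta>)" using \<delta> by (intro mult_right_mono mm) auto
    finally show ?thesis by (subst ennreal_mult[symmetric]) (use \<delta> in \<open>auto intro: ennreal_leI\<close>)
  qed
  have L1: "(\<integral>\<^sup>+y. ennreal (norm (a y)) \<partial>\<mu>) \<le> ennreal (inverse (1 + \<delta>))"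
  proof -
    have "(\<integral>\<^sup>+y. ennreal (norm (a y)) \<partial>\<mu>) = (\<integral>\<^sup>+y\<in>ball c' (\<rho> * r'). ennreal (norm (a y)) \<partial>\<mu>)"
    proof (rule nn_integral_cong)
      fix y
      have "y \<notin> ball c' (\<rho> * r') \<Longrightarrow> a y = 0" using a(4) sub by blast
      then show "ennreal (norm (a y)) = ennreal (norm (a y)) * indicator (ball c' (\<rho> * r')) y"
        by (cases "y \<in> ball c' (\<rho> * r')") simp_all
    qed
    also have "\<dots> \<le> ennreal (m powr (1 - 1 / q)) * ennreal_powr (\<integral>\<^sup>+x. ennreal_powr (ennreal (norm (a x))) q \<partial>\<mu>) (1 / q)"
      unfolding m_def by (rule Holder_set[OF q(1)]) auto
    also have "\<dots> \<le> ennreal (m powr (1 - 1 / q)) * ennreal (m powr (1 / q - 1) * inverse (1 + \<delta>))"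
      by (rule mult_left_mono[OF nrm]) simp
    also have "\<dots> \<le> ennreal (inverse (1 + \<delta>))" by (rule cancel)
    finally show ?thesis .
  qed
  also have "\<dots> \<le> 1" using \<delta> by (simp add: inverse_le_1_iff)
  finally show "(\<integral>\<^sup>+y. ennreal (norm (a y)) \<partial>\<mu>) \<le> 1" .
  have near: "(\<integral>\<^sup>+x\<in>ball c' (\<rho> * r'). MI UNIV a x \<partial>\<mu>) \<le> ennreal (B powr (1 / q))"
  proof -
    have "(\<integral>\<^sup>+x\<in>ball c' (\<rho> * r'). MI UNIV a x \<partial>\<mu>) \<le> ennreal (m powr (1 - 1 / q))
       * ennreal_powr (ennreal B * (\<integral>\<^sup>+y. ennreal_powr (ennreal (norm (a y))) q \<partial>\<mu>)) (1 / q)"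
      unfolding m_def by (rule Holder_MI[OF bd q(1) a3 fin]) auto
    also have "ennreal_powr (ennreal B * (\<integral>\<^sup>+y. ennreal_powr (ennreal (norm (a y))) q \<partial>\<mu>)) (1 / q)
        = ennreal (B powr (1 / q)) * ennreal_powr (\<integral>\<^sup>+y. ennreal_powr (ennreal (norm (a y))) q \<partial>\<mu>) (1 / q)"
      using q by (simp add: ennreal_powr_mult ennreal_powr_ennreal)
    also have "ennreal (m powr (1 - 1 / q)) * (ennreal (B powr (1 / q)) * ennreal_powr (\<integral>\<^sup>+y. ennreal_powr (ennreal (norm (a y))) q \<partial>\<mu>) (1 / q))
      \<le> ennreal (m powr (1 - 1 / q)) * (ennreal (B powr (1 / q)) * ennreal (m powr (1 / q - 1) * inverse (1 + \<delta>)))"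
      by (intro mult_left_mono nrm) auto
    also have "\<dots> = ennreal (B powr (1 / q)) * (ennreal (m powr (1 - 1 / q)) * ennreal (m powr (1 / q - 1) * inverse (1 + \<delta>)))"
      by (simp only: mult.left_commute)
    also have "\<dots> \<le> ennreal (B powr (1 / q)) * 1"
    proof (rule mult_left_mono)
      show "ennreal (m powr (1 - 1 / q)) * ennreal (m powr (1 / q - 1) * inverse (1 + \<delta>)) \<le> 1"
        using \<delta> by (intro order_trans[OF cancel]) (simp add: inverse_le_1_iff)
    qed simp
    finally show ?thesis by simp
  qed
  let ?A = "ball c (2 * r) - ball c' r'"
  \<comment> \<open>Pointwise the image is at most
    \<open>far_const \<rho> / lam c' (dist c' x)\<close> times the \<open>L\<^sup>1\<close> norm of
    the atom, and that norm is at most \<open>inverse (1 + \<delta>)\<close>, not merely 1.\<close>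
  have far: "(\<integral>\<^sup>+x\<in>ball c (2 * r) - ball c' (\<rho> * r'). MI UNIV a x \<partial>\<mu>) \<le> ennreal (far_const \<rho>)"
  proof -
    have pw: "MI UNIV a x \<le> ennreal (far_const \<rho>) * ennreal (1 / lam c' (dist c' x)) * (\<integral>\<^sup>+y. ennreal (norm (a y)) \<partial>\<mu>)"
      if x: "\<rho> * r' \<le> dist c' x" for x
    proof -
      have rx: "r' < dist c' x"
      proof -
        have "1 * r' < \<rho> * r'" using \<rho> a(1) by (intro mult_strict_right_mono) auto
        then show ?thesis using x by simp
      qed
      have lp: "0 < lam c' (dist c' x)" using rx a(1) by (intro lam_pos) auto
      have "MI UNIV a x = L2 (theta UNIV) (\<lambda>t. ennreal (norm (\<integral>y. (if dist x y < t then K0 x y else 0) * a y \<partial>\<mu>)))"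
        unfolding MI_def Kint_def by (intro L2_cong arg_cong[where f=ennreal] arg_cong[where f=norm] Bochner_Integration.integral_cong refl) simp
      also have "\<dots> \<le> (\<integral>\<^sup>+y. L2 (theta UNIV) (\<lambda>t. ennreal (norm (if dist x y < t then K0 x y else 0))) * ennreal (norm (a y)) \<partial>\<mu>)"
        by (rule Minkowski_scalar) (auto simp: split_beta)
      also have "\<dots> \<le> (\<integral>\<^sup>+y. (ennreal (far_const \<rho>) * ennreal (1 / lam c' (dist c' x))) * ennreal (norm (a y)) \<partial>\<mu>)"
      proof (intro nn_integral_mono)
        fix y
        show "L2 (theta UNIV) (\<lambda>t. ennreal (norm (if dist x y < t then K0 x y else 0))) * ennreal (norm (a y))
          \<le> (ennreal (far_const \<rho>) * ennreal (1 / lam c' (dist c' x))) * ennreal (norm (a y))"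
        proof (cases "y \<in> ball c' r'")
          case True
          then have y: "dist c' y < r'" by simp
          then have ne: "x \<noteq> y" using rx by auto
          have "dist c' x - r' \<le> dist x y" using dist_triangle[of c' x y] y by (simp add: dist_commute)
          moreover have "(\<rho> - 1) * dist c' x \<le> \<rho> * (dist c' x - r')"
            using x by (simp add: algebra_simps)
          ultimately have "(\<rho> - 1) * dist c' x \<le> \<rho> * dist x y"
            using \<rho> by (meson mult_left_mono order_trans less_imp_le zero_less_one less_trans)
          then have d: "dist c' x \<le> \<rho> / (\<rho> - 1) * dist x y" using \<rho> by (simp add: field_simps)
          have "norm (K0 x y) / dist x y \<le> far_const \<rho> / lam c' (dist c' x)"
            by (rule lam_far[OF \<rho> _ d _ ne]) (use rx a(1) in \<open>auto intro!: lam_shift\<close>)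
          moreover have "L2 (theta UNIV) (\<lambda>t. ennreal (norm (if dist x y < t then K0 x y else 0))) \<le> ennreal (norm (K0 x y) / dist x y)"
            using L2_theta_cutoff[of UNIV "dist x y" "\<lambda>_. True" "K0 x y"] ne by simp
          ultimately have "L2 (theta UNIV) (\<lambda>t. ennreal (norm (if dist x y < t then K0 x y else 0))) \<le> ennreal (far_const \<rho> / lam c' (dist c' x))"
            using ennreal_leI order_trans by blast
          also have "\<dots> = ennreal (far_const \<rho>) * ennreal (1 / lam c' (dist c' x))"
            using far_const_nonneg[of \<rho>] lp by (simp flip: ennreal_mult)
          finally show ?thesis by (rule mult_right_mono) simp
        qed (use a(4) in simp)
      qed
      also have "\<dots> = ennreal (far_const \<rho>) * ennreal (1 / lam c' (dist c' x)) * (\<integral>\<^sup>+y. ennreal (norm (a y)) \<partial>\<mu>)"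
        by (rule nn_integral_cmult) measurable
      finally show ?thesis .
    qed
    have "(\<integral>\<^sup>+x\<in>ball c (2 * r) - ball c' (\<rho> * r'). MI UNIV a x \<partial>\<mu>)
        \<le> (\<integral>\<^sup>+x. ennreal (far_const \<rho> * inverse (1 + \<delta>)) * (ennreal (1 / lam c' (dist c' x)) * indicator ?A x) \<partial>\<mu>)"
    proof (intro nn_integral_mono)
      fix x
      show "MI UNIV a x * indicator (ball c (2 * r) - ball c' (\<rho> * r')) x
        \<le> ennreal (far_const \<rho> * inverse (1 + \<delta>)) * (ennreal (1 / lam c' (dist c' x)) * indicator ?A x)"
      proof (cases "x \<in> ball c (2 * r) - ball c' (\<rho> * r')")
        case True
        then have xA: "x \<in> ?A" using sub by auto
        have "MI UNIV a x \<le> ennreal (far_const \<rho>) * ennreal (1 / lam c' (dist c' x)) * (\<integral>\<^sup>+y. ennreal (norm (a y)) \<partial>\<mu>)"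
          by (rule pw) (use True in auto)
        also have "\<dots> \<le> ennreal (far_const \<rho>) * ennreal (1 / lam c' (dist c' x)) * ennreal (inverse (1 + \<delta>))"
          by (rule mult_left_mono[OF L1]) simp
        also have "\<dots> = ennreal (far_const \<rho> * inverse (1 + \<delta>)) * ennreal (1 / lam c' (dist c' x))"
          using far_const_nonneg[of \<rho>] \<delta> by (simp add: ennreal_mult ac_simps)
        finally show ?thesis using True xA by simp
      qed simp
    qed
    also have "\<dots> = ennreal (far_const \<rho> * inverse (1 + \<delta>)) * ennreal \<delta>"
      unfolding \<delta>_def ennreal_ball_delta(1)[OF a(1) r] by (rule nn_integral_cmult) measurable
    also have "\<dots> = ennreal (far_const \<rho> * (inverse (1 + \<delta>) * \<delta>))"
      using far_const_nonneg[of \<rho>] \<delta> by (simp add: mult.assoc flip: ennreal_mult)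
    also have "\<dots> \<le> ennreal (far_const \<rho> * 1)"
      using far_const_nonneg[of \<rho>] \<delta> by (intro ennreal_leI mult_left_mono) (auto simp: field_simps)
    finally show ?thesis by simp
  qed
  have "(\<integral>\<^sup>+x\<in>ball c (2 * r). MI UNIV a x \<partial>\<mu>) \<le> (\<integral>\<^sup>+x\<in>ball c' (\<rho> * r'). MI UNIV a x \<partial>\<mu>)
      + (\<integral>\<^sup>+x\<in>ball c (2 * r) - ball c' (\<rho> * r'). MI UNIV a x \<partial>\<mu>)"
    by (rule nn_integral_union_le) auto
  also have "\<dots> \<le> ennreal (B powr (1 / q)) + ennreal (far_const \<rho>)" by (intro add_mono near far)
  finally show "(\<integral>\<^sup>+x\<in>ball c (2 * r). MI UNIV a x \<partial>\<mu>) \<le> ennreal (B powr (1 / q) + far_const \<rho>)"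
    using far_const_nonneg[of \<rho>] by simp
qed

definition block_const :: "real \<Rightarrow> real \<Rightarrow> real \<Rightarrow> real" where
  "block_const q B \<rho> = B powr (1 / q) + far_const \<rho> + reg_const"

text \<open>Inside \<open>ball c (2 * r)\<close> the two atoms are estimated separately. Outside,
  only the block as a whole has mean zero, and the kernel is compared with its value at the centre
  \<open>c\<close>.\<close>

lemma block_estimate:
  assumes bd: "MI_bounded q B" and q: "1 < q" "0 \<le> B" and \<rho>: "1 < \<rho>"
    and bl: "atomic_block \<mu> lam \<rho> (ennreal q) b s"
  shows "locL1 b" "0 \<le> s" "(\<integral>\<^sup>+x. MI UNIV b x \<partial>\<mu>) \<le> ennreal (block_const q B \<rho> * s)"
proof -
  have bc: "0 \<le> block_const q B \<rho>" using far_const_nonneg[of \<rho>] reg_const by (simp add: block_const_def)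
  have "locL1 b \<and> 0 \<le> s \<and> (\<integral>\<^sup>+x. MI UNIV b x \<partial>\<mu>) \<le> ennreal (block_const q B \<rho> * s)"
    using bl unfolding atomic_block_def
  proof (elim disjE conjE exE)
    fix c r a1 a2 \<kappa>1 \<kappa>2
    assume r: "0 < r" and bs: "\<forall>x. x \<notin> ball c r \<longrightarrow> b x = 0" and b0: "(\<integral>x. b x \<partial>\<mu>) = 0"
      and a1: "atom_in \<mu> lam \<rho> (ennreal q) c r a1" and a2: "atom_in \<mu> lam \<rho> (ennreal q) c r a2"
      and b: "b = (\<lambda>x. \<kappa>1 * a1 x + \<kappa>2 * a2 x)" and s: "s = norm \<kappa>1 + norm \<kappa>2"
    note e1 = atom_estimates[OF bd q \<rho> r a1] and e2 = atom_estimates[OF bd q \<rho> r a2]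
    note [measurable] = e1(1) e2(1)
    have bm[measurable]: "b \<in> borel_measurable \<mu>" unfolding b by measurable
    have s0: "0 \<le> s" by (simp add: s)
    have bL1: "(\<integral>\<^sup>+y. ennreal (norm (b y)) \<partial>\<mu>) \<le> ennreal s"
    proof -
      have "(\<integral>\<^sup>+y. ennreal (norm (b y)) \<partial>\<mu>) \<le> (\<integral>\<^sup>+y. ennreal (norm \<kappa>1) * ennreal (norm (a1 y)) + ennreal (norm \<kappa>2) * ennreal (norm (a2 y)) \<partial>\<mu>)"
        unfolding b by (intro nn_integral_mono)
          (auto intro!: ennreal_leI order_trans[OF norm_triangle_ineq] simp: norm_mult simp flip: ennreal_plus ennreal_mult)
      also have "\<dots> = ennreal (norm \<kappa>1) * (\<integral>\<^sup>+y. ennreal (norm (a1 y)) \<partial>\<mu>) + ennreal (norm \<kappa>2) * (\<integral>\<^sup>+y. ennreal (norm (a2 y)) \<partial>\<mu>)"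
        by (simp add: nn_integral_add nn_integral_cmult)
      also have "\<dots> \<le> ennreal (norm \<kappa>1) * 1 + ennreal (norm \<kappa>2) * 1"
        by (intro add_mono mult_left_mono e1(2) e2(2)) auto
      also have "\<dots> = ennreal s" by (simp add: s)
      finally show ?thesis .
    qed
    have loc: "locL1 b" using le_less_trans[OF bL1 ennreal_less_top] by (intro locL1_of_L1) auto
    have loc1: "locL1 a1" using le_less_trans[OF e1(2), of top] by (intro locL1_of_L1) auto
    have loc2: "locL1 a2" using le_less_trans[OF e2(2), of top] by (intro locL1_of_L1) auto
    have bint: "integrable \<mu> b" using le_less_trans[OF bL1 ennreal_less_top] by (intro integrableI_bounded) auto
    have inner: "(\<integral>\<^sup>+x\<in>ball c (2 * r). MI UNIV b x \<partial>\<mu>) \<le> ennreal ((B powr (1 / q) + far_const \<rho>) * s)"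
    proof -
      have "(\<integral>\<^sup>+x\<in>ball c (2 * r). MI UNIV b x \<partial>\<mu>)
          \<le> (\<integral>\<^sup>+x. ennreal (norm \<kappa>1) * (MI UNIV a1 x * indicator (ball c (2 * r)) x)
              + ennreal (norm \<kappa>2) * (MI UNIV a2 x * indicator (ball c (2 * r)) x) \<partial>\<mu>)"
      proof (rule nn_integral_mono_AE)
        show "AE x in \<mu>. MI UNIV b x * indicator (ball c (2 * r)) x
          \<le> ennreal (norm \<kappa>1) * (MI UNIV a1 x * indicator (ball c (2 * r)) x)
              + ennreal (norm \<kappa>2) * (MI UNIV a2 x * indicator (ball c (2 * r)) x)"
          using locL1_convergent_at[OF locL1_cmult[OF loc1, of \<kappa>1]] locL1_convergent_at[OF locL1_cmult[OF loc2, of \<kappa>2]]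
        proof eventually_elim
          case (elim x)
          have "MI UNIV b x \<le> MI UNIV (\<lambda>y. \<kappa>1 * a1 y) x + MI UNIV (\<lambda>y. \<kappa>2 * a2 y) x"
            unfolding b by (rule MI_add) (use elim in auto)
          also have "\<dots> = ennreal (norm \<kappa>1) * MI UNIV a1 x + ennreal (norm \<kappa>2) * MI UNIV a2 x"
            by (simp add: MI_cmult)
          finally show ?case by (simp add: indicator_def)
        qed
      qed
      also have "\<dots> = ennreal (norm \<kappa>1) * (\<integral>\<^sup>+x\<in>ball c (2 * r). MI UNIV a1 x \<partial>\<mu>) + ennreal (norm \<kappa>2) * (\<integral>\<^sup>+x\<in>ball c (2 * r). MI UNIV a2 x \<partial>\<mu>)"
        by (simp add: nn_integral_add nn_integral_cmult)
      also have "\<dots> \<le> ennreal (norm \<kappa>1) * ennreal (B powr (1 / q) + far_const \<rho>) + ennreal (norm \<kappa>2) * ennreal (B powr (1 / q) + far_const \<rho>)"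
        by (intro add_mono mult_left_mono e1(3) e2(3)) auto
      also have "\<dots> = ennreal ((B powr (1 / q) + far_const \<rho>) * s)"
        using far_const_nonneg[of \<rho>] by (simp add: s algebra_simps flip: ennreal_mult ennreal_plus)
      finally show ?thesis .
    qed
    let ?H = "\<lambda>x t y. if dist x y < t then K0 x y else 0"
    let ?D = "\<lambda>x y. L2 (theta UNIV) (\<lambda>t. ennreal (norm (?H x t y - ?H x t c)))"
    have D[measurable]: "(\<lambda>(x, y). ?D x y) \<in> borel_measurable (\<mu> \<Otimes>\<^sub>M \<mu>)"
      unfolding split_beta by (rule L2_measurable[OF sigma_finite_theta]) (auto simp: split_beta)
    have outer: "(\<integral>\<^sup>+x\<in>- ball c (2 * r). MI UNIV b x \<partial>\<mu>) \<le> ennreal (reg_const * s)"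
    proof -
      have "(\<integral>\<^sup>+x\<in>- ball c (2 * r). MI UNIV b x \<partial>\<mu>)
          \<le> (\<integral>\<^sup>+x. (\<integral>\<^sup>+y. ?D x y * ennreal (norm (b y)) * indicator (- ball c (2 * r)) x \<partial>\<mu>) \<partial>\<mu>)"
      proof (rule nn_integral_mono_AE)
        show "AE x in \<mu>. MI UNIV b x * indicator (- ball c (2 * r)) x
            \<le> (\<integral>\<^sup>+y. ?D x y * ennreal (norm (b y)) * indicator (- ball c (2 * r)) x \<partial>\<mu>)"
          using locL1_convergent_at[OF loc]
        proof eventually_elim
          case (elim x)
          have [measurable]: "?D x \<in> borel_measurable \<mu>"
            by (rule L2_measurable[OF sigma_finite_theta]) (auto simp: split_beta)
          \<comment> \<open>The subtracted value at \<open>c\<close> is constant in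
            \<open>y\<close>, and the integral of \<open>b\<close> vanishes.\<close>
          have "Kint b x t = (\<integral>y. (?H x t y - ?H x t c) * b y \<partial>\<mu>)" for t
          proof -
            have "(\<integral>y. (?H x t y - ?H x t c) * b y \<partial>\<mu>) = (\<integral>y. (if dist x y < t then K0 x y * b y else 0) - ?H x t c * b y \<partial>\<mu>)"
              by (intro Bochner_Integration.integral_cong refl) (simp add: left_diff_distrib)
            also have "\<dots> = Kint b x t - ?H x t c * (\<integral>y. b y \<partial>\<mu>)"
              unfolding Kint_def using convergent_at_integrable[OF bm elim, of t] bint by (subst Bochner_Integration.integral_diff) auto
            finally show ?thesis by (simp add: b0)
          qed
          then have "MI UNIV b x = L2 (theta UNIV) (\<lambda>t. ennreal (norm (\<integral>y. (?H x t y - ?H x t c) * b y \<partial>\<mu>)))"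
            unfolding MI_def by simp
          also have "\<dots> \<le> (\<integral>\<^sup>+y. ?D x y * ennreal (norm (b y)) \<partial>\<mu>)"
            by (rule Minkowski_scalar) (auto simp: split_beta)
          finally have "MI UNIV b x * indicator (- ball c (2 * r)) x \<le> (\<integral>\<^sup>+y. ?D x y * ennreal (norm (b y)) \<partial>\<mu>) * indicator (- ball c (2 * r)) x"
            by (rule mult_right_mono) simp
          also have "\<dots> = (\<integral>\<^sup>+y. ?D x y * ennreal (norm (b y)) * indicator (- ball c (2 * r)) x \<partial>\<mu>)"
            by (rule nn_integral_multc[symmetric]) measurable
          finally show ?case .
        qed
      qed
      also have "\<dots> = (\<integral>\<^sup>+y. (\<integral>\<^sup>+x. ?D x y * ennreal (norm (b y)) * indicator (- ball c (2 * r)) x \<partial>\<mu>) \<partial>\<mu>)"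
      proof -
        have [measurable]: "- ball c (2 * r) \<in> sets \<mu>" by (simp add: Compl_eq_Diff_UNIV sets_borel)
        show ?thesis by (rule pair_sigma_finite.Fubini') (auto simp: pair_sigma_finite_def sigma_finite)
      qed
      also have "\<dots> \<le> (\<integral>\<^sup>+y. ennreal reg_const * ennreal (norm (b y)) \<partial>\<mu>)"
      proof (intro nn_integral_mono)
        fix y
        show "(\<integral>\<^sup>+x. ?D x y * ennreal (norm (b y)) * indicator (- ball c (2 * r)) x \<partial>\<mu>) \<le> ennreal reg_const * ennreal (norm (b y))"
        proof (cases "y \<in> ball c r")
          case True
          have [measurable]: "(\<lambda>x. ?D x y) \<in> borel_measurable \<mu>" "- ball c (2 * r) \<in> sets \<mu>"
            by (rule L2_measurable[OF sigma_finite_theta]) (auto simp: split_beta Compl_eq_Diff_UNIV sets_borel)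
          have "(\<integral>\<^sup>+x. ?D x y * ennreal (norm (b y)) * indicator (- ball c (2 * r)) x \<partial>\<mu>)
              = (\<integral>\<^sup>+x\<in>- ball c (2 * r). ?D x y \<partial>\<mu>) * ennreal (norm (b y))"
            by (subst nn_integral_multc[symmetric]) (auto intro!: nn_integral_cong simp: ac_simps)
          also have "\<dots> \<le> ennreal reg_const * ennreal (norm (b y))"
            using jump_first[of UNIV r c y "\<lambda>_. True"] True r by (intro mult_right_mono) auto
          finally show ?thesis .
        qed (use bs in simp)
      qed
      also have "\<dots> = ennreal reg_const * (\<integral>\<^sup>+y. ennreal (norm (b y)) \<partial>\<mu>)" by (rule nn_integral_cmult) measurable
      also have "\<dots> \<le> ennreal reg_const * ennreal s" by (intro mult_left_mono bL1) simp
      also have "\<dots> = ennreal (reg_const * s)" using reg_const s0 by (simp add: ennreal_mult)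
      finally show ?thesis .
    qed
    have "(\<integral>\<^sup>+x. MI UNIV b x \<partial>\<mu>) = (\<integral>\<^sup>+x\<in>UNIV. MI UNIV b x \<partial>\<mu>)" by simp
    also have "\<dots> \<le> (\<integral>\<^sup>+x\<in>ball c (2 * r). MI UNIV b x \<partial>\<mu>) + (\<integral>\<^sup>+x\<in>- ball c (2 * r). MI UNIV b x \<partial>\<mu>)"
      by (rule nn_integral_union_le) (auto simp: Compl_eq_Diff_UNIV sets_borel)
    also have "\<dots> \<le> ennreal ((B powr (1 / q) + far_const \<rho>) * s) + ennreal (reg_const * s)" by (intro add_mono inner outer)
    also have "\<dots> = ennreal (block_const q B \<rho> * s)"
      using s0 reg_const far_const_nonneg[of \<rho>] by (simp add: block_const_def distrib_right)
    finally show ?thesis using loc s0 by simp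
  next
    \<comment> \<open>The exceptional constant block has no cancellation. The space has finite
      measure, so boundedness at exponent \<open>q\<close> and Hoelder on the whole space suffice;
      the powers of that measure cancel.\<close>
    fix \<kappa>
    assume fin: "emeasure \<mu> (space \<mu>) < \<infinity>" and b: "b = (\<lambda>x. \<kappa> * complex_of_real (inverse (measure \<mu> (space \<mu>))))" and s: "s = norm \<kappa>"
    define M where "M = measure \<mu> (space \<mu>)"
    have M: "emeasure \<mu> UNIV = ennreal M" "0 \<le> M" using fin by (simp_all add: M_def emeasure_eq_ennreal_measure less_top)
    have nb: "norm (b x) = s * inverse M" for x using M(2) by (simp only: b s M_def norm_mult norm_of_real abs_inverse abs_of_nonneg)
    have [measurable]: "b \<in> borel_measurable \<mu>" unfolding b by measurable
    have s0: "0 \<le> s" by (simp add: s)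
    have "(\<integral>\<^sup>+y. ennreal (norm (b y)) \<partial>\<mu>) < top" by (simp add: nb M ennreal_mult_less_top)
    then have loc: "locL1 b" by (intro locL1_of_L1) auto
    have bp: "(\<integral>\<^sup>+y. ennreal_powr (ennreal (norm (b y))) q \<partial>\<mu>) = ennreal ((s * inverse M) powr q * M)"
    proof -
      have "ennreal_powr (ennreal (norm (b y))) q = ennreal ((s * inverse M) powr q)" for y
        unfolding nb using s0 M by (intro ennreal_powr_ennreal) auto
      then show ?thesis using M by (simp add: ennreal_mult)
    qed
    have "(\<integral>\<^sup>+x. MI UNIV b x \<partial>\<mu>) = (\<integral>\<^sup>+x\<in>space \<mu>. MI UNIV b x \<partial>\<mu>)" by simp
    also have "\<dots> \<le> ennreal (measure \<mu> (space \<mu>) powr (1 - 1 / q))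
       * ennreal_powr (ennreal B * (\<integral>\<^sup>+y. ennreal_powr (ennreal (norm (b y))) q \<partial>\<mu>)) (1 / q)"
      by (rule Holder_MI[OF bd q(1)]) (use fin bp in \<open>auto simp: sets_borel\<close>)
    also have "\<dots> = ennreal (M powr (1 - 1 / q) * (B * ((s * inverse M) powr q * M)) powr (1 / q))"
      unfolding bp M_def[symmetric] using q M by (simp add: ennreal_powr_ennreal flip: ennreal_mult)
    also have "\<dots> \<le> ennreal (block_const q B \<rho> * s)"
    proof (rule ennreal_leI, cases "M = 0")
      case False
      then have M0: "0 < M" using M by simp
      have "M powr (1 - 1 / q) * M powr (1 / q) = M" using M0 by (simp flip: powr_add)
      moreover have "M powr (1 - 1 / q) * (B * ((s * inverse M) powr q * M)) powr (1 / q)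
          = B powr (1 / q) * (s * inverse M) * (M powr (1 - 1 / q) * M powr (1 / q))"
        using M0 q s0 by (simp add: powr_mult powr_powr)
      ultimately have "M powr (1 - 1 / q) * (B * ((s * inverse M) powr q * M)) powr (1 / q) = B powr (1 / q) * (s * inverse M) * M"
        by simp
      also have "\<dots> = B powr (1 / q) * s" using M0 by simp
      also have "\<dots> \<le> block_const q B \<rho> * s"
        using s0 far_const_nonneg[of \<rho>] reg_const by (intro mult_right_mono) (auto simp: block_const_def)
      finally show "M powr (1 - 1 / q) * (B * ((s * inverse M) powr q * M)) powr (1 / q) \<le> block_const q B \<rho> * s" .
    qed (use bc s0 in simp)
    finally show ?thesis using loc s0 by simp
  qed
  then show "locL1 b" "0 \<le> s" "(\<integral>\<^sup>+x. MI UNIV b x \<partial>\<mu>) \<le> ennreal (block_const q B \<rho> * s)" by auto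
qed

text \<open>Countable subadditivity does not follow from finite subadditivity, since the series
  converges in \<open>L\<^sup>1\<close> and not pointwise. The weak type bound controls the
  remainder: the set where the claim fails by \<open>e\<close> has measure at most a constant over
  \<open>e\<close> times the norm of the remainder.\<close>

lemma MI_series:
  assumes f[measurable]: "f \<in> borel_measurable \<mu>" "(\<integral>\<^sup>+y. ennreal (norm (f y)) \<partial>\<mu>) < top"
    and b: "\<And>j. locL1 (b j)"
    and lim: "(\<lambda>n. \<integral>\<^sup>+y. ennreal (norm (f y - (\<Sum>j<n. b j y))) \<partial>\<mu>) \<longlonglongrightarrow> 0"
    and wk: "\<And>\<epsilon> L. 0 < \<epsilon> \<Longrightarrow> 0 < L \<Longrightarrow> weak_HK \<epsilon> L W"
  shows "AE x in \<mu>. MI UNIV f x \<le> (\<Sum>j. MI UNIV (b j) x)"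
proof -
  define S where "S n y = (\<Sum>j<n. b j y)" for n y
  define g where "g x = (\<Sum>j. MI UNIV (b j) x)" for x
  have floc: "locL1 f" by (rule locL1_of_L1[OF f])
  have Sloc: "locL1 (S n)" for n unfolding S_def by (rule locL1_sum) (rule b)
  have dloc: "locL1 (\<lambda>y. f y - S n y)" for n by (rule locL1_diff[OF floc Sloc])
  note [measurable] = locL1_measurable[OF b] locL1_measurable[OF Sloc] locL1_measurable[OF dloc]
  have [measurable]: "g \<in> borel_measurable \<mu>" unfolding g_def by measurable
  have "AE x in \<mu>. (\<forall>n. convergent_at (\<lambda>y. f y - S n y) x) \<and> (\<forall>n. convergent_at (S n) x) \<and> (\<forall>n. convergent_at (b n) x)"
    using locL1_convergent_at[OF dloc] locL1_convergent_at[OF Sloc] locL1_convergent_at[OF b] by (simp add: AE_all_countable)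
  then have sub: "AE x in \<mu>. \<forall>n. MI UNIV f x \<le> MI UNIV (\<lambda>y. f y - S n y) x + g x"
  proof eventually_elim
    case (elim x)
    have Sn: "MI UNIV (S n) x \<le> (\<Sum>j<n. MI UNIV (b j) x)" for n
    proof (induction n)
      case 0
      have "(if dist x y < t then K0 x y * 0 else 0) = 0" for y t by simp
      then show ?case by (simp add: S_def MI_def Kint_def)
    next
      case (Suc n)
      have "MI UNIV (S (Suc n)) x = MI UNIV (\<lambda>y. S n y + b n y) x" by (simp add: S_def[abs_def])
      also have "\<dots> \<le> MI UNIV (S n) x + MI UNIV (b n) x" by (rule MI_add) (use elim in auto)
      also have "\<dots> \<le> (\<Sum>j<n. MI UNIV (b j) x) + MI UNIV (b n) x" by (intro add_right_mono Suc)
      finally show ?case by simp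
    qed
    show ?case
    proof
      fix n
      have "MI UNIV f x = MI UNIV (\<lambda>y. (f y - S n y) + S n y) x" by simp
      also have "\<dots> \<le> MI UNIV (\<lambda>y. f y - S n y) x + MI UNIV (S n) x" by (rule MI_add) (use elim in auto)
      also have "\<dots> \<le> MI UNIV (\<lambda>y. f y - S n y) x + g x"
        unfolding g_def by (intro add_left_mono order_trans[OF Sn] sum_le_suminf) auto
      finally show "MI UNIV f x \<le> MI UNIV (\<lambda>y. f y - S n y) x + g x" .
    qed
  qed
  \<comment> \<open>The exceptional set \<open>?A\<close> does not depend on \<open>n\<close>, while
    its measure is bounded by a sequence tending to 0.\<close>
  have eps: "AE x in \<mu>. MI UNIV f x \<le> ennreal e + g x" if e: "0 < e" for e
  proof -
    let ?A = "{x. ennreal e + g x < MI UNIV f x}"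
    have A: "?A \<in> sets \<mu>"
    proof -
      have "{x\<in>space \<mu>. ennreal e + g x < MI UNIV f x} \<in> sets \<mu>" by measurable
      then show ?thesis by simp
    qed
    have mn: "{x. ennreal e < MI UNIV (\<lambda>y. f y - S n y) x} \<in> sets \<mu>" for n
    proof -
      have "{x\<in>space \<mu>. ennreal e < MI UNIV (\<lambda>y. f y - S n y) x} \<in> sets \<mu>" by measurable
      then show ?thesis by simp
    qed
    have ev: "\<forall>\<^sub>F n in sequentially. (\<integral>\<^sup>+y. ennreal (norm (f y - S n y)) \<partial>\<mu>) < top"
      using order_tendstoD(2)[OF lim, of top] by (simp add: S_def)
    have "\<forall>\<^sub>F n in sequentially. ennreal e * emeasure \<mu> ?A \<le> ennreal W * (\<integral>\<^sup>+y. ennreal (norm (f y - S n y)) \<partial>\<mu>)"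
      using ev
    proof eventually_elim
      case (elim n)
      have "emeasure \<mu> ?A \<le> emeasure \<mu> {x. ennreal e < MI UNIV (\<lambda>y. f y - S n y) x}"
      proof (rule emeasure_mono_AE)
        show "AE x in \<mu>. x \<in> ?A \<longrightarrow> x \<in> {x. ennreal e < MI UNIV (\<lambda>y. f y - S n y) x}"
          using sub
        proof eventually_elim
          case (elim x)
          show ?case
          proof (rule impI, rule ccontr)
            assume x: "x \<in> ?A" "x \<notin> {x. ennreal e < MI UNIV (\<lambda>y. f y - S n y) x}"
            have "MI UNIV f x \<le> MI UNIV (\<lambda>y. f y - S n y) x + g x" using elim by blast
            also have "\<dots> \<le> ennreal e + g x" using x(2) by (intro add_right_mono) auto
            finally show False using x(1) by auto
          qed
        qed
      qed (rule mn)
      then have "ennreal e * emeasure \<mu> ?A \<le> ennreal e * emeasure \<mu> {x. ennreal e < MI UNIV (\<lambda>y. f y - S n y) x}"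
        by (rule mult_left_mono) simp
      also have "\<dots> \<le> ennreal W * (\<integral>\<^sup>+y. ennreal (norm (f y - S n y)) \<partial>\<mu>)"
        by (rule weak_MI[OF _ e wk elim]) auto
      finally show ?case .
    qed
    moreover have "(\<lambda>n. ennreal W * (\<integral>\<^sup>+y. ennreal (norm (f y - S n y)) \<partial>\<mu>)) \<longlonglongrightarrow> ennreal W * 0"
      unfolding S_def by (intro ennreal_tendsto_cmult lim) simp
    ultimately have "ennreal e * emeasure \<mu> ?A \<le> ennreal W * 0"
      by (intro tendsto_lowerbound[OF _ _ sequentially_bot]) auto
    then have "emeasure \<mu> ?A = 0" using e by (simp add: ennreal_eq_0_iff)
    then have "AE x in \<mu>. x \<notin> ?A" using A by (intro AE_not_in null_setsI)
    then show ?thesis by eventually_elim (simp add: not_less)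
  qed
  have "AE x in \<mu>. \<forall>k::nat. MI UNIV f x \<le> ennreal (1 / real (Suc k)) + g x"
    unfolding AE_all_countable by (intro allI eps) simp
  then show ?thesis
  proof eventually_elim
    case (elim x)
    have "(\<lambda>k. ennreal (1 / real (Suc k)) + g x) \<longlonglongrightarrow> ennreal 0 + g x"
      by (intro tendsto_add tendsto_const tendsto_ennrealI) (rule LIMSEQ_inverse_real_of_nat[unfolded inverse_eq_divide])
    then have "MI UNIV f x \<le> ennreal 0 + g x"
      by (rule tendsto_lowerbound) (use elim in auto)
    then show ?case by (simp add: g_def)
  qed
qed

lemma MI_atomic_decomposition:
  assumes bd: "MI_bounded q B" and q: "1 < q" "0 \<le> B" and \<rho>: "1 < \<rho>"
    and f: "f \<in> borel_measurable \<mu>" "(\<integral>\<^sup>+y. ennreal (norm (f y)) \<partial>\<mu>) < top"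
    and dec: "\<And>j. atomic_block \<mu> lam \<rho> (ennreal q) (b j) (s j)" "summable s"
    and lim: "(\<lambda>n. \<integral>\<^sup>+y. ennreal (norm (f y - (\<Sum>j<n. b j y))) \<partial>\<mu>) \<longlonglongrightarrow> 0"
    and wk: "\<And>\<epsilon> L. 0 < \<epsilon> \<Longrightarrow> 0 < L \<Longrightarrow> weak_HK \<epsilon> L W"
  shows "(\<integral>\<^sup>+x. MI UNIV f x \<partial>\<mu>) \<le> ennreal (block_const q B \<rho>) * ennreal (\<Sum>j. s j)"
proof -
  have bc: "0 \<le> block_const q B \<rho>" using far_const_nonneg[of \<rho>] reg_const by (simp add: block_const_def)
  note bl = block_estimate[OF bd q \<rho> dec(1)]
  note [measurable] = locL1_measurable[OF bl(1)]
  have "(\<integral>\<^sup>+x. MI UNIV f x \<partial>\<mu>) \<le> (\<integral>\<^sup>+x. (\<Sum>j. MI UNIV (b j) x) \<partial>\<mu>)"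
    by (intro nn_integral_mono_AE MI_series[OF f bl(1) lim wk])
  also have "\<dots> = (\<Sum>j. \<integral>\<^sup>+x. MI UNIV (b j) x \<partial>\<mu>)" by (rule nn_integral_suminf) measurable
  also have "\<dots> \<le> (\<Sum>j. ennreal (block_const q B \<rho> * s j))" by (intro suminf_le bl(3)) auto
  also have "\<dots> = ennreal (\<Sum>j. block_const q B \<rho> * s j)"
    using bc bl(2) dec(2) by (intro suminf_ennreal2) (auto intro: summable_mult)
  also have "(\<Sum>j. block_const q B \<rho> * s j) = block_const q B \<rho> * (\<Sum>j. s j)" using dec(2) by (rule suminf_mult)
  also have "ennreal \<dots> = ennreal (block_const q B \<rho>) * ennreal (\<Sum>j. s j)"
    using bc bl(2) dec(2) by (intro ennreal_mult suminf_nonneg) auto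
  finally show ?thesis .
qed

end

section \<open>Operator bounds\<close>

context mk_kernel
begin

lemma marcinkiewicz_MI: "f \<in> borel_measurable \<mu> \<Longrightarrow> marcinkiewicz \<mu> K f = MI UNIV f"
  by (rule ext) (rule marcinkiewicz_eq)

lemma strong_of_bounded:
  assumes p: "1 < p"
    and bo: "bounded_operator \<mu> (Lp_space \<mu> (ennreal p)) (Lp_cnorm \<mu> (ennreal p))
        (Lp_norm \<mu> (ennreal p)) (marcinkiewicz \<mu> K)"
  shows "\<exists>B\<ge>0. \<forall>\<epsilon> L. 0 < \<epsilon> \<longrightarrow> 0 < L \<longrightarrow> strong_HK \<epsilon> L p B"
proof -
  obtain C where C: "0 < C" "\<And>f. f \<in> Lp_space \<mu> (ennreal p) \<Longrightarrow>
      Lp_norm \<mu> (ennreal p) (marcinkiewicz \<mu> K f) \<le> ennreal C * Lp_cnorm \<mu> (ennreal p) f"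
    using bo unfolding bounded_operator_def by blast
  have p0: "0 < p" using p by simp
  have "(\<integral>\<^sup>+x. ennreal_powr (MI UNIV f x) p \<partial>\<mu>) \<le> ennreal (C powr p) * (\<integral>\<^sup>+y. ennreal_powr (ennreal (norm (f y))) p \<partial>\<mu>)"
    if f: "f \<in> borel_measurable \<mu>" for f
  proof (cases "(\<integral>\<^sup>+y. ennreal_powr (ennreal (norm (f y))) p \<partial>\<mu>) < top")
    case True
    then have "f \<in> Lp_space \<mu> (ennreal p)"
      using f by (simp add: Lp_space_def Lp_norm_finite_exponent[OF p0])
    from C(2)[OF this] have "ennreal_powr (ennreal_powr (\<integral>\<^sup>+x. ennreal_powr (MI UNIV f x) p \<partial>\<mu>) (1 / p)) p
        \<le> ennreal_powr (ennreal C * ennreal_powr (\<integral>\<^sup>+y. ennreal_powr (ennreal (norm (f y))) p \<partial>\<mu>) (1 / p)) p"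
      using p0 unfolding Lp_norm_finite_exponent[OF p0] marcinkiewicz_MI[OF f] by (intro ennreal_powr_mono) auto
    then show ?thesis using p0 C(1) by (simp add: ennreal_powr_mult ennreal_powr_ennreal)
  next
    case False
    \<comment> \<open>The right-hand side is infinite because \<open>C > 0\<close>; a zero constant
      would give \<open>0 * top = 0\<close>.\<close>
    then have "(\<integral>\<^sup>+y. ennreal_powr (ennreal (norm (f y))) p \<partial>\<mu>) = top" by (simp add: not_less top_unique)
    then show ?thesis using C(1) by (simp add: ennreal_mult_top)
  qed
  then show ?thesis using strong_truncated[OF _ p] by (intro exI[of _ "C powr p"]) auto
qed

lemma bounded_operator_Lp:
  assumes bd: "MI_bounded q B" and q: "1 < q" "0 \<le> B"
  shows "bounded_operator \<mu> (Lp_space \<mu> (ennreal q)) (Lp_cnorm \<mu> (ennreal q)) (Lp_norm \<mu> (ennreal q)) (marcinkiewicz \<mu> K)"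
  unfolding bounded_operator_def
\<comment> \<open>The summand 1 makes the constant strictly positive, as
  \<open>bounded_operator\<close> demands, also for \<open>B = 0\<close>.\<close>
proof (intro exI[of _ "B powr (1 / q) + 1"] conjI ballI)
  have q0: "0 < q" using q by simp
  show "0 < B powr (1 / q) + 1" by (rule add_nonneg_pos) auto
  fix f assume f: "f \<in> Lp_space \<mu> (ennreal q)"
  then have m[measurable]: "f \<in> borel_measurable \<mu>" by (simp add: Lp_space_def)
  show "marcinkiewicz \<mu> K f \<in> borel_measurable \<mu>" unfolding marcinkiewicz_MI[OF m] by measurable
  have "(\<integral>\<^sup>+y. ennreal_powr (ennreal (norm (f y))) q \<partial>\<mu>) < top"
    using f by (simp add: Lp_space_def Lp_norm_finite_exponent[OF q0])
  then have "Lp_norm \<mu> (ennreal q) (marcinkiewicz \<mu> K f)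
      \<le> ennreal_powr (ennreal B * (\<integral>\<^sup>+y. ennreal_powr (ennreal (norm (f y))) q \<partial>\<mu>)) (1 / q)"
    unfolding Lp_norm_finite_exponent[OF q0] marcinkiewicz_MI[OF m]
    using bd q0 unfolding MI_bounded_def by (intro ennreal_powr_mono) auto
  also have "\<dots> = ennreal (B powr (1 / q)) * Lp_cnorm \<mu> (ennreal q) f"
    unfolding Lp_norm_finite_exponent[OF q0] using q q0 by (simp add: ennreal_powr_mult ennreal_powr_ennreal)
  also have "\<dots> \<le> ennreal (B powr (1 / q) + 1) * Lp_cnorm \<mu> (ennreal q) f"
    by (intro mult_right_mono ennreal_leI) auto
  finally show "Lp_norm \<mu> (ennreal q) (marcinkiewicz \<mu> K f) \<le> ennreal (B powr (1 / q) + 1) * Lp_cnorm \<mu> (ennreal q) f" .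
qed

lemma bounded_operator_weak_L1:
  assumes W: "0 \<le> W"
    and wk: "\<And>\<epsilon> L. 0 < \<epsilon> \<Longrightarrow> 0 < L \<Longrightarrow> weak_HK \<epsilon> L W"
  shows "bounded_operator \<mu> (Lp_space \<mu> 1) (Lp_cnorm \<mu> 1) (weak_L1_norm \<mu>) (marcinkiewicz \<mu> K)"
  unfolding bounded_operator_def
proof (intro exI[of _ "W + 1"] conjI ballI)
  show "0 < W + 1" using W by simp
  fix f assume f: "f \<in> Lp_space \<mu> 1"
  then have m[measurable]: "f \<in> borel_measurable \<mu>" by (simp add: Lp_space_def)
  have fin: "(\<integral>\<^sup>+y. ennreal (norm (f y)) \<partial>\<mu>) < top" using f by (simp add: Lp_space_def Lp_norm_1)
  show "marcinkiewicz \<mu> K f \<in> borel_measurable \<mu>" unfolding marcinkiewicz_MI[OF m] by measurable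
  show "weak_L1_norm \<mu> (marcinkiewicz \<mu> K f) \<le> ennreal (W + 1) * Lp_cnorm \<mu> 1 f"
    unfolding weak_L1_norm_def Lp_norm_1 marcinkiewicz_MI[OF m]
  proof (rule SUP_least)
    fix t :: real assume t: "t \<in> {0<..}"
    have "ennreal t * emeasure \<mu> {x. ennreal t < MI UNIV f x} \<le> ennreal W * (\<integral>\<^sup>+y. ennreal (norm (f y)) \<partial>\<mu>)"
      using t by (intro weak_MI[OF m _ wk fin]) auto
    also have "\<dots> \<le> ennreal (W + 1) * (\<integral>\<^sup>+y. ennreal (norm (f y)) \<partial>\<mu>)" by (intro mult_right_mono ennreal_leI) auto
    finally show "ennreal t * emeasure \<mu> {x \<in> space \<mu>. ennreal t < MI UNIV f x} \<le> ennreal (W + 1) * (\<integral>\<^sup>+y. ennreal (norm (f y)) \<partial>\<mu>)"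
      by simp
  qed
qed

text \<open>The exponent \<open>p\<close> of the blocks and the exponent \<open>q\<close> of the
  operator bound are decoupled by the hypothesis \<open>block\<close>: they agree for finite
  \<open>p\<close>, and \<open>q = 2\<close> serves \<open>p = \<infinity>\<close>.\<close>

lemma bounded_operator_H1:
  assumes bd: "MI_bounded q B" and q: "1 < q" "0 \<le> B" and \<rho>: "1 < \<rho>"
    and wk: "\<And>\<epsilon> L. 0 < \<epsilon> \<Longrightarrow> 0 < L \<Longrightarrow> weak_HK \<epsilon> L W"
    and block: "\<And>b s. atomic_block \<mu> lam \<rho> p b s \<Longrightarrow> atomic_block \<mu> lam \<rho> (ennreal q) b s"
  shows "bounded_operator \<mu> (H1_space \<mu> lam \<rho> p) (H1_norm \<mu> lam \<rho> p) (Lp_norm \<mu> 1) (marcinkiewicz \<mu> K)"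
  unfolding bounded_operator_def
proof (intro exI[of _ "block_const q B \<rho> + 1"] conjI ballI)
  define C where "C = block_const q B \<rho> + 1"
  have bc: "0 \<le> block_const q B \<rho>" using far_const_nonneg[of \<rho>] reg_const by (simp add: block_const_def)
  then have C: "0 < C" by (simp add: C_def)
  then show "0 < block_const q B \<rho> + 1" by (simp add: C_def)
  fix f assume f: "f \<in> H1_space \<mu> lam \<rho> p"
  then have m[measurable]: "f \<in> borel_measurable \<mu>" by (simp add: H1_space_def Lp_space_def)
  have fin: "(\<integral>\<^sup>+y. ennreal (norm (f y)) \<partial>\<mu>) < top" using f by (simp add: H1_space_def Lp_space_def Lp_norm_1)
  show "marcinkiewicz \<mu> K f \<in> borel_measurable \<mu>" unfolding marcinkiewicz_MI[OF m] by measurable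
  \<comment> \<open>Dividing by \<open>C\<close> first makes the left side a lower bound of the set
    whose infimum is the norm.\<close>
  have "ennreal (1 / C) * (\<integral>\<^sup>+x. MI UNIV f x \<partial>\<mu>) \<le> H1_norm \<mu> lam \<rho> p f"
    unfolding H1_norm_def
  proof (rule Inf_greatest)
    fix z assume "z \<in> {ennreal (\<Sum>j. s j) | b s. atomic_decomposition \<mu> lam \<rho> p f b s}"
    then obtain b s where z: "z = ennreal (\<Sum>j. s j)" and d: "atomic_decomposition \<mu> lam \<rho> p f b s" by blast
    have "(\<integral>\<^sup>+x. MI UNIV f x \<partial>\<mu>) \<le> ennreal (block_const q B \<rho>) * z" unfolding z
      using d unfolding atomic_decomposition_def Lp_norm_1
      by (intro MI_atomic_decomposition[OF bd q \<rho> m fin _ _ _ wk]) (auto intro: block)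
    also have "\<dots> \<le> ennreal C * z" by (intro mult_right_mono ennreal_leI) (auto simp: C_def)
    finally have "ennreal (1 / C) * (\<integral>\<^sup>+x. MI UNIV f x \<partial>\<mu>) \<le> ennreal (1 / C) * (ennreal C * z)"
      by (rule mult_left_mono) simp
    also have "\<dots> = z" using C by (simp add: mult.assoc[symmetric] ennreal_mult[symmetric])
    finally show "ennreal (1 / C) * (\<integral>\<^sup>+x. MI UNIV f x \<partial>\<mu>) \<le> z" .
  qed
  then have "ennreal C * (ennreal (1 / C) * (\<integral>\<^sup>+x. MI UNIV f x \<partial>\<mu>)) \<le> ennreal C * H1_norm \<mu> lam \<rho> p f"
    by (rule mult_left_mono) simp
  moreover have "ennreal C * (ennreal (1 / C) * (\<integral>\<^sup>+x. MI UNIV f x \<partial>\<mu>)) = (\<integral>\<^sup>+x. MI UNIV f x \<partial>\<mu>)"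
    using C by (simp add: mult.assoc[symmetric] ennreal_mult[symmetric])
  ultimately show "Lp_norm \<mu> 1 (marcinkiewicz \<mu> K f) \<le> ennreal (block_const q B \<rho> + 1) * H1_norm \<mu> lam \<rho> p f"
    by (simp add: C_def Lp_norm_1 marcinkiewicz_MI[OF m])
qed

lemma RBLO_norm_MI:
  assumes bd: "MI_bounded q B" and q: "1 < q" "0 \<le> B" and \<eta>: "1 < \<eta>" and \<rho>: "1 < \<rho>"
    and f: "f \<in> Lp_space \<mu> \<infinity>" and x0: "marcinkiewicz \<mu> K f x0 < \<infinity>"
  shows "AE x in \<mu>. marcinkiewicz \<mu> K f x < \<infinity>"
    and "(\<lambda>x. enn2real (marcinkiewicz \<mu> K f x)) \<in> RBLO_space \<mu> lam Clam N0 \<eta> \<rho>"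
    and "ennreal (RBLO_norm \<mu> lam Clam N0 \<eta> \<rho> (\<lambda>x. enn2real (marcinkiewicz \<mu> K f x)))
      \<le> ennreal (\<bar>RBLO_const q B \<eta> \<rho>\<bar> + 1) * Lp_cnorm \<mu> \<infinity> f"
proof -
  have m[measurable]: "f \<in> borel_measurable \<mu>" using f by (simp add: Lp_space_def)
  define a where "a = enn2real (Lp_cnorm \<mu> \<infinity> f)"
  have a: "0 \<le> a" "Lp_cnorm \<mu> \<infinity> f = ennreal a" using f by (simp_all add: Lp_space_def a_def)
  have "AE y in \<mu>. ennreal (norm (f y)) \<le> esssup \<mu> (\<lambda>x. ennreal (norm (f x)))" by (rule esssup_AE)
  moreover have "esssup \<mu> (\<lambda>x. ennreal (norm (f x))) = ennreal a" using a(2) by (simp add: Lp_norm_def)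
  ultimately have ae: "AE y in \<mu>. norm (f y) \<le> a" using a(1) by simp
  have x: "MI UNIV f x0 < top" using x0 by (simp add: marcinkiewicz_MI[OF m])
  show "AE x in \<mu>. marcinkiewicz \<mu> K f x < \<infinity>"
    using MI_finite_AE(1)[OF bd q m a(1) ae x] by (simp add: marcinkiewicz_MI[OF m])
  note R = RBLO_MI[OF bd q m a(1) ae x \<eta> \<rho>]
  show "(\<lambda>x. enn2real (marcinkiewicz \<mu> K f x)) \<in> RBLO_space \<mu> lam Clam N0 \<eta> \<rho>"
    unfolding RBLO_space_def marcinkiewicz_MI[OF m] using R by blast
  have "RBLO_norm \<mu> lam Clam N0 \<eta> \<rho> (\<lambda>x. enn2real (MI UNIV f x)) \<le> RBLO_const q B \<eta> \<rho> * a"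
    unfolding RBLO_norm_def
    by (rule cInf_lower) (use R(2) in \<open>auto simp: RBLO_bound_def intro!: bdd_belowI[of _ 0]\<close>)
  also have "\<dots> \<le> (\<bar>RBLO_const q B \<eta> \<rho>\<bar> + 1) * a" using a(1) by (intro mult_right_mono) auto
  finally have "ennreal (RBLO_norm \<mu> lam Clam N0 \<eta> \<rho> (\<lambda>x. enn2real (MI UNIV f x))) \<le> ennreal ((\<bar>RBLO_const q B \<eta> \<rho>\<bar> + 1) * a)"
    by (rule ennreal_leI)
  also have "\<dots> = ennreal (\<bar>RBLO_const q B \<eta> \<rho>\<bar> + 1) * ennreal a" using a(1) by (intro ennreal_mult) auto
  finally show "ennreal (RBLO_norm \<mu> lam Clam N0 \<eta> \<rho> (\<lambda>x. enn2real (marcinkiewicz \<mu> K f x)))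
      \<le> ennreal (\<bar>RBLO_const q B \<eta> \<rho>\<bar> + 1) * Lp_cnorm \<mu> \<infinity> f"
    by (simp only: a(2) marcinkiewicz_MI[OF m])
qed

end

theorem theorem2p1:
  fixes \<mu> :: "'a::metric_space measure"
    and lam :: "'a \<Rightarrow> real \<Rightarrow> real" and Clam :: real and N0 :: nat
    and K :: "'a \<Rightarrow> 'a \<Rightarrow> complex"
  assumes space: "nonhomogeneous_space \<mu> lam Clam N0"
    and kernel: "marcinkiewicz_kernel \<mu> lam K"
    and bounded: "\<exists>p0::real. 1 < p0 \<and>
      bounded_operator \<mu> (Lp_space \<mu> (ennreal p0)) (Lp_cnorm \<mu> (ennreal p0))
        (Lp_norm \<mu> (ennreal p0)) (marcinkiewicz \<mu> K)"
  shows
    "bounded_operator \<mu> (Lp_space \<mu> 1) (Lp_cnorm \<mu> 1) (weak_L1_norm \<mu>) (marcinkiewicz \<mu> K)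
     \<and>
     (\<forall>(\<rho>::real) (p::ennreal). 1 < \<rho> \<and> 1 < p \<longrightarrow>
        bounded_operator \<mu> (H1_space \<mu> lam \<rho> p) (H1_norm \<mu> lam \<rho> p) (Lp_norm \<mu> 1)
          (marcinkiewicz \<mu> K))
     \<and>
     (\<forall>(\<eta>::real) (\<rho>::real). 1 < \<eta> \<and> 1 < \<rho> \<longrightarrow>
        (\<exists>C::real. 0 < C \<and>
          (\<forall>f \<in> Lp_space \<mu> \<infinity>.
             ((\<forall>x. marcinkiewicz \<mu> K f x = \<infinity>) \<or> (AE x in \<mu>. marcinkiewicz \<mu> K f x < \<infinity>)) \<and>
             ((\<exists>x0. marcinkiewicz \<mu> K f x0 < \<infinity>) \<longrightarrow>
                (AE x in \<mu>. marcinkiewicz \<mu> K f x < \<infinity>) \<and>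
                (\<lambda>x. enn2real (marcinkiewicz \<mu> K f x)) \<in> RBLO_space \<mu> lam Clam N0 \<eta> \<rho> \<and>
                ennreal (RBLO_norm \<mu> lam Clam N0 \<eta> \<rho> (\<lambda>x. enn2real (marcinkiewicz \<mu> K f x)))
                  \<le> ennreal C * Lp_cnorm \<mu> \<infinity> f))))
     \<and>
     (\<forall>p::real. 1 < p \<longrightarrow>
        bounded_operator \<mu> (Lp_space \<mu> (ennreal p)) (Lp_cnorm \<mu> (ennreal p))
          (Lp_norm \<mu> (ennreal p)) (marcinkiewicz \<mu> K))"
proof -
  obtain C0 :: real where C0: "0 < C0"
      "\<And>x y. x \<noteq> y \<Longrightarrow> norm (K x y) \<le> C0 * (dist x y / lam x (dist x y))"
      "\<And>y y'. (\<integral>\<^sup>+x\<in>{x. 2 * dist y y' \<le> dist x y}.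
             ennreal ((norm (K x y - K x y') + norm (K y x - K y' x)) * (1 / dist x y)) \<partial>\<mu>) \<le> ennreal C0"
    using kernel unfolding marcinkiewicz_kernel_def by blast
  interpret mk_kernel \<mu> lam Clam N0 K C0
    using space kernel C0 by (auto intro!: mk_kernel.intro mk_kernel_axioms.intro simp: marcinkiewicz_kernel_def)
  obtain p0 :: real where p0: "1 < p0" and bo: "bounded_operator \<mu> (Lp_space \<mu> (ennreal p0)) (Lp_cnorm \<mu> (ennreal p0))
        (Lp_norm \<mu> (ennreal p0)) (marcinkiewicz \<mu> K)"
    using bounded by blast
  obtain B0 where B0: "0 \<le> B0" and st: "\<And>\<epsilon> L. 0 < \<epsilon> \<Longrightarrow> 0 < L \<Longrightarrow> strong_HK \<epsilon> L p0 B0"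
    using strong_of_bounded[OF p0 bo] by blast
  obtain W where W: "0 \<le> W" and wk: "\<And>\<epsilon> L. 0 < \<epsilon> \<Longrightarrow> 0 < L \<Longrightarrow> weak_HK \<epsilon> L W"
    using weak_all[OF p0 B0 st] by blast
  have all: "\<exists>B\<ge>0. MI_bounded q B" if q: "1 < q" for q
  proof -
    obtain B where "0 \<le> B" "\<And>\<epsilon> L. 0 < \<epsilon> \<Longrightarrow> 0 < L \<Longrightarrow> strong_HK \<epsilon> L q B"
      using strong_all[OF p0 B0 q st] by blast
    then show ?thesis unfolding MI_bounded_def using strong_MI[OF q] by blast
  qed
  show ?thesis
  proof (intro conjI allI impI)
    show "bounded_operator \<mu> (Lp_space \<mu> 1) (Lp_cnorm \<mu> 1) (weak_L1_norm \<mu>) (marcinkiewicz \<mu> K)"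
      by (rule bounded_operator_weak_L1[OF W wk])
  next
    fix \<rho> :: real and p :: ennreal
    assume \<rho>p: "1 < \<rho> \<and> 1 < p"
    show "bounded_operator \<mu> (H1_space \<mu> lam \<rho> p) (H1_norm \<mu> lam \<rho> p) (Lp_norm \<mu> 1) (marcinkiewicz \<mu> K)"
    proof (cases p)
      case (real r)
      with \<rho>p have "1 < r" by (simp add: ennreal_less_iff flip: ennreal_1)
      with all obtain B where "0 \<le> B" "MI_bounded r B" by blast
      with \<rho>p \<open>1 < r\<close> real show ?thesis by (intro bounded_operator_H1[OF _ _ _ _ wk]) auto
    next
      \<comment> \<open>Blocks with bounded atoms are blocks with \<open>L\<^sup>2\<close> atoms of
        the same size, so the bound at exponent 2 applies.\<close>
      case top
      obtain B where "0 \<le> B" "MI_bounded 2 B" using all[of 2] by auto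
      with \<rho>p top show ?thesis by (intro bounded_operator_H1[OF _ _ _ _ wk, of 2 B]) (use atomic_block_L2[of \<rho>] in auto)
    qed
  next
    fix \<eta> \<rho> :: real
    assume h: "1 < \<eta> \<and> 1 < \<rho>"
    obtain B where B: "0 \<le> B" "MI_bounded 2 B" using all[of 2] by auto
    have R: "(AE x in \<mu>. marcinkiewicz \<mu> K f x < \<infinity>) \<and>
        (\<lambda>x. enn2real (marcinkiewicz \<mu> K f x)) \<in> RBLO_space \<mu> lam Clam N0 \<eta> \<rho> \<and>
        ennreal (RBLO_norm \<mu> lam Clam N0 \<eta> \<rho> (\<lambda>x. enn2real (marcinkiewicz \<mu> K f x)))
          \<le> ennreal (\<bar>RBLO_const 2 B \<eta> \<rho>\<bar> + 1) * Lp_cnorm \<mu> \<infinity> f"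
      if "f \<in> Lp_space \<mu> \<infinity>" "marcinkiewicz \<mu> K f x0 < \<infinity>" for f x0
      using RBLO_norm_MI[OF B(2) _ B(1) _ _ that, of \<eta> \<rho>] h by simp
    show "\<exists>C::real. 0 < C \<and>
          (\<forall>f \<in> Lp_space \<mu> \<infinity>.
             ((\<forall>x. marcinkiewicz \<mu> K f x = \<infinity>) \<or> (AE x in \<mu>. marcinkiewicz \<mu> K f x < \<infinity>)) \<and>
             ((\<exists>x0. marcinkiewicz \<mu> K f x0 < \<infinity>) \<longrightarrow>
                (AE x in \<mu>. marcinkiewicz \<mu> K f x < \<infinity>) \<and>
                (\<lambda>x. enn2real (marcinkiewicz \<mu> K f x)) \<in> RBLO_space \<mu> lam Clam N0 \<eta> \<rho> \<and>
                ennreal (RBLO_norm \<mu> lam Clam N0 \<eta> \<rho> (\<lambda>x. enn2real (marcinkiewicz \<mu> K f x)))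
                  \<le> ennreal C * Lp_cnorm \<mu> \<infinity> f))"
    proof (intro exI[of _ "\<bar>RBLO_const 2 B \<eta> \<rho>\<bar> + 1"] conjI ballI)
      show "0 < \<bar>RBLO_const 2 B \<eta> \<rho>\<bar> + 1" by simp
      fix f assume f: "f \<in> Lp_space \<mu> \<infinity>"
      show "(\<forall>x. marcinkiewicz \<mu> K f x = \<infinity>) \<or> (AE x in \<mu>. marcinkiewicz \<mu> K f x < \<infinity>)"
      proof (rule disjCI)
        assume "\<not> (AE x in \<mu>. marcinkiewicz \<mu> K f x < \<infinity>)"
        then have "\<not> marcinkiewicz \<mu> K f x < \<infinity>" for x using R[OF f, of x] by argo
        then show "\<forall>x. marcinkiewicz \<mu> K f x = \<infinity>" by (simp add: not_less top_unique)
      qed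
    qed (use R in blast)
  next
    fix p :: real assume p: "1 < p"
    then obtain B where "0 \<le> B" "MI_bounded p B" using all by blast
    with p show "bounded_operator \<mu> (Lp_space \<mu> (ennreal p)) (Lp_cnorm \<mu> (ennreal p)) (Lp_norm \<mu> (ennreal p)) (marcinkiewicz \<mu> K)"
      by (intro bounded_operator_Lp)
  qed
qed

end
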